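(* The group $PSL_2(7)$ occurs infinitely often as a Galois group over $\mathbb{Q}$ with all nontrivial inertia groups of order $2$; that is, there exist infinitely many distinct Galois extensions $K/\mathbb{Q}$ (inside $\mathbb{C}$) with $\mathrm{Gal}(K/\mathbb{Q})\cong PSL_2(7)$ such that every nontrivial inertia group at a (finite) prime of $K$ has order $2$. Moreover, these infinitely many extensions can be chosen to be tamely ramified (i.e. unramified at $2$) and contained in $\mathbb{R}$. *)

theory Defs
  imports
    "HOL-Analysis.Determinants"
    "HOL-Library.Numeral_Type"
    "HOL-Algebra.Bij"
    "HOL-Algebra.Coset"
    "HOL-Algebra.Ideal_Product"
    "HOL-Algebra.Embedded_Algebras"
    "HOL-Algebra.Algebraic_Closure_Type"
begin

section \<open>Projective special linear groups\<close>

definition group_center :: "('g, 'm) monoid_scheme \<Rightarrow> 'g set" where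
  "group_center G = {z \<in> carrier G. \<forall>g\<in>carrier G. z \<otimes>\<^bsub>G\<^esub> g = g \<otimes>\<^bsub>G\<^esub> z}"

definition SL :: "('a::comm_ring_1 ^ 'n ^ 'n) monoid" where
  "SL = \<lparr>carrier = {A. det A = 1}, mult = (**), one = mat 1\<rparr>"

definition PSL :: "('a::comm_ring_1 ^ 'n ^ 'n) set monoid" where
  "PSL = SL Mod group_center SL"

text \<open>The numeral type \<open>7\<close> is the ring of integers modulo 7, that is, the field with
  seven elements.\<close>

abbreviation PSL_2_7 :: "(7 ^ 2 ^ 2) set monoid" where
  "PSL_2_7 \<equiv> PSL"


section \<open>Galois extensions inside the complex numbers\<close>

abbreviation complex_field :: "complex ring" where
  "complex_field \<equiv> ring_of_type_algebra"

text \<open>As for \<^const>\<open>AutoGroup\<close>, automorphisms are elements of \<^term>\<open>Bij K\<close>, hence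
  extensional outside \<open>K\<close>, so that distinct functions are distinct automorphisms.\<close>

definition gal_group :: "complex set \<Rightarrow> complex set \<Rightarrow> (complex \<Rightarrow> complex) monoid" where
  "gal_group F K = BijGroup K
     \<lparr>carrier := {\<sigma> \<in> Bij K.
        \<sigma> \<in> ring_hom (complex_field\<lparr>carrier := K\<rparr>) (complex_field\<lparr>carrier := K\<rparr>) \<and>
        (\<forall>x\<in>F. \<sigma> x = x)}\<rparr>"

definition galois_extension :: "complex set \<Rightarrow> complex set \<Rightarrow> bool" where
  "galois_extension F K \<longleftrightarrow>
     subfield F complex_field \<and> subfield K complex_field \<and> F \<subseteq> K \<and>
     ring.finite_dimension complex_field F K \<and>
     {x \<in> K. \<forall>\<sigma>\<in>carrier (gal_group F K). \<sigma> x = x} = F"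


section \<open>Inertia and ramification over the rationals\<close>

definition ring_of_integers :: "complex set \<Rightarrow> complex ring" where
  "ring_of_integers K = complex_field\<lparr>carrier := {x \<in> K. algebraic_int x}\<rparr>"

definition finite_primes :: "complex set \<Rightarrow> complex set set" where
  "finite_primes K = {P. primeideal P (ring_of_integers K) \<and> P \<noteq> {0}}"

text \<open>The condition below already forces \<open>\<sigma>\<close> to stabilise \<open>P\<close>, so the inertia group
  is a subgroup of the decomposition group.\<close>

definition inertia_group :: "complex set \<Rightarrow> complex set \<Rightarrow> (complex \<Rightarrow> complex) set" where
  "inertia_group K P =
     {\<sigma> \<in> carrier (gal_group \<rat> K). \<forall>x\<in>carrier (ring_of_integers K). \<sigma> x - x \<in> P}"

text \<open>The exponent of \<open>P\<close> in the factorisation of the ideal generated by \<open>p\<close> is the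
  largest \<open>e\<close> such that the \<open>e\<close>-th power of \<open>P\<close> contains that ideal; powers are taken in
  the monoid of ideals. The maximum exists when \<open>K\<close> is a number field, \<open>P\<close> is a nonzero
  prime and \<open>p\<close> is nonzero.\<close>

definition ramification_index :: "complex set \<Rightarrow> complex set \<Rightarrow> nat \<Rightarrow> nat" where
  "ramification_index K P p =
     (GREATEST e. PIdl\<^bsub>ring_of_integers K\<^esub> (of_nat p) \<subseteq> P [^]\<^bsub>ideals_set (ring_of_integers K)\<^esub> e)"

text \<open>Residue fields of number fields are finite, hence perfect, so no separability
  condition on residue extensions is needed in the next two definitions.\<close>

definition unramified_at :: "complex set \<Rightarrow> nat \<Rightarrow> bool" where
  "unramified_at K p \<longleftrightarrow>
     (\<forall>P\<in>finite_primes K. of_nat p \<in> P \<longrightarrow> ramification_index K P p = 1)"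

definition tamely_ramified :: "complex set \<Rightarrow> bool" where
  "tamely_ramified K \<longleftrightarrow>
     (\<forall>p. prime p \<longrightarrow>
        (\<forall>P\<in>finite_primes K. of_nat p \<in> P \<longrightarrow> \<not> p dvd ramification_index K P p))"

definition PSL_2_7_extension_inertia_2 :: "complex set \<Rightarrow> bool" where
  "PSL_2_7_extension_inertia_2 K \<longleftrightarrow>
     galois_extension \<rat> K \<and> gal_group \<rat> K \<cong> PSL_2_7 \<and>
     (\<forall>P\<in>finite_primes K.
        inertia_group K P \<noteq> {\<one>\<^bsub>gal_group \<rat> K\<^esub>} \<longrightarrow> card (inertia_group K P) = 2)"

end

theory Submission
  imports Defs "Jordan_Normal_Form.Char_Poly" "HOL-Number_Theory.Number_Theory"
begin

text \<open>
  The septic \<open>f = septic u w\<close>, a member of LaMacchia's family, has its roots as the points of a Fano plane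
  whose lines are the roots of \<open>septic (- u) w\<close>: the two polynomials satisfy
  \<open>f(x) (w y\<^sup>3 - y\<^sup>4) + f\<^sup>*(y) (w x\<^sup>3 - x\<^sup>4) = incid(x, y) coincid(x, y)\<close>, where \<open>incid\<close> is cubic in \<open>x\<close>.
  If \<open>u \<equiv> w \<equiv> 1\<close> modulo a fixed integer, \<open>w\<close> is a power of \<open>2\<close> and \<open>u\<close> is odd, then the Frobenius at \<open>3\<close> is a
  \<open>7\<close>-cycle and the Frobenius at \<open>2\<close> is an involution with fixed points, so that the Galois group is the whole
  automorphism group of the plane, that is, \<open>PSL\<^sub>2(7)\<close>.

  At an odd prime of bad reduction \<open>f\<close> has at most two double roots and no triple root. An element of the
  inertia group fixes every simple root and permutes each pair of coalescing roots; as a nontrivial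
  automorphism of the Fano plane moves at least three points, there is at most one nontrivial element. At \<open>2\<close> the roots
  \<open>y\<close> are distinguished by the residues of the pairs \<open>(y, 16 w\<^sup>2 / y)\<close>, so \<open>2\<close> is unramified. Twisted
  traces \<open>\<Sum>\<^sub>\<sigma> \<phi>(\<sigma>) \<sigma>(x)\<close> bound ramification indices by the order of inertia without Dedekind's ideal theory.
  For \<open>0 \<le> u \<le> w\<^sup>3\<close> all roots are real.

  Infinitely many fields arise because some prime \<open>l\<close> splits completely in any given field, so that \<open>f\<close> has a
  root modulo \<open>l\<close>, whereas for a suitable residue of \<open>u\<close> modulo \<open>l\<close> and \<open>w \<equiv> 1\<close> it has none.
\<close>

section \<open>Algebraic integers\<close>

text \<open>That the Galois group preserves a Fano plane is extracted from three facts. On the right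
  of the incidence identity the factors have degrees 3 and 4 in x, so each line carries exactly
  three of the seven points. The 7-cycle from 3 moves one such triple to seven different ones, which
  are then all the lines; in the cyclic numbering they are the translates of one triple in Z/7. Of
  the five triples up to translation only two are difference sets and yield a projective plane; the
  others are ruled out because the involution from 2, which fixes two roots, cannot preserve their
  translates. The same involution gives equality, since the proper subgroups of
  \<open>PSL_2(7)\<close> that contain a 7-cycle have odd order.

  The congruences to 1 serve two ends. The identities that control the double roots carry no
  information modulo 3, 5, 17, 47 and 241, and at these primes the septic receives the separable
  reduction of \<open>septic 1 1\<close> instead; and the reduction at 3 becomes one fixed
  polynomial, whose irreducibility can be certified once and for all.\<close>

lemma algebraic_int_of_eigenvector:
  fixes x :: complex and v :: "nat \<Rightarrow> complex" and M :: "nat \<Rightarrow> nat \<Rightarrow> int"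
  assumes ev: "\<And>i. i < n \<Longrightarrow> x * v i = (\<Sum>j<n. of_int (M i j) * v j)"
    and nz: "i0 < n" "v i0 \<noteq> 0"
  shows "algebraic_int x"
proof -
  define A :: "int mat" where "A = Matrix.mat n n (\<lambda>(i,j). M i j)"
  define B :: "complex mat" where "B = map_mat of_int A"
  have A: "A \<in> carrier_mat n n" by (simp add: A_def)
  have B: "B \<in> carrier_mat n n" by (simp add: A_def B_def)
  have "eigenvector B (Matrix.vec n v) x"
    unfolding eigenvector_def
  proof (intro conjI)
    show "Matrix.vec n v \<in> carrier_vec (dim_row B)" using B by simp
    show "Matrix.vec n v \<noteq> 0\<^sub>v (dim_row B)"
      using nz B by (metis carrier_matD(1) index_vec index_zero_vec(1))
    show "B *\<^sub>v Matrix.vec n v = x \<cdot>\<^sub>v Matrix.vec n v"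
    proof (rule eq_vecI)
      fix i assume "i < dim_vec (x \<cdot>\<^sub>v Matrix.vec n v)"
      hence i: "i < n" by simp
      have "(B *\<^sub>v Matrix.vec n v) $ i = (\<Sum>j<n. of_int (M i j) * v j)"
        using i by (auto simp: B_def A_def scalar_prod_def lessThan_atLeast0 intro!: sum.cong)
      thus "(B *\<^sub>v Matrix.vec n v) $ i = (x \<cdot>\<^sub>v Matrix.vec n v) $ i"
        using ev[OF i] i by simp
    qed (use B in simp)
  qed
  hence "eigenvalue B x" unfolding eigenvalue_def by blast
  hence "poly (char_poly B) x = 0" using eigenvalue_root_char_poly[OF B] by simp
  moreover have "char_poly B = map_poly of_int (char_poly A)"
    unfolding B_def by (rule of_int_hom.char_poly_hom[OF A])
  moreover have "lead_coeff (char_poly A) = 1" using degree_monic_char_poly[OF A] by simp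
  ultimately show ?thesis unfolding algebraic_int_altdef_ipoly by auto
qed

definition int_span :: "(nat \<Rightarrow> complex) \<Rightarrow> nat \<Rightarrow> complex set" where
  "int_span v n = {\<Sum>j<n. of_int (c j) * v j | c. True}"

lemma int_span_add: "a \<in> int_span v n \<Longrightarrow> b \<in> int_span v n \<Longrightarrow> a + b \<in> int_span v n"
proof -
  assume "a \<in> int_span v n" "b \<in> int_span v n"
  then obtain c d where "a = (\<Sum>j<n. of_int (c j) * v j)" "b = (\<Sum>j<n. of_int (d j) * v j)"
    by (auto simp: int_span_def)
  hence "a + b = (\<Sum>j<n. of_int (c j + d j) * v j)" by (simp add: algebra_simps sum.distrib)
  thus ?thesis unfolding int_span_def mem_Collect_eq by (intro exI[of _ "\<lambda>j. c j + d j"]) simp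
qed

lemma int_span_scale: "a \<in> int_span v n \<Longrightarrow> of_int k * a \<in> int_span v n"
proof -
  assume "a \<in> int_span v n"
  then obtain c where "a = (\<Sum>j<n. of_int (c j) * v j)" by (auto simp: int_span_def)
  hence "of_int k * a = (\<Sum>j<n. of_int (k * c j) * v j)" by (simp add: sum_distrib_left mult.assoc)
  thus ?thesis unfolding int_span_def mem_Collect_eq by (intro exI[of _ "\<lambda>j. k * c j"]) simp
qed

lemma int_span_0: "0 \<in> int_span v n"
  unfolding int_span_def mem_Collect_eq by (intro exI[of _ "\<lambda>_. 0"]) simp

lemma int_span_sum: "(\<And>i. i \<in> I \<Longrightarrow> f i \<in> int_span v n) \<Longrightarrow> sum f I \<in> int_span v n"
  by (induction I rule: infinite_finite_induct) (auto intro: int_span_0 int_span_add)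

lemma int_span_base: "i < n \<Longrightarrow> v i \<in> int_span v n"
  unfolding int_span_def mem_Collect_eq
  by (intro exI[of _ "\<lambda>j. if j = i then 1 else 0"]) (simp add: sum.delta if_distrib[of "\<lambda>x. x * _"] if_distrib[of of_int] cong: if_cong)

lemma int_span_mult:
  assumes "\<And>i. i < n \<Longrightarrow> x * v i \<in> int_span v n" and "a \<in> int_span v n"
  shows "x * a \<in> int_span v n"
proof -
  obtain c where "a = (\<Sum>j<n. of_int (c j) * v j)" using assms(2) by (auto simp: int_span_def)
  hence "x * a = (\<Sum>j<n. of_int (c j) * (x * v j))" by (simp add: sum_distrib_left algebra_simps)
  thus ?thesis using assms(1) by (auto intro!: int_span_sum int_span_scale)
qed

text \<open>Multiplication by \<open>x\<close> on a finitely generated group of complex numbers is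
  given by an integer matrix, whose characteristic polynomial is monic; the vector of generators is
  an eigenvector, nonzero because of \<open>v i0\<close>.\<close>

lemma algebraic_int_of_int_span:
  assumes "\<And>i. i < n \<Longrightarrow> x * v i \<in> int_span v n" "i0 < n" "v i0 \<noteq> 0"
  shows "algebraic_int x"
proof -
  have "\<forall>i. \<exists>c. i < n \<longrightarrow> x * v i = (\<Sum>j<n. of_int (c j) * v j)"
    using assms(1) by (auto simp: int_span_def)
  then obtain M where "\<And>i. i < n \<Longrightarrow> x * v i = (\<Sum>j<n. of_int (M i j) * v j)" by metis
  thus ?thesis using algebraic_int_of_eigenvector assms(2,3) by blast
qed

lemma algebraic_int_monicE:
  assumes "algebraic_int (x::complex)"
  obtains p :: "int poly" where "lead_coeff p = 1" "degree p > 0"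
    "x ^ degree p = (\<Sum>i<degree p. of_int (- coeff p i) * x ^ i)"
proof -
  from assms obtain p :: "int poly" where p: "poly (map_poly of_int p) x = 0" "lead_coeff p = 1"
    unfolding algebraic_int_altdef_ipoly by blast
  have d: "degree p > 0"
  proof (rule ccontr)
    assume "\<not> degree p > 0"
    then obtain c where "p = [:c:]" by (metis degree_0_id gr0I degree_eq_zeroE)
    with p show False by simp
  qed
  have "0 = (\<Sum>i\<le>degree p. of_int (coeff p i) * x ^ i)"
    using p(1) by (simp add: poly_altdef coeff_map_poly)
  also have "\<dots> = (\<Sum>i<degree p. of_int (coeff p i) * x ^ i) + x ^ degree p"
    using p(2) by (simp add: lessThan_Suc_atMost[symmetric])
  finally have "x ^ degree p = (\<Sum>i<degree p. of_int (- coeff p i) * x ^ i)"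
    by (simp add: sum_negf eq_neg_iff_add_eq_0 add.commute)
  with p d that show thesis by blast
qed

text \<open>The monomials \<open>x ^ a * y ^ b\<close> with \<open>a < m\<close> and
  \<open>b < n\<close> span a group stable under \<open>x\<close> and \<open>y\<close>, since the
  monic equations rewrite \<open>x ^ m\<close> and \<open>y ^ n\<close>. It is then stable under the
  sum and the product.\<close>

lemma algebraic_int_add_mult:
  assumes "algebraic_int (x::complex)" "algebraic_int y"
  shows "algebraic_int (x + y)" "algebraic_int (x * y)"
proof -
  obtain p :: "int poly" where p: "degree p > 0"
    "x ^ degree p = (\<Sum>i<degree p. of_int (- coeff p i) * x ^ i)"
    using algebraic_int_monicE[OF assms(1)] by metis
  obtain q :: "int poly" where q: "degree q > 0"
    "y ^ degree q = (\<Sum>i<degree q. of_int (- coeff q i) * y ^ i)"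
    using algebraic_int_monicE[OF assms(2)] by metis
  define m n where "m = degree p" and "n = degree q"
  \<comment> \<open>One index \<open>k < m * n\<close> encodes the pair of exponents
    \<open>(k div n, k mod n)\<close>.\<close>
  define v where "v k = x ^ (k div n) * y ^ (k mod n)" for k
  let ?S = "int_span v (m * n)"
  have base: "x ^ a * y ^ b \<in> ?S" if "a < m" "b < n" for a b
  proof -
    have "a * n + b < Suc a * n" using that by simp
    also have "\<dots> \<le> m * n" using that by (intro mult_right_mono) auto
    finally have "a * n + b < m * n" .
    moreover have "v (a * n + b) = x ^ a * y ^ b" using that by (simp add: v_def)
    ultimately show ?thesis by (metis int_span_base)
  qed
  have n0: "n > 0" "m > 0" using p q by (auto simp: m_def n_def)
  have X: "x * v k \<in> ?S" if "k < m * n" for k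
  proof -
    have a: "k div n < m" "k mod n < n" using that n0 by (auto simp: less_mult_imp_div_less)
    show ?thesis
    proof (cases "Suc (k div n) < m")
      case True
      have e: "x * v k = x ^ Suc (k div n) * y ^ (k mod n)" by (simp add: v_def)
      show ?thesis unfolding e by (rule base[OF True a(2)])
    next
      case False
      hence "Suc (k div n) = m" using a by simp
      hence "x * v k = x ^ m * y ^ (k mod n)" unfolding v_def by (metis mult.assoc power_Suc)
      also have "\<dots> = (\<Sum>i<m. of_int (- coeff p i) * (x ^ i * y ^ (k mod n)))"
        using p(2) unfolding m_def by (simp add: sum_distrib_right sum_distrib_left algebra_simps)
      finally have e: "x * v k = (\<Sum>i<m. of_int (- coeff p i) * (x ^ i * y ^ (k mod n)))" .
      show ?thesis unfolding e by (intro int_span_sum int_span_scale base) (use a in auto)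
    qed
  qed
  have Y: "y * v k \<in> ?S" if "k < m * n" for k
  proof -
    have a: "k div n < m" "k mod n < n" using that n0 by (auto simp: less_mult_imp_div_less)
    show ?thesis
    proof (cases "Suc (k mod n) < n")
      case True
      have e: "y * v k = x ^ (k div n) * y ^ Suc (k mod n)" by (simp add: v_def)
      show ?thesis unfolding e by (rule base[OF a(1) True])
    next
      case False
      hence "Suc (k mod n) = n" using a by simp
      hence "y * v k = x ^ (k div n) * y ^ n" unfolding v_def by (metis mult.left_commute power_Suc)
      also have "\<dots> = (\<Sum>i<n. of_int (- coeff q i) * (x ^ (k div n) * y ^ i))"
        using q(2) unfolding n_def by (simp add: sum_distrib_right sum_distrib_left algebra_simps)
      finally have e: "y * v k = (\<Sum>i<n. of_int (- coeff q i) * (x ^ (k div n) * y ^ i))" .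
      show ?thesis unfolding e by (intro int_span_sum int_span_scale base) (use a in auto)
    qed
  qed
  have i0: "0 < m * n" "v 0 \<noteq> 0" using n0 by (auto simp: v_def)
  have A: "(x + y) * v k \<in> ?S" if "k < m * n" for k using that by (simp add: distrib_right X Y int_span_add)
  have B: "(x * y) * v k \<in> ?S" if "k < m * n" for k using that by (simp add: mult.assoc X Y int_span_mult)
  show "algebraic_int (x + y)" using algebraic_int_of_int_span[of "m * n" "x + y" v 0] A i0 by blast
  show "algebraic_int (x * y)" using algebraic_int_of_int_span[of "m * n" "x * y" v 0] B i0 by blast
qed

lemma algebraic_int_diff: "algebraic_int (x::complex) \<Longrightarrow> algebraic_int y \<Longrightarrow> algebraic_int (x - y)"
  using algebraic_int_add_mult(1)[of x "- y"] by simp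

section \<open>Subfields of the complex numbers\<close>

text \<open>Subfields are phrased with the operations of the type, and
  \<open>sfield_imp_subfield\<close> leads back to \<open>subfield\<close>. As
  \<open>inverse 0 = 0\<close>, the last clause can include 0.\<close>

definition sfield :: "complex set \<Rightarrow> bool" where
  "sfield F \<longleftrightarrow> 1 \<in> F \<and> (\<forall>x\<in>F. \<forall>y\<in>F. x - y \<in> F \<and> x * y \<in> F) \<and> (\<forall>x\<in>F. inverse x \<in> F)"

context
  fixes F assumes F: "sfield F"
begin
lemma sfield_1: "1 \<in> F" and sfield_diff: "x \<in> F \<Longrightarrow> y \<in> F \<Longrightarrow> x - y \<in> F"
  and sfield_mult: "x \<in> F \<Longrightarrow> y \<in> F \<Longrightarrow> x * y \<in> F"
  and sfield_inverse: "x \<in> F \<Longrightarrow> inverse x \<in> F"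
  using F by (auto simp: sfield_def)
lemma sfield_0: "0 \<in> F" using sfield_diff[OF sfield_1 sfield_1] by simp
lemma sfield_uminus: "x \<in> F \<Longrightarrow> - x \<in> F" using sfield_diff[OF sfield_0, of x] by simp
lemma sfield_add: "x \<in> F \<Longrightarrow> y \<in> F \<Longrightarrow> x + y \<in> F" using sfield_diff[of x "- y"] sfield_uminus by simp
lemma sfield_divide: "x \<in> F \<Longrightarrow> y \<in> F \<Longrightarrow> x / y \<in> F" by (simp add: divide_inverse sfield_mult sfield_inverse)
lemma sfield_power: "x \<in> F \<Longrightarrow> x ^ n \<in> F" by (induction n) (auto intro: sfield_1 sfield_mult)
lemma sfield_sum: "(\<And>i. i \<in> I \<Longrightarrow> f i \<in> F) \<Longrightarrow> sum f I \<in> F"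
  by (induction I rule: infinite_finite_induct) (auto intro: sfield_0 sfield_add)
lemma sfield_prod: "(\<And>i. i \<in> I \<Longrightarrow> f i \<in> F) \<Longrightarrow> prod f I \<in> F"
  by (induction I rule: infinite_finite_induct) (auto intro: sfield_1 sfield_mult)
lemma sfield_of_nat: "of_nat n \<in> F" by (induction n) (auto intro: sfield_0 sfield_1 sfield_add)
lemma sfield_of_int: "of_int n \<in> F" by (cases n) (auto intro!: sfield_of_nat sfield_diff sfield_uminus sfield_1)
lemma sfield_Rats: "\<rat> \<subseteq> F" by (auto elim!: Rats_cases' intro!: sfield_divide sfield_of_int)
lemmas sfield_closed = sfield_0 sfield_1 sfield_add sfield_mult sfield_diff sfield_uminus
  sfield_inverse sfield_divide sfield_power sfield_of_int
end

lemma sfield_imp_subfield: assumes "sfield F" shows "subfield F complex_field"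
proof -
  interpret field complex_field by (rule field_from_type_algebra)
  note c = sfield_closed[OF assms]
  have neg: "\<ominus>\<^bsub>complex_field\<^esub> x = - x" for x :: complex
    using minus_equality[of "- x" x] by (simp add: ring_of_type_algebra_def)
  have inv: "inv\<^bsub>complex_field\<^esub> x = inverse x" if "x \<noteq> 0" for x :: complex
    using inv_char[of x "inverse x"] that by (simp add: ring_of_type_algebra_def)
  show ?thesis
  proof (rule subfieldI')
    show "subring F complex_field"
      by (rule subringI) (use c in \<open>auto simp: neg\<close>, auto simp: ring_of_type_algebra_def c)
    fix k assume "k \<in> F - {\<zero>\<^bsub>complex_field\<^esub>}"
    thus "inv\<^bsub>complex_field\<^esub> k \<in> F" using inv[of k] c by (auto simp: ring_of_type_algebra_def)
  qed
qed

lemma sfield_Rats_self: "sfield \<rat>" by (auto simp: sfield_def)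

section \<open>Polynomials with coefficients in a subfield, and minimal polynomials\<close>

definition polys_over :: "complex set \<Rightarrow> complex poly set" where
  "polys_over F = {p. \<forall>i. coeff p i \<in> F}"

context
  fixes F assumes F: "sfield F"
begin
lemma po_0: "0 \<in> polys_over F" and po_1: "1 \<in> polys_over F"
  and po_add: "p \<in> polys_over F \<Longrightarrow> q \<in> polys_over F \<Longrightarrow> p + q \<in> polys_over F"
  and po_diff: "p \<in> polys_over F \<Longrightarrow> q \<in> polys_over F \<Longrightarrow> p - q \<in> polys_over F"
  and po_smult: "c \<in> F \<Longrightarrow> p \<in> polys_over F \<Longrightarrow> Polynomial.smult c p \<in> polys_over F"
  and po_mult: "p \<in> polys_over F \<Longrightarrow> q \<in> polys_over F \<Longrightarrow> p * q \<in> polys_over F"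
  and po_monom: "c \<in> F \<Longrightarrow> Polynomial.monom c n \<in> polys_over F"
  and po_pCons: "c \<in> F \<Longrightarrow> p \<in> polys_over F \<Longrightarrow> pCons c p \<in> polys_over F"
  using sfield_closed[OF F]
  by (auto simp: polys_over_def coeff_1 coeff_mult coeff_pCons split: nat.splits intro!: sfield_sum[OF F])
lemma po_pcompose: "p \<in> polys_over F \<Longrightarrow> q \<in> polys_over F \<Longrightarrow> pcompose p q \<in> polys_over F"
proof (induction p)
  case (pCons a p)
  have "a \<in> F" using pCons(3) by (metis coeff_pCons_0 mem_Collect_eq polys_over_def)
  moreover have "p \<in> polys_over F" using pCons(3) unfolding polys_over_def mem_Collect_eq by (metis coeff_pCons_Suc)
  ultimately show ?case using pCons by (auto simp: pcompose_pCons intro!: po_add po_mult po_pCons po_0)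
qed (auto intro: po_0)
lemma poly_po: "p \<in> polys_over F \<Longrightarrow> x \<in> F \<Longrightarrow> poly p x \<in> F"
  unfolding poly_altdef by (intro sfield_sum[OF F] sfield_mult[OF F] sfield_power[OF F]) (auto simp: polys_over_def)

text \<open>Each step of the division by a monic \<open>m\<close> subtracts a multiple
  \<open>t * m\<close> with \<open>t\<close> a monomial over \<open>F\<close>, without dividing by
  any coefficient. The quotient and remainder of complex polynomials therefore stay over
  \<open>F\<close>.\<close>

lemma po_mod_monic:
  assumes m: "m \<in> polys_over F" "lead_coeff m = 1" "degree m > 0" and p: "p \<in> polys_over F"
  shows "p mod m \<in> polys_over F \<and> p div m \<in> polys_over F"
  using p
proof (induction "degree p" arbitrary: p rule: less_induct)
  case less
  show ?case
  proof (cases "degree p < degree m")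
    case True
    hence "p mod m = p" "p div m = 0" by (auto simp: mod_poly_less div_poly_less)
    with less show ?thesis using po_0 by simp
  next
    case False
    define t where "t = Polynomial.monom (lead_coeff p) (degree p - degree m)"
    have t: "t \<in> polys_over F" unfolding t_def by (rule po_monom) (use less in \<open>auto simp: polys_over_def\<close>)
    define p' where "p' = p - t * m"
    have p': "p' \<in> polys_over F" unfolding p'_def by (intro po_diff po_mult t m less)
    have p0: "p \<noteq> 0" using False m by auto
    have t0: "t \<noteq> 0" "degree t = degree p - degree m" using p0 by (auto simp: t_def degree_monom_eq)
    have m0: "m \<noteq> 0" using m by auto
    have dtm: "degree (t * m) = degree p" using t0 m0 False by (simp add: degree_mult_eq)
    have lc: "coeff (t * m) (degree p) = coeff p (degree p)"
      using dtm lead_coeff_mult[of t m] m t0(2) by (simp add: t_def lead_coeff_monom)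
    have "degree p' < degree p"
    proof -
      have "degree p' \<le> degree p" unfolding p'_def using dtm by (simp add: degree_diff_le)
      moreover have "degree p' \<noteq> degree p"
      proof
        assume e: "degree p' = degree p"
        have "coeff p' (degree p) = 0" using lc by (simp add: p'_def)
        hence "lead_coeff p' = 0" using e by simp
        hence "p' = 0" by simp
        with e have "degree p = 0" by simp
        with False m show False by simp
      qed
      ultimately show ?thesis by simp
    qed
    from less(1)[OF this p'] have "p' mod m \<in> polys_over F" "p' div m \<in> polys_over F" by auto
    moreover have "p = p' + t * m" by (simp add: p'_def)
    hence "p mod m = p' mod m" "p div m = p' div m + t" using m0 by (auto simp: mult.commute)
    ultimately show ?thesis using t by (auto intro: po_add)
  qed
qed
end

definition is_minpoly :: "complex set \<Rightarrow> complex \<Rightarrow> complex poly \<Rightarrow> bool" where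
  "is_minpoly F x m \<longleftrightarrow> m \<in> polys_over F \<and> lead_coeff m = 1 \<and> poly m x = 0 \<and>
     (\<forall>p\<in>polys_over F. poly p x = 0 \<longrightarrow> m dvd p)"

lemma is_minpoly_degree: "is_minpoly F x m \<Longrightarrow> degree m > 0"
proof (rule ccontr)
  assume a: "is_minpoly F x m" "\<not> degree m > 0"
  then obtain c where "m = [:c:]" by (metis degree_eq_zeroE gr0I)
  with a(1) show False by (auto simp: is_minpoly_def)
qed

lemma minpoly_exists:
  assumes F: "sfield F" and p: "p \<in> polys_over F" "p \<noteq> 0" "poly p x = 0"
  shows "\<exists>m. is_minpoly F x m"
proof -
  let ?P = "\<lambda>q. q \<in> polys_over F \<and> q \<noteq> 0 \<and> poly q x = 0"
  obtain q where q: "?P q" "\<And>r. ?P r \<Longrightarrow> degree q \<le> degree r"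
    using ex_has_least_nat[of ?P p degree] p by blast
  define m where "m = Polynomial.smult (inverse (lead_coeff q)) q"
  have lq: "lead_coeff q \<in> F" using q by (auto simp: polys_over_def)
  have m: "m \<in> polys_over F" "lead_coeff m = 1" "poly m x = 0" "degree m = degree q"
    using q lq by (auto simp: m_def intro!: po_smult[OF F] sfield_inverse[OF F])
  have dm: "degree m > 0"
  proof (rule ccontr)
    assume "\<not> degree m > 0"
    then obtain c where "m = [:c:]" by (metis degree_eq_zeroE gr0I)
    with m show False by simp
  qed
  have "m dvd r" if r: "r \<in> polys_over F" "poly r x = 0" for r
  proof (rule ccontr)
    assume "\<not> m dvd r"
    hence "r mod m \<noteq> 0" by (simp add: mod_eq_0_iff_dvd)
    moreover have "poly (r mod m) x = 0"
      using r m by (metis add_0 mult_zero_right div_mult_mod_eq mult.commute poly_add poly_mult)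
    moreover have "r mod m \<in> polys_over F" using po_mod_monic[OF F m(1,2) dm r(1)] by simp
    ultimately have "degree q \<le> degree (r mod m)" using q(2) by blast
    moreover have "degree (r mod m) < degree m" using dm \<open>r mod m \<noteq> 0\<close> using degree_mod_less[of m r] dm \<open>r mod m \<noteq> 0\<close> by (cases "m = 0") auto
    ultimately show False using m(4) by simp
  qed
  with m show ?thesis unfolding is_minpoly_def by blast
qed

lemma coeff_linear_power_sub1:
  "coeff ([:- b, 1:] ^ Suc k) k = - (of_nat (Suc k) * (b::complex))"
proof (induction k)
  case (Suc k)
  have l: "coeff ([:- b, 1:] ^ Suc k) (Suc k) = 1"
    by (metis coeff_linear_power)
  have "coeff ([:- b, 1:] ^ Suc (Suc k)) (Suc k) = coeff ([:- b, 1:] * [:- b, 1:] ^ Suc k) (Suc k)"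
    by (simp only: power_Suc)
  also have "\<dots> = - b * coeff ([:- b, 1:] ^ Suc k) (Suc k) + coeff ([:- b, 1:] ^ Suc k) k"
    by (simp only: mult_pCons_left coeff_add coeff_smult coeff_pCons_Suc) simp
  finally show ?case unfolding l Suc by (simp add: algebra_simps)
qed simp

text \<open>Over the complex numbers \<open>m\<close> is a power of \<open>[:- b, 1:]\<close>. In
  characteristic 0 its second highest coefficient, a nonzero integer multiple of \<open>b\<close>,
  exhibits \<open>b\<close> as an element of \<open>F\<close>.\<close>

lemma mem_of_single_root:
  assumes F: "sfield F" and m: "m \<in> polys_over F" "lead_coeff m = 1" "degree m > 0"
    and r: "\<And>z. poly m z = 0 \<Longrightarrow> z = b"
  shows "b \<in> F"
proof -
  have "\<exists>z. poly m z = 0"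
    using m(3) fundamental_theorem_of_algebra[of m] constant_degree[of m] by auto
  with r have root: "{z. poly m z = 0} = {b}" by auto
  have "m = Polynomial.smult (lead_coeff m) (\<Prod>z|poly m z = 0. [:- z, 1:] ^ order z m)"
    by (rule complex_poly_decompose[symmetric])
  hence mm: "m = [:- b, 1:] ^ order b m" using m(2) root by simp
  obtain k where k: "order b m = Suc k"
    using mm m(3) by (cases "order b m") auto
  have "coeff m k = - (of_nat (Suc k) * b)"
    by (subst mm, subst k) (rule coeff_linear_power_sub1)
  hence "b = - coeff m k / of_nat (Suc k)" by (simp add: field_simps del: of_nat_Suc)
  moreover have "coeff m k \<in> F" using m by (auto simp: polys_over_def)
  ultimately show ?thesis using sfield_closed[OF F] sfield_of_nat[OF F] by metis
qed

lemma polys_over_mono: "F \<subseteq> G \<Longrightarrow> polys_over F \<subseteq> polys_over G" by (auto simp: polys_over_def)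

text \<open>Put \<open>t = a + c * b\<close>. The polynomials \<open>g(z)\<close> and
  \<open>f(t - c * z)\<close> over \<open>F\<close> share the root \<open>b\<close>, and no other
  root for a suitable \<open>c\<close>. The minimal polynomial of \<open>b\<close> divides both, so
  \<open>b\<close> is its only root.\<close>

lemma primitive_element2:
  assumes f: "f \<in> polys_over \<rat>" "f \<noteq> 0" "poly f a = 0" and g: "g \<in> polys_over \<rat>" "g \<noteq> 0" "poly g b = 0"
  shows "\<exists>c::nat. \<forall>F. sfield F \<longrightarrow> a + of_nat c * b \<in> F \<longrightarrow> a \<in> F \<and> b \<in> F"
proof -
  \<comment> \<open>These are the values of \<open>c\<close> for which some root \<open>y\<close> of
    \<open>g\<close> other than \<open>b\<close> makes \<open>a + c * (b - y)\<close> a root of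
    \<open>f\<close>.\<close>
  define bad where "bad = {(x - a) / (b - y) | x y. poly f x = 0 \<and> poly g y = 0}"
  have "finite bad" unfolding bad_def using f g by (intro finite_image_set2) (auto simp: poly_roots_finite)
  moreover have "infinite (range (of_nat :: nat \<Rightarrow> complex))"
    by (rule range_inj_infinite) (simp add: inj_on_def)
  ultimately obtain c :: nat where c: "of_nat c \<notin> bad" by (meson finite_subset image_subsetI)
  show ?thesis
  proof (intro exI[of _ c] allI impI)
    fix F assume F: "sfield F" and t: "a + of_nat c * b \<in> F"
    let ?t = "a + of_nat c * b"
    define h where "h = pcompose f [:?t, - of_nat c:]"
    have fg: "f \<in> polys_over F" "g \<in> polys_over F" using f g polys_over_mono[OF sfield_Rats[OF F]] by auto
    have h: "h \<in> polys_over F" unfolding h_def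
      by (intro po_pcompose[OF F fg(1)] po_pCons[OF F] po_0[OF F] t sfield_uminus[OF F] sfield_of_nat[OF F])
    have hb: "poly h b = 0" using f by (simp add: h_def poly_pcompose algebra_simps)
    obtain m where m: "is_minpoly F b m" using minpoly_exists[OF F fg(2) g(2,3)] by blast
    have "m dvd h" "m dvd g" using m h hb fg g by (auto simp: is_minpoly_def)
    have "z = b" if "poly m z = 0" for z
    proof (rule ccontr)
      assume zb: "z \<noteq> b"
      have z: "poly h z = 0" "poly g z = 0" using that \<open>m dvd h\<close> \<open>m dvd g\<close> by (auto elim!: dvdE)
      let ?x = "?t - of_nat c * z"
      have "poly f ?x = 0" using z by (simp add: h_def poly_pcompose algebra_simps)
      hence "(?x - a) / (b - z) \<in> bad" unfolding bad_def using z by blast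
      moreover have "(?x - a) / (b - z) = of_nat c" using zb by (simp add: field_simps)
      ultimately show False using c by simp
    qed
    hence b: "b \<in> F" using mem_of_single_root[OF F] m is_minpoly_degree[OF m] by (auto simp: is_minpoly_def)
    have "?t - of_nat c * b \<in> F" by (intro sfield_diff[OF F] sfield_mult[OF F] t b sfield_of_nat[OF F])
    with b show "a \<in> F \<and> b \<in> F" by simp
  qed
qed

lemma algebraic_int_poly_over:
  assumes "algebraic_int (x::complex)" shows "\<exists>p\<in>polys_over \<rat>. p \<noteq> 0 \<and> poly p x = 0"
proof -
  obtain p :: "int poly" where p: "poly (map_poly of_int p) x = 0" "lead_coeff p = 1"
    using assms unfolding algebraic_int_altdef_ipoly by blast
  have "map_poly of_int p \<noteq> (0 :: complex poly)" using p(2) by (auto simp: map_poly_eq_0_iff)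
  with p(1) show ?thesis by (intro bexI[of _ "map_poly of_int p"]) (auto simp: polys_over_def coeff_map_poly)
qed

lemma algebraic_int_of_nat_mult: "algebraic_int (x::complex) \<Longrightarrow> algebraic_int (of_nat c * x)"
  by (intro algebraic_int_add_mult) (auto intro: int_imp_algebraic_int)

text \<open>Quantifying over all subfields, in place of naming the generated one, lets the induction
  absorb one generator at a time through \<open>primitive_element2\<close>.\<close>

lemma primitive_element:
  assumes "finite S" "\<And>s. s \<in> S \<Longrightarrow> algebraic_int (s::complex)"
  shows "\<exists>c::complex \<Rightarrow> nat. algebraic_int (\<Sum>s\<in>S. of_nat (c s) * s) \<and>
     (\<forall>F. sfield F \<longrightarrow> (\<Sum>s\<in>S. of_nat (c s) * s) \<in> F \<longrightarrow> S \<subseteq> F)"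
  using assms
proof (induction S rule: finite_induct)
  case empty thus ?case by (auto intro: int_imp_algebraic_int)
next
  case (insert b S)
  then obtain c where c: "algebraic_int (\<Sum>s\<in>S. of_nat (c s) * s)"
    "\<And>F. sfield F \<Longrightarrow> (\<Sum>s\<in>S. of_nat (c s) * s) \<in> F \<Longrightarrow> S \<subseteq> F" by auto
  obtain f where f: "f \<in> polys_over \<rat>" "f \<noteq> 0" "poly f (\<Sum>s\<in>S. of_nat (c s) * s) = 0"
    using algebraic_int_poly_over[OF c(1)] by blast
  obtain g where g: "g \<in> polys_over \<rat>" "g \<noteq> 0" "poly g b = 0"
    using algebraic_int_poly_over[of b] insert.prems by auto
  from primitive_element2[OF f g] obtain d :: nat where
    d: "\<And>F. sfield F \<Longrightarrow> (\<Sum>s\<in>S. of_nat (c s) * s) + of_nat d * b \<in> F \<Longrightarrow> (\<Sum>s\<in>S. of_nat (c s) * s) \<in> F \<and> b \<in> F"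
    by blast
  have e: "(\<Sum>s\<in>insert b S. of_nat ((c(b := d)) s) * s) = (\<Sum>s\<in>S. of_nat (c s) * s) + of_nat d * b"
  proof -
    have "(\<Sum>s\<in>insert b S. of_nat ((c(b := d)) s) * s) = of_nat d * b + (\<Sum>s\<in>S. of_nat ((c(b := d)) s) * s)"
      using insert(1,2) by simp
    also have "(\<Sum>s\<in>S. of_nat ((c(b := d)) s) * s) = (\<Sum>s\<in>S. of_nat (c s) * s)"
      using insert(2) by (intro sum.cong) auto
    finally show ?thesis by simp
  qed
  have i: "algebraic_int ((\<Sum>s\<in>S. of_nat (c s) * s) + of_nat d * b)"
    using insert.prems by (intro algebraic_int_add_mult(1) c(1) algebraic_int_of_nat_mult) auto
  show ?case
  proof (rule exI[of _ "c(b := d)"], unfold e, intro conjI allI impI i)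
    fix F assume F: "sfield F" "(\<Sum>s\<in>S. of_nat (c s) * s) + of_nat d * b \<in> F"
    show "insert b S \<subseteq> F" using d[OF F] c(2)[OF F(1)] by simp
  qed
qed

section \<open>Simple extensions of the rationals\<close>

definition adj :: "complex \<Rightarrow> complex set" where
  "adj \<theta> = {poly p \<theta> | p. p \<in> polys_over \<rat>}"

text \<open>To invert \<open>x\<close>, take a rational polynomial of least degree whose value at
  \<theta> is nonzero and a multiple of \<open>x\<close>. Were it not constant, the remainder of
  \<open>m\<close> modulo it would have the same property and smaller degree.\<close>

lemma adj_sfield:
  assumes m: "is_minpoly \<rat> \<theta> m" shows "sfield (adj \<theta>)"
proof -
  note R = sfield_Rats_self
  have inv: "inverse x \<in> adj \<theta>" if x: "x \<in> adj \<theta>" "x \<noteq> 0" for x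
  proof -
    obtain p where p: "p \<in> polys_over \<rat>" "x = poly p \<theta>" using x by (auto simp: adj_def)
    let ?P = "\<lambda>q. q \<in> polys_over \<rat> \<and> poly q \<theta> \<noteq> 0 \<and> (\<exists>r\<in>polys_over \<rat>. poly q \<theta> = poly r \<theta> * x)"
    have "?P p" using p x po_1[OF R] by (auto intro!: bexI[of _ 1])
    then obtain q where q: "?P q" "\<And>s. ?P s \<Longrightarrow> degree q \<le> degree s"
      using ex_has_least_nat[of ?P p degree] by blast
    then obtain r where r: "r \<in> polys_over \<rat>" "poly q \<theta> = poly r \<theta> * x" by blast
    have dq: "degree q = 0"
    proof (rule ccontr)
      assume d0: "degree q \<noteq> 0"
      define l where "l = lead_coeff q"
      have l: "l \<in> \<rat>" "l \<noteq> 0" using q d0 by (auto simp: l_def polys_over_def)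
      define q' where "q' = Polynomial.smult (inverse l) q"
      have q': "q' \<in> polys_over \<rat>" "lead_coeff q' = 1" "degree q' > 0" "degree q' = degree q"
        "poly q' \<theta> = inverse l * poly q \<theta>"
        using q l d0 by (auto simp: q'_def l_def intro!: po_smult[OF R])
      have mp: "m \<in> polys_over \<rat>" "poly m \<theta> = 0" "degree m > 0" using m is_minpoly_degree[OF m] by (auto simp: is_minpoly_def)
      define k s where "k = m div q'" and "s = m mod q'"
      have ks: "k \<in> polys_over \<rat>" "s \<in> polys_over \<rat>" using po_mod_monic[OF R q'(1-3) mp(1)] by (auto simp: k_def s_def)
      have eq: "m = k * q' + s" by (simp add: k_def s_def)
      have "degree s < degree q'" unfolding s_def using degree_mod_less[of q' m] q'(3) by (cases "q' = 0") auto
      have dm: "degree q' \<le> degree m"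
      proof (rule ccontr)
        assume a: "\<not> degree q' \<le> degree m"
        define q2 where "q2 = q' mod m"
        define k2 where "k2 = q' div m"
        have m1: "lead_coeff m = 1" using m by (simp add: is_minpoly_def)
        have q2: "q2 \<in> polys_over \<rat>" using po_mod_monic[OF R mp(1) m1 mp(3) q'(1)] by (simp add: q2_def)
        have "q' = k2 * m + q2" by (simp add: k2_def q2_def)
        hence v: "poly q2 \<theta> = inverse l * poly q \<theta>" using mp q' by (metis add_0 mult_zero_right poly_add poly_mult)
        have "poly q2 \<theta> = poly (Polynomial.smult (inverse l) r) \<theta> * x" using v r(2) by simp
        moreover have "poly q2 \<theta> \<noteq> 0" using v q(1) l(2) by simp
        moreover have "Polynomial.smult (inverse l) r \<in> polys_over \<rat>" using l r by (intro po_smult[OF R]) auto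
        ultimately have "?P q2" using q2 by blast
        hence "degree q \<le> degree q2" using q(2) by blast
        moreover have "degree q2 < degree m" unfolding q2_def using degree_mod_less[of m q'] mp(3) by (cases "m = 0") auto
        ultimately show False using a q' by simp
      qed
      have k0: "k \<noteq> 0" using eq \<open>degree s < degree q'\<close> dm by auto
      have dk: "degree k < degree m"
      proof -
        have "degree (k * q') = degree k + degree q'" using k0 q'(3) by (intro degree_mult_eq) auto
        moreover have "degree m = degree (k * q')" unfolding eq
          using \<open>degree s < degree q'\<close> calculation by (intro degree_add_eq_left) simp
        ultimately show ?thesis using q'(3) by simp
      qed
      \<comment> \<open>A quotient \<open>k\<close> of smaller degree than \<open>m\<close> cannot
        vanish at \<theta>; this is why the value of the remainder \<open>s\<close> is
        nonzero.\<close>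
      have kn: "poly k \<theta> \<noteq> 0"
      proof
        assume "poly k \<theta> = 0"
        hence "m dvd k" using m ks by (auto simp: is_minpoly_def)
        with k0 dk show False by (meson dvd_imp_degree_le leD)
      qed
      have sv: "poly s \<theta> = - poly k \<theta> * inverse l * poly q \<theta>"
        using mp(2) q'(5) arg_cong[OF eq, of "\<lambda>p. poly p \<theta>"] by (simp add: eq_neg_iff_add_eq_0 algebra_simps)
      have "poly s \<theta> = poly (Polynomial.smult (- inverse l) (k * r)) \<theta> * x" using sv r(2) by simp
      moreover have "poly s \<theta> \<noteq> 0" using sv kn q(1) l(2) by simp
      moreover have "Polynomial.smult (- inverse l) (k * r) \<in> polys_over \<rat>"
        using l r ks by (intro po_smult[OF R] po_mult[OF R]) auto
      ultimately have "?P s" using ks by blast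
      hence "degree q \<le> degree s" using q(2) by blast
      with \<open>degree s < degree q'\<close> q'(4) show False by simp
    qed
    then obtain c where c: "q = [:c:]" by (metis degree_eq_zeroE)
    hence "c \<in> \<rat>" using q by (metis coeff_pCons_0 mem_Collect_eq polys_over_def)
    moreover have "c \<noteq> 0" "c = poly r \<theta> * x" using q r c by auto
    hence "inverse x = inverse c * poly r \<theta>" using x by (simp add: field_simps)
    ultimately show ?thesis unfolding adj_def using r
      by (auto intro!: exI[of _ "Polynomial.smult (inverse c) r"] po_smult[OF R])
  qed
  show ?thesis unfolding sfield_def
  proof (intro conjI ballI)
    show "1 \<in> adj \<theta>" unfolding adj_def using po_1[OF R] by (auto intro!: exI[of _ 1])
  next
    fix x y assume "x \<in> adj \<theta>" "y \<in> adj \<theta>"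
    then obtain p q where "p \<in> polys_over \<rat>" "x = poly p \<theta>" "q \<in> polys_over \<rat>" "y = poly q \<theta>"
      by (auto simp: adj_def)
    hence "x - y = poly (p - q) \<theta>" "x * y = poly (p * q) \<theta>" "p - q \<in> polys_over \<rat>" "p * q \<in> polys_over \<rat>"
      by (auto intro!: po_diff[OF R] po_mult[OF R])
    thus "x - y \<in> adj \<theta>" "x * y \<in> adj \<theta>" unfolding adj_def by blast+
  next
    fix x assume "x \<in> adj \<theta>" thus "inverse x \<in> adj \<theta>" using inv[of x] by (cases "x = 0") auto
  qed
qed

lemma adj_self: "\<theta> \<in> adj \<theta>"
  unfolding adj_def by (auto intro!: exI[of _ "[:0,1:]"] simp: polys_over_def coeff_pCons split: nat.splits)

lemma adj_Rats: "\<rat> \<subseteq> adj \<theta>"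
proof
  fix x :: complex assume "x \<in> \<rat>"
  thus "x \<in> adj \<theta>" unfolding adj_def
    by (auto intro!: exI[of _ "[:x:]"] simp: polys_over_def coeff_pCons split: nat.splits)
qed

text \<open>HOL-Algebra lists coefficients from the leading one downwards, hence the
  \<open>rev\<close>.\<close>

lemma poly_Poly_rev_eval: "ring.eval complex_field l x = poly (Poly (rev l)) (x::complex)"
proof -
  interpret field complex_field by (rule field_from_type_algebra)
  have pw: "x [^]\<^bsub>complex_field\<^esub> n = x ^ n" for n :: nat
    by (induction n) (auto simp: ring_of_type_algebra_def nat_pow_def)
  show ?thesis
    by (induction l) (auto simp: Poly_append poly_monom pw, auto simp: ring_of_type_algebra_def poly_monom algebra_simps)
qed

lemma adj_finite_dimension:
  assumes m: "is_minpoly \<rat> \<theta> m" shows "ring.finite_dimension complex_field \<rat> (adj \<theta>)"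
proof -
  interpret field complex_field by (rule field_from_type_algebra)
  have Q: "subfield \<rat> complex_field" by (rule sfield_imp_subfield[OF sfield_Rats_self])
  have c: "carrier complex_field = (UNIV :: complex set)" by (simp add: ring_of_type_algebra_def)
  have "(algebraic over \<rat>) \<theta>"
  proof (rule algebraicI[of "rev (coeffs m)"])
    have "lead_coeff m = 1" using m by (simp add: is_minpoly_def)
    hence m0: "m \<noteq> 0" by auto
    show "rev (coeffs m) \<noteq> []" using m0 by simp
    show "eval (rev (coeffs m)) \<theta> = \<zero>\<^bsub>complex_field\<^esub>"
      using m unfolding poly_Poly_rev_eval by (simp add: is_minpoly_def ring_of_type_algebra_def)
    have "set (coeffs m) \<subseteq> \<rat>" using m by (auto simp: is_minpoly_def polys_over_def coeffs_def)
    moreover have "hd (rev (coeffs m)) \<noteq> 0" using m0 by (simp add: hd_rev last_coeffs_eq_coeff_degree)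
    ultimately show "rev (coeffs m) \<in> carrier (\<rat>[X]\<^bsub>complex_field\<^esub>)"
      unfolding univ_poly_def polynomial_def by (auto simp: ring_of_type_algebra_def)
  qed
  hence fd: "finite_dimension \<rat> (simple_extension \<rat> \<theta>)"
    using finite_dimension_simple_extension[OF Q, of \<theta>] c by simp
  have "simple_extension \<rat> \<theta> = adj \<theta>"
  proof
    show "simple_extension \<rat> \<theta> \<subseteq> adj \<theta>"
    proof
      fix x assume "x \<in> simple_extension \<rat> \<theta>"
      thus "x \<in> adj \<theta>"
      proof (induction rule: simple_extension.induct)
        case zero
        show ?case using subsetD[OF adj_Rats, of 0 \<theta>] by (simp add: ring_of_type_algebra_def)
      next
        case (lin k1 k2)
        thus ?case using sfield_closed[OF adj_sfield[OF m]] adj_self[of \<theta>] subsetD[OF adj_Rats, of k2 \<theta>]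
            by (simp add: ring_of_type_algebra_def)
      qed
    qed
    show "adj \<theta> \<subseteq> simple_extension \<rat> \<theta>"
    proof
      fix x assume "x \<in> adj \<theta>"
      then obtain p where p: "p \<in> polys_over \<rat>" "x = poly p \<theta>" by (auto simp: adj_def)
      have "poly p \<theta> \<in> simple_extension \<rat> \<theta>" using p(1)
      proof (induction p)
        case 0 show ?case using simple_extension.zero[of \<rat> \<theta>] by (simp add: ring_of_type_algebra_def)
      next
        case (pCons a p)
        have "a \<in> \<rat>" using pCons(3) by (metis coeff_pCons_0 mem_Collect_eq polys_over_def)
        moreover have "p \<in> polys_over \<rat>" using pCons(3) unfolding polys_over_def mem_Collect_eq by (metis coeff_pCons_Suc)
        ultimately show ?case using simple_extension.lin[of "poly p \<theta>" \<rat> \<theta> a] pCons(2)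
          by (simp add: ring_of_type_algebra_def algebra_simps)
      qed
      with p show "x \<in> simple_extension \<rat> \<theta>" by simp
    qed
  qed
  with fd show ?thesis by simp
qed

section \<open>Galois groups\<close>

abbreviation Gal :: "complex set \<Rightarrow> (complex \<Rightarrow> complex) set" where
  "Gal K \<equiv> carrier (gal_group \<rat> K)"

lemma Gal_iff_fix:
  assumes "sfield K"
  shows "\<sigma> \<in> Gal K \<longleftrightarrow> \<sigma> \<in> extensional K \<and> bij_betw \<sigma> K K \<and>
    (\<forall>x\<in>K. \<forall>y\<in>K. \<sigma> (x + y) = \<sigma> x + \<sigma> y \<and> \<sigma> (x * y) = \<sigma> x * \<sigma> y) \<and> \<sigma> 1 = 1 \<and> (\<forall>x\<in>\<rat>. \<sigma> x = x)"
  by (auto simp: gal_group_def Bij_def Ring.ring_hom_def ring_of_type_algebra_def bij_betw_def)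

lemma hom_fixes_Rats:
  assumes K: "sfield K"
    and h: "\<And>x y. x \<in> K \<Longrightarrow> y \<in> K \<Longrightarrow> \<sigma> (x + y) = \<sigma> x + (\<sigma> y :: complex)"
      "\<And>x y. x \<in> K \<Longrightarrow> y \<in> K \<Longrightarrow> \<sigma> (x * y) = \<sigma> x * \<sigma> y" "\<sigma> 1 = 1"
  shows "x \<in> \<rat> \<Longrightarrow> \<sigma> x = x"
proof -
  note c = sfield_closed[OF K] sfield_of_nat[OF K]
  have z: "\<sigma> 0 = 0" using h(1)[of 0 0] c by simp
  have m: "\<sigma> (- x) = - \<sigma> x" if "x \<in> K" for x
    using h(1)[of x "- x"] that c z by (simp add: add_eq_0_iff)
  have n: "\<sigma> (of_nat n) = of_nat n" for n
    by (induction n) (use z h c in auto)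
  have i: "\<sigma> (of_int k) = of_int k" for k
    by (cases k rule: int_cases2) (use n m c in auto)
  show "\<sigma> x = x" if xq: "x \<in> \<rat>"
  proof -
    obtain a b :: int where ab0: "b > 0" "coprime a b" "x = of_int a / of_int b"
      using xq by (rule Rats_cases')
    hence ab: "x = of_int a / of_int b" "b \<noteq> 0" by auto
    have xK: "x \<in> K" using sfield_Rats[OF K] xq by auto
    have "\<sigma> (x * of_int b) = \<sigma> x * of_int b" using h(2) xK c i by simp
    moreover have "x * of_int b = of_int a" using ab by simp
    ultimately have "\<sigma> x * of_int b = x * of_int b" using i[of a] by metis
    thus ?thesis using ab(2) by simp
  qed
qed

lemma Gal_iff:
  assumes "sfield K"
  shows "\<sigma> \<in> Gal K \<longleftrightarrow> \<sigma> \<in> extensional K \<and> bij_betw \<sigma> K K \<and>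
    (\<forall>x\<in>K. \<forall>y\<in>K. \<sigma> (x + y) = \<sigma> x + \<sigma> y \<and> \<sigma> (x * y) = \<sigma> x * \<sigma> y) \<and> \<sigma> 1 = 1"
  unfolding Gal_iff_fix[OF assms] using hom_fixes_Rats[OF assms, of \<sigma>] by blast

lemma Gal_one: "\<one>\<^bsub>gal_group \<rat> K\<^esub> = (\<lambda>x\<in>K. x)"
  and Gal_mult: "\<sigma> \<in> Gal K \<Longrightarrow> \<tau> \<in> Gal K \<Longrightarrow> \<sigma> \<otimes>\<^bsub>gal_group \<rat> K\<^esub> \<tau> = compose K \<sigma> \<tau>"
  by (auto simp: gal_group_def BijGroup_def)

lemma Gal_group:
  assumes K: "sfield K" shows "group (gal_group \<rat> K)"
proof -
  interpret B: group "BijGroup K" by (rule group_BijGroup)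
  have one: "\<one>\<^bsub>BijGroup K\<^esub> = (\<lambda>x\<in>K. x)" by (simp add: BijGroup_def)
  have sub: "Gal K \<subseteq> carrier (BijGroup K)" by (auto simp: gal_group_def BijGroup_def)
  have mult: "a \<otimes>\<^bsub>BijGroup K\<^esub> b = compose K a b" if "a \<in> Gal K" "b \<in> Gal K" for a b
    using that sub by (auto simp: BijGroup_def)
  note c = sfield_closed[OF K]
  have "subgroup (Gal K) (BijGroup K)"
  proof (rule B.subgroupI)
    show "Gal K \<subseteq> carrier (BijGroup K)" by (rule sub)
    have "(\<lambda>x\<in>K. x) \<in> Gal K" using c by (auto simp: Gal_iff[OF K] bij_betw_def inj_on_def)
    thus "Gal K \<noteq> {}" by blast
  next
    fix a assume a: "a \<in> Gal K"
    note a' = a[unfolded Gal_iff[OF K]]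
    let ?i = "restrict (inv_into K a) K"
    have bij: "bij_betw a K K" and inK: "\<And>x. x \<in> K \<Longrightarrow> inv_into K a x \<in> K"
      and ai: "\<And>x. x \<in> K \<Longrightarrow> a (inv_into K a x) = x"
      and ia: "\<And>x. x \<in> K \<Longrightarrow> inv_into K a (a x) = x"
      using a' by (auto simp: bij_betw_def inv_into_into f_inv_into_f)
    have "?i \<in> Gal K" unfolding Gal_iff[OF K]
    proof (intro conjI ballI)
      show "bij_betw ?i K K" using bij_betw_inv_into[OF bij] by (simp cong: bij_betw_cong)
      show "?i 1 = 1" using ia[of 1] a' c by simp
    next
      fix x y assume xy: "x \<in> K" "y \<in> K"
      have "a (inv_into K a x + inv_into K a y) = x + y" "a (inv_into K a x * inv_into K a y) = x * y"
        using a' inK ai xy by auto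
      hence "inv_into K a (x + y) = inv_into K a x + inv_into K a y"
        "inv_into K a (x * y) = inv_into K a x * inv_into K a y"
        using ia inK xy c by metis+
      thus "?i (x + y) = ?i x + ?i y" "?i (x * y) = ?i x * ?i y" using xy c by auto
    qed auto
    moreover have "inv\<^bsub>BijGroup K\<^esub> a = ?i"
      using a sub by (intro inv_BijGroup) (auto simp: BijGroup_def)
    ultimately show "inv\<^bsub>BijGroup K\<^esub> a \<in> Gal K" by simp
  next
    fix a b assume ab: "a \<in> Gal K" "b \<in> Gal K"
    note a' = ab(1)[unfolded Gal_iff[OF K]] and b' = ab(2)[unfolded Gal_iff[OF K]]
    have bK: "b x \<in> K" if "x \<in> K" for x using b' that by (auto simp: bij_betw_def)
    show "a \<otimes>\<^bsub>BijGroup K\<^esub> b \<in> Gal K" unfolding mult[OF ab]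
      unfolding Gal_iff[OF K] using a' b' bK c
      by (auto simp: compose_eq intro: bij_betw_compose)
  qed
  from B.subgroup_imp_group[OF this] show ?thesis by (simp add: gal_group_def)
qed

text \<open>\<open>K\<close> is an arbitrary subfield at this point; finiteness of the Galois group
  enters with \<open>galfield\<close>.\<close>

locale numfield =
  fixes K :: "complex set" assumes K: "sfield K"
begin

abbreviation "GK \<equiv> gal_group \<rat> K"

sublocale G: group GK by (rule Gal_group[OF K])

lemma Gal_in: "\<sigma> \<in> Gal K \<Longrightarrow> x \<in> K \<Longrightarrow> \<sigma> x \<in> K"
  and Gal_add: "\<sigma> \<in> Gal K \<Longrightarrow> x \<in> K \<Longrightarrow> y \<in> K \<Longrightarrow> \<sigma> (x + y) = \<sigma> x + \<sigma> y"
  and Gal_times: "\<sigma> \<in> Gal K \<Longrightarrow> x \<in> K \<Longrightarrow> y \<in> K \<Longrightarrow> \<sigma> (x * y) = \<sigma> x * \<sigma> y"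
  and Gal_1: "\<sigma> \<in> Gal K \<Longrightarrow> \<sigma> 1 = 1"
  and Gal_inj: "\<sigma> \<in> Gal K \<Longrightarrow> inj_on \<sigma> K" and Gal_surj: "\<sigma> \<in> Gal K \<Longrightarrow> \<sigma> ` K = K"
  and Gal_ext: "\<sigma> \<in> Gal K \<Longrightarrow> \<sigma> \<in> extensional K"
  unfolding Gal_iff[OF K] bij_betw_def by auto

lemma Gal_Rats: "\<sigma> \<in> Gal K \<Longrightarrow> q \<in> \<rat> \<Longrightarrow> \<sigma> q = q"
  unfolding Gal_iff_fix[OF K] by auto

lemma Gal_0: "\<sigma> \<in> Gal K \<Longrightarrow> \<sigma> 0 = 0" by (rule Gal_Rats) auto

lemma Gal_of_int: "\<sigma> \<in> Gal K \<Longrightarrow> \<sigma> (of_int n) = of_int n"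
  by (rule Gal_Rats) auto

lemma Gal_uminus: "\<sigma> \<in> Gal K \<Longrightarrow> x \<in> K \<Longrightarrow> \<sigma> (- x) = - \<sigma> x"
  using Gal_add[of \<sigma> x "- x"] Gal_0[of \<sigma>] sfield_closed[OF K] by (simp add: add_eq_0_iff)

lemma Gal_diff: "\<sigma> \<in> Gal K \<Longrightarrow> x \<in> K \<Longrightarrow> y \<in> K \<Longrightarrow> \<sigma> (x - y) = \<sigma> x - \<sigma> y"
  using Gal_add[of \<sigma> x "- y"] Gal_uminus[of \<sigma> y] sfield_closed[OF K] by simp

lemma Gal_power: "\<sigma> \<in> Gal K \<Longrightarrow> x \<in> K \<Longrightarrow> \<sigma> (x ^ n) = \<sigma> x ^ n"
  by (induction n) (auto simp: Gal_1 Gal_times sfield_closed[OF K])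

lemma Gal_sum: "\<sigma> \<in> Gal K \<Longrightarrow> (\<And>i. i \<in> I \<Longrightarrow> f i \<in> K) \<Longrightarrow> \<sigma> (sum f I) = (\<Sum>i\<in>I. \<sigma> (f i))"
  by (induction I rule: infinite_finite_induct) (auto simp: Gal_0 Gal_add sfield_sum[OF K])

lemma Gal_prod: "\<sigma> \<in> Gal K \<Longrightarrow> (\<And>i. i \<in> I \<Longrightarrow> f i \<in> K) \<Longrightarrow> \<sigma> (prod f I) = (\<Prod>i\<in>I. \<sigma> (f i))"
  by (induction I rule: infinite_finite_induct) (auto simp: Gal_1 Gal_times sfield_prod[OF K])

lemma Gal_poly: "\<sigma> \<in> Gal K \<Longrightarrow> p \<in> polys_over \<rat> \<Longrightarrow> x \<in> K \<Longrightarrow> \<sigma> (poly p x) = poly p (\<sigma> x)"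
proof (induction p)
  case (pCons a p)
  have a: "a \<in> \<rat>" using pCons(4) by (metis coeff_pCons_0 mem_Collect_eq polys_over_def)
  have p: "p \<in> polys_over \<rat>" using pCons(4) unfolding polys_over_def mem_Collect_eq by (metis coeff_pCons_Suc)
  have "poly p x \<in> K" using poly_po[OF K] polys_over_mono[OF sfield_Rats[OF K]] p pCons(5) by auto
  moreover have "a \<in> K" using sfield_Rats[OF K] a by auto
  ultimately show ?case using pCons a p by (simp add: Gal_add Gal_times Gal_Rats sfield_closed[OF K])
qed (simp add: Gal_0)

lemma Gal_compose: "\<sigma> \<in> Gal K \<Longrightarrow> \<tau> \<in> Gal K \<Longrightarrow> x \<in> K \<Longrightarrow> (\<sigma> \<otimes>\<^bsub>GK\<^esub> \<tau>) x = \<sigma> (\<tau> x)"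
  by (simp add: Gal_mult compose_eq)

lemma Gal_inv: assumes "\<sigma> \<in> Gal K" "x \<in> K"
  shows "\<sigma> ((inv\<^bsub>GK\<^esub> \<sigma>) x) = x" "(inv\<^bsub>GK\<^esub> \<sigma>) (\<sigma> x) = x"
  using Gal_compose[of \<sigma> "inv\<^bsub>GK\<^esub> \<sigma>" x] Gal_compose[of "inv\<^bsub>GK\<^esub> \<sigma>" \<sigma> x] assms
  by (auto simp: G.r_inv G.l_inv Gal_one)

lemma Gal_eqI: "\<sigma> \<in> Gal K \<Longrightarrow> \<tau> \<in> Gal K \<Longrightarrow> (\<And>x. x \<in> K \<Longrightarrow> \<sigma> x = \<tau> x) \<Longrightarrow> \<sigma> = \<tau>"
  using Gal_ext by (meson extensionalityI)

end

text \<open>\<open>K\<close> is the splitting field of the squarefree rational polynomial with root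
  set \<open>R\<close>, presented as the simple extension by a primitive element \<theta> that is an
  integer combination of the roots.\<close>

locale splitting =
  fixes R K :: "complex set" and \<theta> :: complex and c :: "complex \<Rightarrow> nat" and m :: "complex poly"
  assumes fin: "finite R" and int: "\<And>r. r \<in> R \<Longrightarrow> algebraic_int r"
    and rat: "(\<Prod>r\<in>R. [:- r, 1:]) \<in> polys_over \<rat>"
    and th: "\<theta> = (\<Sum>r\<in>R. of_nat (c r) * r)" "algebraic_int \<theta>"
    and gen: "\<And>F. sfield F \<Longrightarrow> \<theta> \<in> F \<Longrightarrow> R \<subseteq> F"
    and m: "is_minpoly \<rat> \<theta> m" and K_def: "K = adj \<theta>"

lemma splitting_exists:
  assumes "finite R" "\<And>r. r \<in> R \<Longrightarrow> algebraic_int r" "(\<Prod>r\<in>R. [:- r, 1:]) \<in> polys_over \<rat>"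
  shows "\<exists>K \<theta> c m. splitting R K \<theta> c m"
proof -
  obtain c :: "complex \<Rightarrow> nat" where c: "algebraic_int (\<Sum>s\<in>R. of_nat (c s) * s)"
    "\<And>F. sfield F \<Longrightarrow> (\<Sum>s\<in>R. of_nat (c s) * s) \<in> F \<Longrightarrow> R \<subseteq> F"
    using primitive_element[OF assms(1,2)] by blast
  obtain m where "is_minpoly \<rat> (\<Sum>s\<in>R. of_nat (c s) * s) m"
    using algebraic_int_poly_over[OF c(1)] minpoly_exists[OF sfield_Rats_self] by blast
  with c assms show ?thesis unfolding splitting_def by blast
qed

context splitting
begin

sublocale numfield K by unfold_locales (simp add: K_def adj_sfield[OF m])

lemma R_K: "R \<subseteq> K" by (rule gen[OF K]) (simp add: K_def adj_self)

lemma th_K: "\<theta> \<in> K" by (simp add: K_def adj_self)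

lemma K_E: assumes "x \<in> K" obtains p where "p \<in> polys_over \<rat>" "x = poly p \<theta>"
  using assms by (auto simp: K_def adj_def)

lemma roots_R: "poly (\<Prod>r\<in>R. [:- r, 1:]) x = 0 \<longleftrightarrow> x \<in> R"
  using fin by (auto simp: poly_prod)

lemma Gal_R: "\<sigma> \<in> Gal K \<Longrightarrow> r \<in> R \<Longrightarrow> \<sigma> r \<in> R"
proof -
  assume a: "\<sigma> \<in> Gal K" "r \<in> R"
  hence "r \<in> K" using R_K by auto
  from Gal_poly[OF a(1) rat this] show ?thesis using a Gal_0[OF a(1)] roots_R[of r] roots_R[of "\<sigma> r"] by metis
qed

lemma Gal_eq_th: "\<sigma> \<in> Gal K \<Longrightarrow> \<tau> \<in> Gal K \<Longrightarrow> \<sigma> \<theta> = \<tau> \<theta> \<Longrightarrow> \<sigma> = \<tau>"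
  by (rule Gal_eqI) (auto elim!: K_E simp: Gal_poly th_K)

lemma Gal_eq_R: "\<sigma> \<in> Gal K \<Longrightarrow> \<tau> \<in> Gal K \<Longrightarrow> (\<And>r. r \<in> R \<Longrightarrow> \<sigma> r = \<tau> r) \<Longrightarrow> \<sigma> = \<tau>"
proof -
  assume a: "\<sigma> \<in> Gal K" "\<tau> \<in> Gal K" "\<And>r. r \<in> R \<Longrightarrow> \<sigma> r = \<tau> r"
  have "\<sigma> \<theta> = (\<Sum>r\<in>R. of_nat (c r) * \<sigma> r)" if "\<sigma> \<in> Gal K" for \<sigma>
  proof -
    have "\<sigma> \<theta> = (\<Sum>r\<in>R. \<sigma> (of_nat (c r) * r))" unfolding th(1)
      using that R_K by (intro Gal_sum) (auto intro!: sfield_mult[OF K] sfield_of_nat[OF K])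
    also have "\<dots> = (\<Sum>r\<in>R. of_nat (c r) * \<sigma> r)"
      using that R_K by (intro sum.cong refl) (auto simp: Gal_times Gal_Rats sfield_of_nat[OF K])
    finally show ?thesis .
  qed
  note e = this
  have "\<sigma> \<theta> = \<tau> \<theta>" unfolding e[OF a(1)] e[OF a(2)] by (intro sum.cong) (simp_all add: a(3))
  with a show ?thesis using Gal_eq_th by blast
qed

lemma Gal_th_root: "\<sigma> \<in> Gal K \<Longrightarrow> poly m (\<sigma> \<theta>) = 0"
proof -
  assume a: "\<sigma> \<in> Gal K"
  have mm: "m \<in> polys_over \<rat>" "poly m \<theta> = 0" using m by (auto simp: is_minpoly_def)
  from Gal_poly[OF a mm(1) th_K] show ?thesis using mm Gal_0[OF a] by metis
qed

lemma m_nz: "m \<noteq> 0" using is_minpoly_degree[OF m] by auto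

lemma Gal_finite: "finite (Gal K)"
proof (rule finite_imageD)
  show "finite ((\<lambda>\<sigma>. \<sigma> \<theta>) ` Gal K)"
    by (rule finite_subset[of _ "{z. poly m z = 0}"]) (auto simp: Gal_th_root poly_roots_finite m_nz)
  show "inj_on (\<lambda>\<sigma>. \<sigma> \<theta>) (Gal K)" by (auto simp: inj_on_def Gal_eq_th)
qed

text \<open>If \<open>poly p \<theta>\<close> is nonzero, it has an inverse
  \<open>poly q \<theta>\<close> in \<open>K\<close>. Then \<open>m\<close> divides
  \<open>p * q - 1\<close>, so \<open>p\<close> cannot vanish at the conjugate either.\<close>

lemma conj_vanish: assumes "poly m \<theta>' = 0" "p \<in> polys_over \<rat>"
  shows "poly p \<theta>' = 0 \<longleftrightarrow> poly p \<theta> = 0"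
proof
  assume "poly p \<theta> = 0"
  hence "m dvd p" using m assms by (auto simp: is_minpoly_def)
  with assms show "poly p \<theta>' = 0" by (auto elim!: dvdE)
next
  assume a: "poly p \<theta>' = 0"
  show "poly p \<theta> = 0"
  proof (rule ccontr)
    assume n: "poly p \<theta> \<noteq> 0"
    have "poly p \<theta> \<in> K" using assms by (auto simp: K_def adj_def)
    hence "inverse (poly p \<theta>) \<in> K" by (rule sfield_inverse[OF K])
    then obtain q where q: "q \<in> polys_over \<rat>" "inverse (poly p \<theta>) = poly q \<theta>" by (rule K_E)
    have "p * q - 1 \<in> polys_over \<rat>"
      by (intro po_diff[OF sfield_Rats_self] po_mult[OF sfield_Rats_self] po_1[OF sfield_Rats_self] assms q)
    moreover have "poly (p * q - 1) \<theta> = 0" using q(2)[symmetric] n by simp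
    ultimately have "m dvd p * q - 1" using m by (auto simp: is_minpoly_def)
    then obtain k where "p * q - 1 = m * k" by (rule dvdE)
    hence "poly (p * q - 1) \<theta>' = poly (m * k) \<theta>'" by metis
    hence "poly (p * q - 1) \<theta>' = 0" using assms(1) by simp
    with a show False by simp
  qed
qed

text \<open>Substituting \<theta>' for \<theta> is well defined and injective by
  \<open>conj_vanish\<close>. It maps \<open>R\<close> into \<open>R\<close>, which puts \<theta>'
  into \<open>K\<close>: this is normality.\<close>

lemma Gal_exists: assumes r: "poly m \<theta>' = 0" shows "\<exists>\<sigma>\<in>Gal K. \<sigma> \<theta> = \<theta>'"
proof -
  note Q = sfield_Rats_self
  define \<sigma> where "\<sigma> = restrict (\<lambda>x. poly (SOME p. p \<in> polys_over \<rat> \<and> x = poly p \<theta>) \<theta>') K"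
  have s: "\<sigma> (poly p \<theta>) = poly p \<theta>'" if p: "p \<in> polys_over \<rat>" for p
  proof -
    let ?q = "SOME q. q \<in> polys_over \<rat> \<and> poly p \<theta> = poly q \<theta>"
    have q: "?q \<in> polys_over \<rat> \<and> poly p \<theta> = poly ?q \<theta>"
      by (rule someI[of _ p]) (use p in simp)
    have "poly (p - ?q) \<theta>' = 0" using q p conj_vanish[OF r, of "p - ?q"] po_diff[OF Q] by simp
    moreover have "poly p \<theta> \<in> K" using p by (auto simp: K_def adj_def)
    ultimately show ?thesis by (simp add: \<sigma>_def)
  qed
  define pp where "pp x = (SOME p. p \<in> polys_over \<rat> \<and> x = poly p \<theta>)" for x
  have pp: "pp x \<in> polys_over \<rat>" "x = poly (pp x) \<theta>" if "x \<in> K" for x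
    using someI_ex[of "\<lambda>p. p \<in> polys_over \<rat> \<and> x = poly p \<theta>"] that K_E unfolding pp_def by metis+
  have sp: "\<sigma> x = poly (pp x) \<theta>'" if "x \<in> K" for x using s[OF pp(1)[OF that]] pp(2)[OF that] by simp
  have add: "\<sigma> (x + y) = \<sigma> x + \<sigma> y" and mul: "\<sigma> (x * y) = \<sigma> x * \<sigma> y" if "x \<in> K" "y \<in> K" for x y
    using s[of "pp x + pp y"] s[of "pp x * pp y"] pp[OF that(1)] pp[OF that(2)] sp[OF that(1)] sp[OF that(2)]
    by (auto simp: po_add[OF Q] po_mult[OF Q])
  have one: "\<sigma> 1 = 1" using s[of 1] po_1[OF Q] by simp
  have inj: "inj_on \<sigma> K"
  proof (rule inj_onI)
    fix x y assume a: "x \<in> K" "y \<in> K" "\<sigma> x = \<sigma> y"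
    hence "poly (pp x - pp y) \<theta>' = 0" using sp by simp
    hence "poly (pp x - pp y) \<theta> = 0" using conj_vanish[OF r] po_diff[OF Q] pp a by blast
    with pp a show "x = y" by simp
  qed
  have sR: "\<sigma> x \<in> R" if x: "x \<in> R" for x
  proof -
    have xK: "x \<in> K" using x R_K by auto
    let ?h = "pcompose (\<Prod>r\<in>R. [:- r, 1:]) (pp x)"
    have "?h \<in> polys_over \<rat>" by (rule po_pcompose[OF Q rat pp(1)[OF xK]])
    moreover have "poly ?h \<theta> = 0" using pp(2)[OF xK] roots_R x by (simp add: poly_pcompose)
    ultimately have "poly ?h \<theta>' = 0" using conj_vanish[OF r] by blast
    thus ?thesis using sp[OF xK] roots_R by (simp add: poly_pcompose)
  qed
  have sth: "\<sigma> \<theta> = \<theta>'" using s[of "[:0,1:]"] by (simp add: polys_over_def coeff_pCons split: nat.splits)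
  have rats: "\<sigma> q = q" if "q \<in> \<rat>" for q using hom_fixes_Rats[OF K add mul one that] by blast
  have sumR: "\<sigma> (\<Sum>r\<in>A. of_nat (c r) * r) = (\<Sum>r\<in>A. of_nat (c r) * \<sigma> r)" if "A \<subseteq> R" for A
    using finite_subset[OF that fin] that
  proof (induction A rule: finite_induct)
    case (insert a A)
    have "of_nat (c a) * a \<in> K" "(\<Sum>r\<in>A. of_nat (c r) * r) \<in> K" "a \<in> K" "of_nat (c a) \<in> K"
      using insert.prems R_K by (auto intro!: sfield_sum[OF K] sfield_mult[OF K] sfield_of_nat[OF K])
    thus ?case using insert by (simp add: add mul rats)
  qed (simp add: rats)
  have thK: "\<theta>' \<in> K"
  proof -
    have "\<theta>' = (\<Sum>r\<in>R. of_nat (c r) * \<sigma> r)" using sumR[of R] sth th(1) by simp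
    also have "\<dots> \<in> K" using sR R_K by (auto intro!: sfield_sum[OF K] sfield_mult[OF K] sfield_of_nat[OF K])
    finally show ?thesis .
  qed
  have sK: "\<sigma> x \<in> K" if "x \<in> K" for x
    using sp[OF that] poly_po[OF K _ thK] pp(1)[OF that] polys_over_mono[OF sfield_Rats[OF K]] by auto
  note cl = sfield_closed[OF K]
  \<comment> \<open>Surjectivity: the image is a subfield and contains \<open>R\<close>, since an
    injection of the finite set \<open>R\<close> into itself is onto. It therefore contains \<theta>
    and all of \<open>K\<close>.\<close>
  have im: "sfield (\<sigma> ` K)" unfolding sfield_def
  proof (intro conjI ballI)
    show "1 \<in> \<sigma> ` K" using one cl by (metis image_eqI)
  next
    fix x y assume "x \<in> \<sigma> ` K" "y \<in> \<sigma> ` K"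
    then obtain a b where ab: "a \<in> K" "b \<in> K" "x = \<sigma> a" "y = \<sigma> b" by auto
    have "\<sigma> (a - b) + \<sigma> b = \<sigma> a" using add[of "a - b" b] ab cl by simp
    hence "x - y = \<sigma> (a - b)" "x * y = \<sigma> (a * b)" using ab mul by (auto simp: algebra_simps)
    thus "x - y \<in> \<sigma> ` K" "x * y \<in> \<sigma> ` K" using ab cl by auto
  next
    fix x assume "x \<in> \<sigma> ` K"
    then obtain a where a: "a \<in> K" "x = \<sigma> a" by auto
    show "inverse x \<in> \<sigma> ` K"
    proof (cases "a = 0")
      case True thus ?thesis using a rats[of 0] cl by auto
    next
      case False
      hence "\<sigma> (inverse a) * x = 1" using mul[of "inverse a" a] a cl one by simp
      hence "inverse x = \<sigma> (inverse a)" by (metis inverse_unique mult.commute)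
      thus ?thesis using a cl by auto
    qed
  qed
  have "\<sigma> ` R = R" using sR inj R_K fin by (metis endo_inj_surj image_subsetI inj_on_subset)
  hence "R \<subseteq> \<sigma> ` K" using R_K by blast
  hence "\<theta> \<in> \<sigma> ` K" unfolding th(1) by (intro sfield_sum[OF im] sfield_mult[OF im] sfield_of_nat[OF im]) auto
  hence "K \<subseteq> \<sigma> ` K" using poly_po[OF im] polys_over_mono[OF sfield_Rats[OF im]] K_E by (metis subsetD subsetI)
  hence "bij_betw \<sigma> K K" using inj sK by (auto simp: bij_betw_def)
  hence "\<sigma> \<in> Gal K" unfolding Gal_iff[OF K] using add mul one by (auto simp: \<sigma>_def)
  with sth show ?thesis by blast
qed

text \<open>By \<open>conj_vanish\<close> a multiple root would make \<theta> a root of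
  \<open>pderiv m\<close>, which is nonzero and of smaller degree than \<open>m\<close>.\<close>

lemma m_simple: assumes "poly m z = 0" shows "poly (pderiv m) z \<noteq> 0"
proof
  assume a: "poly (pderiv m) z = 0"
  have mQ: "m \<in> polys_over \<rat>" using m by (simp add: is_minpoly_def)
  hence p: "pderiv m \<in> polys_over \<rat>" by (auto simp: polys_over_def coeff_pderiv)
  have "poly (pderiv m) \<theta> = 0" using conj_vanish[OF assms p] a by simp
  hence "m dvd pderiv m" using m p by (auto simp: is_minpoly_def)
  moreover have d: "degree m > 0" by (rule is_minpoly_degree[OF m])
  moreover have "pderiv m \<noteq> 0" using d by (simp add: pderiv_eq_0_iff)
  ultimately have "degree m \<le> degree (pderiv m)" by (intro dvd_imp_degree_le)
  with d show False by (simp add: degree_pderiv)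
qed

text \<open>Write \<open>x = poly p \<theta>\<close> with \<open>degree p < degree m\<close>. Then
  \<open>p - x\<close> vanishes at every conjugate of \<theta>, and there are
  \<open>degree m\<close> of them since \<open>m\<close> is squarefree; hence \<open>p\<close> is
  constant.\<close>

lemma fixed_Rats:
  assumes x: "x \<in> K" and f: "\<And>\<sigma>. \<sigma> \<in> Gal K \<Longrightarrow> \<sigma> x = x" shows "x \<in> \<rat>"
proof -
  obtain p0 where p0: "p0 \<in> polys_over \<rat>" "x = poly p0 \<theta>" using x by (rule K_E)
  define p where "p = p0 mod m"
  have m': "m \<in> polys_over \<rat>" "lead_coeff m = 1" "poly m \<theta> = 0" using m by (auto simp: is_minpoly_def)
  have d: "degree m > 0" by (rule is_minpoly_degree[OF m])
  have p: "p \<in> polys_over \<rat>" using po_mod_monic[OF sfield_Rats_self m'(1,2) d p0(1)] by (simp add: p_def)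
  have px: "x = poly p \<theta>"
  proof -
    have "poly p0 \<theta> = poly (p0 div m * m + p0 mod m) \<theta>" by simp
    also have "\<dots> = poly p \<theta>" unfolding poly_add poly_mult p_def using m'(3) by simp
    finally show ?thesis using p0 by simp
  qed
  have dp: "degree p < degree m" unfolding p_def using degree_mod_less[of m p0] d m_nz by auto
  have "rsquarefree m" using m_simple by (auto simp: rsquarefree_roots)
  hence "m = (\<Prod>z|poly m z = 0. [:- z, 1:])" using complex_poly_decompose_rsquarefree[of m] m' by simp
  moreover have "degree (\<Prod>z\<in>A. [:- z, 1:]) = card A" for A :: "complex set"
    by (subst degree_prod_eq_sum_degree) auto
  ultimately have "card {z. poly m z = 0} = degree m" by metis
  moreover have "{z. poly m z = 0} \<subseteq> {z. poly (p - [:x:]) z = 0}"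
  proof safe
    fix z assume "poly m z = 0"
    then obtain \<sigma> where s: "\<sigma> \<in> Gal K" "\<sigma> \<theta> = z" using Gal_exists by blast
    have "poly p z = \<sigma> x" using px Gal_poly[OF s(1) p th_K] s by simp
    thus "poly (p - [:x:]) z = 0" using f[OF s(1)] by simp
  qed
  ultimately have le: "degree m \<le> card {z. poly (p - [:x:]) z = 0}" if "p - [:x:] \<noteq> 0"
    using poly_roots_finite[OF that] by (metis card_mono)
  have "degree (p - [:x:]) < degree m"
    using dp d degree_diff_le_max[of p "[:x:]"] by simp
  have "p - [:x:] = 0"
  proof (rule ccontr)
    assume n: "p - [:x:] \<noteq> 0"
    from card_poly_roots_bound[OF this] le[OF n] \<open>degree (p - [:x:]) < degree m\<close> show False by simp
  qed
  hence "x = coeff p 0" by (metis coeff_pCons_0 eq_iff_diff_eq_0)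
  thus ?thesis using p by (auto simp: polys_over_def)
qed

theorem galois: "galois_extension \<rat> K"
  unfolding galois_extension_def
proof (intro conjI)
  show "subfield \<rat> complex_field" by (rule sfield_imp_subfield[OF sfield_Rats_self])
  show "subfield K complex_field" by (rule sfield_imp_subfield[OF K])
  show "\<rat> \<subseteq> K" by (rule sfield_Rats[OF K])
  show "ring.finite_dimension complex_field \<rat> K" unfolding K_def by (rule adj_finite_dimension[OF m])
  show "{x \<in> K. \<forall>\<sigma>\<in>Gal K. \<sigma> x = x} = \<rat>"
    using fixed_Rats sfield_Rats[OF K] Gal_Rats by auto
qed

lemma K_real: "R \<subseteq> \<real> \<Longrightarrow> K \<subseteq> \<real>"
proof -
  assume R: "R \<subseteq> \<real>"
  have r: "sfield (\<real> :: complex set)" by (auto simp: sfield_def)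
  have "\<theta> \<in> \<real>" unfolding th(1) using R by (intro sfield_sum[OF r] sfield_mult[OF r] sfield_of_nat[OF r]) auto
  thus ?thesis using poly_po[OF r] polys_over_mono[OF sfield_Rats[OF r]] K_E by (metis subsetD subsetI)
qed

end

section \<open>Prime ideals of the ring of integers\<close>

text \<open>The arithmetic of \<open>K\<close> rests on these two properties alone and makes no
  reference to a generator or a polynomial.\<close>

locale galfield = numfield +
  assumes Gal_fin: "finite (Gal K)"
    and fix_Rats: "\<And>x. x \<in> K \<Longrightarrow> (\<And>\<sigma>. \<sigma> \<in> Gal K \<Longrightarrow> \<sigma> x = x) \<Longrightarrow> x \<in> \<rat>"

sublocale splitting \<subseteq> galfield K
  by unfold_locales (auto intro: Gal_finite fixed_Rats)

context galfield
begin

definition "ZK = {x \<in> K. algebraic_int x}"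

lemma ZK_K: "x \<in> ZK \<Longrightarrow> x \<in> K" by (simp add: ZK_def)
lemma ZK_add: "x \<in> ZK \<Longrightarrow> y \<in> ZK \<Longrightarrow> x + y \<in> ZK"
  and ZK_mult: "x \<in> ZK \<Longrightarrow> y \<in> ZK \<Longrightarrow> x * y \<in> ZK"
  and ZK_diff: "x \<in> ZK \<Longrightarrow> y \<in> ZK \<Longrightarrow> x - y \<in> ZK"
  and ZK_uminus: "x \<in> ZK \<Longrightarrow> - x \<in> ZK"
  and ZK_of_int: "of_int n \<in> ZK" and ZK_0: "0 \<in> ZK" and ZK_1: "1 \<in> ZK"
  by (auto simp: ZK_def sfield_closed[OF K] algebraic_int_add_mult algebraic_int_diff int_imp_algebraic_int)
lemma ZK_of_nat: "of_nat n \<in> ZK" using ZK_of_int[of "int n"] by simp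
lemma ZK_numeral: "numeral n \<in> ZK" using ZK_of_nat[of "numeral n"] by simp
lemma ZK_power: "x \<in> ZK \<Longrightarrow> x ^ n \<in> ZK" by (induction n) (auto intro: ZK_mult ZK_1)
lemma ZK_sum: "(\<And>i. i \<in> I \<Longrightarrow> f i \<in> ZK) \<Longrightarrow> sum f I \<in> ZK"
  by (induction I rule: infinite_finite_induct) (auto intro: ZK_add ZK_0)
lemma ZK_prod: "(\<And>i. i \<in> I \<Longrightarrow> f i \<in> ZK) \<Longrightarrow> prod f I \<in> ZK"
  by (induction I rule: infinite_finite_induct) (auto intro: ZK_mult ZK_1)
lemmas ZK_closed = ZK_add ZK_mult ZK_diff ZK_uminus ZK_of_int ZK_0 ZK_1 ZK_of_nat ZK_numeral ZK_power

lemma ZK_Gal: assumes s: "\<sigma> \<in> Gal K" and x: "x \<in> ZK" shows "\<sigma> x \<in> ZK"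
proof -
  obtain p :: "int poly" where p: "poly (map_poly of_int p) x = 0" "lead_coeff p = 1"
    using x unfolding ZK_def algebraic_int_altdef_ipoly by blast
  have "map_poly of_int p \<in> polys_over \<rat>" by (auto simp: polys_over_def coeff_map_poly)
  from Gal_poly[OF s this ZK_K[OF x]] have "poly (map_poly of_int p) (\<sigma> x) = 0" using p Gal_0[OF s] by simp
  with p(2) have "algebraic_int (\<sigma> x)" unfolding algebraic_int_altdef_ipoly by blast
  with Gal_in[OF s ZK_K[OF x]] show ?thesis by (simp add: ZK_def)
qed

lemma ZK_fixed: assumes "x \<in> ZK" "\<And>\<sigma>. \<sigma> \<in> Gal K \<Longrightarrow> \<sigma> x = x" shows "\<exists>n. x = of_int n"
  using rational_algebraic_int_is_int[of x] fix_Rats[of x] assms by (auto simp: ZK_def elim: Ints_cases)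

text \<open>A prime ideal of \<open>ZK\<close>, in the operations of the type. The zero ideal
  qualifies, so a rational prime in \<open>P\<close> is assumed where it matters.\<close>

definition "pid P \<longleftrightarrow> P \<subseteq> ZK \<and> 0 \<in> P \<and> (\<forall>x\<in>P. \<forall>y\<in>P. x + y \<in> P) \<and> (\<forall>x\<in>ZK. \<forall>y\<in>P. x * y \<in> P) \<and>
   1 \<notin> P \<and> (\<forall>x\<in>ZK. \<forall>y\<in>ZK. x * y \<in> P \<longrightarrow> x \<in> P \<or> y \<in> P)"

lemma primeideal_pid:
  assumes "primeideal P (ring_of_integers K)" shows "pid P"
proof -
  interpret primeideal P "ring_of_integers K" by fact
  have c: "carrier (ring_of_integers K) = ZK" by (simp add: ring_of_integers_def ZK_def)
  have m: "x \<otimes>\<^bsub>ring_of_integers K\<^esub> y = x * y" "x \<oplus>\<^bsub>ring_of_integers K\<^esub> y = x + y"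
    "\<zero>\<^bsub>ring_of_integers K\<^esub> = 0" "\<one>\<^bsub>ring_of_integers K\<^esub> = 1" for x y
    by (auto simp: ring_of_integers_def ring_of_type_algebra_def)
  have "1 \<notin> P" using I_notcarr one_imp_carrier c m by auto
  thus ?thesis unfolding pid_def
    using a_subset zero_closed additive_subgroup.a_closed[OF is_additive_subgroup] I_l_closed I_prime additive_subgroup.zero_closed[OF is_additive_subgroup]
    unfolding c m by auto
qed

context
  fixes P assumes P: "pid P"
begin
lemma P_ZK: "x \<in> P \<Longrightarrow> x \<in> ZK" and P_0: "0 \<in> P" and P_add: "x \<in> P \<Longrightarrow> y \<in> P \<Longrightarrow> x + y \<in> P"
  and P_l: "x \<in> ZK \<Longrightarrow> y \<in> P \<Longrightarrow> x * y \<in> P" and P_1: "1 \<notin> P"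
  and P_prime: "x \<in> ZK \<Longrightarrow> y \<in> ZK \<Longrightarrow> x * y \<in> P \<Longrightarrow> x \<in> P \<or> y \<in> P"
  using P by (auto simp: pid_def)
lemma P_r: "x \<in> P \<Longrightarrow> y \<in> ZK \<Longrightarrow> x * y \<in> P" using P_l[of y x] by (simp add: mult.commute)
lemma P_uminus: "x \<in> P \<Longrightarrow> - x \<in> P" using P_l[of "- 1" x] ZK_closed by simp
lemma P_diff: "x \<in> P \<Longrightarrow> y \<in> P \<Longrightarrow> x - y \<in> P" using P_add[of x "- y"] P_uminus by simp
lemma P_sum: "(\<And>i. i \<in> I \<Longrightarrow> f i \<in> P) \<Longrightarrow> sum f I \<in> P"
  by (induction I rule: infinite_finite_induct) (auto intro: P_add P_0)
lemma P_prod: "finite I \<Longrightarrow> i \<in> I \<Longrightarrow> f i \<in> P \<Longrightarrow> (\<And>i. i \<in> I \<Longrightarrow> f i \<in> ZK) \<Longrightarrow> prod f I \<in> P"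
  by (subst prod.remove[of I i]) (auto intro!: P_r ZK_prod)
lemma P_prod_notin: "finite I \<Longrightarrow> (\<And>i. i \<in> I \<Longrightarrow> f i \<in> ZK) \<Longrightarrow> (\<And>i. i \<in> I \<Longrightarrow> f i \<notin> P) \<Longrightarrow> prod f I \<notin> P"
proof (induction I rule: finite_induct)
  case (insert a I)
  have "prod f I \<in> ZK" using insert.prems by (intro ZK_prod) auto
  thus ?case using insert P_prime[of "f a" "prod f I"] by auto
qed (simp add: P_1)
lemma P_mult_notin: "x \<in> ZK \<Longrightarrow> y \<in> ZK \<Longrightarrow> x \<notin> P \<Longrightarrow> y \<notin> P \<Longrightarrow> x * y \<notin> P" using P_prime by blast
lemma P_power: "x \<in> ZK \<Longrightarrow> x ^ n \<in> P \<Longrightarrow> x \<in> P"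
  by (induction n) (use P_1 P_prime ZK_power in auto)
lemma P_power': "x \<in> P \<Longrightarrow> n > 0 \<Longrightarrow> x ^ n \<in> P"
  by (cases n) (auto intro: P_r ZK_power P_ZK)
lemma P_cong_mult: "a - b \<in> P \<Longrightarrow> c - d \<in> P \<Longrightarrow> b \<in> ZK \<Longrightarrow> c \<in> ZK \<Longrightarrow> a * c - b * d \<in> P"
  using P_add[OF P_r[of "a - b" c] P_l[of b "c - d"]] by (simp add: algebra_simps)
lemma P_cong_prod: "finite I \<Longrightarrow> (\<And>i. i \<in> I \<Longrightarrow> f i - g i \<in> P) \<Longrightarrow> (\<And>i. i \<in> I \<Longrightarrow> f i \<in> ZK) \<Longrightarrow>
   (\<And>i. i \<in> I \<Longrightarrow> g i \<in> ZK) \<Longrightarrow> prod f I - prod g I \<in> P"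
proof (induction I rule: finite_induct)
  case (insert a I)
  have "prod f I - prod g I \<in> P" "prod f I \<in> ZK" using insert by (auto intro!: ZK_prod)
  thus ?case using insert by (auto intro!: P_cong_mult)
qed (simp add: P_0)
lemma P_cong_power: "a - b \<in> P \<Longrightarrow> a \<in> ZK \<Longrightarrow> b \<in> ZK \<Longrightarrow> a ^ n - b ^ n \<in> P"
  by (induction n) (auto intro!: P_cong_mult ZK_power P_0)
lemma P_cong_iff: "a - b \<in> P \<Longrightarrow> a \<in> P \<longleftrightarrow> b \<in> P"
  using P_add[of "a - b" b] P_diff[of a "a - b"] by auto
lemma P_cong_trans: "a - b \<in> P \<Longrightarrow> b - c \<in> P \<Longrightarrow> a - c \<in> P" using P_add[of "a - b" "b - c"] by simp
lemma P_cong_sym: "a - b \<in> P \<Longrightarrow> b - a \<in> P" using P_uminus[of "a - b"] by simp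

lemma P_of_int_iff:
  assumes p: "prime p" "of_nat p \<in> P" shows "of_int n \<in> P \<longleftrightarrow> int p dvd n"
proof
  assume "int p dvd n"
  then obtain k where "n = k * int p" by (metis dvdE mult.commute)
  hence "(of_int n :: complex) = of_int k * of_nat p" by simp
  thus "of_int n \<in> P" using P_l[OF ZK_of_int p(2)] by simp
next
  assume n: "of_int n \<in> P"
  show "int p dvd n"
  proof (rule ccontr)
    assume "\<not> int p dvd n"
    hence "coprime (int p) n" using p by (simp add: prime_imp_coprime)
    then obtain a b where "a * int p + b * n = 1" by (metis bezout_int coprime_imp_gcd_eq_1)
    hence "(1 :: complex) = of_int a * of_nat p + of_int b * of_int n"
      by (metis of_int_1 of_int_add of_int_mult of_int_of_nat_eq)
    also have "\<dots> \<in> P" by (intro P_add P_l ZK_of_int p n)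
    finally show False using P_1 by simp
  qed
qed

lemma Gal_pid: assumes s: "\<sigma> \<in> Gal K" shows "pid {x \<in> ZK. \<sigma> x \<in> P}"
  unfolding pid_def
  using P_add P_l P_0 P_1 P_prime ZK_Gal[OF s] ZK_closed Gal_0[OF s] Gal_1[OF s]
  by (auto simp: Gal_add[OF s] Gal_times[OF s] ZK_K)

end

text \<open>The Galois group permutes the factors of the norm, so the norm is rational and, being
  integral, an integer. No factor vanishes because automorphisms are injective.\<close>

lemma norm_int:
  assumes xO: "x \<in> ZK" and x: "x \<noteq> 0"
  shows "\<exists>n. n \<noteq> 0 \<and> (\<Prod>\<sigma>\<in>Gal K. \<sigma> x) = of_int n"
proof -
  define N where "N = (\<Prod>\<sigma>\<in>Gal K. \<sigma> x)"
  have NO: "N \<in> ZK" unfolding N_def using ZK_Gal[OF _ xO] by (rule ZK_prod)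
  have N0: "N \<noteq> 0" unfolding N_def
  proof (subst prod_zero_iff[OF Gal_fin], clarify)
    fix \<sigma> assume s: "\<sigma> \<in> Gal K" "\<sigma> x = 0"
    hence "x = 0" using Gal_inj[OF s(1)] Gal_0[OF s(1)] ZK_K[OF xO] sfield_0[OF K] by (metis inj_onD)
    with x show False by simp
  qed
  have "\<tau> N = N" if t: "\<tau> \<in> Gal K" for \<tau>
  proof -
    have "\<tau> N = (\<Prod>\<sigma>\<in>Gal K. \<tau> (\<sigma> x))" unfolding N_def
      by (rule Gal_prod[OF t]) (use xO ZK_Gal ZK_K in auto)
    also have "\<dots> = (\<Prod>\<sigma>\<in>Gal K. (\<tau> \<otimes>\<^bsub>GK\<^esub> \<sigma>) x)"
      by (intro prod.cong refl) (simp add: Gal_compose[OF t] ZK_K[OF xO])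
    also have "\<dots> = N" unfolding N_def
      by (rule prod.reindex_bij_witness[of _ "\<lambda>\<sigma>. inv\<^bsub>GK\<^esub> \<tau> \<otimes>\<^bsub>GK\<^esub> \<sigma>" "\<lambda>\<sigma>. \<tau> \<otimes>\<^bsub>GK\<^esub> \<sigma>"])
        (use t in \<open>auto simp: G.m_assoc[symmetric] G.r_inv G.l_inv\<close>)
    finally show ?thesis .
  qed
  then obtain n where n: "N = of_int n" using ZK_fixed[of N] NO by blast
  thus ?thesis using N0 unfolding N_def by auto
qed

lemma norm_in:
  assumes P: "pid P" and x: "x \<in> P" shows "(\<Prod>\<sigma>\<in>Gal K. \<sigma> x) \<in> P"
proof -
  have one: "\<one>\<^bsub>GK\<^esub> \<in> Gal K" by simp
  show ?thesis
    by (rule P_prod[OF P Gal_fin one]) (use x P_ZK[OF P x] ZK_Gal ZK_K in \<open>auto simp: Gal_one\<close>)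
qed

text \<open>The norm of \<open>x\<close> is a nonzero integer in \<open>P\<close>, and one of its
  prime factors lies in \<open>P\<close>.\<close>

lemma pid_nonzero_prime:
  assumes P: "pid P" and x: "x \<in> P" "x \<noteq> 0" shows "\<exists>p. prime p \<and> of_nat p \<in> P"
proof -
  obtain n where n: "n \<noteq> 0" "(\<Prod>\<sigma>\<in>Gal K. \<sigma> x) = of_int n" using norm_int[OF P_ZK[OF P x(1)] x(2)] by blast
  have NP: "of_int n \<in> P" using norm_in[OF P x(1)] n by simp
  have "\<exists>p. prime p \<and> of_nat p \<in> P" if "m > 0" "of_nat m \<in> P" for m :: nat
    using that
  proof (induction m rule: less_induct)
    case (less m)
    have "m \<noteq> 1" using less.prems P_1[OF P] by auto
    then obtain p where p: "prime p" "p dvd m" using prime_factor_nat by blast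
    then obtain k where k: "m = p * k" by blast
    hence "of_nat p * of_nat k \<in> P" using less.prems by simp
    hence "of_nat p \<in> P \<or> of_nat k \<in> P" using P_prime[OF P] ZK_of_nat by blast
    moreover have "k < m" "k > 0" using k p less.prems prime_gt_1_nat[OF p(1)] by auto
    ultimately show ?case using less.IH p by blast
  qed
  moreover have "of_nat (nat \<bar>n\<bar>) \<in> P"
    using NP P_uminus[OF P, of "of_int n"] by (cases "n \<ge> 0") auto
  ultimately show ?thesis using n(1) by (metis nat_0_iff abs_le_zero_iff gr0I)
qed

text \<open>An ideal that is maximal among the proper ones containing \<open>p\<close> is prime.
  Zorn's lemma starts from the multiples of \<open>p\<close>, which omit 1 because
  \<open>1 / p\<close> is rational but not an integer.\<close>

lemma pid_exists:
  assumes p: "prime (p::nat)" shows "\<exists>P. pid P \<and> of_nat p \<in> P"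
proof -
  define idl where "idl I \<longleftrightarrow> I \<subseteq> ZK \<and> (\<forall>x\<in>I. \<forall>y\<in>I. x + y \<in> I) \<and> (\<forall>x\<in>ZK. \<forall>y\<in>I. x * y \<in> I) \<and> 1 \<notin> I \<and> of_nat p \<in> I"
    for I
  let ?A = "{I. idl I}"
  let ?p = "{of_nat p * x | x. x \<in> ZK}"
  have base: "?p \<in> ?A"
  proof -
    have "1 \<notin> ?p"
    proof
      assume "1 \<in> ?p"
      then obtain x where x: "x \<in> ZK" "1 = of_nat p * x" by auto
      have p0: "(of_nat p :: complex) \<noteq> 0" using p by (metis not_prime_0 of_nat_eq_0_iff)
      hence "x = 1 / of_nat p" using x by (simp add: field_simps)
      moreover have "x \<in> \<int>"
        using rational_algebraic_int_is_int[of x] x calculation by (auto simp: ZK_def)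
      ultimately obtain k where k: "1 / of_nat p = (of_int k :: complex)" by (auto elim: Ints_cases)
      hence "(of_int (k * int p) :: complex) = 1" using p0 by (simp add: field_simps)
      hence "k * int p = 1" by (metis of_int_eq_1_iff)
      hence "int p dvd 1" by (metis dvd_triv_right)
      hence "p dvd 1" by (metis int_dvd_int_iff of_nat_1)
      thus False using p by (simp add: prime_nat_iff)
    qed
    moreover have "of_nat p * x + of_nat p * y \<in> ?p" if "x \<in> ZK" "y \<in> ZK" for x y
      using ZK_add[OF that] by (auto simp: distrib_left[symmetric])
    moreover have "z * (of_nat p * x) \<in> ?p" if "x \<in> ZK" "z \<in> ZK" for x z
      using ZK_mult[OF that(2,1)] by (auto simp: mult.left_commute)
    moreover have "of_nat p \<in> ?p" using ZK_1 by force
    ultimately show ?thesis by (auto simp: idl_def intro: ZK_mult ZK_of_nat)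
  qed
  have "\<exists>M\<in>?A. \<forall>W\<in>?A. M \<subseteq> W \<longrightarrow> W = M"
  proof (rule subset_Zorn_nonempty)
    show "?A \<noteq> {}" using base by blast
    fix C assume C: "C \<noteq> {}" "subset.chain ?A C"
    have ch: "x \<subseteq> y \<or> y \<subseteq> x" if "x \<in> C" "y \<in> C" for x y using C that by (auto simp: subset_chain_def)
    have id: "idl x" if "x \<in> C" for x using C that by (auto simp: subset_chain_def)
    have "idl (\<Union> C)" unfolding idl_def
    proof (intro conjI ballI)
      show "\<Union> C \<subseteq> ZK" using id unfolding idl_def by blast
      show "1 \<notin> \<Union> C" using id by (auto simp: idl_def)
      show "of_nat p \<in> \<Union> C" using id C by (auto simp: idl_def)
    next
      fix x y assume "x \<in> \<Union> C" "y \<in> \<Union> C"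
      then obtain W Y where "W \<in> C" "Y \<in> C" "x \<in> W" "y \<in> Y" by auto
      then obtain Z where "Z \<in> C" "x \<in> Z" "y \<in> Z" using ch by blast
      thus "x + y \<in> \<Union> C" using id unfolding idl_def by blast
    next
      fix x y assume "x \<in> ZK" "y \<in> \<Union> C"
      thus "x * y \<in> \<Union> C" using id unfolding idl_def by blast
    qed
    thus "\<Union> C \<in> ?A" by simp
  qed
  then obtain M where M: "idl M" "\<And>W. idl W \<Longrightarrow> M \<subseteq> W \<Longrightarrow> W = M" by blast
  note Mi = M(1)[unfolded idl_def]
  have M0: "0 \<in> M" using Mi ZK_0 by (metis mult_zero_left)
  have Mu: "- x \<in> M" if "x \<in> M" for x
    using Mi that ZK_uminus[OF ZK_1] by (metis mult_minus_left mult_1)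
  have prime: "x \<in> M \<or> y \<in> M" if xy: "x \<in> ZK" "y \<in> ZK" "x * y \<in> M" for x y
  proof (rule ccontr)
    assume n: "\<not> (x \<in> M \<or> y \<in> M)"
    have key: "\<exists>a\<in>ZK. \<exists>b\<in>M. 1 = a * z + b" if z: "z \<in> ZK" "z \<notin> M" for z
    proof (rule ccontr)
      assume c: "\<not> ?thesis"
      let ?W = "{a * z + b | a b. a \<in> ZK \<and> b \<in> M}"
      have "idl ?W" unfolding idl_def
      proof (intro conjI ballI)
        show "?W \<subseteq> ZK" using Mi z by (auto intro!: ZK_add ZK_mult)
        show "1 \<notin> ?W" using c by auto
        have "of_nat p = 0 * z + of_nat p" by simp
        thus "of_nat p \<in> ?W" using Mi ZK_0 by blast
      next
        fix u v assume "u \<in> ?W" "v \<in> ?W"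
        then obtain a b a' b' where *: "u = a * z + b" "v = a' * z + b'" "a \<in> ZK" "b \<in> M" "a' \<in> ZK" "b' \<in> M" by auto
        have "u + v = (a + a') * z + (b + b')" using * by (simp add: algebra_simps)
        moreover have "a + a' \<in> ZK" "b + b' \<in> M" using * Mi ZK_add by auto
        ultimately show "u + v \<in> ?W" by blast
      next
        fix u v assume "u \<in> ZK" "v \<in> ?W"
        then obtain a b where *: "v = a * z + b" "a \<in> ZK" "b \<in> M" "u \<in> ZK" by auto
        have "u * v = (u * a) * z + u * b" using * by (simp add: algebra_simps)
        moreover have "u * a \<in> ZK" "u * b \<in> M" using * Mi ZK_mult by auto
        ultimately show "u * v \<in> ?W" by blast
      qed
      moreover have "M \<subseteq> ?W"
      proof
        fix b assume "b \<in> M"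
        moreover have "b = 0 * z + b" by simp
        ultimately show "b \<in> ?W" using ZK_0 by blast
      qed
      ultimately have "?W = M" by (rule M(2))
      moreover have "z = 1 * z + 0" by simp
      hence "z \<in> ?W" using ZK_1 M0 by blast
      ultimately show False using z by simp
    qed
    obtain a b where ab: "a \<in> ZK" "b \<in> M" "1 = a * x + b" using key[of x] xy n by blast
    have "y = a * (x * y) + y * b" using ab(3) by (metis distrib_left mult.assoc mult.commute mult.right_neutral)
    also have "\<dots> \<in> M" using Mi ab xy by blast
    finally show False using n by simp
  qed
  have "pid M" unfolding pid_def using Mi M0 prime by blast
  with Mi show ?thesis by blast
qed

end

section \<open>Inertia and ramification\<close>

context galfield
begin

definition "iner P = {\<sigma> \<in> Gal K. \<forall>x\<in>ZK. \<sigma> x - x \<in> P}"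

lemma iner_eq: "inertia_group K P = iner P"
  by (simp add: inertia_group_def iner_def ring_of_integers_def ZK_def)

lemma one_Gal: "\<one>\<^bsub>GK\<^esub> \<in> Gal K" by simp
lemma one_app: "x \<in> K \<Longrightarrow> \<one>\<^bsub>GK\<^esub> x = x" by (simp add: Gal_one)
lemma one_iner: "pid P \<Longrightarrow> \<one>\<^bsub>GK\<^esub> \<in> iner P"
  by (simp add: iner_def one_app ZK_K P_0)

lemma trace_int: assumes x: "x \<in> ZK" shows "\<exists>n. (\<Sum>\<sigma>\<in>Gal K. \<sigma> x) = of_int n"
proof (rule ZK_fixed)
  show "(\<Sum>\<sigma>\<in>Gal K. \<sigma> x) \<in> ZK" using ZK_Gal[OF _ x] by (rule ZK_sum)
  fix \<tau> assume t: "\<tau> \<in> Gal K"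
  have "\<tau> (\<Sum>\<sigma>\<in>Gal K. \<sigma> x) = (\<Sum>\<sigma>\<in>Gal K. \<tau> (\<sigma> x))"
    by (rule Gal_sum[OF t]) (use x ZK_Gal ZK_K in auto)
  also have "\<dots> = (\<Sum>\<sigma>\<in>Gal K. (\<tau> \<otimes>\<^bsub>GK\<^esub> \<sigma>) x)"
    by (intro sum.cong refl) (simp add: Gal_compose[OF t] ZK_K[OF x])
  also have "\<dots> = (\<Sum>\<sigma>\<in>Gal K. \<sigma> x)"
    by (rule sum.reindex_bij_witness[of _ "\<lambda>\<sigma>. inv\<^bsub>GK\<^esub> \<tau> \<otimes>\<^bsub>GK\<^esub> \<sigma>" "\<lambda>\<sigma>. \<tau> \<otimes>\<^bsub>GK\<^esub> \<sigma>"])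
      (use t in \<open>auto simp: G.m_assoc[symmetric] G.r_inv G.l_inv\<close>)
  finally show "\<tau> (\<Sum>\<sigma>\<in>Gal K. \<sigma> x) = (\<Sum>\<sigma>\<in>Gal K. \<sigma> x)" .
qed

text \<open>Multiplying by an element of the other conjugates of \<open>P\<close> moves \<open>P\<close> into all of its conjugates.\<close>

lemma conj_avoid:
  assumes P: "pid P"
  shows "\<exists>u\<in>ZK - P. \<forall>x\<in>P. \<forall>\<sigma>\<in>Gal K. \<sigma> (u * x) \<in> P"
proof -
  define B where "B = {\<sigma> \<in> Gal K. \<not> (\<forall>x\<in>P. \<sigma> x \<in> P)}"
  have fB: "finite B" using Gal_fin by (simp add: B_def)
  have ex: "\<exists>u\<in>ZK - P. \<sigma> u \<in> P" if s: "\<sigma> \<in> B" for \<sigma>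
  proof (rule ccontr)
    assume c: "\<not> ?thesis"
    let ?s = "inv\<^bsub>GK\<^esub> \<sigma>"
    have sG: "\<sigma> \<in> Gal K" "?s \<in> Gal K" using s by (auto simp: B_def)
    have step: "?s x \<in> P" if x: "x \<in> P" for x
    proof -
      have "?s x \<in> ZK" "\<sigma> (?s x) = x" using x P_ZK[OF P] ZK_Gal[OF sG(2)] Gal_inv[OF sG(1)] ZK_K by auto
      thus ?thesis using c x by (metis DiffI)
    qed
    \<comment> \<open>Under the contrary assumption the inverse of \<sigma> maps \<open>P\<close>
      into itself. So do its powers, and \<sigma> is one of them as the order is finite.\<close>
    have pw: "(?s [^]\<^bsub>GK\<^esub> n) x \<in> P" if "x \<in> P" for n :: nat and x
      using that
    proof (induction n arbitrary: x)
      case 0 thus ?case using one_app P_ZK[OF P] ZK_K by simp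
    next
      case (Suc n)
      have "(?s [^]\<^bsub>GK\<^esub> Suc n) x = (?s [^]\<^bsub>GK\<^esub> n) (?s x)"
        using Gal_compose[of "?s [^]\<^bsub>GK\<^esub> n" ?s x] sG Suc P_ZK[OF P] ZK_K by simp
      thus ?case using Suc step by simp
    qed
    have "group.ord GK ?s > 0" using G.ord_ge_1[OF Gal_fin sG(2)] by simp
    then obtain k where k: "group.ord GK ?s = Suc k" by (metis gr0_conv_Suc)
    have "?s [^]\<^bsub>GK\<^esub> k \<otimes>\<^bsub>GK\<^esub> ?s = \<one>\<^bsub>GK\<^esub>" using G.pow_ord_eq_1[OF sG(2)] k by simp
    hence "?s [^]\<^bsub>GK\<^esub> k = \<sigma>"
      using sG by (metis G.inv_inv G.inv_equality G.nat_pow_closed)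
    hence "\<forall>x\<in>P. \<sigma> x \<in> P" using pw[of _ k] by auto
    with s show False by (simp add: B_def)
  qed
  then obtain u where u: "\<And>\<sigma>. \<sigma> \<in> B \<Longrightarrow> u \<sigma> \<in> ZK \<and> u \<sigma> \<notin> P \<and> \<sigma> (u \<sigma>) \<in> P" by (metis DiffE)
  let ?u = "\<Prod>\<sigma>\<in>B. u \<sigma>"
  have uO: "?u \<in> ZK" using u by (intro ZK_prod) auto
  show ?thesis
  proof (intro bexI[of _ ?u] ballI)
    show "?u \<in> ZK - P" using uO P_prod_notin[OF P fB, of u] u by auto
    fix x \<sigma> assume x: "x \<in> P" and s: "\<sigma> \<in> Gal K"
    have xO: "x \<in> ZK" by (rule P_ZK[OF P x])
    have e: "\<sigma> (?u * x) = \<sigma> ?u * \<sigma> x" by (rule Gal_times[OF s]) (use uO xO ZK_K in auto)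
    show "\<sigma> (?u * x) \<in> P"
    proof (cases "\<sigma> \<in> B")
      case False
      hence "\<sigma> x \<in> P" using s x by (auto simp: B_def)
      thus ?thesis unfolding e using P_l[OF P] ZK_Gal[OF s uO] by blast
    next
      case True
      have "\<sigma> ?u = (\<Prod>\<tau>\<in>B. \<sigma> (u \<tau>))" by (rule Gal_prod[OF s]) (use u ZK_K in auto)
      also have "\<dots> \<in> P" by (rule P_prod[OF P fB True]) (use u True ZK_Gal[OF s] in auto)
      finally show ?thesis unfolding e using P_r[OF P] ZK_Gal[OF s xO] by blast
    qed
  qed
qed

definition "pmul p x \<longleftrightarrow> (\<exists>z\<in>ZK. x = of_nat p * z)"

lemma pmul_add: "pmul p x \<Longrightarrow> pmul p y \<Longrightarrow> pmul p (x + y)"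
  and pmul_diff: "pmul p x \<Longrightarrow> pmul p y \<Longrightarrow> pmul p (x - y)"
  and pmul_mult: "a \<in> ZK \<Longrightarrow> pmul p x \<Longrightarrow> pmul p (a * x)"
  unfolding pmul_def
  by (metis ZK_add distrib_left, metis ZK_diff right_diff_distrib, metis ZK_mult mult.left_commute)

text \<open>The coefficient functions whose twisted trace sends the conjugates of \<open>P\<close> into \<open>p\<close>
  are stable under multiplication by \<open>\<sigma> y - e\<close>, so they can be made to vanish outside the inertia group.\<close>

lemma twisted_trace:
  assumes P: "pid P" and p: "prime p" "of_nat p \<in> P"
  shows "\<exists>\<phi>. (\<forall>\<sigma>\<in>iner P. \<phi> \<sigma> \<in> ZK - P) \<and> (\<forall>\<sigma>\<in>iner P. \<forall>\<tau>\<in>iner P. \<phi> \<sigma> - \<phi> \<tau> \<in> P) \<and>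
    (\<forall>x\<in>ZK. (\<forall>\<sigma>\<in>Gal K. \<sigma> x \<in> P) \<longrightarrow> pmul p (\<Sum>\<sigma>\<in>iner P. \<phi> \<sigma> * \<sigma> x))"
proof -
  let ?J = "{x \<in> ZK. \<forall>\<sigma>\<in>Gal K. \<sigma> x \<in> P}"
  have "\<forall>\<sigma>. \<exists>y. \<sigma> \<in> Gal K - iner P \<longrightarrow> y \<in> ZK \<and> \<sigma> y - y \<notin> P" by (auto simp: iner_def)
  then obtain y where y: "\<And>\<sigma>. \<sigma> \<in> Gal K - iner P \<Longrightarrow> y \<sigma> \<in> ZK \<and> \<sigma> (y \<sigma>) - y \<sigma> \<notin> P" by metis
  have y': "\<And>\<sigma>. \<sigma> \<in> Gal K - iner P \<Longrightarrow> y \<sigma> \<in> ZK" using y by blast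
  define L where "L \<phi> \<longleftrightarrow> (\<forall>\<sigma>\<in>Gal K. \<phi> \<sigma> \<in> ZK) \<and> (\<forall>x\<in>?J. pmul p (\<Sum>\<sigma>\<in>Gal K. \<phi> \<sigma> * \<sigma> x))"
    for \<phi> :: "(complex \<Rightarrow> complex) \<Rightarrow> complex"
  have L1: "L (\<lambda>_. 1)"
    unfolding L_def
  proof (intro conjI ballI ZK_1)
    fix x assume x: "x \<in> ?J"
    then obtain n where n: "(\<Sum>\<sigma>\<in>Gal K. \<sigma> x) = of_int n" using trace_int by blast
    have "(\<Sum>\<sigma>\<in>Gal K. \<sigma> x) \<in> P" using x by (intro P_sum[OF P]) auto
    hence "int p dvd n" using P_of_int_iff[OF P p] n by simp
    then obtain k where "n = int p * k" by blast
    hence "(\<Sum>\<sigma>\<in>Gal K. \<sigma> x) = of_nat p * of_int k" using n by simp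
    thus "pmul p (\<Sum>\<sigma>\<in>Gal K. 1 * \<sigma> x)" unfolding pmul_def using ZK_of_int by auto
  qed
  have Lstep: "L (\<lambda>\<sigma>. \<phi> \<sigma> * (\<sigma> z - e))" if L: "L \<phi>" and z: "z \<in> ZK" "e \<in> ZK" for \<phi> z e
    unfolding L_def
  proof (intro conjI ballI)
    fix \<sigma> assume s: "\<sigma> \<in> Gal K"
    thus "\<phi> \<sigma> * (\<sigma> z - e) \<in> ZK" using L z ZK_Gal[OF s] by (auto simp: L_def intro!: ZK_mult ZK_diff)
  next
    fix x assume x: "x \<in> ?J"
    have zx: "z * x \<in> ?J"
    proof safe
      show "z * x \<in> ZK" using z x by (auto intro: ZK_mult)
      fix \<sigma> assume s: "\<sigma> \<in> Gal K"
      have "\<sigma> (z * x) = \<sigma> z * \<sigma> x" by (rule Gal_times[OF s]) (use x z ZK_K in auto)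
      thus "\<sigma> (z * x) \<in> P" using P_l[OF P] ZK_Gal[OF s z(1)] x s by auto
    qed
    have "(\<Sum>\<sigma>\<in>Gal K. \<phi> \<sigma> * (\<sigma> z - e) * \<sigma> x) = (\<Sum>\<sigma>\<in>Gal K. \<phi> \<sigma> * \<sigma> (z * x)) - e * (\<Sum>\<sigma>\<in>Gal K. \<phi> \<sigma> * \<sigma> x)"
      unfolding sum_distrib_left sum_subtractf[symmetric]
    proof (intro sum.cong refl)
      fix \<sigma> assume s: "\<sigma> \<in> Gal K"
      have "\<sigma> (z * x) = \<sigma> z * \<sigma> x" by (rule Gal_times[OF s]) (use x z ZK_K in auto)
      thus "\<phi> \<sigma> * (\<sigma> z - e) * \<sigma> x = \<phi> \<sigma> * \<sigma> (z * x) - e * (\<phi> \<sigma> * \<sigma> x)" by (simp add: algebra_simps)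
    qed
    thus "pmul p (\<Sum>\<sigma>\<in>Gal K. \<phi> \<sigma> * (\<sigma> z - e) * \<sigma> x)"
      using L x zx z by (auto simp: L_def intro!: pmul_diff pmul_mult)
  qed
  have "L (\<lambda>\<sigma>. \<Prod>\<tau>\<in>A. (\<sigma> (y \<tau>) - \<tau> (y \<tau>)))" if "finite A" "A \<subseteq> Gal K - iner P" for A
    using that
  proof (induction A rule: finite_induct)
    case empty thus ?case using L1 by simp
  next
    case (insert a A)
    hence "L (\<lambda>\<sigma>. (\<Prod>\<tau>\<in>A. (\<sigma> (y \<tau>) - \<tau> (y \<tau>))) * (\<sigma> (y a) - a (y a)))"
      using y' ZK_Gal by (intro Lstep) auto
    thus ?case using insert by (simp add: mult.commute)
  qed
  \<comment> \<open>The factor for \<tau> vanishes at \<sigma> = \<tau>. On the inertia group it is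
    congruent to \<open>y \<tau> - \<tau> (y \<tau>)\<close>, which lies outside
    \<open>P\<close>.\<close>
  define \<phi> where "\<phi> \<sigma> = (\<Prod>\<tau>\<in>Gal K - iner P. (\<sigma> (y \<tau>) - \<tau> (y \<tau>)))" for \<sigma> :: "complex \<Rightarrow> complex"
  have fin: "finite (Gal K - iner P)" using Gal_fin by simp
  have L: "L \<phi>" unfolding \<phi>_def
    using \<open>\<And>A. finite A \<Longrightarrow> A \<subseteq> Gal K - iner P \<Longrightarrow> L (\<lambda>\<sigma>. \<Prod>\<tau>\<in>A. (\<sigma> (y \<tau>) - \<tau> (y \<tau>)))\<close>[OF fin] by simp
  have iG: "iner P \<subseteq> Gal K" by (auto simp: iner_def)
  have zero: "\<phi> \<sigma> = 0" if "\<sigma> \<in> Gal K - iner P" for \<sigma>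
    unfolding \<phi>_def using fin that by (intro prod_zero) auto
  have z1: "z \<tau> \<in> ZK" if "z = y" "\<tau> \<in> Gal K - iner P" for z \<tau> using that y' by auto
  let ?c = "\<Prod>\<tau>\<in>Gal K - iner P. (y \<tau> - \<tau> (y \<tau>))"
  have cP: "?c \<notin> P"
  proof (rule P_prod_notin[OF P fin])
    fix \<tau> assume t: "\<tau> \<in> Gal K - iner P"
    thus "y \<tau> - \<tau> (y \<tau>) \<in> ZK" using y' ZK_Gal by (auto intro!: ZK_diff)
    show "y \<tau> - \<tau> (y \<tau>) \<notin> P" using y[OF t] P_cong_sym[OF P, of "y \<tau>" "\<tau> (y \<tau>)"] by blast
  qed
  have cong: "\<phi> \<sigma> - ?c \<in> P" if s: "\<sigma> \<in> iner P" for \<sigma>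
    unfolding \<phi>_def
  proof (rule P_cong_prod[OF P fin])
    fix \<tau> assume t: "\<tau> \<in> Gal K - iner P"
    have sG: "\<sigma> \<in> Gal K" using s iG by auto
    show "\<sigma> (y \<tau>) - \<tau> (y \<tau>) \<in> ZK" "y \<tau> - \<tau> (y \<tau>) \<in> ZK"
      using t y' ZK_Gal sG by (auto intro!: ZK_diff)
    show "\<sigma> (y \<tau>) - \<tau> (y \<tau>) - (y \<tau> - \<tau> (y \<tau>)) \<in> P" using s y'[OF t] by (simp add: iner_def)
  qed
  show ?thesis
  proof (intro exI[of _ \<phi>] conjI ballI impI)
    fix \<sigma> assume s: "\<sigma> \<in> iner P"
    have "\<phi> \<sigma> \<in> ZK" using s iG L by (auto simp: L_def)
    moreover have "\<phi> \<sigma> \<notin> P" using cP P_cong_iff[OF P cong[OF s]] by simp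
    ultimately show "\<phi> \<sigma> \<in> ZK - P" by simp
    fix \<tau> assume t: "\<tau> \<in> iner P"
    show "\<phi> \<sigma> - \<phi> \<tau> \<in> P" using P_cong_trans[OF P cong[OF s] P_cong_sym[OF P cong[OF t]]] .
  next
    fix x assume "x \<in> ZK" "\<forall>\<sigma>\<in>Gal K. \<sigma> x \<in> P"
    hence "pmul p (\<Sum>\<sigma>\<in>Gal K. \<phi> \<sigma> * \<sigma> x)" using L by (auto simp: L_def)
    also have "(\<Sum>\<sigma>\<in>Gal K. \<phi> \<sigma> * \<sigma> x) = (\<Sum>\<sigma>\<in>iner P. \<phi> \<sigma> * \<sigma> x)"
      by (rule sum.mono_neutral_right[OF Gal_fin iG]) (auto simp: zero)
    finally show "pmul p (\<Sum>\<sigma>\<in>iner P. \<phi> \<sigma> * \<sigma> x)" .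
  qed
qed

text \<open>After localisation at \<open>P\<close> this says that \<open>p\<close> generates
  \<open>P\<close>. The twisted trace has a single summand here, and \<open>conj_avoid\<close> moves
  \<open>P\<close> into its domain.\<close>

lemma trivial_inertia_mul:
  assumes P: "pid P" and p: "prime p" "of_nat p \<in> P" and I: "iner P = {\<one>\<^bsub>GK\<^esub>}"
  shows "\<exists>s\<in>ZK - P. \<forall>x\<in>P. pmul p (s * x)"
proof -
  obtain \<phi> where f: "\<phi> \<one>\<^bsub>GK\<^esub> \<in> ZK - P"
    "\<And>x. x \<in> ZK \<Longrightarrow> (\<forall>\<sigma>\<in>Gal K. \<sigma> x \<in> P) \<Longrightarrow> pmul p (\<phi> \<one>\<^bsub>GK\<^esub> * \<one>\<^bsub>GK\<^esub> x)"
    using twisted_trace[OF P p] unfolding I by auto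
  obtain u where u: "u \<in> ZK - P" "\<And>x. x \<in> P \<Longrightarrow> \<forall>\<sigma>\<in>Gal K. \<sigma> (u * x) \<in> P" using conj_avoid[OF P] by blast
  show ?thesis
  proof (intro bexI[of _ "\<phi> \<one>\<^bsub>GK\<^esub> * u"] ballI)
    show "\<phi> \<one>\<^bsub>GK\<^esub> * u \<in> ZK - P" using f u P_mult_notin[OF P] ZK_mult by auto
    fix x assume x: "x \<in> P"
    have "u * x \<in> ZK" using u P_ZK[OF P x] ZK_mult by auto
    thus "pmul p (\<phi> \<one>\<^bsub>GK\<^esub> * u * x)" using f(2)[of "u * x"] u(2)[OF x] by (simp add: one_app ZK_K mult.assoc)
  qed
qed

text \<open>After localisation at \<open>P\<close> this says that the square of \<open>P\<close>
  lies in the ideal of \<open>p\<close>. The two coefficients \<open>a\<close> and \<open>b\<close>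
  of the twisted trace are congruent, so \<open>a + b\<close> is congruent to \<open>2 * a\<close>
  and, for odd \<open>p\<close>, avoids \<open>P\<close>.\<close>

lemma order2_inertia_mul:
  assumes P: "pid P" and p: "prime p" "of_nat p \<in> P" "odd p" and c: "card (iner P) = 2"
  shows "\<exists>s\<in>ZK - P. \<forall>x\<in>P. \<forall>y\<in>P. pmul p (s * (x * y))"
proof -
  let ?e = "\<one>\<^bsub>GK\<^esub>"
  obtain t where t: "iner P = {?e, t}" "t \<noteq> ?e"
  proof -
    obtain x y where "iner P = {x, y}" "x \<noteq> y" using c by (auto simp: card_2_iff)
    with one_iner[OF P] show thesis by (cases "x = ?e") (auto intro: that[of x] that[of y])
  qed
  have tG: "t \<in> Gal K" using t by (auto simp: iner_def)
  obtain \<phi> where f: "\<phi> ?e \<in> ZK - P" "\<phi> t \<in> ZK - P" "\<phi> t - \<phi> ?e \<in> P"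
    "\<And>x. x \<in> ZK \<Longrightarrow> (\<forall>\<sigma>\<in>Gal K. \<sigma> x \<in> P) \<Longrightarrow> pmul p (\<phi> ?e * ?e x + \<phi> t * t x)"
    using twisted_trace[OF P p(1,2)] t unfolding t(1) by auto
  define a b where "a = \<phi> ?e" and "b = \<phi> t"
  have ab: "a \<in> ZK" "b \<in> ZK" "a \<notin> P" "b \<notin> P" "b - a \<in> P" using f by (auto simp: a_def b_def)
  have two: "2 \<notin> P"
  proof
    assume "2 \<in> P"
    hence "int p dvd 2" using P_of_int_iff[OF P p(1,2), of 2] by simp
    hence "p dvd 2" by (metis int_dvd_int_iff of_nat_numeral)
    hence "p = 2" using p(1) by (metis dvd_imp_le even_Suc le_antisym numeral_2_eq_2 pos2 prime_ge_2_nat)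
    with p(3) show False by simp
  qed
  have abP: "a + b \<notin> P"
  proof
    assume "a + b \<in> P"
    hence "2 * a \<in> P" using P_diff[OF P, of "a + b" "b - a"] ab by simp
    hence "2 \<in> P \<or> a \<in> P" using P_prime[OF P] ZK_numeral ab by blast
    with two ab show False by simp
  qed
  obtain u where u: "u \<in> ZK" "u \<notin> P" "\<And>x. x \<in> P \<Longrightarrow> \<forall>\<sigma>\<in>Gal K. \<sigma> (u * x) \<in> P" using conj_avoid[OF P] by blast
  have tr: "pmul p (a * x + b * t x)" if "x \<in> ZK" "\<forall>\<sigma>\<in>Gal K. \<sigma> x \<in> P" for x
    using f(4)[OF that] that by (simp add: a_def b_def one_app ZK_K)
  have main: "pmul p (a * (a + b) * (x * y))"
    if x: "x \<in> ZK" "\<forall>\<sigma>\<in>Gal K. \<sigma> x \<in> P" and y: "y \<in> ZK" "\<forall>\<sigma>\<in>Gal K. \<sigma> y \<in> P" for x y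
  proof -
    have txy: "t (x * y) = t x * t y" by (rule Gal_times[OF tG]) (use x y ZK_K in auto)
    have xy: "x * y \<in> ZK" "\<forall>\<sigma>\<in>Gal K. \<sigma> (x * y) \<in> P"
    proof -
      show "x * y \<in> ZK" using x y ZK_mult by auto
      show "\<forall>\<sigma>\<in>Gal K. \<sigma> (x * y) \<in> P"
      proof
        fix \<sigma> assume s: "\<sigma> \<in> Gal K"
        have "\<sigma> (x * y) = \<sigma> x * \<sigma> y" by (rule Gal_times[OF s]) (use x y ZK_K in auto)
        thus "\<sigma> (x * y) \<in> P" using P_l[OF P] ZK_Gal[OF s x(1)] y s by auto
      qed
    qed
    have tx: "t x \<in> ZK" using ZK_Gal[OF tG x(1)] .
    have 1: "pmul p (a * y * (a * x + b * t x))" by (intro pmul_mult tr x ZK_mult ab y)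
    have 2: "pmul p (b * t x * (a * y + b * t y))" by (intro pmul_mult tr y ZK_mult ab tx)
    have 3: "pmul p (b * (a * (x * y) + b * t (x * y)))" by (intro pmul_mult tr xy ab)
    \<comment> \<open>The twisted traces of \<open>x\<close>, \<open>y\<close> and
      \<open>x * y\<close> are combined so that all terms containing \<open>t\<close>
      cancel.\<close>
    have "a * (a + b) * (x * y) = a * y * (a * x + b * t x) - b * t x * (a * y + b * t y) + b * (a * (x * y) + b * t (x * y))"
      unfolding txy by (simp add: algebra_simps)
    thus ?thesis using 1 2 3 by (metis pmul_add pmul_diff)
  qed
  show ?thesis
  proof (intro bexI[of _ "a * (a + b) * (u * u)"] ballI)
    show "a * (a + b) * (u * u) \<in> ZK - P" using ab abP u P_mult_notin[OF P] ZK_closed by auto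
    fix x y assume xy: "x \<in> P" "y \<in> P"
    have "pmul p (a * (a + b) * ((u * x) * (u * y)))"
      using xy P_ZK[OF P] u by (intro main) (auto intro!: ZK_mult)
    thus "pmul p (a * (a + b) * (u * u) * (x * y))" by (simp add: mult_ac)
  qed
qed

section \<open>Powers of a prime ideal and ramification indices\<close>

lemma ideal_pow_Suc: "P [^]\<^bsub>ideals_set (ring_of_integers K)\<^esub> Suc n =
    ideal_prod (ring_of_integers K) (P [^]\<^bsub>ideals_set (ring_of_integers K)\<^esub> n) P"
  by (simp add: nat_pow_def ideals_set_def)

lemma ideal_pow_0: "P [^]\<^bsub>ideals_set (ring_of_integers K)\<^esub> (0::nat) = ZK"
  by (simp add: nat_pow_def ideals_set_def ring_of_integers_def ZK_def)

lemma ideal_prod_sub: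
  assumes "\<And>x y. x \<in> I \<Longrightarrow> y \<in> J \<Longrightarrow> x * y \<in> S" "\<And>x y. x \<in> S \<Longrightarrow> y \<in> S \<Longrightarrow> x + y \<in> S"
  shows "ideal_prod (ring_of_integers K) I J \<subseteq> S"
proof
  fix x assume "x \<in> ideal_prod (ring_of_integers K) I J"
  thus "x \<in> S"
    by (induction rule: ideal_prod.induct) (use assms in \<open>auto simp: ring_of_integers_def ring_of_type_algebra_def\<close>)
qed

lemma ideal_pow_sub:
  assumes P: "pid P"
  shows "P [^]\<^bsub>ideals_set (ring_of_integers K)\<^esub> n \<subseteq> ZK" "P [^]\<^bsub>ideals_set (ring_of_integers K)\<^esub> Suc n \<subseteq> P"
proof -
  show 1: "P [^]\<^bsub>ideals_set (ring_of_integers K)\<^esub> n \<subseteq> ZK" for n :: nat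
  proof (induction n)
    case (Suc n)
    show ?case unfolding ideal_pow_Suc
      by (rule ideal_prod_sub) (use Suc P_ZK[OF P] ZK_add ZK_mult in auto)
  qed (simp only: ideal_pow_0 subset_refl)
  show "P [^]\<^bsub>ideals_set (ring_of_integers K)\<^esub> Suc n \<subseteq> P" unfolding ideal_pow_Suc
    by (rule ideal_prod_sub) (use 1[of n] P_l[OF P] P_add[OF P] in auto)
qed

lemma ideal_pow_sub2:
  assumes P: "pid P" and S: "\<And>x y. x \<in> P \<Longrightarrow> y \<in> P \<Longrightarrow> x * y \<in> S" "\<And>x y. x \<in> S \<Longrightarrow> y \<in> S \<Longrightarrow> x + y \<in> S"
  shows "P [^]\<^bsub>ideals_set (ring_of_integers K)\<^esub> Suc (Suc n) \<subseteq> S"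
  by (subst ideal_pow_Suc, rule ideal_prod_sub) (use ideal_pow_sub(2)[OF P, of n] S in auto)

lemma ideal_pow_sub3:
  assumes P: "pid P" and S: "\<And>x y z. x \<in> P \<Longrightarrow> y \<in> P \<Longrightarrow> z \<in> P \<Longrightarrow> x * y * z \<in> S"
      "\<And>x y. x \<in> S \<Longrightarrow> y \<in> S \<Longrightarrow> x + y \<in> S"
  shows "P [^]\<^bsub>ideals_set (ring_of_integers K)\<^esub> Suc (Suc (Suc n)) \<subseteq> S"
proof (subst ideal_pow_Suc, rule ideal_prod_sub)
  fix x z assume xz: "x \<in> P [^]\<^bsub>ideals_set (ring_of_integers K)\<^esub> Suc (Suc n)" "z \<in> P"
  have "P [^]\<^bsub>ideals_set (ring_of_integers K)\<^esub> Suc (Suc n) \<subseteq> {x. x * z \<in> S}"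
    by (rule ideal_pow_sub2[OF P]) (use S xz in \<open>auto simp: distrib_right\<close>)
  with xz show "x * z \<in> S" by auto
qed (rule S)

lemma P_pow_1: assumes P: "pid P" shows "P \<subseteq> P [^]\<^bsub>ideals_set (ring_of_integers K)\<^esub> (1::nat)"
proof
  fix x assume "x \<in> P"
  from ideal_prod.prod[OF ZK_1 this, of "ring_of_integers K"]
  show "x \<in> P [^]\<^bsub>ideals_set (ring_of_integers K)\<^esub> (1::nat)"
    unfolding One_nat_def ideal_pow_Suc ideal_pow_0 by (simp add: ring_of_integers_def ring_of_type_algebra_def)
qed

lemma PIdl_sub: "PIdl\<^bsub>ring_of_integers K\<^esub> (of_nat p) = {x * of_nat p | x. x \<in> ZK}"
  by (auto simp: cgenideal_def ring_of_integers_def ring_of_type_algebra_def ZK_def)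

text \<open>If \<open>p\<close> were in the square of \<open>P\<close>, then
  \<open>s * s * p\<close> would be a multiple of \<open>p * p\<close>, so that \<open>s * s\<close>
  would be a multiple of \<open>p\<close> and lie in \<open>P\<close>.\<close>

lemma ramification_1:
  assumes P: "pid P" and p: "prime p" "of_nat p \<in> P" and I: "iner P = {\<one>\<^bsub>GK\<^esub>}"
  shows "ramification_index K P p = 1"
proof -
  obtain s where s: "s \<in> ZK" "s \<notin> P" "\<And>x. x \<in> P \<Longrightarrow> pmul p (s * x)"
    using trivial_inertia_mul[OF P p I] by blast
  let ?p = "of_nat p :: complex"
  have p0: "?p \<noteq> 0" using p by (metis not_prime_0 of_nat_eq_0_iff)
  have no: "?p \<notin> P [^]\<^bsub>ideals_set (ring_of_integers K)\<^esub> Suc (Suc n)" for n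
  proof
    assume a: "?p \<in> P [^]\<^bsub>ideals_set (ring_of_integers K)\<^esub> Suc (Suc n)"
    have "P [^]\<^bsub>ideals_set (ring_of_integers K)\<^esub> Suc (Suc n) \<subseteq> {x. \<exists>z\<in>ZK. s * s * x = ?p * ?p * z}"
    proof (rule ideal_pow_sub2[OF P])
      fix x y assume "x \<in> P" "y \<in> P"
      then obtain z w where "z \<in> ZK" "w \<in> ZK" "s * x = ?p * z" "s * y = ?p * w" using s(3) unfolding pmul_def by blast
      moreover have "s * s * (x * y) = (s * x) * (s * y)" by simp
      ultimately show "x * y \<in> {x. \<exists>z\<in>ZK. s * s * x = ?p * ?p * z}"
        by (auto intro!: bexI[of _ "z * w"] ZK_mult)
    next
      fix x y assume "x \<in> {x. \<exists>z\<in>ZK. s * s * x = ?p * ?p * z}" "y \<in> {x. \<exists>z\<in>ZK. s * s * x = ?p * ?p * z}"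
      then obtain z w where "z \<in> ZK" "w \<in> ZK" "s * s * x = ?p * ?p * z" "s * s * y = ?p * ?p * w" by blast
      hence "s * s * (x + y) = ?p * ?p * (z + w)" "z + w \<in> ZK" by (simp_all only: distrib_left ZK_add)
      thus "x + y \<in> {x. \<exists>z\<in>ZK. s * s * x = ?p * ?p * z}" by blast
    qed
    with a obtain z where z: "z \<in> ZK" "s * s * ?p = ?p * ?p * z" by blast
    hence "s * s = z * ?p" using p0 by (simp add: field_simps)
    also have "\<dots> \<in> P" by (rule P_l[OF P z(1) p(2)])
    finally show False using s P_prime[OF P] by blast
  qed
  show ?thesis unfolding ramification_index_def
  proof (rule Greatest_equality)
    show "PIdl\<^bsub>ring_of_integers K\<^esub> (of_nat p) \<subseteq> P [^]\<^bsub>ideals_set (ring_of_integers K)\<^esub> (1::nat)"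
      using P_pow_1[OF P] P_l[OF P _ p(2)] unfolding PIdl_sub by auto
    fix e :: nat assume e: "PIdl\<^bsub>ring_of_integers K\<^esub> (of_nat p) \<subseteq> P [^]\<^bsub>ideals_set (ring_of_integers K)\<^esub> e"
    have "?p \<in> PIdl\<^bsub>ring_of_integers K\<^esub> (of_nat p)" unfolding PIdl_sub using ZK_1 by force
    hence "?p \<in> P [^]\<^bsub>ideals_set (ring_of_integers K)\<^esub> e" using e by blast
    thus "e \<le> 1" using no by (metis One_nat_def not_less_eq_eq Suc_le_D le_SucE less_Suc_eq_le linorder_not_le old.nat.exhaust)
  qed
qed

text \<open>An exponent of 3 or more is impossible: multiplying by \<open>x\<close> in
  \<open>P\<close> and cancelling \<open>p\<close> gives \<open>s * s * x\<close> as a multiple of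
  \<open>p\<close>, after which the argument for trivial inertia applies with \<open>s * s\<close>
  for \<open>s\<close>. The bound 2 suffices for tameness at odd primes.\<close>

lemma ramification_2:
  assumes P: "pid P" and p: "prime p" "of_nat p \<in> P" "odd p" and c: "card (iner P) = 2"
  shows "ramification_index K P p \<in> {1, 2}"
proof -
  obtain s where s: "s \<in> ZK" "s \<notin> P" "\<And>x y. x \<in> P \<Longrightarrow> y \<in> P \<Longrightarrow> pmul p (s * (x * y))"
    using order2_inertia_mul[OF P p c] by blast
  let ?p = "of_nat p :: complex"
  let ?I = "ideals_set (ring_of_integers K)"
  have p0: "?p \<noteq> 0" using p by (metis not_prime_0 of_nat_eq_0_iff)
  have no: "?p \<notin> P [^]\<^bsub>?I\<^esub> Suc (Suc (Suc n))" for n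
  proof
    assume a: "?p \<in> P [^]\<^bsub>?I\<^esub> Suc (Suc (Suc n))"
    have sx: "pmul p (s * s * x)" if x: "x \<in> P" for x
    proof -
      have "P [^]\<^bsub>?I\<^esub> Suc (Suc (Suc n)) \<subseteq> {v. \<exists>z\<in>ZK. s * s * v * x = ?p * ?p * z}"
      proof (rule ideal_pow_sub3[OF P])
        fix a b c assume abc: "a \<in> P" "b \<in> P" "c \<in> P"
        obtain z w where "z \<in> ZK" "w \<in> ZK" "s * (a * b) = ?p * z" "s * (c * x) = ?p * w"
          using s(3)[OF abc(1,2)] s(3)[OF abc(3) x] unfolding pmul_def by blast
        moreover have "s * s * (a * b * c) * x = (s * (a * b)) * (s * (c * x))" by simp
        ultimately show "a * b * c \<in> {v. \<exists>z\<in>ZK. s * s * v * x = ?p * ?p * z}"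
          by (auto intro!: bexI[of _ "z * w"] ZK_mult)
      next
        fix v v' assume "v \<in> {v. \<exists>z\<in>ZK. s * s * v * x = ?p * ?p * z}" "v' \<in> {v. \<exists>z\<in>ZK. s * s * v * x = ?p * ?p * z}"
        then obtain z w where "z \<in> ZK" "w \<in> ZK" "s * s * v * x = ?p * ?p * z" "s * s * v' * x = ?p * ?p * w" by blast
        hence "s * s * (v + v') * x = ?p * ?p * (z + w)" "z + w \<in> ZK" by (simp_all only: distrib_left distrib_right ZK_add)
        thus "v + v' \<in> {v. \<exists>z\<in>ZK. s * s * v * x = ?p * ?p * z}" by blast
      qed
      with a obtain z where z: "z \<in> ZK" "s * s * ?p * x = ?p * ?p * z" by blast
      hence "s * s * x = ?p * z" using p0 by (simp add: field_simps)
      with z show ?thesis unfolding pmul_def by blast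
    qed
    let ?s = "s * s"
    have "P [^]\<^bsub>?I\<^esub> Suc (Suc (Suc n)) \<subseteq> {v. \<exists>z\<in>ZK. ?s * ?s * v = ?p * ?p * z}"
    proof (rule ideal_pow_sub2[OF P])
      fix x y assume "x \<in> P" "y \<in> P"
      then obtain z w where "z \<in> ZK" "w \<in> ZK" "?s * x = ?p * z" "?s * y = ?p * w" using sx unfolding pmul_def by blast
      moreover have "?s * ?s * (x * y) = (?s * x) * (?s * y)" by simp
      ultimately show "x * y \<in> {v. \<exists>z\<in>ZK. ?s * ?s * v = ?p * ?p * z}"
        by (auto intro!: bexI[of _ "z * w"] ZK_mult)
    next
      fix v v' assume "v \<in> {v. \<exists>z\<in>ZK. ?s * ?s * v = ?p * ?p * z}" "v' \<in> {v. \<exists>z\<in>ZK. ?s * ?s * v = ?p * ?p * z}"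
      then obtain z w where "z \<in> ZK" "w \<in> ZK" "?s * ?s * v = ?p * ?p * z" "?s * ?s * v' = ?p * ?p * w" by blast
      hence "?s * ?s * (v + v') = ?p * ?p * (z + w)" "z + w \<in> ZK" by (simp_all only: distrib_left ZK_add)
      thus "v + v' \<in> {v. \<exists>z\<in>ZK. ?s * ?s * v = ?p * ?p * z}" by blast
    qed
    with a obtain z where z: "z \<in> ZK" "?s * ?s * ?p = ?p * ?p * z" by blast
    hence "?s * ?s = z * ?p" using p0 by (simp add: field_simps)
    also have "\<dots> \<in> P" by (rule P_l[OF P z(1) p(2)])
    finally show False using s P_prime[OF P] ZK_mult by blast
  qed
  let ?Q = "\<lambda>e. PIdl\<^bsub>ring_of_integers K\<^esub> (of_nat p) \<subseteq> P [^]\<^bsub>?I\<^esub> (e::nat)"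
  have 1: "?Q 1" using P_pow_1[OF P] P_l[OF P _ p(2)] unfolding PIdl_sub by auto
  have 2: "e \<le> 2" if e: "?Q e" for e
  proof (rule ccontr)
    assume "\<not> e \<le> 2"
    then obtain n where n: "e = Suc (Suc (Suc n))" by (metis not_less_eq_eq numeral_2_eq_2 Suc_le_D)
    have "?p \<in> PIdl\<^bsub>ring_of_integers K\<^esub> (of_nat p)" unfolding PIdl_sub using ZK_1 by force
    with e n no show False by blast
  qed
  have "1 \<le> ramification_index K P p" unfolding ramification_index_def by (rule Greatest_le_nat[of ?Q 1 2]) (use 1 2 in auto)
  moreover have "?Q (ramification_index K P p)" unfolding ramification_index_def by (rule GreatestI_nat[of ?Q 1 2]) (use 1 2 in auto)
  ultimately show ?thesis using 2 by force
qed

end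

section \<open>Frobenius elements and primes of degree one\<close>

context galfield
begin

lemma freshman2:
  assumes P: "pid P" and p: "prime p" "of_nat p \<in> P" and ab: "a \<in> ZK" "b \<in> ZK"
  shows "(a + b) ^ p - (a ^ p + b ^ p) \<in> P"
proof -
  have p0: "p > 0" using p(1) by (simp add: prime_gt_0_nat)
  have "(a + b) ^ p = (\<Sum>k\<le>p. of_nat (p choose k) * a ^ k * b ^ (p - k))" by (rule binomial_ring)
  also have "{..p} = insert 0 (insert p {0<..<p})" using p0 by auto
  also have "(\<Sum>k\<in>\<dots>. of_nat (p choose k) * a ^ k * b ^ (p - k)) =
      b ^ p + a ^ p + (\<Sum>k\<in>{0<..<p}. of_nat (p choose k) * a ^ k * b ^ (p - k))"
    using p0 by simp
  finally have "(a + b) ^ p - (a ^ p + b ^ p) = (\<Sum>k\<in>{0<..<p}. of_nat (p choose k) * a ^ k * b ^ (p - k))" by simp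
  also have "\<dots> \<in> P"
  proof (rule P_sum[OF P])
    fix k assume k: "k \<in> {0<..<p}"
    hence "p dvd (p choose k)" using p(1) by (intro dvd_choose_prime) auto
    then obtain j where "p choose k = j * p" by (metis dvdE mult.commute)
    hence "(of_nat (p choose k) :: complex) = of_nat j * of_nat p" by simp
    hence e: "of_nat (p choose k) * a ^ k * b ^ (p - k) = (of_nat j * a ^ k * b ^ (p - k)) * of_nat p" by simp
    show "of_nat (p choose k) * a ^ k * b ^ (p - k) \<in> P"
      unfolding e by (intro P_l[OF P] p(2) ZK_mult ZK_power ZK_of_nat ab)
  qed
  finally show ?thesis .
qed

lemma freshman_diff:
  assumes P: "pid P" and p: "prime p" "of_nat p \<in> P" and ab: "a \<in> ZK" "b \<in> ZK"
  shows "a ^ p - b ^ p \<in> P \<longleftrightarrow> a - b \<in> P"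
proof
  assume "a - b \<in> P" thus "a ^ p - b ^ p \<in> P" using P_cong_power[OF P] ab by blast
next
  assume a: "a ^ p - b ^ p \<in> P"
  have "(b + (a - b)) ^ p - (b ^ p + (a - b) ^ p) \<in> P" by (rule freshman2[OF P p]) (use ab ZK_diff in auto)
  hence "a ^ p - (b ^ p + (a - b) ^ p) \<in> P" by simp
  from P_diff[OF P a this] have "(a - b) ^ p \<in> P" by simp
  thus "a - b \<in> P" using P_power[OF P] ab ZK_diff by blast
qed

lemma freshman_sum:
  assumes P: "pid P" and p: "prime p" "of_nat p \<in> P"
  shows "finite I \<Longrightarrow> (\<And>i. i \<in> I \<Longrightarrow> f i \<in> ZK) \<Longrightarrow> sum f I ^ p - (\<Sum>i\<in>I. f i ^ p) \<in> P"
proof (induction I rule: finite_induct)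
  case empty
  have "p > 0" using p(1) by (simp add: prime_gt_0_nat)
  thus ?case by (simp add: P_0[OF P] power_0_left)
next
  case (insert a I)
  have "sum f I \<in> ZK" using insert by (intro ZK_sum) auto
  hence "(f a + sum f I) ^ p - (f a ^ p + sum f I ^ p) \<in> P" using insert by (intro freshman2[OF P p]) auto
  moreover have "sum f I ^ p - (\<Sum>i\<in>I. f i ^ p) \<in> P" using insert by auto
  ultimately have "((f a + sum f I) ^ p - (f a ^ p + sum f I ^ p)) + (sum f I ^ p - (\<Sum>i\<in>I. f i ^ p)) \<in> P"
    by (rule P_add[OF P])
  thus ?case using insert(1,2) by (simp add: algebra_simps)
qed

lemma fermat_P:
  assumes P: "pid P" and p: "prime p" "of_nat p \<in> P"
  shows "of_int n ^ p - of_int n \<in> P"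
proof -
  have "[(nat (n mod int p)) ^ p = nat (n mod int p)] (mod p)"
  proof (cases "p dvd nat (n mod int p)")
    case True
    moreover have "p dvd nat (n mod int p) ^ p"
      using True prime_gt_0_nat[OF p(1)] by (metis dvd_power dvd_trans)
    ultimately show ?thesis by (simp add: cong_def dvd_imp_mod_0)
  next
    case False
    hence "[nat (n mod int p) ^ (p - 1) = 1] (mod p)" by (rule fermat_theorem[OF p(1)])
    hence "[nat (n mod int p) * nat (n mod int p) ^ (p - 1) = nat (n mod int p) * 1] (mod p)" by (rule cong_scalar_left)
    thus ?thesis using prime_gt_0_nat[OF p(1)] by (simp add: power_eq_if)
  qed
  hence "[int (nat (n mod int p) ^ p) = int (nat (n mod int p))] (mod int p)" by (simp only: cong_int_iff)
  hence "[(n mod int p) ^ p = n mod int p] (mod int p)" using prime_gt_0_nat[OF p(1)] by simp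
  hence "[n ^ p = n] (mod int p)" by (simp add: cong_def power_mod)
  hence "int p dvd n ^ p - n" by (simp add: cong_iff_dvd_diff)
  thus ?thesis using P_of_int_iff[OF P p, of "n ^ p - n"] by simp
qed

text \<open>The trace satisfies \<open>Tr(x)^p = Tr(x)\<close> modulo \<open>P\<close>. By independence of the characters
  \<open>\<sigma> mod P\<close>, the character \<open>x^p mod P\<close> is one of them.\<close>

lemma frobenius:
  assumes P: "pid P" and p: "prime p" "of_nat p \<in> P" and I: "iner P = {\<one>\<^bsub>GK\<^esub>}"
  shows "\<exists>\<sigma>\<in>Gal K. \<forall>x\<in>ZK. \<sigma> x - x ^ p \<in> P"
proof (rule ccontr)
  assume c: "\<not> ?thesis"
  let ?e = "\<one>\<^bsub>GK\<^esub>"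
  have "\<forall>\<sigma>. \<exists>x. \<sigma> \<in> Gal K \<longrightarrow> x \<in> ZK \<and> \<sigma> x - x ^ p \<notin> P" using c by blast
  then obtain Xa where Xa: "\<And>\<sigma>. \<sigma> \<in> Gal K \<Longrightarrow> Xa \<sigma> \<in> ZK \<and> \<sigma> (Xa \<sigma>) - Xa \<sigma> ^ p \<notin> P" by metis
  have "\<forall>\<sigma>. \<exists>y. \<sigma> \<in> Gal K - {?e} \<longrightarrow> y \<in> ZK \<and> \<sigma> y - y \<notin> P" using I unfolding iner_def by blast
  then obtain Y where Y: "\<And>\<sigma>. \<sigma> \<in> Gal K - {?e} \<Longrightarrow> Y \<sigma> \<in> ZK \<and> \<sigma> (Y \<sigma>) - Y \<sigma> \<notin> P" by metis
  define L where "L a b \<longleftrightarrow> (\<forall>\<sigma>\<in>Gal K. a \<sigma> \<in> ZK \<and> b \<sigma> \<in> ZK) \<and>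
    (\<forall>x\<in>ZK. (\<Sum>\<sigma>\<in>Gal K. a \<sigma> * \<sigma> x ^ p) - (\<Sum>\<sigma>\<in>Gal K. b \<sigma> * \<sigma> x) \<in> P)"
    for a b :: "(complex \<Rightarrow> complex) \<Rightarrow> complex"
  have L1: "L (\<lambda>_. 1) (\<lambda>_. 1)"
    unfolding L_def
  proof (intro conjI ballI ZK_1)
    fix x assume x: "x \<in> ZK"
    obtain n where n: "(\<Sum>\<sigma>\<in>Gal K. \<sigma> x) = of_int n" using trace_int[OF x] by blast
    have 1: "(\<Sum>\<sigma>\<in>Gal K. \<sigma> x) ^ p - (\<Sum>\<sigma>\<in>Gal K. \<sigma> x ^ p) \<in> P"
      using freshman_sum[OF P p Gal_fin, of "\<lambda>\<sigma>. \<sigma> x"] ZK_Gal[OF _ x] by blast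
    have 2: "(\<Sum>\<sigma>\<in>Gal K. \<sigma> x) ^ p - (\<Sum>\<sigma>\<in>Gal K. \<sigma> x) \<in> P" unfolding n by (rule fermat_P[OF P p])
    show "(\<Sum>\<sigma>\<in>Gal K. 1 * \<sigma> x ^ p) - (\<Sum>\<sigma>\<in>Gal K. 1 * \<sigma> x) \<in> P"
      using P_diff[OF P 2 1] by simp
  qed
  \<comment> \<open>The relation for \<open>z * x\<close>, minus \<open>e\<close> times the relation
    for \<open>x\<close>.\<close>
  have Lstep: "L (\<lambda>\<sigma>. a \<sigma> * (\<sigma> z ^ p - e)) (\<lambda>\<sigma>. b \<sigma> * (\<sigma> z - e))" if L: "L a b" and z: "z \<in> ZK" "e \<in> ZK" for a b z e
    unfolding L_def
  proof (intro conjI ballI)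
    fix \<sigma> assume s: "\<sigma> \<in> Gal K"
    thus "a \<sigma> * (\<sigma> z ^ p - e) \<in> ZK" "b \<sigma> * (\<sigma> z - e) \<in> ZK"
      using L z ZK_Gal[OF s] by (auto simp: L_def intro!: ZK_mult ZK_diff ZK_power)
  next
    fix x assume x: "x \<in> ZK"
    have m: "\<sigma> (z * x) = \<sigma> z * \<sigma> x" if s: "\<sigma> \<in> Gal K" for \<sigma>
      by (rule Gal_times[OF s]) (use x z ZK_K in auto)
    have "(\<Sum>\<sigma>\<in>Gal K. a \<sigma> * (\<sigma> z ^ p - e) * \<sigma> x ^ p) = (\<Sum>\<sigma>\<in>Gal K. a \<sigma> * \<sigma> (z * x) ^ p) - e * (\<Sum>\<sigma>\<in>Gal K. a \<sigma> * \<sigma> x ^ p)"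
      "(\<Sum>\<sigma>\<in>Gal K. b \<sigma> * (\<sigma> z - e) * \<sigma> x) = (\<Sum>\<sigma>\<in>Gal K. b \<sigma> * \<sigma> (z * x)) - e * (\<Sum>\<sigma>\<in>Gal K. b \<sigma> * \<sigma> x)"
      unfolding sum_distrib_left sum_subtractf[symmetric]
      by (intro sum.cong refl, subst m, assumption, simp add: algebra_simps power_mult_distrib)+
    hence e: "(\<Sum>\<sigma>\<in>Gal K. a \<sigma> * (\<sigma> z ^ p - e) * \<sigma> x ^ p) - (\<Sum>\<sigma>\<in>Gal K. b \<sigma> * (\<sigma> z - e) * \<sigma> x) =
      ((\<Sum>\<sigma>\<in>Gal K. a \<sigma> * \<sigma> (z * x) ^ p) - (\<Sum>\<sigma>\<in>Gal K. b \<sigma> * \<sigma> (z * x)))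
      - e * ((\<Sum>\<sigma>\<in>Gal K. a \<sigma> * \<sigma> x ^ p) - (\<Sum>\<sigma>\<in>Gal K. b \<sigma> * \<sigma> x))"
      by (simp add: algebra_simps)
    show "(\<Sum>\<sigma>\<in>Gal K. a \<sigma> * (\<sigma> z ^ p - e) * \<sigma> x ^ p) - (\<Sum>\<sigma>\<in>Gal K. b \<sigma> * (\<sigma> z - e) * \<sigma> x) \<in> P"
      unfolding e
    proof (rule P_diff[OF P _ P_l[OF P z(2)]])
      show "(\<Sum>\<sigma>\<in>Gal K. a \<sigma> * \<sigma> (z * x) ^ p) - (\<Sum>\<sigma>\<in>Gal K. b \<sigma> * \<sigma> (z * x)) \<in> P"
        using L ZK_mult[OF z(1) x] by (simp add: L_def)
      show "(\<Sum>\<sigma>\<in>Gal K. a \<sigma> * \<sigma> x ^ p) - (\<Sum>\<sigma>\<in>Gal K. b \<sigma> * \<sigma> x) \<in> P"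
        using L x by (simp add: L_def)
    qed
  qed
  \<comment> \<open>With \<open>e = \<tau> (Xa \<tau>)\<close> the right-hand coefficient at \<tau>
    vanishes, while the left-hand coefficient at the identity gains a factor outside
    \<open>P\<close>.\<close>
  have A: "L (\<lambda>\<sigma>. \<Prod>\<tau>\<in>A. (\<sigma> (Xa \<tau>) ^ p - \<tau> (Xa \<tau>))) (\<lambda>\<sigma>. \<Prod>\<tau>\<in>A. (\<sigma> (Xa \<tau>) - \<tau> (Xa \<tau>)))"
    if "finite A" "A \<subseteq> Gal K" for A
    using that
  proof (induction A rule: finite_induct)
    case empty thus ?case using L1 by simp
  next
    case (insert t A)
    have t: "t \<in> Gal K" using insert by auto
    have "Xa t \<in> ZK" "t (Xa t) \<in> ZK" using Xa[OF t] ZK_Gal[OF t] by auto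
    from Lstep[OF insert.IH this] insert show ?case by (simp add: mult.commute)
  qed
  define a where "a \<sigma> = (\<Prod>\<tau>\<in>Gal K. (\<sigma> (Xa \<tau>) ^ p - \<tau> (Xa \<tau>)))" for \<sigma> :: "complex \<Rightarrow> complex"
  have b0: "(\<Prod>\<tau>\<in>Gal K. (\<sigma> (Xa \<tau>) - \<tau> (Xa \<tau>))) = 0" if "\<sigma> \<in> Gal K" for \<sigma>
    using that Gal_fin by (intro prod_zero) auto
  have L0: "L a (\<lambda>_. 0)"
    using A[OF Gal_fin subset_refl] b0 unfolding a_def L_def by (auto simp: ZK_0)
  have a1: "a ?e \<in> ZK - P"
  proof -
    have o: "Xa t ^ p - t (Xa t) \<in> ZK - P" if t: "t \<in> Gal K" for t
      using Xa[OF t] ZK_Gal[OF t] P_cong_sym[OF P, of "Xa t ^ p" "t (Xa t)"] by (auto intro!: ZK_diff ZK_power)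
    have "a ?e = (\<Prod>\<tau>\<in>Gal K. (Xa \<tau> ^ p - \<tau> (Xa \<tau>)))"
      unfolding a_def using Xa by (intro prod.cong refl) (auto simp: one_app ZK_K)
    thus ?thesis using o P_prod_notin[OF P Gal_fin, of "\<lambda>t. Xa t ^ p - t (Xa t)"] ZK_prod[of "Gal K" "\<lambda>t. Xa t ^ p - t (Xa t)"] by auto
  qed
  \<comment> \<open>With the right-hand side gone, \<open>e = \<tau> (Y \<tau>) ^ p\<close> removes
    the left-hand coefficient at \<tau>. At the identity the new factor is outside \<open>P\<close>
    by \<open>freshman_diff\<close>.\<close>
  have B: "L (\<lambda>\<sigma>. a \<sigma> * (\<Prod>\<tau>\<in>A. (\<sigma> (Y \<tau>) ^ p - \<tau> (Y \<tau>) ^ p))) (\<lambda>_. 0)"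
    if "finite A" "A \<subseteq> Gal K - {?e}" for A
    using that
  proof (induction A rule: finite_induct)
    case empty thus ?case using L0 by simp
  next
    case (insert t A)
    have t: "t \<in> Gal K - {?e}" using insert by auto
    have "Y t \<in> ZK" "t (Y t) ^ p \<in> ZK" using Y[OF t] ZK_Gal[of t] t by (auto intro: ZK_power)
    from Lstep[OF insert.IH this] insert show ?case by (simp add: mult_ac)
  qed
  let ?G = "Gal K - {?e}"
  define b where "b \<sigma> = (\<Prod>\<tau>\<in>?G. (\<sigma> (Y \<tau>) ^ p - \<tau> (Y \<tau>) ^ p))" for \<sigma> :: "complex \<Rightarrow> complex"
  have fG: "finite ?G" using Gal_fin by simp
  have L2: "L (\<lambda>\<sigma>. a \<sigma> * b \<sigma>) (\<lambda>_. 0)" unfolding b_def by (rule B[OF fG subset_refl])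
  have bz: "b \<sigma> = 0" if "\<sigma> \<in> ?G" for \<sigma> unfolding b_def using that fG by (intro prod_zero) auto
  have b1: "b ?e \<in> ZK - P"
  proof -
    have o: "Y t ^ p - t (Y t) ^ p \<in> ZK - P" if t: "t \<in> ?G" for t
    proof -
      have y: "Y t \<in> ZK" "t (Y t) \<in> ZK" using Y[OF t] ZK_Gal[of t] t by auto
      hence "Y t ^ p - t (Y t) ^ p \<in> P \<longleftrightarrow> Y t - t (Y t) \<in> P" by (rule freshman_diff[OF P p])
      thus ?thesis using Y[OF t] y P_cong_sym[OF P, of "Y t" "t (Y t)"] by (auto intro!: ZK_diff ZK_power)
    qed
    have "b ?e = (\<Prod>\<tau>\<in>?G. (Y \<tau> ^ p - \<tau> (Y \<tau>) ^ p))"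
      unfolding b_def using Y by (intro prod.cong refl) (auto simp: one_app ZK_K)
    thus ?thesis using o P_prod_notin[OF P fG, of "\<lambda>t. Y t ^ p - t (Y t) ^ p"] ZK_prod[of ?G "\<lambda>t. Y t ^ p - t (Y t) ^ p"] by auto
  qed
  have "(\<Sum>\<sigma>\<in>Gal K. a \<sigma> * b \<sigma> * \<sigma> 1 ^ p) \<in> P" using L2 ZK_1 unfolding L_def by force
  also have "(\<Sum>\<sigma>\<in>Gal K. a \<sigma> * b \<sigma> * \<sigma> 1 ^ p) = (\<Sum>\<sigma>\<in>{?e}. a \<sigma> * b \<sigma> * \<sigma> 1 ^ p)"
    by (rule sum.mono_neutral_right[OF Gal_fin]) (auto simp: bz)
  also have "\<dots> = a ?e * b ?e" by (simp add: Gal_1 one_Gal)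
  finally show False using P_prime[OF P, of "a ?e" "b ?e"] a1 b1 by blast
qed

lemma P_int_inverse:
  assumes P: "pid P" and p: "prime p" "of_nat p \<in> P" and n: "of_int n \<notin> P"
  shows "\<exists>v. of_int (v * n) - 1 \<in> P"
proof -
  have "\<not> int p dvd n" using P_of_int_iff[OF P p] n by simp
  hence "coprime (int p) n" using p by (simp add: prime_imp_coprime)
  then obtain a b where "a * int p + b * n = 1" by (metis bezout_int coprime_imp_gcd_eq_1)
  hence "b * n - 1 = - a * int p" by (simp add: algebra_simps)
  hence "of_int (b * n - 1) \<in> P" using P_of_int_iff[OF P p, of "b * n - 1"] by simp
  thus ?thesis by (intro exI[of _ b]) simp
qed

text \<open>A prime dividing the norm of \<open>n - \<theta>\<close>, but not the discriminant of \<open>\<theta>\<close>, has a prime of degree one above it.\<close>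

lemma degree_one_prime:
  assumes th: "\<theta> \<in> ZK" "\<And>\<sigma>. \<sigma> \<in> Gal K \<Longrightarrow> \<sigma> \<theta> = \<theta> \<Longrightarrow> \<sigma> = \<one>\<^bsub>GK\<^esub>"
  shows "\<exists>l P. prime l \<and> l > B \<and> pid P \<and> of_nat l \<in> P \<and> (\<forall>x\<in>ZK. \<exists>n. x - of_int n \<in> P)"
proof -
  let ?e = "\<one>\<^bsub>GK\<^esub>"
  \<comment> \<open>The derivative at \<theta> of its characteristic polynomial; its norm
    \<open>d\<close> is the discriminant up to sign.\<close>
  define D where "D = (\<Prod>\<tau>\<in>Gal K - {?e}. (\<theta> - \<tau> \<theta>))"
  have DO: "D \<in> ZK" unfolding D_def using th ZK_Gal by (auto intro!: ZK_prod ZK_diff)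
  have D0: "D \<noteq> 0" unfolding D_def using th(2) Gal_fin by (subst prod_zero_iff) auto
  obtain d where d: "d \<noteq> 0" "(\<Prod>\<sigma>\<in>Gal K. \<sigma> D) = of_int d" using norm_int[OF DO D0] by blast
  define C where "C = (\<Sum>\<sigma>\<in>Gal K. cmod (\<sigma> \<theta>))"
  have C: "cmod (\<sigma> \<theta>) \<le> C" if "\<sigma> \<in> Gal K" for \<sigma>
    unfolding C_def using that Gal_fin by (intro member_le_sum) auto
  define N where "N n = (\<Prod>\<sigma>\<in>Gal K. \<sigma> (of_int n - \<theta>))" for n
  have sn: "\<sigma> (of_int n - \<theta>) = of_int n - \<sigma> \<theta>" if "\<sigma> \<in> Gal K" for \<sigma> n
    using Gal_diff[OF that, of "of_int n" \<theta>] Gal_of_int[OF that] ZK_K ZK_of_int th by simp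
  have big: "cmod (N n) \<ge> b" if n: "real_of_int n \<ge> C + b" and b: "b \<ge> 1" for n b
  proof -
    have "b \<le> b ^ card (Gal K)"
      using b Gal_fin one_Gal by (intro self_le_power) (auto simp: card_gt_0_iff)
    also have "\<dots> = (\<Prod>\<sigma>\<in>Gal K. b)" by simp
    also have "\<dots> \<le> (\<Prod>\<sigma>\<in>Gal K. cmod (\<sigma> (of_int n - \<theta>)))"
    proof (intro prod_mono conjI)
      fix \<sigma> assume s: "\<sigma> \<in> Gal K"
      have "cmod (of_int n) \<le> cmod (of_int n - \<sigma> \<theta>) + cmod (\<sigma> \<theta>)" by (metis diff_add_cancel norm_triangle_ineq)
      moreover have "cmod (of_int n) \<ge> real_of_int n" by (simp add: norm_of_int)
      ultimately show "b \<le> cmod (\<sigma> (of_int n - \<theta>))" using sn[OF s] C[OF s] n by simp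
    qed (use b in auto)
    also have "\<dots> = cmod (N n)" by (simp add: N_def prod_norm)
    finally show ?thesis .
  qed
  have nO: "of_int n - \<theta> \<in> ZK" for n using th ZK_diff ZK_of_int by blast
  have Nint: "\<exists>k. N n = of_int k" for n
  proof (cases "of_int n - \<theta> = 0")
    case True
    have "N n = 0" unfolding N_def True using one_Gal Gal_fin Gal_0 by (intro prod_zero) auto
    thus ?thesis by (metis of_int_0)
  next
    case False thus ?thesis using norm_int[OF nO False] unfolding N_def by blast
  qed
  then obtain k where k: "\<And>n. N n = of_int (k n)" by metis
  obtain n0 :: int where n0: "real_of_int n0 \<ge> C + 1" by (metis ex_of_int_less less_eq_real_def real_arch_simple of_int_of_nat_eq)
  have N0: "k n0 \<noteq> 0" using big[OF n0] k[of n0] by auto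
  \<comment> \<open>The primes to be avoided are those up to \<open>B\<close> and those dividing
    \<open>d\<close>.\<close>
  define M where "M = fact B * \<bar>d\<bar>"
  have M0: "M > 0" using d by (simp add: M_def)
  define c where "c = \<bar>k n0\<bar>"
  have c0: "c > 0" using N0 by (simp add: c_def)
  obtain j :: int where j: "real_of_int j \<ge> C + real_of_int c + 1 - real_of_int n0" "j \<ge> 0"
    by (metis real_arch_simple of_int_of_nat_eq of_nat_0_le_iff)
  \<comment> \<open>A shift by a multiple of \<open>M * c\<close> keeps the norm divisible by
    \<open>c\<close>, and \<open>j\<close> is so large that the norm exceeds \<open>c\<close> in
    absolute value: its cofactor is not a unit.\<close>
  define n where "n = n0 + M * c * j"
  have "M * c * j \<ge> j" using M0 c0 j(2) by (metis mult_le_cancel_right1 mult_pos_pos int_one_le_iff_zero_less mult.commute not_le)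
  hence "real_of_int n \<ge> real_of_int n0 + real_of_int j" unfolding n_def by (simp flip: of_int_add)
  hence "real_of_int n \<ge> C + real_of_int (c + 1)" using j by simp
  hence "cmod (N n) \<ge> real_of_int (c + 1)" by (rule big) (use c0 in simp)
  hence kn: "\<bar>k n\<bar> \<ge> c + 1" using k[of n] by (simp add: norm_of_int flip: of_int_abs)
  have dv: "M * c dvd k n - k n0"
  proof -
    have "\<exists>z\<in>ZK. (\<Prod>\<sigma>\<in>A. \<sigma> (of_int n - \<theta>)) = (\<Prod>\<sigma>\<in>A. \<sigma> (of_int n0 - \<theta>)) + of_int (M * c) * z"
      if "finite A" "A \<subseteq> Gal K" for A
      using that
    proof (induction A rule: finite_induct)
      case empty thus ?case using ZK_0 by force
    next
      case (insert s A)
      then obtain z where z: "z \<in> ZK" "(\<Prod>\<sigma>\<in>A. \<sigma> (of_int n - \<theta>)) = (\<Prod>\<sigma>\<in>A. \<sigma> (of_int n0 - \<theta>)) + of_int (M * c) * z" by auto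
      have s: "s \<in> Gal K" using insert by auto
      have sz: "s (of_int n0 - \<theta>) \<in> ZK" by (rule ZK_Gal[OF s nO])
      have A: "(\<Prod>\<sigma>\<in>A. \<sigma> (of_int n0 - \<theta>)) \<in> ZK" using insert.prems by (intro ZK_prod ZK_Gal[OF _ nO]) auto
      have e: "s (of_int n - \<theta>) = s (of_int n0 - \<theta>) + of_int (M * c) * of_int j"
        unfolding sn[OF s] n_def by simp
      show ?case
      proof (intro bexI)
        show "(\<Prod>\<sigma>\<in>insert s A. \<sigma> (of_int n - \<theta>)) = (\<Prod>\<sigma>\<in>insert s A. \<sigma> (of_int n0 - \<theta>)) + of_int (M * c) *
          (of_int j * (\<Prod>\<sigma>\<in>A. \<sigma> (of_int n0 - \<theta>)) + s (of_int n0 - \<theta>) * z + of_int j * of_int (M * c) * z)"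
          using insert(1,2) z(2) e by (simp add: algebra_simps)
        show "of_int j * (\<Prod>\<sigma>\<in>A. \<sigma> (of_int n0 - \<theta>)) + s (of_int n0 - \<theta>) * z + of_int j * of_int (M * c) * z \<in> ZK"
          using A sz z by (intro ZK_add ZK_mult ZK_of_int)
      qed
    qed
    from this[OF Gal_fin subset_refl] obtain z where z: "z \<in> ZK" "N n = N n0 + of_int (M * c) * z" unfolding N_def by blast
    hence "of_int (k n - k n0) = of_int (M * c) * z" using k by simp
    moreover have mc: "(of_int (M * c) :: complex) \<noteq> 0" using M0 c0 by (metis mult_pos_pos of_int_eq_0_iff less_irrefl)
    ultimately have "z = of_int (k n - k n0) / of_int (M * c)" by (simp add: field_simps)
    hence "z \<in> \<rat>" by auto
    hence "z \<in> \<int>" using z rational_algebraic_int_is_int by (auto simp: ZK_def)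
    then obtain q where "z = of_int q" by (auto elim: Ints_cases)
    hence "of_int (k n - k n0) = (of_int (M * c * q) :: complex)" using \<open>of_int (k n - k n0) = of_int (M * c) * z\<close> by simp
    hence "k n - k n0 = M * c * q" by (simp only: of_int_eq_iff)
    thus ?thesis by simp
  qed
  have "c dvd k n0" by (simp add: c_def)
  then obtain e where e: "k n0 = c * e" by blast
  from dv obtain q where q: "k n - k n0 = M * c * q" by blast
  \<comment> \<open>As \<open>e\<close> is 1 or -1, the cofactor \<open>r\<close> of
    \<open>c\<close> in \<open>k n\<close> is a unit modulo \<open>M\<close>, and all its prime
    factors avoid \<open>M\<close>.\<close>
  define r where "r = e + M * q"
  have kr: "k n = c * r" using e q by (simp add: r_def algebra_simps)
  have "\<bar>k n0\<bar> = c * \<bar>e\<bar>" using e c0 by (simp only: abs_mult abs_of_pos)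
  hence "c * \<bar>e\<bar> = c * 1" by (simp add: c_def)
  hence e1: "\<bar>e\<bar> = 1" using c0 by auto
  have r1: "\<not> r dvd 1"
  proof
    assume "r dvd 1"
    hence "\<bar>r\<bar> = 1" by (simp add: zdvd1_eq)
    hence "\<bar>k n\<bar> = c" using kr c0 by (simp add: abs_mult)
    with kn show False by simp
  qed
  hence "r \<noteq> 0 \<or> True" by simp
  have "\<exists>l. prime l \<and> l dvd nat \<bar>r\<bar>"
  proof (rule prime_factor_nat)
    show "nat \<bar>r\<bar> \<noteq> 1" using r1 by (auto simp: zdvd1_eq)
  qed
  then obtain l where l: "prime l" "l dvd nat \<bar>r\<bar>" by blast
  have lr: "int l dvd r" using l(2) by (simp add: int_dvd_int_iff[symmetric])
  have lM: "\<not> int l dvd M"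
  proof
    assume "int l dvd M"
    hence "int l dvd e" using lr unfolding r_def by (metis dvd_add_left_iff dvd_mult2)
    hence "int l dvd 1" using e1 by (metis dvd_abs_iff)
    hence "l dvd 1" by (metis int_dvd_int_iff of_nat_1)
    thus False using l(1) by (simp add: prime_nat_iff)
  qed
  have lB: "l > B"
  proof (rule ccontr)
    assume "\<not> l > B"
    hence "l dvd fact B" using l(1) by (intro dvd_fact) (auto simp: prime_gt_0_nat Suc_leI)
    hence "int l dvd fact B" by (metis int_dvd_int_iff of_nat_fact)
    hence "int l dvd M" by (simp add: M_def)
    with lM show False by simp
  qed
  have ld: "\<not> int l dvd d" using lM by (auto simp: M_def)
  obtain P0 where P0: "pid P0" "of_nat l \<in> P0" using pid_exists[OF l(1)] by blast
  have "N n \<in> P0" using k[of n] kr lr P_of_int_iff[OF P0(1) l(1) P0(2), of "k n"] by simp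
  then obtain s where s: "s \<in> Gal K" "s (of_int n - \<theta>) \<in> P0"
    using P_prod_notin[OF P0(1) Gal_fin, of "\<lambda>\<sigma>. \<sigma> (of_int n - \<theta>)"] ZK_Gal[OF _ nO] unfolding N_def by blast
  \<comment> \<open>Pulling back along \<open>s\<close> turns the divisibility of one conjugate of
    \<open>n - \<theta>\<close> into \<theta> being congruent to \<open>n\<close> modulo
    \<open>P\<close>.\<close>
  define P where "P = {x \<in> ZK. s x \<in> P0}"
  have P: "pid P" unfolding P_def by (rule Gal_pid[OF P0(1) s(1)])
  have lP: "of_nat l \<in> P" unfolding P_def using Gal_of_int[OF s(1), of "int l"] P0 ZK_of_nat by simp
  have tP: "of_int n - \<theta> \<in> P" unfolding P_def using s nO by simp
  have DP: "D \<notin> P"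
  proof
    assume "D \<in> P"
    hence "of_int d \<in> P" using norm_in[OF P] d by metis
    with ld show False using P_of_int_iff[OF P l(1) lP] by simp
  qed
  \<comment> \<open>For each nontrivial \<sigma> the product \<sigma>(\<open>E\<close>) has the
    factor \<open>of_int n - \<theta>\<close> and lies in \<open>P\<close>. Hence
    \<open>a * E\<close> is congruent to its trace, an integer, for every \<open>a\<close>, whereas
    \<open>E\<close> itself is congruent to \<open>D\<close> and a unit modulo
    \<open>P\<close>.\<close>
  define E where "E = (\<Prod>\<tau>\<in>Gal K - {?e}. (of_int n - \<tau> \<theta>))"
  have tO: "\<tau> \<theta> \<in> ZK" if "\<tau> \<in> Gal K" for \<tau> using ZK_Gal[OF that th(1)] .
  have EO: "E \<in> ZK" unfolding E_def using tO by (intro ZK_prod ZK_diff ZK_of_int) auto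
  have "E - D \<in> P" unfolding E_def D_def
  proof (rule P_cong_prod[OF P])
    fix \<tau> assume t: "\<tau> \<in> Gal K - {?e}"
    show "of_int n - \<tau> \<theta> - (\<theta> - \<tau> \<theta>) \<in> P" using tP by simp
    show "of_int n - \<tau> \<theta> \<in> ZK" "\<theta> - \<tau> \<theta> \<in> ZK" using t tO th by (auto intro: ZK_diff ZK_of_int)
  qed (use Gal_fin in simp)
  hence EP: "E \<notin> P" using P_cong_iff[OF P] DP by blast
  have tr: "\<exists>m. a * E - of_int m \<in> P" if a: "a \<in> ZK" for a
  proof -
    have aE: "a * E \<in> ZK" using a EO ZK_mult by blast
    obtain m where m: "(\<Sum>\<sigma>\<in>Gal K. \<sigma> (a * E)) = of_int m" using trace_int[OF aE] by blast
    have "(\<Sum>\<sigma>\<in>Gal K - {?e}. \<sigma> (a * E)) \<in> P"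
    proof (rule P_sum[OF P])
      fix \<sigma> assume s: "\<sigma> \<in> Gal K - {?e}"
      hence sG: "\<sigma> \<in> Gal K" by simp
      let ?i = "inv\<^bsub>GK\<^esub> \<sigma>"
      have i: "?i \<in> Gal K - {?e}" using s by (metis DiffD1 DiffD2 DiffI G.inv_closed G.inv_inv G.inv_one singletonD singletonI)
      have "\<sigma> E = (\<Prod>\<tau>\<in>Gal K - {?e}. \<sigma> (of_int n - \<tau> \<theta>))" unfolding E_def
        by (rule Gal_prod[OF sG]) (use tO ZK_K ZK_diff ZK_of_int in blast)
      also have "\<dots> \<in> P"
      proof (rule P_prod[OF P _ i])
        have "\<sigma> (of_int n - ?i \<theta>) = of_int n - \<theta>"
          using Gal_diff[OF sG, of "of_int n" "?i \<theta>"] Gal_of_int[OF sG] Gal_inv(1)[OF sG, of \<theta>] th tO i ZK_K ZK_of_int by simp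
        thus "\<sigma> (of_int n - ?i \<theta>) \<in> P" using tP by simp
      next
        fix \<tau> assume "\<tau> \<in> Gal K - {?e}"
        hence "of_int n - \<tau> \<theta> \<in> ZK" using tO ZK_diff ZK_of_int by blast
        thus "\<sigma> (of_int n - \<tau> \<theta>) \<in> ZK" by (rule ZK_Gal[OF sG])
      qed (use Gal_fin in simp)
      finally have "\<sigma> E \<in> P" .
      moreover have "\<sigma> (a * E) = \<sigma> a * \<sigma> E" using Gal_times[OF sG] a EO ZK_K by blast
      ultimately show "\<sigma> (a * E) \<in> P" using P_l[OF P] ZK_Gal[OF sG a] by metis
    qed
    moreover have "(\<Sum>\<sigma>\<in>Gal K. \<sigma> (a * E)) = a * E + (\<Sum>\<sigma>\<in>Gal K - {?e}. \<sigma> (a * E))"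
      using sum.remove[OF Gal_fin one_Gal, of "\<lambda>\<sigma>. \<sigma> (a * E)"] one_app[of "a * E"] aE ZK_K by simp
    ultimately have "of_int m - a * E \<in> P" using m by simp
    thus ?thesis using P_cong_sym[OF P] by blast
  qed
  have fin: "\<exists>n. x - of_int n \<in> P" if x: "x \<in> ZK" for x
  proof -
    obtain m1 where m1: "1 * E - of_int m1 \<in> P" using tr[OF ZK_1] by blast
    obtain m where m: "x * E - of_int m \<in> P" using tr[OF x] by blast
    have "of_int m1 \<notin> P" using P_cong_iff[OF P m1] EP by simp
    then obtain v where v: "of_int (v * m1) - 1 \<in> P" using P_int_inverse[OF P l(1) lP] by blast
    have "x * (of_int (v * m1) - 1) \<in> P" "x * of_int v * (1 * E - of_int m1) \<in> P" "of_int v * (x * E - of_int m) \<in> P"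
      using v m1 m x by (auto intro!: P_l[OF P] ZK_mult ZK_of_int)
    hence "of_int v * (x * E - of_int m) - x * of_int v * (1 * E - of_int m1) - x * (of_int (v * m1) - 1) \<in> P"
      by (intro P_diff[OF P])
    also have "of_int v * (x * E - of_int m) - x * of_int v * (1 * E - of_int m1) - x * (of_int (v * m1) - 1) = x - of_int (v * m)"
      by (simp add: algebra_simps)
    finally show ?thesis by blast
  qed
  show ?thesis using l(1) lB P lP fin by blast
qed

end

lemma (in splitting) split_primes:
  "\<exists>l P. prime l \<and> l > B \<and> pid P \<and> of_nat l \<in> P \<and> (\<forall>x\<in>ZK. \<exists>n. x - of_int n \<in> P)"
proof (rule degree_one_prime)
  show "\<theta> \<in> ZK" using th_K th(2) by (simp add: ZK_def)
  fix \<sigma> assume "\<sigma> \<in> Gal K" "\<sigma> \<theta> = \<theta>"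
  thus "\<sigma> = \<one>\<^bsub>gal_group \<rat> K\<^esub>" using Gal_eq_th[OF _ one_Gal] one_app[OF th_K] by simp
qed

section \<open>The action of the projective special linear group on seven forms\<close>

lemma all7: "(\<forall>x::7. Q x) \<longleftrightarrow> Q 0 \<and> Q 1 \<and> Q 2 \<and> Q 3 \<and> Q 4 \<and> Q 5 \<and> Q 6"
proof (intro iffI allI)
  fix x :: 7 assume *: "Q 0 \<and> Q 1 \<and> Q 2 \<and> Q 3 \<and> Q 4 \<and> Q 5 \<and> Q 6"
  show "Q x"
  proof (cases x rule: bit1_cases)
    case (of_int z)
    hence "z \<in> {0,1,2,3,4,5,6}" by auto
    thus ?thesis using of_int * by auto
  qed
qed blast

lemma pow6: "(a::7) \<noteq> 0 \<Longrightarrow> a ^ 6 = 1"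
proof -
  have "(\<forall>a::7. a \<noteq> 0 \<longrightarrow> a ^ 6 = 1)" unfolding all7 by simp
  thus "a \<noteq> 0 \<Longrightarrow> a ^ 6 = 1" by blast
qed

lemma of_nat_mod7: "of_nat (n mod 7) = (of_nat n :: 7)"
proof -
  have "(of_nat n :: 7) = of_nat (7 * (n div 7) + n mod 7)" by simp
  also have "\<dots> = 7 * of_nat (n div 7) + of_nat (n mod 7)" by (simp only: of_nat_add of_nat_mult of_nat_numeral)
  also have "(7::7) = 0" by simp
  finally show ?thesis by simp
qed

lemma ex_nat7: "\<exists>n<7. (x::7) = of_nat n"
proof -
  have "\<forall>x::7. \<exists>n\<in>{0,1,2,3,4,5,6}. x = of_nat n" unfolding all7 by simp
  then obtain n where "n \<in> {0,1,2,3,4,5,6}" "x = of_nat n" by blast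
  thus ?thesis by (intro exI[of _ n]) auto
qed

text \<open>The translates of this binary sextic form are the \<open>7\<close> octahedral forms of one class of
  subgroups \<open>S\<^sub>4\<close>, and \<open>SL\<^sub>2(7)\<close> permutes them up to sign.\<close>

definition sextic :: "7 \<Rightarrow> 7 \<Rightarrow> 7 \<Rightarrow> 7" where
  "sextic i x y = (x - i * y) ^ 6 - (x - i * y) ^ 3 * y ^ 3 - y ^ 6"

lemma sextic_10: "sextic i 1 0 = 1" by (simp add: sextic_def)

lemma sextic_inj: "(\<And>x. sextic j x 1 = sextic k x 1) \<Longrightarrow> j = k"
proof (rule ccontr)
  assume a: "\<And>x. sextic j x 1 = sextic k x 1" "j \<noteq> k"
  have "\<forall>j k. j \<noteq> k \<longrightarrow> \<not> (\<forall>x. sextic j x 1 = sextic k x 1)" unfolding all7 sextic_def by simp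
  with a show False by blast
qed

text \<open>Permutations of \<open>{..<7}\<close> are represented by their lists of values.\<close>

definition cmp :: "nat list \<Rightarrow> nat list \<Rightarrow> nat list" where "cmp l m = map ((!) l) m"
definition tl7 :: "nat \<Rightarrow> nat list" where "tl7 k = map (\<lambda>i. (i + k) mod 7) [0..<7]"
definition ml7 :: "nat \<Rightarrow> nat list" where "ml7 k = map (\<lambda>i. (i * k) mod 7) [0..<7]"
definition sl7 :: "nat list" where "sl7 = [0,2,1,6,4,5,3]"
definition id7 :: "nat list" where "id7 = [0,1,2,3,4,5,6]"

text \<open>The permutations belonging to the Bruhat normal forms: 21 upper triangular ones and 147
  in the big cell, 168 in all. The factors 1, 2, 4 are the squares modulo 7, as a diagonal matrix
  acts through the square of its entry.\<close>

definition nforms :: "nat list list" where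
  "nforms = concat (map (\<lambda>x. concat (map (\<lambda>k. cmp (tl7 x) (ml7 k) #
     map (\<lambda>y. cmp (tl7 x) (cmp sl7 (cmp (ml7 k) (tl7 y)))) [0..<7]) [1,2,4])) [0..<7])"

definition mt2 :: "7 \<Rightarrow> 7 \<Rightarrow> 7 \<Rightarrow> 7 \<Rightarrow> 7^2^2" where
  "mt2 a b c d = vector [vector [a, b], vector [c, d]]"

lemma mt2_eta: "\<exists>a b c d. A = mt2 a b c d"
  by (rule exI[of _ "vec_nth (vec_nth A 1) 1"], rule exI[of _ "vec_nth (vec_nth A 1) 2"],
      rule exI[of _ "vec_nth (vec_nth A 2) 1"], rule exI[of _ "vec_nth (vec_nth A 2) 2"])
     (simp add: mt2_def Finite_Cartesian_Product.vec_eq_iff forall_2)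

lemma mt2_eq: "mt2 a b c d = mt2 a' b' c' d' \<longleftrightarrow> a = a' \<and> b = b' \<and> c = c' \<and> d = d'"
  by (auto simp: mt2_def Finite_Cartesian_Product.vec_eq_iff forall_2)

lemma mt2_mult: "mt2 a b c d ** mt2 a' b' c' d' = mt2 (a*a'+b*c') (a*b'+b*d') (c*a'+d*c') (c*b'+d*d')"
  by (simp add: mt2_def Finite_Cartesian_Product.vec_eq_iff forall_2 matrix_matrix_mult_def sum_2)

lemma mt2_det: "Determinants.det (mt2 a b c d) = a * d - b * c"
  by (simp add: mt2_def Determinants.det_2)

lemma mt2_one: "Finite_Cartesian_Product.mat 1 = mt2 1 0 0 1"
  by (simp add: mt2_def Finite_Cartesian_Product.vec_eq_iff forall_2 Finite_Cartesian_Product.mat_def)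

text \<open>For determinant 1 the substitution is the inverse matrix applied to
  \<open>(x, y)\<close>, so that products of matrices go to compositions in the same order. The
  factor \<open>e\<close> is a sign.\<close>

definition acts :: "7^2^2 \<Rightarrow> nat list \<Rightarrow> bool" where
  "acts A l \<longleftrightarrow> length l = 7 \<and> (\<forall>i<7. l ! i < 7) \<and> (\<forall>a b c d. A = mt2 a b c d \<longrightarrow>
     (\<forall>i<7. \<exists>e. e * e = 1 \<and> (\<forall>x y. sextic (of_nat i) (d * x - b * y) (a * y - c * x) = e * sextic (of_nat (l ! i)) x y)))"

lemma acts_mult:
  assumes "acts A l" "acts B m" shows "acts (A ** B) (cmp l m)"
proof -
  obtain a b c d where A: "A = mt2 a b c d" using mt2_eta by blast
  obtain a' b' c' d' where B: "B = mt2 a' b' c' d'" using mt2_eta by blast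
  have m: "length m = 7" "\<And>i. i < 7 \<Longrightarrow> m ! i < 7" and l: "length l = 7" "\<And>i. i < 7 \<Longrightarrow> l ! i < 7"
    using assms by (auto simp: acts_def)
  have "\<exists>e. e * e = 1 \<and> (\<forall>x y. sextic (of_nat i) ((c*b'+d*d') * x - (a*b'+b*d') * y) ((a*a'+b*c') * y - (c*a'+d*c') * x)
      = e * sextic (of_nat (cmp l m ! i)) x y)" if i: "i < 7" for i
  proof -
    obtain e where e: "e * e = 1" "\<And>x y. sextic (of_nat i) (d' * x - b' * y) (a' * y - c' * x) = e * sextic (of_nat (m ! i)) x y"
      using assms(2) i B unfolding acts_def by blast
    obtain f where f: "f * f = 1" "\<And>x y. sextic (of_nat (m ! i)) (d * x - b * y) (a * y - c * x) = f * sextic (of_nat (l ! (m ! i))) x y"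
      using assms(1) m(2)[OF i] A unfolding acts_def by blast
    have "sextic (of_nat i) ((c*b'+d*d') * x - (a*b'+b*d') * y) ((a*a'+b*c') * y - (c*a'+d*c') * x)
      = (e * f) * sextic (of_nat (cmp l m ! i)) x y" for x y
    proof -
      have "(c*b'+d*d') * x - (a*b'+b*d') * y = d' * (d * x - b * y) - b' * (a * y - c * x)"
        "(a*a'+b*c') * y - (c*a'+d*c') * x = a' * (a * y - c * x) - c' * (d * x - b * y)" by (simp_all add: algebra_simps)
      thus ?thesis using e(2)[of "d * x - b * y" "a * y - c * x"] f(2)[of x y] i m by (simp add: cmp_def mult.assoc)
    qed
    moreover have "(e * f) * (e * f) = (e * e) * (f * f)" by (simp add: mult_ac)
    hence "(e * f) * (e * f) = 1" using e f by simp
    ultimately show ?thesis by blast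
  qed
  thus ?thesis unfolding acts_def A B mt2_mult mt2_eq using m l by (auto simp: cmp_def)
qed

lemma acts_unique: assumes "acts A l" "acts A m" shows "l = m"
proof (rule nth_equalityI)
  show "length l = length m" using assms by (simp add: acts_def)
  fix i assume "i < length l"
  hence i: "i < 7" using assms by (simp add: acts_def)
  obtain a b c d where A: "A = mt2 a b c d" using mt2_eta by blast
  obtain e where e: "e * e = 1" "\<And>x y. sextic (of_nat i) (d * x - b * y) (a * y - c * x) = e * sextic (of_nat (l ! i)) x y"
    using assms(1) i A unfolding acts_def by blast
  obtain f where f: "f * f = 1" "\<And>x y. sextic (of_nat i) (d * x - b * y) (a * y - c * x) = f * sextic (of_nat (m ! i)) x y"
    using assms(2) i A unfolding acts_def by blast
  have ef: "e * sextic (of_nat (l ! i)) x y = f * sextic (of_nat (m ! i)) x y" for x y using e(2) f(2) by metis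
  \<comment> \<open>All seven forms take the value 1 at \<open>(1, 0)\<close>, which forces the two
    signs to agree.\<close>
  have "e = f" using ef[of 1 0] by (simp add: sextic_10)
  hence "e * (e * sextic (of_nat (l ! i)) x y) = e * (e * sextic (of_nat (m ! i)) x y)" for x y using ef by simp
  hence "sextic (of_nat (l ! i)) x y = sextic (of_nat (m ! i)) x y" for x y
    by (simp only: mult.assoc[symmetric] e(1) mult_1)
  hence o: "(of_nat (l ! i) :: 7) = of_nat (m ! i)" by (rule sextic_inj)
  have lt: "l ! i < 7" "m ! i < 7" using assms i by (auto simp: acts_def)
  have "inj_on (of_nat :: nat \<Rightarrow> 7) {..<7}"
  proof -
    have "{..<7::nat} = {0,1,2,3,4,5,6}" by auto
    thus ?thesis by (simp add: inj_on_def)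
  qed
  with o lt show "l ! i = m ! i" by (auto simp: inj_on_def)
qed

lemma acts_T: "acts (mt2 1 (of_nat k) 0 1) (tl7 k)"
proof -
  have "sextic (of_nat i) (x - of_nat k * y) y = sextic (of_nat (tl7 k ! i)) x y" if "i < 7" for i x y
    using that by (simp add: tl7_def of_nat_mod7 sextic_def algebra_simps)
  thus ?thesis unfolding acts_def mt2_eq by (auto simp: tl7_def intro!: exI[of _ 1])
qed

lemma acts_D:
  assumes ab: "a * b = 1" and k: "of_nat k = a * a" shows "acts (mt2 a 0 0 b) (ml7 k)"
proof -
  have a0: "a \<noteq> 0" "b \<noteq> 0" using ab by auto
  have "sextic (of_nat i) (b * x) (a * y) = sextic (of_nat (ml7 k ! i)) x y" if "i < 7" for i x y
  proof -
    define u where "u = x - of_nat i * (a * a) * y"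
    have "b * u = b * x - of_nat i * (a * b) * (a * y)" by (simp add: u_def algebra_simps)
    hence u: "b * x - of_nat i * (a * y) = b * u" using ab by simp
    have "(b * u) ^ 6 = u ^ 6" "(a * y) ^ 6 = y ^ 6" using pow6[OF a0(1)] pow6[OF a0(2)] by (simp_all add: power_mult_distrib)
    moreover have "(b * u) ^ 3 * (a * y) ^ 3 = (a * b) ^ 3 * u ^ 3 * y ^ 3" by (simp add: power_mult_distrib mult_ac)
    ultimately have "sextic (of_nat i) (b * x) (a * y) = u ^ 6 - u ^ 3 * y ^ 3 - y ^ 6"
      unfolding sextic_def u using ab by simp
    moreover have "ml7 k ! i = (i * k) mod 7" using that by (simp add: ml7_def)
    ultimately show ?thesis by (simp add: sextic_def u_def of_nat_mod7 k)
  qed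
  thus ?thesis unfolding acts_def mt2_eq by (auto simp: ml7_def intro!: exI[of _ 1])
qed

lemma acts_S: "acts (mt2 0 (- 1) 1 0) sl7"
proof -
  have s: "\<forall>x y. sextic 0 y (- x) = - sextic 0 x y" "\<forall>x y. sextic 1 y (- x) =  sextic 2 x y" "\<forall>x y. sextic 2 y (- x) = 
      sextic 1 x y" "\<forall>x y. sextic 3 y (- x) = - sextic 6 x y" "\<forall>x y. sextic 4 y (- x) =  sextic 4 x y" "\<forall>x y. sextic 5 y (-
      x) = - sextic 5 x y" "\<forall>x y. sextic 6 y (- x) = - sextic 3 x y"
    unfolding all7 sextic_def by simp_all
  have "\<exists>e. e * e = 1 \<and> (\<forall>x y. sextic (of_nat i) y (- x) = e * sextic (of_nat (sl7 ! i)) x y)" if "i < 7" for i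
  proof -
    have "i \<in> {0,1,2,3,4,5,6}" using that by auto
    moreover have "\<exists>e. e * e = 1 \<and> (\<forall>x y. sextic 0 y (- x) = e * sextic 0 x y)"
      "\<exists>e. e * e = 1 \<and> (\<forall>x y. sextic 1 y (- x) = e * sextic 2 x y)"
      "\<exists>e. e * e = 1 \<and> (\<forall>x y. sextic 2 y (- x) = e * sextic 1 x y)"
      "\<exists>e. e * e = 1 \<and> (\<forall>x y. sextic 3 y (- x) = e * sextic 6 x y)"
      "\<exists>e. e * e = 1 \<and> (\<forall>x y. sextic 4 y (- x) = e * sextic 4 x y)"
      "\<exists>e. e * e = 1 \<and> (\<forall>x y. sextic 5 y (- x) = e * sextic 5 x y)"
      "\<exists>e. e * e = 1 \<and> (\<forall>x y. sextic 6 y (- x) = e * sextic 3 x y)"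
      apply (rule exI[of _ "- 1"], use s in simp)
      apply (rule exI[of _ "1"], use s in simp)
      apply (rule exI[of _ "1"], use s in simp)
      apply (rule exI[of _ "- 1"], use s in simp)
      apply (rule exI[of _ "1"], use s in simp)
      apply (rule exI[of _ "- 1"], use s in simp)
      apply (rule exI[of _ "- 1"], use s in simp)
      done
    ultimately show ?thesis by (auto simp: sl7_def)
  qed
  moreover have "sl7 ! i < 7" if "i < 7" for i
  proof -
    have "i \<in> {0,1,2,3,4,5,6}" using that by auto
    thus ?thesis by (auto simp: sl7_def)
  qed
  ultimately show ?thesis unfolding acts_def mt2_eq by (auto simp: sl7_def)
qed

lemma sq7: "(a::7) \<noteq> 0 \<Longrightarrow> \<exists>k\<in>set [1,2,4]. of_nat k = a * a"
proof -
  have "(\<forall>a::7. a \<noteq> 0 \<longrightarrow> (\<exists>k\<in>set [1,2,4]. of_nat k = a * a))" unfolding all7 by simp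
  thus "a \<noteq> 0 \<Longrightarrow> ?thesis" by blast
qed

lemma inv7: "(a::7) \<noteq> 0 \<Longrightarrow> \<exists>b. a * b = 1"
  by (rule exI[of _ "a ^ 5"]) (use pow6[of a] in \<open>simp add: numeral_eq_Suc\<close>)

lemma nz7: "(a::7) * b = 0 \<longleftrightarrow> a = 0 \<or> b = 0"
proof (cases "a = 0")
  case False
  then obtain c where c: "a * c = 1" using inv7 by blast
  have "b = c * (a * b)" using c by (metis mult.assoc mult.commute mult_1)
  thus ?thesis using False by auto
qed simp

text \<open>This is the Bruhat decomposition of \<open>SL\<^sub>2\<close>.\<close>

lemma SL_cases:
  assumes "a * d - b * c = (1::7)"
  obtains (upper) k x where "k \<in> set [1,2,4]" "x < 7" "c = 0" "of_nat k = a * a" "of_nat x = a * b"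
      "acts (mt2 a b c d) (cmp (tl7 x) (ml7 k))"
  | (big) k x y where "k \<in> set [1,2,4]" "x < 7" "y < 7" "acts (mt2 a b c d) (cmp (tl7 x) (cmp sl7 (cmp (ml7 k) (tl7 y))))"
proof (cases "c = 0")
  case True
  hence ad: "a * d = 1" using assms by simp
  hence a0: "a \<noteq> 0" by auto
  obtain k where k: "k \<in> set [1,2,4]" "of_nat k = a * a" using sq7[OF a0] by blast
  obtain x where x: "x < 7" "a * b = of_nat x" using ex_nat7 by metis
  have "acts (mt2 1 (of_nat x) 0 1 ** mt2 a 0 0 d) (cmp (tl7 x) (ml7 k))"
    by (intro acts_mult acts_T acts_D ad k)
  also have "mt2 1 (of_nat x) 0 1 ** mt2 a 0 0 d = mt2 a b c d"
  proof -
    have "a * b * d = b" using ad by (metis mult.assoc mult.commute mult_1)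
    thus ?thesis unfolding mt2_mult mt2_eq x(2)[symmetric] using ad True by simp
  qed
  finally show thesis using upper k x True by metis
next
  case False
  obtain c' where c': "c * c' = 1" using inv7[OF False] by blast
  obtain k where k: "k \<in> set [1,2,4]" "of_nat k = c * c" using sq7[OF False] by blast
  \<comment> \<open>For nonzero \<open>c\<close> the matrix is the translation by
    \<open>a / c\<close>, times the element for \<open>sl7\<close>, times the diagonal matrix of
    \<open>c\<close>, times the translation by \<open>d / c\<close>.\<close>
  obtain x where x: "x < 7" "a * c' = of_nat x" using ex_nat7 by metis
  obtain y where y: "y < 7" "d * c' = of_nat y" using ex_nat7 by metis
  have "acts (mt2 1 (of_nat x) 0 1 ** (mt2 0 (- 1) 1 0 ** (mt2 c 0 0 c' ** mt2 1 (of_nat y) 0 1)))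
      (cmp (tl7 x) (cmp sl7 (cmp (ml7 k) (tl7 y))))"
    by (intro acts_mult acts_T acts_D acts_S c' k)
  also have "mt2 1 (of_nat x) 0 1 ** (mt2 0 (- 1) 1 0 ** (mt2 c 0 0 c' ** mt2 1 (of_nat y) 0 1)) = mt2 a b c d"
  proof -
    have 1: "a * c' * c = a" "c * (d * c') = d" using c' by (metis mult.assoc mult.commute mult.right_neutral)+
    have "a * c' * (c * (d * c')) - c' = c' * (a * d - 1)" using 1 by (simp add: algebra_simps)
    also have "a * d - 1 = b * c" using assms by (simp add: algebra_simps)
    also have "c' * (b * c) = b" using c' by (metis mult.assoc mult.commute mult.right_neutral)
    finally show ?thesis unfolding mt2_mult mt2_eq x(2)[symmetric] y(2)[symmetric] using 1 by simp
  qed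
  finally show thesis using big k x y by metis
qed

lemma acts_ex: assumes "a * d - b * c = (1::7)" shows "\<exists>l\<in>set nforms. acts (mt2 a b c d) l"
  using assms
proof (cases rule: SL_cases)
  case (upper k x)
  moreover have "cmp (tl7 x) (ml7 k) \<in> set nforms" unfolding nforms_def using upper by force
  ultimately show ?thesis by blast
next
  case (big k x y)
  moreover have "cmp (tl7 x) (cmp sl7 (cmp (ml7 k) (tl7 y))) \<in> set nforms" unfolding nforms_def using big by force
  ultimately show ?thesis by blast
qed

lemma nforms_acts: assumes "l \<in> set nforms" shows "\<exists>a b c d. a * d - b * c = (1::7) \<and> acts (mt2 a b c d) l"
proof -
  have sq: "\<exists>a b. a * b = 1 \<and> of_nat k = a * (a::7)" if "k \<in> set [1,2,4]" for k :: nat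
  proof -
    have "k \<in> {1,2,4}" using that by simp
    moreover have "(1::7) * 1 = 1 \<and> of_nat 1 = (1::7) * 1" "(3::7) * 5 = 1 \<and> of_nat 2 = (3::7) * 3"
      "(2::7) * 4 = 1 \<and> of_nat 4 = (2::7) * 2" by simp_all
    ultimately show ?thesis by (elim insertE emptyE) blast+
  qed
  from assms consider k x where "k \<in> set [1,2,4]" "l = cmp (tl7 x) (ml7 k)"
    | k x y where "k \<in> set [1,2,4]" "l = cmp (tl7 x) (cmp sl7 (cmp (ml7 k) (tl7 y)))"
  proof -
    from assms obtain x k where xk: "k \<in> set [1,2,4]" "l \<in> set (cmp (tl7 x) (ml7 k) #
       map (\<lambda>y. cmp (tl7 x) (cmp sl7 (cmp (ml7 k) (tl7 y)))) [0..<7])"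
      unfolding nforms_def by (auto simp only: set_concat set_map image_image UN_iff)
    hence "l = cmp (tl7 x) (ml7 k) \<or> (\<exists>y. l = cmp (tl7 x) (cmp sl7 (cmp (ml7 k) (tl7 y))))" by auto
    thus thesis using xk(1) that by blast
  qed
  thus ?thesis
  proof cases
    case 1
    then obtain a b :: 7 where ab: "a * b = 1" "of_nat k = a * a" using sq by blast
    have "acts (mt2 1 (of_nat x) 0 1 ** mt2 a 0 0 b) l" unfolding 1 by (intro acts_mult acts_T acts_D ab)
    moreover have "Determinants.det (mt2 1 (of_nat x) 0 1 ** mt2 a 0 0 b) = 1"
      unfolding Determinants.det_mul mt2_det using ab by simp
    ultimately show ?thesis using mt2_det mt2_eta by metis
  next
    case 2
    then obtain a b :: 7 where ab: "a * b = 1" "of_nat k = a * a" using sq by blast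
    have "acts (mt2 1 (of_nat x) 0 1 ** (mt2 0 (- 1) 1 0 ** (mt2 a 0 0 b ** mt2 1 (of_nat y) 0 1))) l"
      unfolding 2 by (intro acts_mult acts_T acts_D acts_S ab)
    moreover have "Determinants.det (mt2 1 (of_nat x) 0 1 ** (mt2 0 (- 1) 1 0 ** (mt2 a 0 0 b ** mt2 1 (of_nat y) 0 1))) = 1"
      unfolding Determinants.det_mul mt2_det using ab by simp
    ultimately show ?thesis using mt2_det mt2_eta by metis
  qed
qed

lemma nforms_id:
  "\<forall>x\<in>set [0..<7]. \<forall>k\<in>set [1,2,4]. cmp (tl7 x) (ml7 k) = id7 \<longrightarrow> x = 0 \<and> k = 1"
  "\<forall>x\<in>set [0..<7]. \<forall>k\<in>set [1,2,4]. \<forall>y\<in>set [0..<7]. cmp (tl7 x) (cmp sl7 (cmp (ml7 k) (tl7 y))) \<noteq> id7"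
  by code_simp+

lemma acts_one: "acts (mt2 1 0 0 1) id7"
proof -
  have "tl7 0 = id7" by code_simp
  thus ?thesis using acts_T[of 0] by simp
qed

text \<open>Among the normal forms only the upper one with \<open>x = 0\<close> and
  \<open>k = 1\<close> is the identity. This means \<open>c = 0\<close>, \<open>a * b = 0\<close>
  and \<open>a * a = 1\<close>, so the matrix is 1 or -1.\<close>

lemma acts_kernel:
  assumes "a * d - b * c = (1::7)" "acts (mt2 a b c d) id7"
  shows "b = 0 \<and> c = 0 \<and> a = d"
  using assms(1)
proof (cases rule: SL_cases)
  case (upper k x)
  hence "cmp (tl7 x) (ml7 k) = id7" using acts_unique assms(2) by blast
  moreover have "x \<in> set [0..<7]" using upper(2) by simp
  ultimately have "x = 0 \<and> k = 1" using nforms_id(1) upper(1) by blast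
  hence 1: "a * a = 1" "a * b = 0" using upper by auto
  have "a \<noteq> 0" using 1 by auto
  hence "b = 0" using 1 nz7 by blast
  moreover have "a * d = 1" using assms upper by simp
  hence "a * (a * d) = a" by simp
  hence "a = d" using 1 by (metis mult.assoc mult_1)
  ultimately show ?thesis using upper by simp
next
  case (big k x y)
  hence "cmp (tl7 x) (cmp sl7 (cmp (ml7 k) (tl7 y))) = id7" using acts_unique assms(2) by blast
  moreover have "x \<in> set [0..<7]" "y \<in> set [0..<7]" using big by simp_all
  ultimately show ?thesis using nforms_id(2) big(1) by blast
qed

section \<open>The centre of \<open>SL\<close> and a criterion for being isomorphic to
  \<open>PSL_2_7\<close>\<close>

lemma SL_mem: "mt2 a b c d \<in> carrier SL \<longleftrightarrow> a * d - b * c = 1"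
  by (simp add: SL_def mt2_det)

lemma SL_group: "group (SL :: (7^2^2) monoid)"
proof (rule groupI)
  fix A B :: "7^2^2" assume "A \<in> carrier SL" "B \<in> carrier SL"
  thus "A \<otimes>\<^bsub>SL\<^esub> B \<in> carrier SL" by (simp add: SL_def Determinants.det_mul)
next
  fix A :: "7^2^2" assume A: "A \<in> carrier SL"
  obtain a b c d where e: "A = mt2 a b c d" using mt2_eta by blast
  have "mt2 d (- b) (- c) a ** A = mt2 1 0 0 1"
    using A unfolding e SL_mem mt2_mult mt2_eq by (auto simp: algebra_simps)
  moreover have "mt2 d (- b) (- c) a \<in> carrier SL" using A unfolding e SL_mem by (simp add: algebra_simps)
  ultimately show "\<exists>B\<in>carrier SL. B \<otimes>\<^bsub>SL\<^esub> A = \<one>\<^bsub>SL\<^esub>" by (auto simp: SL_def mt2_one)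
qed (auto simp: SL_def matrix_mul_assoc matrix_mul_lid Determinants.det_I)

text \<open>Commuting with \<open>mt2 1 1 0 1\<close> gives \<open>c = 0\<close> and
  \<open>a = d\<close>, and commuting with \<open>mt2 0 (-1) 1 0\<close> gives
  \<open>b = 0\<close>.\<close>

lemma SL_center: "mt2 a b c d \<in> group_center SL \<longleftrightarrow> a * d - b * c = 1 \<and> b = 0 \<and> c = 0 \<and> a = d"
proof
  assume z: "mt2 a b c d \<in> group_center SL"
  hence 1: "a * d - b * c = 1" by (simp add: group_center_def SL_mem)
  have "mt2 1 1 0 1 \<in> carrier SL" "mt2 0 (-1) 1 0 \<in> carrier SL" by (simp_all add: SL_mem)
  hence "mt2 a b c d ** mt2 1 1 0 1 = mt2 1 1 0 1 ** mt2 a b c d"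
    "mt2 a b c d ** mt2 0 (-1) 1 0 = mt2 0 (-1) 1 0 ** mt2 a b c d"
    using z by (auto simp: group_center_def SL_def)
  thus "a * d - b * c = 1 \<and> b = 0 \<and> c = 0 \<and> a = d" using 1 unfolding mt2_mult mt2_eq by auto
next
  assume a: "a * d - b * c = 1 \<and> b = 0 \<and> c = 0 \<and> a = d"
  have "mt2 a b c d ** B = B ** mt2 a b c d" for B
  proof -
    obtain x y z w where B: "B = mt2 x y z w" using mt2_eta by blast
    show ?thesis unfolding B mt2_mult mt2_eq using a by (simp add: mult.commute)
  qed
  thus "mt2 a b c d \<in> group_center SL" using a by (auto simp: group_center_def SL_mem) (simp add: SL_def)
qed

text \<open>Sending a matrix to the element of \<open>G\<close> labelled by the permutation it
  induces on the forms is a surjection from \<open>SL\<close> whose kernel is the centre. A group of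
  permutations of seven things is thus recognised by its list of elements.\<close>

theorem iso_PSL_2_7:
  assumes G: "group G" and inj: "inj_on L (carrier G)" and im: "L ` carrier G = set nforms"
    and hom: "\<And>x y. x \<in> carrier G \<Longrightarrow> y \<in> carrier G \<Longrightarrow> L (x \<otimes>\<^bsub>G\<^esub> y) = cmp (L x) (L y)"
  shows "G \<cong> PSL_2_7"
proof -
  interpret G: group G by fact
  interpret S: group "SL :: (7^2^2) monoid" by (rule SL_group)
  have ex: "\<exists>g\<in>carrier G. acts A (L g)" if A: "A \<in> carrier SL" for A
  proof -
    obtain a b c d where e: "A = mt2 a b c d" using mt2_eta by blast
    thus ?thesis using acts_ex[of a d b c] A im by (auto simp: SL_mem) (metis image_iff)
  qed
  define h where "h A = (SOME g. g \<in> carrier G \<and> acts A (L g))" for A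
  have h: "h A \<in> carrier G" "acts A (L (h A))" if "A \<in> carrier SL" for A
    using someI_ex[of "\<lambda>g. g \<in> carrier G \<and> acts A (L g)"] ex[OF that] unfolding h_def by blast+
  have hu: "h A = g" if "A \<in> carrier SL" "g \<in> carrier G" "acts A (L g)" for A g
    using acts_unique[OF h(2)[OF that(1)] that(3)] inj h(1)[OF that(1)] that(2) by (auto dest: inj_onD)
  have mult: "A \<otimes>\<^bsub>SL\<^esub> B = A ** B" for A B :: "7^2^2" by (simp add: SL_def)
  have "h \<in> hom SL G"
  proof (rule homI)
    fix A B :: "7^2^2" assume AB: "A \<in> carrier SL" "B \<in> carrier SL"
    show "h (A \<otimes>\<^bsub>SL\<^esub> B) = h A \<otimes>\<^bsub>G\<^esub> h B"
    proof (rule hu)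
      show "A \<otimes>\<^bsub>SL\<^esub> B \<in> carrier SL" using AB by simp
      show "h A \<otimes>\<^bsub>G\<^esub> h B \<in> carrier G" using AB h by simp
      show "acts (A \<otimes>\<^bsub>SL\<^esub> B) (L (h A \<otimes>\<^bsub>G\<^esub> h B))"
        using acts_mult[OF h(2)[OF AB(1)] h(2)[OF AB(2)]] AB h(1) by (simp add: mult hom)
    qed
  qed (use h in auto)
  then interpret H: group_hom "SL :: (7^2^2) monoid" G h by unfold_locales
  have surj: "h ` carrier SL = carrier G"
  proof
    show "carrier G \<subseteq> h ` carrier SL"
    proof
      fix g assume g: "g \<in> carrier G"
      hence "L g \<in> set nforms" using im by blast
      then obtain a b c d :: 7 where m: "a * d - b * c = 1" "acts (mt2 a b c d) (L g)" using nforms_acts by blast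
      have "h (mt2 a b c d) = g" by (rule hu) (use m g in \<open>simp_all add: SL_mem\<close>)
      thus "g \<in> h ` carrier SL" using m SL_mem by blast
    qed
  qed (use h in auto)
  have one: "L \<one>\<^bsub>G\<^esub> = id7"
  proof -
    have "mt2 1 0 0 1 \<in> carrier SL" by (simp add: SL_mem)
    moreover have "h (mt2 1 0 0 1) = \<one>\<^bsub>G\<^esub>" using H.hom_one by (simp add: SL_def mt2_one)
    ultimately show ?thesis using h(2)[of "mt2 1 0 0 1"] acts_unique acts_one by metis
  qed
  have "kernel SL G h = group_center SL"
  proof (rule Set.set_eqI)
    fix A :: "7^2^2"
    obtain a b c d where e: "A = mt2 a b c d" using mt2_eta by blast
    show "A \<in> kernel SL G h \<longleftrightarrow> A \<in> group_center SL"
    proof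
      assume k: "A \<in> kernel SL G h"
      hence k': "A \<in> carrier SL" "h A = \<one>\<^bsub>G\<^esub>" by (auto simp: kernel_def)
      have "acts A id7" using h(2)[OF k'(1)] k'(2) one by simp
      moreover have "a * d - b * c = 1" using k'(1) e by (simp add: SL_mem)
      ultimately show "A \<in> group_center SL" using acts_kernel[of a d b c] e unfolding e SL_center by simp
    next
      assume z: "A \<in> group_center SL"
      hence "a * a = 1" "A = mt2 a 0 0 a" unfolding e SL_center by auto
      hence "acts A (ml7 1)" using acts_D[of a a 1] by simp
      moreover have "ml7 1 = id7" by code_simp
      ultimately have "acts A id7" by simp
      moreover have "A \<in> carrier SL" using z by (simp add: group_center_def)
      ultimately show "A \<in> kernel SL G h" using hu[of A "\<one>\<^bsub>G\<^esub>"] one by (simp add: kernel_def)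
    qed
  qed
  hence "PSL_2_7 \<cong> G" using H.FactGroup_iso[OF surj] by (simp add: PSL_def)
  moreover have "group PSL_2_7" unfolding PSL_def using H.normal_kernel \<open>kernel SL G h = group_center SL\<close>
    by (metis normal.factorgroup_is_group)
  ultimately show ?thesis by (rule group.iso_sym[rotated])
qed

section \<open>The Fano plane\<close>

definition perm7 :: "nat list \<Rightarrow> bool" where
  "perm7 l \<longleftrightarrow> length l = 7 \<and> distinct l \<and> set l \<subseteq> {..<7}"

text \<open>The translates of a subset of \<open>\<int>/7\<close>; for a difference set such as \<open>[0, 1, 3]\<close> they are the lines of a Fano plane.\<close>

definition fam :: "nat list \<Rightarrow> nat list list" where
  "fam S = map (\<lambda>j. map (\<lambda>s. (s + j) mod 7) S) [0..<7]"

text \<open>The executable counterpart of \<open>spres\<close>, for the exhaustive checks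
  \<open>fano_brute1\<close> and \<open>fano_brute2\<close>.\<close>

definition pres :: "nat list list \<Rightarrow> nat list \<Rightarrow> bool" where
  "pres FL l \<longleftrightarrow> list_all (\<lambda>F. list_ex (\<lambda>G. list_all (\<lambda>x. l ! x \<in> set G) F) FL) FL"

definition neg7 :: "nat list" where "neg7 = [0,6,5,4,3,2,1]"

definition swp :: "nat \<Rightarrow> nat \<Rightarrow> nat list" where "swp a b = id7[a := b, b := a]"

text \<open>The third point on the line through \<open>a\<close> and \<open>b\<close> in the plane
  of \<open>[0, 1, 3]\<close>. The table is indexed by the difference modulo 7; its entry 0 belongs
  to \<open>a = b\<close>, where there is no such line.\<close>

definition third :: "nat \<Rightarrow> nat \<Rightarrow> nat" where
  "third a b = (a + [0,3,6,1,5,4,2] ! ((b + 7 - a) mod 7)) mod 7"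

definition mk7 :: "nat \<Rightarrow> nat \<Rightarrow> nat \<Rightarrow> nat list" where
  "mk7 a b e = [a, b, e, third a b, third b e, third e (third a b), third (third a b) (third b e)]"

text \<open>Words in the \<open>7\<close>-cycle (\<open>True\<close>) and the involution \<open>d\<close> (\<open>False\<close>); an entry \<open>(d, v, v')\<close> of the table below
  expresses \<open>sl7\<close> by \<open>v\<close> and \<open>ml7 2\<close> by \<open>v'\<close>.\<close>

primrec wev :: "nat list \<Rightarrow> bool list \<Rightarrow> nat list" where
  "wev d [] = id7" | "wev d (x # w) = cmp (if x then tl7 1 else d) (wev d w)"

definition word_table :: "(nat list \<times> bool list \<times> bool list) list" where
  "word_table = [
    ([0, 1, 4, 3, 2, 6, 5], [True,False,True,True,True,True,False,True], [True,False,True,True,True,True,False,True,False]),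
    ([0, 1, 5, 3, 6, 2, 4], [False,True,True,False,True,True], [True,False,True,False,True,True,False,True]),
    ([0, 1, 6, 3, 5, 4, 2], [True,True,True,True,False,True,True,True], [False,True,True,False,True,True,True,True,False]),
    ([0, 2, 1, 6, 4, 5, 3], [False], [False,True,True,False,True,True,True,True,False,True,True]),
    ([0, 3, 2, 1, 5, 4, 6], [True,True,False,True,True,True,True,False], [False,True,True,True,True,False,True,False]),
    ([0, 3, 6, 1, 4, 5, 2], [False,True,False,True,False,True,True,True], [False,True,False,True,True,False]),
    ([0, 4, 2, 5, 1, 3, 6], [True,False,True,True,False,True], [False,True,False,True,True,False,True]),
    ([0, 5, 2, 4, 3, 1, 6], [True,True,True,True,True,False,True,True], [False,True,True,False,True,True,True,True,False,True,True,True]),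
    ([0, 6, 3, 2, 4, 5, 1], [True,True,False,True,True,True,False,True,True,True], [False,True,True,True,False,True,False,True,True,False]),
    ([1, 0, 2, 3, 6, 5, 4], [True,True,True,True,False,True,True,True,False,True], [True,False,True,True,True,True,False,True,False,True]),
    ([1, 0, 5, 3, 4, 2, 6], [True,True,False,True,False], [True,False,True,True,False,True,True,True,True,False,True]),
    ([2, 1, 0, 4, 3, 5, 6], [True,False,True,True,True,False,True,True,True,True], [False,True,True,True,True,False,True,False,True,True,True]),
    ([2, 5, 0, 3, 4, 1, 6], [True,False,True,False,True,False,True,True], [False,True,False,True,True,False,True,True,True]),
    ([3, 1, 2, 0, 4, 6, 5], [True,True,True,False,True,True,True,True], [True,False,True,True,False,True,True,True,True,False]),
    ([3, 1, 4, 0, 2, 5, 6], [True,True,False,True,True,False], [True,False,True,False,True,True,False]),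
    ([4, 1, 3, 2, 0, 5, 6], [False,True,False,True,True], [False,True,True,True,False,True,True,False,True,True,False]),
    ([4, 6, 2, 3, 0, 5, 1], [True,True,False,True,False,True,False,True], [True,False,True,False,True,True,False,True,True]),
    ([5, 1, 2, 6, 4, 0, 3], [False,True,True,True,False,True,False,True], [False,True,False,True,True,False,True,True]),
    ([5, 2, 1, 3, 4, 0, 6], [True,True,True,False,True,True,True,False,True,True], [False,True,True,True,True,False,True,False,True,True]),
    ([6, 1, 2, 5, 4, 3, 0], [False,True,True,True,True,False,True,True], [False,True,True,True,True,False,True,False,True]),
    ([6, 4, 2, 3, 1, 5, 0], [True,True,False,True,True,True,True,True], [False,True,True,False,True,True,True,True,False,True])]"

text \<open>The 168 entries of \<open>nforms\<close> in evaluated form, which keeps the later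
  exhaustive checks cheap.\<close>

definition nf_lits :: "nat list list" where
  "nf_lits = [[0,1,2,3,4,5,6],
    [0,2,1,6,4,5,3],
    [2,1,6,4,5,3,0],
    [1,6,4,5,3,0,2],
    [6,4,5,3,0,2,1],
    [4,5,3,0,2,1,6],
    [5,3,0,2,1,6,4],
    [3,0,2,1,6,4,5],
    [0,2,4,6,1,3,5],
    [0,1,4,3,2,6,5],
    [1,4,3,2,6,5,0],
    [4,3,2,6,5,0,1],
    [3,2,6,5,0,1,4],
    [2,6,5,0,1,4,3],
    [6,5,0,1,4,3,2],
    [5,0,1,4,3,2,6],
    [0,4,1,5,2,6,3],
    [0,4,2,5,1,3,6],
    [4,2,5,1,3,6,0],
    [2,5,1,3,6,0,4],
    [5,1,3,6,0,4,2],
    [1,3,6,0,4,2,5],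
    [3,6,0,4,2,5,1],
    [6,0,4,2,5,1,3],
    [1,2,3,4,5,6,0],
    [1,3,2,0,5,6,4],
    [3,2,0,5,6,4,1],
    [2,0,5,6,4,1,3],
    [0,5,6,4,1,3,2],
    [5,6,4,1,3,2,0],
    [6,4,1,3,2,0,5],
    [4,1,3,2,0,5,6],
    [1,3,5,0,2,4,6],
    [1,2,5,4,3,0,6],
    [2,5,4,3,0,6,1],
    [5,4,3,0,6,1,2],
    [4,3,0,6,1,2,5],
    [3,0,6,1,2,5,4],
    [0,6,1,2,5,4,3],
    [6,1,2,5,4,3,0],
    [1,5,2,6,3,0,4],
    [1,5,3,6,2,4,0],
    [5,3,6,2,4,0,1],
    [3,6,2,4,0,1,5],
    [6,2,4,0,1,5,3],
    [2,4,0,1,5,3,6],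
    [4,0,1,5,3,6,2],
    [0,1,5,3,6,2,4],
    [2,3,4,5,6,0,1],
    [2,4,3,1,6,0,5],
    [4,3,1,6,0,5,2],
    [3,1,6,0,5,2,4],
    [1,6,0,5,2,4,3],
    [6,0,5,2,4,3,1],
    [0,5,2,4,3,1,6],
    [5,2,4,3,1,6,0],
    [2,4,6,1,3,5,0],
    [2,3,6,5,4,1,0],
    [3,6,5,4,1,0,2],
    [6,5,4,1,0,2,3],
    [5,4,1,0,2,3,6],
    [4,1,0,2,3,6,5],
    [1,0,2,3,6,5,4],
    [0,2,3,6,5,4,1],
    [2,6,3,0,4,1,5],
    [2,6,4,0,3,5,1],
    [6,4,0,3,5,1,2],
    [4,0,3,5,1,2,6],
    [0,3,5,1,2,6,4],
    [3,5,1,2,6,4,0],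
    [5,1,2,6,4,0,3],
    [1,2,6,4,0,3,5],
    [3,4,5,6,0,1,2],
    [3,5,4,2,0,1,6],
    [5,4,2,0,1,6,3],
    [4,2,0,1,6,3,5],
    [2,0,1,6,3,5,4],
    [0,1,6,3,5,4,2],
    [1,6,3,5,4,2,0],
    [6,3,5,4,2,0,1],
    [3,5,0,2,4,6,1],
    [3,4,0,6,5,2,1],
    [4,0,6,5,2,1,3],
    [0,6,5,2,1,3,4],
    [6,5,2,1,3,4,0],
    [5,2,1,3,4,0,6],
    [2,1,3,4,0,6,5],
    [1,3,4,0,6,5,2],
    [3,0,4,1,5,2,6],
    [3,0,5,1,4,6,2],
    [0,5,1,4,6,2,3],
    [5,1,4,6,2,3,0],
    [1,4,6,2,3,0,5],
    [4,6,2,3,0,5,1],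
    [6,2,3,0,5,1,4],
    [2,3,0,5,1,4,6],
    [4,5,6,0,1,2,3],
    [4,6,5,3,1,2,0],
    [6,5,3,1,2,0,4],
    [5,3,1,2,0,4,6],
    [3,1,2,0,4,6,5],
    [1,2,0,4,6,5,3],
    [2,0,4,6,5,3,1],
    [0,4,6,5,3,1,2],
    [4,6,1,3,5,0,2],
    [4,5,1,0,6,3,2],
    [5,1,0,6,3,2,4],
    [1,0,6,3,2,4,5],
    [0,6,3,2,4,5,1],
    [6,3,2,4,5,1,0],
    [3,2,4,5,1,0,6],
    [2,4,5,1,0,6,3],
    [4,1,5,2,6,3,0],
    [4,1,6,2,5,0,3],
    [1,6,2,5,0,3,4],
    [6,2,5,0,3,4,1],
    [2,5,0,3,4,1,6],
    [5,0,3,4,1,6,2],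
    [0,3,4,1,6,2,5],
    [3,4,1,6,2,5,0],
    [5,6,0,1,2,3,4],
    [5,0,6,4,2,3,1],
    [0,6,4,2,3,1,5],
    [6,4,2,3,1,5,0],
    [4,2,3,1,5,0,6],
    [2,3,1,5,0,6,4],
    [3,1,5,0,6,4,2],
    [1,5,0,6,4,2,3],
    [5,0,2,4,6,1,3],
    [5,6,2,1,0,4,3],
    [6,2,1,0,4,3,5],
    [2,1,0,4,3,5,6],
    [1,0,4,3,5,6,2],
    [0,4,3,5,6,2,1],
    [4,3,5,6,2,1,0],
    [3,5,6,2,1,0,4],
    [5,2,6,3,0,4,1],
    [5,2,0,3,6,1,4],
    [2,0,3,6,1,4,5],
    [0,3,6,1,4,5,2],
    [3,6,1,4,5,2,0],
    [6,1,4,5,2,0,3],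
    [1,4,5,2,0,3,6],
    [4,5,2,0,3,6,1],
    [6,0,1,2,3,4,5],
    [6,1,0,5,3,4,2],
    [1,0,5,3,4,2,6],
    [0,5,3,4,2,6,1],
    [5,3,4,2,6,1,0],
    [3,4,2,6,1,0,5],
    [4,2,6,1,0,5,3],
    [2,6,1,0,5,3,4],
    [6,1,3,5,0,2,4],
    [6,0,3,2,1,5,4],
    [0,3,2,1,5,4,6],
    [3,2,1,5,4,6,0],
    [2,1,5,4,6,0,3],
    [1,5,4,6,0,3,2],
    [5,4,6,0,3,2,1],
    [4,6,0,3,2,1,5],
    [6,3,0,4,1,5,2],
    [6,3,1,4,0,2,5],
    [3,1,4,0,2,5,6],
    [1,4,0,2,5,6,3],
    [4,0,2,5,6,3,1],
    [0,2,5,6,3,1,4],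
    [2,5,6,3,1,4,0],
    [5,6,3,1,4,0,2]]"

section \<open>Finite checks by evaluation\<close>

lemma fam_lits: "fam [0,1,2] = [[0,1,2],[1,2,3],[2,3,4],[3,4,5],[4,5,6],[5,6,0],[6,0,1]]" "fam [0,2,4] =
    [[0,2,4],[1,3,5],[2,4,6],[3,5,0],[4,6,1],[5,0,2],[6,1,3]]" "fam [0,3,6] = [[0,3,6],[1,4,0],[2,5,1],[3,6,2],[4,0,3],[5,1,4],[6,2,5]]"
  "fam [0,1,3] = [[0,1,3],[1,2,4],[2,3,5],[3,4,6],[4,5,0],[5,6,1],[6,0,2]]" "fam [0,2,3] = [[0,2,3],[1,3,4],[2,4,5],[3,5,6],[4,6,0],[5,0,1],[6,1,2]]"
  by code_simp+

lemma third_unique: "\<forall>F\<in>set (fam [0,1,3]). \<forall>x\<in>set F. \<forall>y\<in>set F. \<forall>z\<in>set F.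
   x \<noteq> y \<longrightarrow> x \<noteq> z \<longrightarrow> y \<noteq> z \<longrightarrow> z = third x y"
  unfolding fam_lits by code_simp

lemma nforms_lits: "nforms = nf_lits"
  by code_simp

text \<open>The value \<open>y = 7\<close> marks the upper triangular normal forms, which have no
  second translation.\<close>

definition nf7 :: "nat \<times> nat \<times> nat \<Rightarrow> nat list" where
  "nf7 = (\<lambda>(x, k, y). if y = 7 then cmp (tl7 x) (ml7 k) else cmp (tl7 x) (cmp sl7 (cmp (ml7 k) (tl7 y))))"

text \<open>Normal forms for the 7 * 6 * 4 = 168 permutations \<open>mk7 a b e\<close> with
  noncollinear \<open>a\<close>, \<open>b\<close>, \<open>e\<close>, in the order in which
  \<open>mk7_table\<close> enumerates them.\<close>

definition nf_table :: "(nat \<times> nat \<times> nat) list" where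
  "nf_table = [(0,1,7),(0,2,0),(1,4,6),(3,1,4),(0,1,0),(2,2,6),(0,2,7),(6,4,4),(6,2,1),(4,4,5),(2,4,3),(5,4,2),(0,4,7),(0,4,0),(5,2,4),(4,1,6),(3,4,
      1),(2,1,5),(6,1,2),(1,1,3),(1,2,5),(4,2,3),(5,1,1),(3,2,2),(2,2,5),(5,2,3),(6,1,1),(4,2,2),(4,1,4),(1,1,7),(1,2,0),(2,4,6),(1,1,0),(3,2,6),(1,2,
      7),(0,4,4),(6,4,2),(0,2,1),(5,4,5),(3,4,3),(5,1,6),(1,4,7),(1,4,0),(6,2,4),(2,1,3),(4,4,1),(3,1,5),(0,1,2),(3,1,3),(5,4,1),(4,1,5),(1,1,2),(5,2,
      2),(3,2,5),(6,2,3),(0,1,1),(3,4,6),(5,1,4),(2,1,7),(2,2,0),(1,4,4),(2,1,0),(4,2,6),(2,2,7),(4,4,3),(0,4,2),(1,2,1),(6,4,5),(6,1,6),(2,4,7),(2,4,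
      0),(0,2,4),(0,1,6),(3,4,7),(3,4,0),(1,2,4),(4,1,3),(6,4,1),(5,1,5),(2,1,2),(1,1,1),(6,2,2),(4,2,5),(0,2,3),(3,2,0),(4,4,6),(6,1,4),(3,1,7),(3,2,
      7),(2,4,4),(3,1,0),(5,2,6),(0,4,5),(5,4,3),(1,4,2),(2,2,1),(1,4,5),(6,4,3),(2,4,2),(3,2,1),(2,2,4),(1,1,6),(4,4,7),(4,4,0),(3,1,2),(5,1,3),(0,4,
      1),(6,1,5),(1,2,3),(2,1,1),(0,2,2),(5,2,5),(4,2,0),(5,4,6),(0,1,4),(4,1,7),(6,2,6),(4,2,7),(3,4,4),(4,1,0),(0,2,6),(5,2,7),(4,4,4),(5,1,0),(4,2,
      1),(2,4,5),(0,4,3),(3,4,2),(5,4,0),(3,2,4),(2,1,6),(5,4,7),(0,1,5),(4,1,2),(6,1,3),(1,4,1),(2,2,3),(3,1,1),(1,2,2),(6,2,5),(5,1,7),(5,2,0),(6,4,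
      6),(1,1,4),(6,1,7),(6,2,0),(0,4,6),(2,1,4),(6,1,0),(1,2,6),(6,2,7),(5,4,4),(5,2,1),(3,4,5),(1,4,3),(4,4,2),(6,4,7),(6,4,0),(4,2,4),(3,1,6),(2,4,
      1),(1,1,5),(5,1,2),(0,1,3),(0,2,5),(3,2,3),(4,1,1),(2,2,2)]"

lemma nf_table_ok: "list_all (\<lambda>(x, k, y). x < 7 \<and> k \<in> set [1,2,4] \<and> y \<le> 7) nf_table"
  by code_simp

lemma mk7_table: "[mk7 a b e. a \<leftarrow> [0..<7], b \<leftarrow> [0..<7], a \<noteq> b, e \<leftarrow> [0..<7], e \<noteq> a \<and> e \<noteq> b \<and> e \<noteq> third a b]
    = map nf7 nf_table"
  by code_simp

lemma word_table_ok1: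
  "\<forall>d\<in>set nf_lits. cmp d d = id7 \<longrightarrow> d \<noteq> id7 \<longrightarrow> d \<in> set (map fst word_table)"
  by code_simp

lemma word_table_ok2:
  "\<forall>(d, w, w')\<in>set word_table. wev d w = sl7 \<and> wev d w' = ml7 2"
  by code_simp

lemma fam_reps: "\<forall>S\<in>set [[x,y,z]. x \<leftarrow> [0..<7], y \<leftarrow> [Suc x..<7], z \<leftarrow> [Suc y..<7]].
   \<exists>R\<in>set [[0,1,3],[0,2,3],[0,1,2],[0,2,4],[0,3,6]]. list_all (\<lambda>F. list_ex (\<lambda>G. set F = set G) (fam R)) (fam S) \<and>
     list_all (\<lambda>F. list_ex (\<lambda>G. set F = set G) (fam S)) (fam R)"
  by code_simp

text \<open>The translation classes that are not difference sets are the arithmetic progressions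
  with difference 1, 2 and 3. They are tested against single transpositions here and against
  products of two disjoint ones in \<open>fano_brute2\<close>, the two shapes allowed by
  \<open>involution_form\<close>.\<close>

lemma fano_brute1: "\<forall>a\<in>set [0..<7]. \<forall>b\<in>set [Suc a..<7]. \<forall>FL\<in>set
    [[[0,1,2],[1,2,3],[2,3,4],[3,4,5],[4,5,6],[5,6,0],[6,0,1]], [[0,2,4],[1,3,5],[2,4,6],[3,5,0],[4,6,1],[5,0,2],[6,1,3]],
    [[0,3,6],[1,4,0],[2,5,1],[3,6,2],[4,0,3],[5,1,4],[6,2,5]]]. \<not> pres FL (swp a b)"
  by code_simp

lemma fano_brute2: "\<forall>a\<in>set [0..<7]. \<forall>b\<in>set [Suc a..<7]. \<forall>e\<in>set [Suc a..<7]. \<forall>f\<in>set [Suc e..<7].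
    e \<noteq> b \<longrightarrow> f \<noteq> b \<longrightarrow> (\<forall>FL\<in>set [[[0,1,2],[1,2,3],[2,3,4],[3,4,5],[4,5,6],[5,6,0],[6,0,1]],
        [[0,2,4],[1,3,5],[2,4,6],[3,5,0],[4,6,1],[5,0,2],[6,1,3]], [[0,3,6],[1,4,0],[2,5,1],[3,6,2],[4,0,3],[5,1,4],[6,2,5]]]. \<not> pres FL (cmp
        (swp a b) (swp e f)))"
  by code_simp

lemma neg_fam: "\<forall>F\<in>set (fam [0,1,3]). \<exists>G\<in>set (fam [0,2,3]). set (map ((!) neg7) F) = set G"
  by code_simp
lemma neg_fam': "\<forall>F\<in>set (fam [0,2,3]). \<exists>G\<in>set (fam [0,1,3]). set (map ((!) neg7) F) = set G"
  by code_simp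

section \<open>Automorphisms of the plane, and groups generated by a 7-cycle and an
  involution\<close>

lemma perm7_all: "perm7 l \<Longrightarrow> i < 7 \<Longrightarrow> l ! i < 7"
  unfolding perm7_def by (metis lessThan_iff nth_mem subsetD)

lemma id7_length: "length id7 = 7" by (simp add: id7_def)

lemma perm7D: assumes "perm7 l"
  shows "length l = 7" "i < 7 \<Longrightarrow> l ! i < 7" "i < 7 \<Longrightarrow> j < 7 \<Longrightarrow> l ! i = l ! j \<longleftrightarrow> i = j"
  using assms perm7_all[OF assms] by (auto simp: perm7_def nth_eq_iff_index_eq)

lemma cmp_nth: "length m = 7 \<Longrightarrow> i < 7 \<Longrightarrow> cmp l m ! i = l ! (m ! i)"
  and cmp_length: "length (cmp l m) = length m"
  by (auto simp: cmp_def)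

lemma id7_nth: "i < 7 \<Longrightarrow> id7 ! i = i"
proof -
  assume "i < 7"
  hence "i \<in> {0,1,2,3,4,5,6}" by auto
  thus ?thesis by (auto simp: id7_def)
qed

lemma list7_eqI: "length l = 7 \<Longrightarrow> length m = 7 \<Longrightarrow> (\<And>i. i < 7 \<Longrightarrow> l ! i = m ! i) \<Longrightarrow> l = m"
  by (rule nth_equalityI) auto

definition spres :: "nat set set \<Rightarrow> nat list \<Rightarrow> bool" where
  "spres FS l \<longleftrightarrow> (\<forall>F\<in>FS. \<exists>G\<in>FS. \<forall>x\<in>F. l ! x \<in> G)"

definition fset7 :: "nat list \<Rightarrow> nat set set" where "fset7 S = set ` set (fam S)"

lemma pres_spres: "pres (fam S) l \<longleftrightarrow> spres (fset7 S) l"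
  by (auto simp: pres_def spres_def fset7_def list_all_iff list_ex_iff)

lemma nf7_nforms: assumes "t \<in> set nf_table" shows "nf7 t \<in> set nforms"
proof -
  obtain x k y where t: "t = (x, k, y)" by (cases t)
  hence v: "x < 7" "k \<in> set [1,2,4]" "y \<le> 7" using nf_table_ok assms by (auto simp: list_all_iff)
  show ?thesis
  proof (cases "y = 7")
    case True
    thus ?thesis unfolding nforms_def t nf7_def using v by force
  next
    case False
    hence "y \<in> set [0..<7]" using v by simp
    thus ?thesis unfolding nforms_def t nf7_def using v False by force
  qed
qed

lemma third_pres:
  assumes l: "perm7 l" "spres (fset7 [0,1,3]) l" and F: "[x, y, z] \<in> set (fam [0,1,3])"
    and d: "x < 7" "y < 7" "z < 7" "x \<noteq> y" "x \<noteq> z" "y \<noteq> z"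
  shows "l ! z = third (l ! x) (l ! y)"
proof -
  have "{x, y, z} \<in> fset7 [0,1,3]" using F unfolding fset7_def by force
  from l(2)[unfolded spres_def, THEN bspec, OF this] obtain G' where G': "G' \<in> fset7 [0,1,3]"
    "\<forall>v\<in>{x, y, z}. l ! v \<in> G'" by (rule bexE)
  from G'(1) obtain G where "G \<in> set (fam [0,1,3])" "G' = set G" unfolding fset7_def by (rule imageE)
  with G'(2) have G: "G \<in> set (fam [0,1,3])" "l ! x \<in> set G" "l ! y \<in> set G" "l ! z \<in> set G" by simp_all
  have "l ! x \<noteq> l ! y" "l ! x \<noteq> l ! z" "l ! y \<noteq> l ! z" using perm7D(3)[OF l(1)] d by auto
  thus ?thesis
    using third_unique[THEN bspec, OF G(1), THEN bspec, OF G(2), THEN bspec, OF G(3), THEN bspec, OF G(4)] by iprover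
qed

text \<open>An automorphism respects \<open>third\<close>, so it equals \<open>mk7\<close> of its
  values at 0, 1, 2, which are noncollinear by injectivity at 3. The table then names its normal
  form.\<close>

lemma fano_aut_nforms:
  assumes l: "perm7 l" "spres (fset7 [0,1,3]) l" shows "l \<in> set nforms"
proof -
  let ?a = "l ! 0" and ?b = "l ! 1" and ?e = "l ! 2"
  note T = third_pres[OF l]
  have F: "[0,1,3] \<in> set (fam [0,1,3])" "[1,2,4] \<in> set (fam [0,1,3])"
    "[2,3,5] \<in> set (fam [0,1,3])" "[3,4,6] \<in> set (fam [0,1,3])" unfolding fam_lits by simp_all
  have 3: "l ! 3 = third ?a ?b" by (rule T[OF F(1)]) simp_all
  have 4: "l ! 4 = third ?b ?e" by (rule T[OF F(2)]) simp_all
  have 5: "l ! 5 = third ?e (l ! 3)" by (rule T[OF F(3)]) simp_all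
  have 6: "l ! 6 = third (l ! 3) (l ! 4)" by (rule T[OF F(4)]) simp_all
  have L: "l = mk7 ?a ?b ?e"
  proof (rule list7_eqI)
    fix i :: nat assume "i < 7"
    hence "i \<in> {0,1,2,3,4,5,6}" by auto
    thus "l ! i = mk7 ?a ?b ?e ! i" using 3 4 5 6 by (auto simp: mk7_def)
  qed (use perm7D(1)[OF l(1)] in \<open>simp_all add: mk7_def\<close>)
  have C: "?a < 7" "?b < 7" "?e < 7" "?a \<noteq> ?b" "?e \<noteq> ?a" "?e \<noteq> ?b" "?e \<noteq> third ?a ?b"
    using perm7D(2,3)[OF l(1)] unfolding 3[symmetric] by auto
  have M: "mk7 p q r \<in> set [mk7 a b e. a \<leftarrow> [0..<7], b \<leftarrow> [0..<7], a \<noteq> b, e \<leftarrow> [0..<7], e \<noteq> a \<and> e \<noteq> b \<and> e \<noteq> third a b]"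
    if "p < 7" "q < 7" "r < 7" "p \<noteq> q" "r \<noteq> p" "r \<noteq> q" "r \<noteq> third p q" for p q r
    using that by (simp, intro bexI[of _ p] bexI[of _ q] bexI[of _ r]) auto
  from M[OF C] have "l \<in> set [mk7 a b e. a \<leftarrow> [0..<7], b \<leftarrow> [0..<7], a \<noteq> b, e \<leftarrow> [0..<7], e \<noteq> a \<and> e \<noteq> b \<and> e \<noteq> third a b]"
    by (simp only: L[symmetric])
  thus ?thesis unfolding mk7_table using nf7_nforms by auto
qed

text \<open>Subgroups of \<open>PSL_2(7)\<close> containing a 7-cycle have order 7, 21 or 168, so
  any of the 21 involutions forces the whole group. Concretely, the table expresses
  \<open>sl7\<close> and \<open>ml7 2\<close> through \<open>d\<close> and the cycle, and these
  build all normal forms.\<close>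

lemma fano_gen:
  assumes G: "\<And>l. l \<in> Gs \<Longrightarrow> perm7 l \<and> spres (fset7 [0,1,3]) l"
    and cl: "\<And>l m. l \<in> Gs \<Longrightarrow> m \<in> Gs \<Longrightarrow> cmp l m \<in> Gs"
    and c: "tl7 1 \<in> Gs" and d: "d \<in> Gs" "d \<noteq> id7" "cmp d d = id7"
  shows "Gs = set nforms"
proof
  show "Gs \<subseteq> set nforms" using G fano_aut_nforms by blast
  have id: "id7 \<in> Gs" using cl[OF d(1) d(1)] d(3) by simp
  have w: "wev d w \<in> Gs" for w 
  proof (induction w)
    case (Cons x w)
    thus ?case using cl[OF c Cons] cl[OF d(1) Cons] by (cases x) (simp_all del: One_nat_def)
  qed (simp add: id)
  have "d \<in> set nf_lits" using G d(1) fano_aut_nforms unfolding nforms_lits[symmetric] by blast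
  hence "d \<in> set (map fst word_table)" using word_table_ok1 d by blast
  then obtain u v where "(d, u, v) \<in> set word_table" by auto
  hence "wev d u = sl7" "wev d v = ml7 2" using word_table_ok2 by auto
  hence s: "sl7 \<in> Gs" "ml7 2 \<in> Gs" using w by metis+
  have "cmp (ml7 2) (ml7 2) = ml7 4" "ml7 1 = id7" by code_simp+
  hence m: "ml7 k \<in> Gs" if "k \<in> set [1,2,4]" for k using that s id cl[of "ml7 2" "ml7 2"] by auto
  have t: "tl7 x \<in> Gs" for x
  proof (induction x)
    case 0
    have "tl7 0 = id7" by code_simp
    thus ?case using id by simp
  next
    case (Suc x)
    have "tl7 (Suc x) = cmp (tl7 1) (tl7 x)"
      by (rule list7_eqI) (auto simp: tl7_def cmp_def mod_Suc_eq)
    thus ?case using cl[OF c Suc] by simp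
  qed
  show "set nforms \<subseteq> Gs"
  proof
    fix l assume "l \<in> set nforms"
    then obtain x k where xk: "k \<in> set [1,2,4]" "l \<in> set (cmp (tl7 x) (ml7 k) #
       map (\<lambda>y. cmp (tl7 x) (cmp sl7 (cmp (ml7 k) (tl7 y)))) [0..<7])"
      unfolding nforms_def by (auto simp only: set_concat set_map image_image UN_iff)
    thus "l \<in> Gs" using m t s cl by auto
  qed
qed

lemma swp_nth: "x < 7 \<Longrightarrow> a < 7 \<Longrightarrow> b < 7 \<Longrightarrow> swp a b ! x = (if x = b then a else if x = a then b else x)"
  and swp_length: "length (swp a b) = 7"
  by (simp_all add: swp_def nth_list_update id7_nth id7_length)

text \<open>The moved points come in pairs and avoid \<open>i\<close> and \<open>j\<close>, so there
  are two or four of them. Taking \<open>a\<close> least among them and \<open>e\<close> least among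
  the rest matches the ranges searched by \<open>fano_brute1\<close> and
  \<open>fano_brute2\<close>.\<close>

lemma involution_form:
  assumes d: "perm7 d" "cmp d d = id7" "d \<noteq> id7" and ij: "i < 7" "j < 7" "i \<noteq> j" "d ! i = i" "d ! j = j"
  shows "\<exists>a b. a < b \<and> b < 7 \<and> (d = swp a b \<or>
    (\<exists>e f. a < e \<and> e < f \<and> f < 7 \<and> e \<noteq> b \<and> f \<noteq> b \<and> d = cmp (swp a b) (swp e f)))"
proof -
  note p = perm7D[OF d(1)]
  have dd: "d ! (d ! x) = x" if "x < 7" for x
    using arg_cong[OF d(2), of "\<lambda>l. l ! x"] that p(1) by (simp add: cmp_nth id7_nth)
  define D where "D = {x. x < 7 \<and> d ! x \<noteq> x}"
  have Df: "finite D" "D \<subseteq> {..<7} - {i, j}" using ij by (auto simp: D_def)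
  have Dd: "d ! x \<in> D" if "x \<in> D" for x using that p dd by (auto simp: D_def)
  have "D \<noteq> {}"
  proof
    assume "D = {}"
    hence "d = id7" using p(1) by (intro list7_eqI) (auto simp: D_def id7_nth, simp add: id7_def)
    with d(3) show False by simp
  qed
  define a where "a = Min D"
  have a: "a \<in> D" "\<And>x. x \<in> D \<Longrightarrow> a \<le> x" using Df \<open>D \<noteq> {}\<close> by (auto simp: a_def)
  define b where "b = d ! a"
  have b: "b \<in> D" "b \<noteq> a" "d ! b = a" using a Dd dd by (auto simp: b_def D_def)
  have ab: "a < b" "b < 7" "a < 7" using a b by (auto simp: D_def order.not_eq_order_implies_strict)
  show ?thesis
  proof (cases "D = {a, b}")
    case True
    have "d = swp a b"
    proof (rule list7_eqI)
      fix x :: nat assume x: "x < 7"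
      show "d ! x = swp a b ! x" unfolding swp_nth[OF x ab(3,2)]
        using True x b by (auto simp: D_def b_def)
    qed (use p in \<open>auto simp: swp_length\<close>)
    thus ?thesis using ab by blast
  next
    case False
    define E where "E = D - {a, b}"
    have E: "finite E" "E \<noteq> {}" using Df False a b by (auto simp: E_def)
    have Ed: "d ! x \<in> E" if "x \<in> E" for x
    proof -
      have "x \<in> D" "x \<noteq> a" "x \<noteq> b" using that by (auto simp: E_def)
      moreover hence "x < 7" by (simp add: D_def)
      ultimately show ?thesis using Dd[of x] p(3)[of x a] p(3)[of x b] ab b by (auto simp: E_def b_def)
    qed
    define e where "e = Min E"
    have e: "e \<in> E" "\<And>x. x \<in> E \<Longrightarrow> e \<le> x" using E by (auto simp: e_def)
    define f where "f = d ! e"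
    have eD: "e < 7" "d ! e \<noteq> e" "e \<noteq> a" "e \<noteq> b" "e \<in> D" using e by (auto simp: E_def D_def)
    have f: "f \<in> E" "d ! f = e" using Ed[OF e(1)] dd[OF eD(1)] by (auto simp: f_def)
    have fD: "f < 7" "f \<noteq> e" "f \<noteq> a" "f \<noteq> b" "f \<in> D" using f eD by (auto simp: E_def D_def f_def)
    have ef: "e < f" using e(2)[OF f(1)] fD by simp
    have ae: "a < e" using a(2)[OF eD(5)] eD by simp
    have DD: "D = {a, b, e, f}"
    proof (rule ccontr)
      assume "D \<noteq> {a, b, e, f}"
      then obtain g where g: "g \<in> D" "g \<noteq> a" "g \<noteq> b" "g \<noteq> e" "g \<noteq> f" using a b eD fD by auto
      define h where "h = d ! g"
      have g7: "g < 7" "h \<noteq> g" using g by (auto simp: D_def h_def)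
      have h: "h \<in> D" "h \<noteq> a" "h \<noteq> b" "h \<noteq> e" "h \<noteq> f"
        using Dd[OF g(1)] p(3)[OF g7(1) ab(2)] p(3)[OF g7(1) ab(3)] p(3)[OF g7(1) eD(1)] p(3)[OF g7(1) fD(1)] g b f
        by (auto simp: h_def b_def f_def)
      have "card {a, b, e, f, g, h} = 6" using ab eD fD g h g7 b by auto
      moreover have "{a, b, e, f, g, h} \<subseteq> {..<7} - {i, j}" using Df a b eD fD g h by blast
      hence "card {a, b, e, f, g, h} \<le> card ({..<7} - {i, j})" by (intro card_mono) auto
      moreover have "card ({..<7} - {i, j}) = 5" using ij by (subst card_Diff_subset) auto
      ultimately show False by simp
    qed
    have "d = cmp (swp a b) (swp e f)"
    proof (rule list7_eqI)
      fix x :: nat assume x: "x < 7"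
      show "d ! x = cmp (swp a b) (swp e f) ! x"
        unfolding cmp_nth[OF swp_length x]
        using DD x b f eD fD ab swp_nth[OF x eD(1) fD(1)] swp_nth[of _ a b] by (auto simp: D_def b_def f_def)
    qed (use p in \<open>auto simp: swp_length cmp_length\<close>)
    thus ?thesis using ab ae ef fD eD by blast
  qed
qed

text \<open>Up to translation there are five triples. Unless it is one of the difference sets \<open>{0, 1, 3}\<close> and \<open>{0, 2, 3}\<close>,
  which negation interchanges, no nontrivial involution with two fixed points preserves the family of translates.\<close>

theorem fano_main:
  assumes S: "x < y" "y < z" "z < 7"
    and G: "\<And>l. l \<in> Gs \<Longrightarrow> perm7 l \<and> spres (fset7 [x, y, z]) l"
    and cl: "\<And>l m. l \<in> Gs \<Longrightarrow> m \<in> Gs \<Longrightarrow> cmp l m \<in> Gs"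
    and c: "tl7 1 \<in> Gs" and d: "d \<in> Gs" "d \<noteq> id7" "cmp d d = id7"
    and ij: "i < 7" "j < 7" "i \<noteq> j" "d ! i = i" "d ! j = j"
  shows "\<exists>\<nu>\<in>{id7, neg7}. (\<lambda>l. cmp \<nu> (cmp l \<nu>)) ` Gs = set nforms"
proof -
  have "[x, y, z] \<in> set [[x,y,z]. x \<leftarrow> [0..<7], y \<leftarrow> [Suc x..<7], z \<leftarrow> [Suc y..<7]]"
    using S by (simp, intro bexI[of _ x] bexI[of _ y]) auto
  then obtain R where R: "R \<in> set [[0,1,3],[0,2,3],[0,1,2],[0,2,4],[0,3,6]]"
     "list_all (\<lambda>F. list_ex (\<lambda>G. set F = set G) (fam R)) (fam [x,y,z])"
     "list_all (\<lambda>F. list_ex (\<lambda>G. set F = set G) (fam [x,y,z])) (fam R)"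
    using fam_reps by blast
  have eq: "fset7 [x, y, z] = fset7 R"
    using R(2,3) unfolding fset7_def list_all_iff list_ex_iff by blast
  have GR: "perm7 l \<and> spres (fset7 R) l" if "l \<in> Gs" for l using G[OF that] eq by simp
  have nR: "R \<in> set [[0,1,3],[0,2,3]]"
  proof (rule ccontr)
    assume "R \<notin> set [[0,1,3],[0,2,3]]"
    hence R': "R \<in> set [[0,1,2],[0,2,4],[0,3,6]]" using R(1) by auto
    have pr: "pres (fam R) d" using GR[OF d(1)] pres_spres by simp
    have FR: "fam R \<in> set [fam [0,1,2], fam [0,2,4], fam [0,3,6]]" using R' by auto
    obtain a b where ab: "a < b" "b < 7" "d = swp a b \<or>
      (\<exists>e f. a < e \<and> e < f \<and> f < 7 \<and> e \<noteq> b \<and> f \<noteq> b \<and> d = cmp (swp a b) (swp e f))"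
      using involution_form[OF _ d(3,2) ij] GR[OF d(1)] by blast
    have m: "a \<in> set [0..<7]" "b \<in> set [Suc a..<7]" using ab by auto
    from ab(3) show False
    proof (elim disjE exE conjE)
      assume "d = swp a b"
      thus False using fano_brute1[folded fam_lits] m FR pr by blast
    next
      fix e f assume *: "a < e" "e < f" "f < 7" "e \<noteq> b" "f \<noteq> b" "d = cmp (swp a b) (swp e f)"
      hence "e \<in> set [Suc a..<7]" "f \<in> set [Suc e..<7]" by auto
      thus False using fano_brute2[folded fam_lits] m FR pr * by blast
    qed
  qed
  show ?thesis
  proof (cases "R = [0,1,3]")
    case True
    have "Gs = set nforms" by (rule fano_gen[OF _ cl c d]) (use GR True in auto)
    moreover have "cmp id7 (cmp l id7) = l" if "l \<in> Gs" for l
      using perm7D[of l] GR[OF that] by (intro list7_eqI) (auto simp: cmp_nth cmp_length id7_nth id7_length)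
    hence "(\<lambda>l. cmp id7 (cmp l id7)) ` Gs = Gs" by simp
    ultimately have "(\<lambda>l. cmp id7 (cmp l id7)) ` Gs = set nforms" by simp
    thus ?thesis by blast
  next
    case False
    hence R2: "R = [0,2,3]" using nR by auto
    have n7: "neg7 ! i < 7 \<and> neg7 ! (neg7 ! i) = i" if "i < 7" for i
    proof -
      have "i \<in> {0,1,2,3,4,5,6}" using that by auto
      thus ?thesis by (auto simp: neg7_def)
    qed
    have nl: "length neg7 = 7" by (simp add: neg7_def)
    define H where "H = (\<lambda>l. cmp neg7 (cmp l neg7)) ` Gs"
    have nth: "cmp neg7 (cmp l neg7) ! i = neg7 ! (l ! (neg7 ! i))" if "perm7 l" "i < 7" for l i
      using that n7[of i] nl perm7D[OF that(1)] by (simp add: cmp_nth cmp_length)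
    have len: "length (cmp neg7 (cmp l neg7)) = 7" for l by (simp add: cmp_length nl)
    have "H = set nforms"
    proof (rule fano_gen[where d = "cmp neg7 (cmp d neg7)"])
      fix m assume "m \<in> H"
      then obtain l where l: "l \<in> Gs" "m = cmp neg7 (cmp l neg7)" by (auto simp: H_def)
      have pl: "perm7 l" "spres (fset7 [0,2,3]) l" using GR[OF l(1)] R2 by auto
      have inj: "m ! i = m ! j \<longleftrightarrow> i = j" if "i < 7" "j < 7" for i j
        unfolding l(2) nth[OF pl(1) that(1)] nth[OF pl(1) that(2)]
        using n7 that perm7D[OF pl(1)] by metis
      have "perm7 m" unfolding perm7_def
      proof (intro conjI subsetI)
        show m7: "length m = 7" using len l(2) by simp
        show "distinct m" using inj m7 by (simp add: distinct_conv_nth)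
        fix v assume "v \<in> set m"
        then obtain i where "i < 7" "v = m ! i" using m7 by (auto simp: in_set_conv_nth)
        thus "v \<in> {..<7}" unfolding l(2) using nth[OF pl(1)] n7 perm7D[OF pl(1)] by auto
      qed
      moreover have "spres (fset7 [0,1,3]) m" unfolding spres_def
      proof
        fix F assume "F \<in> fset7 [0,1,3]"
        then obtain F0 where F0: "F0 \<in> set (fam [0,1,3])" "F = set F0" by (auto simp: fset7_def)
        then obtain F1 where F1: "F1 \<in> set (fam [0,2,3])" "set (map ((!) neg7) F0) = set F1" using neg_fam by blast
        have "set F1 \<in> fset7 [0,2,3]" using F1 by (auto simp: fset7_def)
        from pl(2)[unfolded spres_def, THEN bspec, OF this] obtain G' where G': "G' \<in> fset7 [0,2,3]"
          "\<forall>x\<in>set F1. l ! x \<in> G'" by (rule bexE)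
        from G'(1) obtain G where "G \<in> set (fam [0,2,3])" "G' = set G" unfolding fset7_def by (rule imageE)
        with G'(2) have G: "G \<in> set (fam [0,2,3])" "\<forall>x\<in>set F1. l ! x \<in> set G" by simp_all
        obtain G1 where G1: "G1 \<in> set (fam [0,1,3])" "set (map ((!) neg7) G) = set G1" using neg_fam' G by blast
        have F7: "x < 7" if "x \<in> F" for x using that F0 by (auto simp: fam_def)
        have "m ! x \<in> set G1" if x: "x \<in> F" for x
        proof -
          have "neg7 ! x \<in> set F1" using x F0 F1(2)[symmetric] by auto
          hence "l ! (neg7 ! x) \<in> set G" using G by blast
          thus ?thesis unfolding l(2) nth[OF pl(1) F7[OF x]] G1(2)[symmetric] by auto
        qed
        thus "\<exists>G\<in>fset7 [0,1,3]. \<forall>x\<in>F. m ! x \<in> G" using G1(1) by (auto simp: fset7_def)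
      qed
      ultimately show "perm7 m \<and> spres (fset7 [0,1,3]) m" by simp
    next
      fix l m assume "l \<in> H" "m \<in> H"
      then obtain l' m' where lm: "l' \<in> Gs" "m' \<in> Gs" "l = cmp neg7 (cmp l' neg7)" "m = cmp neg7 (cmp m' neg7)"
        by (auto simp: H_def)
      have "cmp l m = cmp neg7 (cmp (cmp l' m') neg7)"
      proof (rule list7_eqI)
        fix i :: nat assume i: "i < 7"
        have p: "perm7 l'" "perm7 m'" "perm7 (cmp l' m')" using GR lm cl by auto
        have "m ! i < 7" unfolding lm(4) nth[OF p(2) i] using n7 i perm7D[OF p(2)] by simp
        thus "cmp l m ! i = cmp neg7 (cmp (cmp l' m') neg7) ! i"
          using nth[OF p(3) i] nth[OF p(2) i] nth[OF p(1)] n7 i perm7D[OF p(2)] len lm by (simp add: cmp_nth)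
      qed (simp_all add: cmp_length nl lm)
      thus "cmp l m \<in> H" unfolding H_def using cl lm by blast
    next
      \<comment> \<open>Negation conjugates the translation by 6 into the translation by 1.\<close>
      have p: "tl7 6 \<in> Gs"
      proof -
        have "tl7 6 = cmp (tl7 1) (cmp (tl7 1) (cmp (tl7 1) (cmp (tl7 1) (cmp (tl7 1) (tl7 1)))))" by code_simp
        thus ?thesis using c cl by simp
      qed
      have "tl7 1 = cmp neg7 (cmp (tl7 6) neg7)" by code_simp
      thus "tl7 1 \<in> H" unfolding H_def using p by blast
    next
      show "cmp neg7 (cmp d neg7) \<in> H" unfolding H_def using d by blast
      have p: "perm7 d" using GR d by blast
      have dd: "d ! (d ! x) = x" if "x < 7" for x
        using arg_cong[OF d(3), of "\<lambda>l. l ! x"] that perm7D(1)[OF p] by (simp add: cmp_nth id7_nth)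
      show "cmp neg7 (cmp d neg7) \<noteq> id7"
      proof
        assume a: "cmp neg7 (cmp d neg7) = id7"
        have "d = id7"
        proof (rule list7_eqI)
          fix x :: nat assume x: "x < 7"
          have "neg7 ! (d ! (neg7 ! (neg7 ! x))) = neg7 ! x"
            using nth[OF p, of "neg7 ! x"] a n7[OF x] by (simp add: id7_nth)
          hence "neg7 ! (neg7 ! (d ! x)) = neg7 ! (neg7 ! x)" using n7[OF x] by simp
          thus "d ! x = id7 ! x" using n7 x perm7D[OF p] by (simp add: id7_nth)
        qed (use perm7D[OF p] in \<open>auto simp: id7_def\<close>)
        with d(2) show False by simp
      qed
      show "cmp (cmp neg7 (cmp d neg7)) (cmp neg7 (cmp d neg7)) = id7"
      proof (rule list7_eqI)
        fix x :: nat assume x: "x < 7"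
        have 1: "d ! (neg7 ! x) < 7" using n7 x perm7D[OF p] by simp
        hence 2: "neg7 ! (d ! (neg7 ! x)) < 7" using n7 by simp
        show "cmp (cmp neg7 (cmp d neg7)) (cmp neg7 (cmp d neg7)) ! x = id7 ! x"
          unfolding cmp_nth[OF len x] nth[OF p x] nth[OF p 2] using n7[OF 1] dd[of "neg7 ! x"] n7[OF x] x by (simp add: id7_nth)
      qed (auto simp: cmp_length nl id7_def)
    qed
    thus ?thesis unfolding H_def by blast
  qed
qed

section \<open>The septic and its double roots\<close>

text \<open>With \<open>t = u / w\<^sup>3\<close> and \<open>y = w x\<close> this is, up to the factor \<open>w\<^sup>7\<close>, a one-parameter subfamily of
  LaMacchia's polynomials in \<open>x\<close>.\<close>

definition septic :: "complex \<Rightarrow> complex \<Rightarrow> complex \<Rightarrow> complex" where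
  "septic u w y = (y ^ 7 - 46 * w * y ^ 6 + 541 * w ^ 2 * y ^ 5 - (850 * w ^ 3 + u) * y ^ 4 + (u - 3742 * w ^ 3) * w * y ^ 3 + 5120 * w ^ 5 * y ^ 2 + 3328 * w ^ 6 * y - 4096 * w ^ 7)"

definition septic_d :: "complex \<Rightarrow> complex \<Rightarrow> complex \<Rightarrow> complex" where
  "septic_d u w y = (7 * y ^ 6 - 276 * w * y ^ 5 + 2705 * w ^ 2 * y ^ 4 - 4 * (850 * w ^ 3 + u) * y ^ 3 + 3 * (u - 3742 * w ^ 3) * w * y ^ 2 + 10240 * w ^ 5 * y + 3328 * w ^ 6)"

definition septic_dd :: "complex \<Rightarrow> complex \<Rightarrow> complex \<Rightarrow> complex" where
  "septic_dd u w y = (42 * y ^ 5 - 1380 * w * y ^ 4 + 10820 * w ^ 2 * y ^ 3 - 12 * (850 * w ^ 3 + u) * y ^ 2 + 6 * (u - 3742 * w ^ 3) * w * y + 10240 * w ^ 5)"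

text \<open>The septic is \<open>A(y) + u (w y\<^sup>3 - y\<^sup>4)\<close>, so its double roots are critical points of \<open>A(y) / (w y\<^sup>3 - y\<^sup>4)\<close>;
  the polynomial \<open>ram8\<close> is the interesting part of the numerator of the derivative.\<close>

definition ram8 :: "complex \<Rightarrow> complex \<Rightarrow> complex" where
  "ram8 w y = 12288 * w ^ 8 - 23040 * y * w ^ 7 + 4864 * y ^ 2 * w ^ 6 + 10240 * y ^ 3 * w ^ 5 - 4592 * y ^ 4 * w ^ 4 + 1082 * y ^ 5 * w ^ 3 - 679 * y ^ 6 * w ^ 2 + 96 * y ^ 7 * w - 3 * y ^ 8"

definition ram8_d :: "complex \<Rightarrow> complex \<Rightarrow> complex" where
  "ram8_d w y = - 23040 * w ^ 7 + 9728 * y * w ^ 6 + 30720 * y ^ 2 * w ^ 5 - 18368 * y ^ 3 * w ^ 4 + 5410 * y ^ 4 * w ^ 3 - 4074 * y ^ 5 * w ^ 2 + 672 * y ^ 6 * w - 24 * y ^ 7"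

text \<open>The point \<open>x\<close>, a root of \<open>septic u w\<close>, lies on the line \<open>y\<close>, a root of \<open>septic (- u) w\<close>, if and only if
  \<open>incid w x y = 0\<close>.\<close>

definition incid :: "complex \<Rightarrow> complex \<Rightarrow> complex \<Rightarrow> complex" where
  "incid w x y = - 16 * y * w ^ 3 + 16 * y ^ 2 * w ^ 2 - 16 * x * w ^ 3 + 30 * x * y * w ^ 2 - 15 * x * y ^ 2 * w + x * y ^ 3 + 16 * x ^ 2 * w ^ 2 - 15 * x ^ 2 * y * w - x ^ 2 * y ^ 2 + x ^ 3 * y"

definition coincid :: "complex \<Rightarrow> complex \<Rightarrow> complex \<Rightarrow> complex" where
  "coincid w x y = 256 * y ^ 2 * w ^ 5 - 256 * x * y * w ^ 5 + 16 * x * y ^ 2 * w ^ 4 - 16 * x * y ^ 3 * w ^ 3 + 256 * x ^ 2 * w ^ 5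
      + 16 * x ^ 2 * y * w ^ 4 - 258 * x ^ 2 * y ^ 2 * w ^ 3 - 15 * x ^ 2 * y ^ 3 * w ^ 2 + x ^ 2 * y ^ 4 * w - 16 * x ^ 3 * y * w ^ 3
      - 15 * x ^ 3 * y ^ 2 * w ^ 2 + 32 * x ^ 3 * y ^ 3 * w - x ^ 3 * y ^ 4 + x ^ 4 * y ^ 2 * w - x ^ 4 * y ^ 3"

lemma incidence: "septic u w x * (w * y ^ 3 - y ^ 4) + septic (- u) w y * (w * x ^ 3 - x ^ 4) = incid w x y * coincid w x y"
  unfolding septic_def incid_def coincid_def by Groebner_Basis.algebra

lemma ramification_poly: "y ^ 2 * ram8 w y = (w * y ^ 3 - y ^ 4) * septic_d u w y - (3 * w * y ^ 2 - 4 * y ^ 3) * septic u w y"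
  unfolding septic_def septic_d_def ram8_def by Groebner_Basis.algebra

text \<open>This is \<open>ramification_poly\<close> differentiated in \<open>y\<close>; the two
  terms with \<open>septic_d\<close> cancel.\<close>

lemma ramification_poly_d: "y ^ 2 * ram8_d w y + 2 * y * ram8 w y = (w * y ^ 3 - y ^ 4) * septic_dd u w y - (6 * w * y - 12 * y ^ 2) * septic u w y"
  unfolding septic_def septic_d_def septic_dd_def ram8_def ram8_d_def by Groebner_Basis.algebra

text \<open>A Bezout identity for \<open>ram8\<close> and its derivative, used to exclude triple
  roots. The constant on the left divides \<open>2 ^ 40 * badN ^ 3\<close>.\<close>

lemma ram8_separable: "60498106515456000 * w ^ 14 = (- 169310331058640 * y ^ 2 * w ^ 4 - 36287477975634 * y ^ 4 * w ^ 2 - 250185937272 * y ^ 6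
    + 6777385421280 * y ^ 5 * w + 23092696881082 * y ^ 3 * w ^ 3 + 166434684124416 * y * w ^ 5 + 260850544229120 * w ^ 6) * ram8 w y
    + (136494504382464 * w ^ 7 - 114454366401280 * y * w ^ 6 - 67997583544576 * y ^ 2 * w ^ 5 + 42563857564544 * y ^ 3 * w ^ 4
    - 5603634495386 * y ^ 4 * w ^ 3 + 6191568621283 * y ^ 5 * w ^ 2 - 972266146296 * y ^ 6 * w + 31273242159 * y ^ 7) * ram8_d w y"
  unfolding ram8_def ram8_d_def by Groebner_Basis.algebra

text \<open>The double roots satisfy a quadratic equation, so there are at most two of them.\<close>

definition quad1 :: "complex \<Rightarrow> complex \<Rightarrow> complex" where
  "quad1 u w = - 38402439477723136000 * w ^ 19 + 27444653048463360 * u * w ^ 16 - 3908763648000 * u ^ 2 * w ^ 13 + 3078881280 * u ^ 3 * w ^ 10"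

definition quad0 :: "complex \<Rightarrow> complex \<Rightarrow> complex" where
  "quad0 u w = 37111813205393408000 * w ^ 20 - 85396389125685248 * u * w ^ 17 + 3908763648000 * u ^ 2 * w ^ 14 - 9080930304 * u ^ 3 * w ^ 11"

lemma double_root_quadratic:
  "2581252544659456000 * w ^ 18 * y ^ 2 + quad1 u w * y + quad0 u w =
   (102775664277833728 * w ^ 13 - 95364721785256960 * y * w ^ 12 - 47038623375415296 * y ^ 2 * w ^ 11 + 32729536123270912 * y ^ 3 * w ^ 10
       - 3706759771059656 * y ^ 4 * w ^ 9 + 4725767286466396 * y ^ 5 * w ^ 8 - 755968747311456 * y ^ 6 * w ^ 7 + 24433498558668 * y ^ 7 * w ^ 6
       - 878908900685824 * u * w ^ 10 + 644566734205952 * y * u * w ^ 9 + 419077686904832 * y ^ 2 * u * w ^ 8 - 248193174569216 * y ^ 3 * u * w ^ 7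
       + 35702803533496 * y ^ 4 * u * w ^ 6 - 36547953681252 * y ^ 5 * u * w ^ 5 + 5671770658464 * y ^ 6 * u * w ^ 4
       - 181857462516 * y ^ 7 * u * w ^ 3 + 213304619520 * u ^ 2 * w ^ 7 - 224246314752 * y * u ^ 2 * w ^ 6 - 113866630656 * y ^ 2 * u ^ 2 * w ^ 5
       + 80523180480 * y ^ 3 * u ^ 2 * w ^ 4 - 8816485170 * y ^ 4 * u ^ 2 * w ^ 3 + 11397780087 * y ^ 5 * u ^ 2 * w ^ 2
       - 1829909592 * y ^ 6 * u ^ 2 * w + 59206995 * y ^ 7 * u ^ 2) * septic u w y + (37278721849560576 * w ^ 12 + 7149088605721792 * y * w ^ 11
       - 33816345817272760 * y ^ 2 * w ^ 10 - 2618591839618024 * y ^ 3 * w ^ 9 + 4017176647001460 * y ^ 4 * w ^ 8 - 366012575710936 * y ^ 5 * w ^ 7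
       + 8144499519556 * y ^ 6 * w ^ 6 - 299919209499904 * u * w ^ 9 - 107221660891872 * y * u * w ^ 8 + 249011853328044 * y ^ 2 * u * w ^ 7
       + 18457660294740 * y ^ 3 * u * w ^ 6 - 30568360410316 * y ^ 4 * u * w ^ 5 + 2739258377896 * y ^ 5 * u * w ^ 4
       - 60619154172 * y ^ 6 * u * w ^ 3 + 71419635840 * u ^ 2 * w ^ 6 + 1074948496 * y * u ^ 2 * w ^ 5 - 92353835530 * y ^ 2 * u ^ 2 * w ^ 4
       + 54492921666 * y ^ 3 * u ^ 2 * w ^ 3 + 9707416125 * y ^ 4 * u ^ 2 * w ^ 2 - 886269174 * y ^ 5 * u ^ 2 * w + 19735665 * y ^ 6 * u ^ 2
       - 739008 * u ^ 3 * w ^ 3 - 1135080 * y * u ^ 3 * w ^ 2 - 1835751 * y ^ 2 * u ^ 3 * w - 19735665 * y ^ 3 * u ^ 3) * ram8 w y"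
  unfolding septic_def ram8_def quad1_def quad0_def by Groebner_Basis.algebra

text \<open>None of the primes 3, 5, 17, 47, 241 divides the constant, so \<open>septic 1 1\<close>
  has distinct roots modulo each of them.\<close>

lemma septic_1_separable: "4996785307593900032 = (2274015947835576 + 13536477168520969 * y + 1191979597280812 * y ^ 2 - 2818063255739983 * y ^ 3
    + 310912027140788 * y ^ 4 - 8089896977785 * y ^ 5) * septic 1 1 y + (4300226751781376 + 1154796715632152 * y - 4619496025277819 * y ^ 2
    - 422917648974661 * y ^ 3 + 573651078572531 * y ^ 4 - 52010601040074 * y ^ 5 + 1155699568255 * y ^ 6) * septic_d 1 1 (y::complex)"
  unfolding septic_def septic_d_def power_one mult_1_left mult_1_right by Groebner_Basis.algebra

text \<open>Modulo 3 the septic is coprime to \<open>y ^ 3 ^ k - y\<close> for \<open>k \<le> 3\<close>.\<close>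

lemma septic_frob1: "1 + 3 * (- 2731 + 2218 * y + 682 * y ^ 2 - 275 * y ^ 3 + 2846 * y ^ 4 - 2133 * y ^ 5 - 598 * y ^ 6 + 361 * y ^ 7 - 30 * y ^ 8
    + y ^ 9) = (2 + 2 * y ^ 2) * septic 1 1 y + (2 + 2 * y + y ^ 2 + 2 * y ^ 3 + 2 * y ^ 5 + y ^ 6) * (y ^ 3 - (y::complex))"
  unfolding septic_def power_one mult_1_left mult_1_right by Groebner_Basis.algebra

lemma septic_frob2: "1 + 3 * (- 2731 - 512 * y + 2901 * y ^ 2 + 3138 * y ^ 3 - 1014 * y ^ 4 - 1592 * y ^ 5 + 104 * y ^ 6 - 1173 * y ^ 7
    + 1137 * y ^ 8 + 1750 * y ^ 9 + 161 * y ^ 10 - 1350 * y ^ 11 - 118 * y ^ 12 + 166 * y ^ 13 - 15 * y ^ 14 + y ^ 15) = (2 + 2 * y + 2 * y ^ 2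
    + y ^ 4 + y ^ 6 + y ^ 7 + y ^ 8) * septic 1 1 y + (1 * y + 2 * y ^ 3 + 2 * y ^ 4 + 2 * y ^ 6) * (y ^ 9 - (y::complex))"
  unfolding septic_def power_one mult_1_left mult_1_right by Groebner_Basis.algebra

lemma septic_frob3: "1 + 3 * (- 2731 - 512 * y + 2901 * y ^ 2 + 1772 * y ^ 3 + 96 * y ^ 4 - 2616 * y ^ 5 + 1075 * y ^ 6 + 1957 * y ^ 7
    - 2542 * y ^ 8 - 454 * y ^ 9 + 4447 * y ^ 10 - 1945 * y ^ 11 - 677 * y ^ 12 + 461 * y ^ 13 + 55 * y ^ 14 + 2816 * y ^ 15 - 3498 * y ^ 16
    - 854 * y ^ 17 + 1812 * y ^ 18 + 173 * y ^ 19 + 1286 * y ^ 20 - 1009 * y ^ 21 - 2987 * y ^ 22 + 3807 * y ^ 23 - 399 * y ^ 24 - 574 * y ^ 25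
    + 296 * y ^ 26 + 70 * y ^ 27 + 2816 * y ^ 28 - 2132 * y ^ 29 - 598 * y ^ 30 + 362 * y ^ 31 - 30 * y ^ 32 + y ^ 33) = (2 + 2 * y + 2 * y ^ 2
    + y ^ 3 + y ^ 4 + 2 * y ^ 5 + y ^ 6 + y ^ 7 + 2 * y ^ 8 + 2 * y ^ 9 + 2 * y ^ 11 + 2 * y ^ 13 + y ^ 16 + y ^ 17 + y ^ 18 + y ^ 19 + y ^ 21
    + 2 * y ^ 22 + 2 * y ^ 24 + 2 * y ^ 26) * septic 1 1 y + (1 * y + 2 * y ^ 2 + 2 * y ^ 4 + 2 * y ^ 5 + y ^ 6) * (y ^ 27 - (y::complex))"
  unfolding septic_def power_one mult_1_left mult_1_right by Groebner_Basis.algebra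

section \<open>Roots modulo odd primes\<close>

definition septic_poly :: "complex \<Rightarrow> complex \<Rightarrow> complex poly" where
  "septic_poly u w = [:- 4096 * w ^ 7, 3328 * w ^ 6, 5120 * w ^ 5, (u - 3742 * w ^ 3) * w, - (850 * w ^ 3 + u), 541 * w ^ 2, - 46 * w, 1:]"

lemma septic_poly: "poly (septic_poly u w) y = septic u w y"
  unfolding septic_poly_def septic_def poly_pCons poly_0 by Groebner_Basis.algebra

lemma septic_poly_d: "poly (pderiv (septic_poly u w)) y = septic_d u w y"
  unfolding septic_poly_def septic_d_def pderiv_pCons poly_pCons poly_0 poly_add pderiv_0 by Groebner_Basis.algebra

lemma septic_poly_dd: "poly (pderiv (pderiv (septic_poly u w))) y = septic_dd u w y"
  unfolding septic_poly_def septic_dd_def pderiv_pCons pderiv_add poly_pCons poly_0 poly_add pderiv_0 by Groebner_Basis.algebra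

lemma septic_poly_monic: "degree (septic_poly u w) = 7" "coeff (septic_poly u w) 7 = 1"
  by (simp_all add: septic_poly_def numeral_eq_Suc)

lemma septic_poly_of_int:
  "\<exists>p :: int poly. lead_coeff p = 1 \<and> map_poly of_int p = septic_poly (of_int u) (of_int w)"
  by (rule exI[of _ "[:- 4096 * w ^ 7, 3328 * w ^ 6, 5120 * w ^ 5, (u - 3742 * w ^ 3) * w, - (850 * w ^ 3 + u), 541 * w ^ 2, - 46 * w, 1:]"])
    (simp add: septic_poly_def map_poly_pCons)

lemma septic_poly_coeff4: "coeff (septic_poly u w) 4 = - (850 * w ^ 3 + u)"
  by (simp add: septic_poly_def numeral_eq_Suc)

text \<open>After the scaling \<open>y = w * x\<close> only \<open>t = u / w ^ 3\<close> remains.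
  For every \<open>t\<close> in the unit interval the signs at -3, -2, 0, 1, 2, 4, 16, 28 alternate,
  which isolates seven roots.\<close>

lemma septic_roots_real:
  fixes u w :: real assumes w: "w > 0" and u: "0 \<le> u" "u \<le> w ^ 3"
  shows "\<exists>b :: nat \<Rightarrow> real. inj_on b {..<7} \<and> (\<forall>i<7. septic (of_real u) (of_real w) (of_real (b i)) = 0)"
proof -
  define t where "t = u / w ^ 3"
  have t: "0 \<le> t" "t \<le> 1" using w u by (auto simp: t_def)
  define p :: "real poly" where "p = [:- 4096, 3328, 5120, t - 3742, - (850 + t), 541, - 46, 1:]"
  have s: "poly p (-3) < 0" "poly p (-2) > 0" "poly p 0 < 0" "poly p 1 > 0" "poly p 2 < 0"
    "poly p 4 > 0" "poly p 16 < 0" "poly p 28 > 0"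
    using t by (simp_all add: p_def)
  obtain x0 where x0: "-3 < x0" "x0 < -2" "poly p x0 = 0" using poly_IVT_pos[of "-3" "-2" p] s by auto
  obtain x1 where x1: "-2 < x1" "x1 < 0" "poly p x1 = 0" using poly_IVT_neg[of "-2" 0 p] s by auto
  obtain x2 where x2: "0 < x2" "x2 < 1" "poly p x2 = 0" using poly_IVT_pos[of 0 1 p] s by auto
  obtain x3 where x3: "1 < x3" "x3 < 2" "poly p x3 = 0" using poly_IVT_neg[of 1 2 p] s by auto
  obtain x4 where x4: "2 < x4" "x4 < 4" "poly p x4 = 0" using poly_IVT_pos[of 2 4 p] s by auto
  obtain x5 where x5: "4 < x5" "x5 < 16" "poly p x5 = 0" using poly_IVT_neg[of 4 16 p] s by auto
  obtain x6 where x6: "16 < x6" "x6 < 28" "poly p x6 = 0" using poly_IVT_pos[of 16 28 p] s by auto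
  let ?l = "[x0, x1, x2, x3, x4, x5, x6]"
  have d: "distinct ?l" using x0 x1 x2 x3 x4 x5 x6 by auto
  have r: "septic (of_real u) (of_real w) (of_real (w * x)) = 0" if "poly p x = 0" for x
  proof -
    have ut: "u = t * w ^ 3" using w by (simp add: t_def)
    have "septic (of_real u) (of_real w) (of_real (w * x)) = of_real (w ^ 7 * poly p x)"
      unfolding septic_def ut p_def poly_pCons poly_0 of_real_mult of_real_power of_real_add of_real_diff of_real_minus of_real_numeral of_real_1 of_real_0
      by Groebner_Basis.algebra
    with that show ?thesis by simp
  qed
  have z: "poly p (?l ! i) = 0" if "i < 7" for i
  proof -
    have "i \<in> {0,1,2,3,4,5,6}" using that by auto
    thus ?thesis using x0 x1 x2 x3 x4 x5 x6 by auto
  qed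
  have "inj_on ((!) ?l) {..<7}" by (intro inj_on_nth d) auto
  hence "inj_on (\<lambda>i. w * ?l ! i) {..<7}" using w by (auto simp: inj_on_def)
  thus ?thesis using r z by (intro exI[of _ "\<lambda>i. w * ?l ! i"]) blast
qed

lemma prod_linear_eqI:
  fixes p :: "complex poly"
  assumes "degree p = n" "coeff p n = 1" "inj_on b {..<n}" "\<And>i. i < n \<Longrightarrow> poly p (b i) = 0"
  shows "p = (\<Prod>i<n. [:- b i, 1:])"
proof (rule poly_eqI_degree_lead_coeff[where n = n and A = "b ` {..<n}"])
  have d: "degree (\<Prod>i\<in>A. [:- b i, 1:]) = card A" for A :: "nat set" by (subst degree_prod_eq_sum_degree) auto
  show "degree (\<Prod>i<n. [:- b i, 1:]) \<le> n" using d[of "{..<n}"] by simp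
  have "lead_coeff (\<Prod>i<n. [:- b i, 1:]) = 1" by (simp add: lead_coeff_prod)
  thus "coeff p n = coeff (\<Prod>i<n. [:- b i, 1:]) n" using d[of "{..<n}"] assms by simp
  show "n \<le> card (b ` {..<n})" using assms(3) by (simp add: card_image)
  fix z assume "z \<in> b ` {..<n}"
  then obtain i where "i < n" "z = b i" by auto
  thus "poly p z = poly (\<Prod>i<n. [:- b i, 1:]) z" using assms by (auto simp: poly_prod)
qed (use assms in auto)

lemma pderiv_prod_linear:
  fixes b :: "'i \<Rightarrow> complex"
  assumes "finite A" "i \<in> A"
  shows "poly (pderiv (\<Prod>k\<in>A. [:- b k, 1:])) (b i) = (\<Prod>k\<in>A - {i}. (b i - b k))"
proof -
  let ?G = "\<Prod>k\<in>A - {i}. [:- b k, 1:]"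
  have "(\<Prod>k\<in>A. [:- b k, 1:]) = [:- b i, 1:] * ?G" by (rule prod.remove[OF assms])
  hence "poly (pderiv (\<Prod>k\<in>A. [:- b k, 1:])) (b i) = poly ?G (b i)"
    by (simp add: pderiv_mult pderiv_pCons del: mult_pCons_left)
  thus ?thesis by (simp add: poly_prod)
qed

lemma pderiv2_prod_linear:
  fixes b :: "'i \<Rightarrow> complex"
  assumes "finite A" "i \<in> A"
  shows "poly (pderiv (pderiv (\<Prod>k\<in>A. [:- b k, 1:]))) (b i) = 2 * (\<Sum>a\<in>A - {i}. \<Prod>k\<in>A - {i} - {a}. (b i - b k))"
proof -
  let ?G = "\<Prod>k\<in>A - {i}. [:- b k, 1:]"
  have "(\<Prod>k\<in>A. [:- b k, 1:]) = [:- b i, 1:] * ?G" by (rule prod.remove[OF assms])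
  hence "poly (pderiv (pderiv (\<Prod>k\<in>A. [:- b k, 1:]))) (b i) = 2 * poly (pderiv ?G) (b i)"
    by (simp add: pderiv_mult pderiv_add pderiv_pCons del: mult_pCons_left)
  also have "poly (pderiv ?G) (b i) = (\<Sum>a\<in>A - {i}. \<Prod>k\<in>A - {i} - {a}. (b i - b k))"
    by (simp add: pderiv_prod poly_sum poly_prod pderiv_pCons)
  finally show ?thesis .
qed

context galfield
begin

text \<open>Since membership in \<open>ZK\<close> is carried along, congruence is compositional:
  introducing \<open>cgr_rules\<close> repeatedly transports a whole polynomial expression.\<close>

definition "cgr P a b \<longleftrightarrow> a \<in> ZK \<and> b \<in> ZK \<and> a - b \<in> P"

context
  fixes P assumes P: "pid P"
begin
lemma cgr_refl: "a \<in> ZK \<Longrightarrow> cgr P a a" by (simp add: cgr_def P_0[OF P])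
lemma cgr_add: "cgr P a b \<Longrightarrow> cgr P c d \<Longrightarrow> cgr P (a + c) (b + d)"
  using P_add[OF P, of "a - b" "c - d"] by (auto simp: cgr_def ZK_add algebra_simps)
lemma cgr_diff: "cgr P a b \<Longrightarrow> cgr P c d \<Longrightarrow> cgr P (a - c) (b - d)"
  using P_diff[OF P, of "a - b" "c - d"] by (auto simp: cgr_def ZK_diff algebra_simps)
lemma cgr_uminus: "cgr P a b \<Longrightarrow> cgr P (- a) (- b)"
  using P_uminus[OF P, of "a - b"] by (auto simp: cgr_def ZK_uminus)
lemma cgr_mult: "cgr P a b \<Longrightarrow> cgr P c d \<Longrightarrow> cgr P (a * c) (b * d)"
  using P_cong_mult[OF P, of a b c d] by (auto simp: cgr_def ZK_mult)
lemma cgr_power: "cgr P a b \<Longrightarrow> cgr P (a ^ n) (b ^ n)"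
  using P_cong_power[OF P, of a b] by (auto simp: cgr_def ZK_power)
lemma cgr_numeral: "cgr P (numeral n) (numeral n)" by (rule cgr_refl) (rule ZK_numeral)
lemma cgr_iff: "cgr P a b \<Longrightarrow> a \<in> P \<longleftrightarrow> b \<in> P" using P_cong_iff[OF P, of a b] by (auto simp: cgr_def)
lemma cgr_P: "a \<in> P \<Longrightarrow> cgr P a 0" using P_ZK[OF P, of a] ZK_0 by (simp add: cgr_def)
lemma cgr_of_int: "of_int (a - b) \<in> P \<Longrightarrow> cgr P (of_int a) (of_int b)" by (simp add: cgr_def ZK_of_int)
lemmas cgr_rules = cgr_add cgr_diff cgr_uminus cgr_mult cgr_power cgr_numeral

text \<open>Modulo \<open>P\<close> each \<open>b i\<close> in \<open>P\<close> contributes a factor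
  X, so the product is divisible by a power of X.\<close>

lemma coeff_prod_in:
  assumes "finite I" "\<And>i. i \<in> I \<Longrightarrow> b i \<in> ZK"
  shows "coeff (\<Prod>i\<in>I. [:- b i, 1:]) k \<in> ZK \<and> (k < card {i \<in> I. b i \<in> P} \<longrightarrow> coeff (\<Prod>i\<in>I. [:- b i, 1:]) k \<in> P)"
  using assms
proof (induction I arbitrary: k rule: finite_induct)
  case empty
  thus ?case by (cases k) (auto simp: ZK_0 ZK_1)
next
  case (insert a I)
  let ?q = "\<Prod>i\<in>I. [:- b i, 1:]"
  have IH: "coeff ?q k \<in> ZK" "k < card {i \<in> I. b i \<in> P} \<Longrightarrow> coeff ?q k \<in> P" for k using insert by auto
  have a: "b a \<in> ZK" using insert by simp
  have c: "coeff (\<Prod>i\<in>insert a I. [:- b i, 1:]) k = - b a * coeff ?q k + (case k of 0 \<Rightarrow> 0 | Suc j \<Rightarrow> coeff ?q j)"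
    using insert(1,2) by (simp add: coeff_pCons split: nat.splits)
  have z: "(case k of 0 \<Rightarrow> 0 | Suc j \<Rightarrow> coeff ?q j) \<in> ZK" using IH(1) ZK_0 by (auto split: nat.splits)
  have 1: "coeff (\<Prod>i\<in>insert a I. [:- b i, 1:]) k \<in> ZK"
    unfolding c by (intro ZK_add ZK_mult ZK_uminus a IH z)
  have "coeff (\<Prod>i\<in>insert a I. [:- b i, 1:]) k \<in> P" if k: "k < card {i \<in> insert a I. b i \<in> P}"
  proof (cases "b a \<in> P")
    case True
    have "{i \<in> insert a I. b i \<in> P} = insert a {i \<in> I. b i \<in> P}" using True by auto
    hence "k < Suc (card {i \<in> I. b i \<in> P})" using k insert(1,2) by simp
    hence "(case k of 0 \<Rightarrow> 0 | Suc j \<Rightarrow> coeff ?q j) \<in> P" using IH(2) P_0[OF P] by (auto split: nat.splits)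
    moreover have "- b a * coeff ?q k \<in> P" using P_r[OF P P_uminus[OF P True] IH(1)] .
    ultimately show ?thesis unfolding c by (intro P_add[OF P])
  next
    case False
    hence "{i \<in> insert a I. b i \<in> P} = {i \<in> I. b i \<in> P}" by auto
    hence "k < card {i \<in> I. b i \<in> P}" using k by simp
    hence "coeff ?q k \<in> P" "(case k of 0 \<Rightarrow> 0 | Suc j \<Rightarrow> coeff ?q j) \<in> P" using IH(2) P_0[OF P] by (auto split: nat.splits)
    thus ?thesis unfolding c by (intro P_add[OF P] P_l[OF P] ZK_uminus a)
  qed
  with 1 show ?case by blast
qed

end
end

text \<open>The product \<open>3 * 5 * 17 * 47 * 241\<close> of the odd primes dividing the constants in \<open>ram8_separable\<close> and
  \<open>double_root_quadratic\<close>.\<close>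

definition badN :: int where "badN = 2888385"

text \<open>Modulo the primes dividing \<open>badN\<close> the septic becomes the separable \<open>septic 1 1\<close>. As a power of 2, \<open>w\<close> is a unit at all
  odd primes. The inequalities make all roots real.\<close>

definition good :: "int \<Rightarrow> int \<Rightarrow> bool" where
  "good u w \<longleftrightarrow> odd u \<and> badN dvd u - 1 \<and> badN dvd w - 1 \<and> (\<exists>k>0. w = 2 ^ k) \<and> 0 \<le> u \<and> u \<le> w ^ 3"

locale septic_field = splitting R K \<theta> c m for R K \<theta> c m +
  fixes u w :: int and b :: "nat \<Rightarrow> complex"
  assumes good: "good u w" and b_inj: "inj_on b {..<7}" and R_def: "R = b ` {..<7}"
    and b_root: "\<And>i. i < 7 \<Longrightarrow> septic (of_int u) (of_int w) (b i) = 0"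
begin

abbreviation "U \<equiv> (of_int u :: complex)"
abbreviation "V \<equiv> (of_int w :: complex)"

lemma b_R: "i < 7 \<Longrightarrow> b i \<in> R" by (simp add: R_def)
lemma b_K: "i < 7 \<Longrightarrow> b i \<in> K" using b_R R_K by auto
lemma b_Z: "i < 7 \<Longrightarrow> b i \<in> ZK" using b_R R_K int by (auto simp: ZK_def)
lemma b_eq: "i < 7 \<Longrightarrow> j < 7 \<Longrightarrow> b i = b j \<longleftrightarrow> i = j" using b_inj by (auto simp: inj_on_def)
lemma R_card: "card R = 7" using b_inj by (simp add: R_def card_image)
lemma UV_Z: "U \<in> ZK" "V \<in> ZK" by (rule ZK_of_int)+

lemma septic_factor: "septic_poly U V = (\<Prod>i<7. [:- b i, 1:])"
  by (rule prod_linear_eqI[OF septic_poly_monic b_inj]) (simp add: septic_poly b_root)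

lemma septic_0_R: "septic U V y = 0 \<longleftrightarrow> y \<in> R"
  using arg_cong[OF septic_factor, of "\<lambda>p. poly p y"] by (auto simp: septic_poly poly_prod R_def)

lemma w_even: "even w" "w > 0" using good by (auto simp: good_def)

lemma w_notin: assumes P: "pid P" and p: "prime p" "of_nat p \<in> P" "odd p" shows "V \<notin> P"
proof
  assume "V \<in> P"
  hence "int p dvd w" using P_of_int_iff[OF P p(1,2)] by simp
  moreover obtain k where "w = 2 ^ k" using good by (auto simp: good_def)
  ultimately have "int p dvd 2 ^ k" by simp
  hence "int p dvd 2" using p(1) by (metis prime_dvd_power prime_int_nat_transfer prime_nat_int_transfer)
  hence "p dvd 2" by (metis int_dvd_int_iff of_nat_numeral)
  hence "p = 2" using p(1) by (metis primes_dvd_imp_eq two_is_prime_nat)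
  with p(3) show False by simp
qed

lemma double_d: assumes P: "pid P" and ij: "i < 7" "j < 7" "i \<noteq> j" "b i - b j \<in> P"
  shows "septic_d U V (b i) \<in> P"
proof -
  have "septic_d U V (b i) = (\<Prod>k\<in>{..<7} - {i}. (b i - b k))"
    unfolding septic_poly_d[symmetric] septic_factor by (rule pderiv_prod_linear) (use ij in auto)
  also have "\<dots> \<in> P"
    by (rule P_prod[OF P, where i = j and f = "\<lambda>k. b i - b k"]) (use ij b_Z ZK_diff in auto)
  finally show ?thesis .
qed

text \<open>Each product in the second derivative at \<open>b i\<close> omits a single factor
  \<open>b i - b a\<close>, so the factor for \<open>j\<close> or the one for \<open>k\<close>
  survives.\<close>

lemma triple_dd:
  assumes P: "pid P" and ij: "i < 7" "j < 7" "k < 7" "i \<noteq> j" "i \<noteq> k" "j \<noteq> k" "b i - b j \<in> P" "b i - b k \<in> P"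
  shows "septic_dd U V (b i) \<in> P"
proof -
  have "septic_dd U V (b i) = 2 * (\<Sum>a\<in>{..<7} - {i}. \<Prod>k\<in>{..<7} - {i} - {a}. (b i - b k))"
    unfolding septic_poly_dd[symmetric] septic_factor by (rule pderiv2_prod_linear) (use ij in auto)
  also have "\<dots> \<in> P"
  proof (intro P_l[OF P] ZK_numeral P_sum[OF P])
    fix a assume a: "a \<in> {..<7} - {i}"
    have z: "b i - b l \<in> ZK" if "l \<in> {..<7} - {i} - {a}" for l using that ij(1) b_Z ZK_diff by auto
    show "(\<Prod>k\<in>{..<7} - {i} - {a}. (b i - b k)) \<in> P"
    proof (cases "a = j")
      case True
      show ?thesis by (rule P_prod[OF P, where i = k and f = "\<lambda>k. b i - b k"]) (use z ij True in auto)
    next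
      case False
      show ?thesis by (rule P_prod[OF P, where i = j and f = "\<lambda>k. b i - b k"]) (use z ij False in auto)
    qed
  qed
  finally show ?thesis .
qed

lemma distinct_mod_bad:
  assumes P: "pid P" and p: "prime p" "of_nat p \<in> P" "int p dvd badN" and ij: "i < 7" "j < 7" "i \<noteq> j"
  shows "b i - b j \<notin> P"
proof
  assume a: "b i - b j \<in> P"
  let ?y = "b i"
  have y: "?y \<in> ZK" by (rule b_Z[OF ij(1)])
  have "int p dvd u - 1" "int p dvd w - 1" using good p(3) by (auto simp: good_def intro: dvd_trans)
  hence "of_int (u - 1) \<in> P" "of_int (w - 1) \<in> P" using P_of_int_iff[OF P p(1,2)] by blast+
  hence "cgr P (of_int u) (of_int 1)" "cgr P (of_int w) (of_int 1)" using cgr_of_int[OF P] by blast+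
  hence uw: "cgr P U 1" "cgr P V 1" by simp_all
  note cr = cgr_rules[OF P] uw cgr_refl[OF P y]
  have "cgr P (septic U V ?y) (septic 1 1 ?y)" unfolding septic_def by (intro cr)
  hence 1: "septic 1 1 ?y \<in> P" using cgr_iff[OF P] b_root[OF ij(1)] P_0[OF P] by metis
  have "cgr P (septic_d U V ?y) (septic_d 1 1 ?y)" unfolding septic_d_def by (intro cr)
  hence 2: "septic_d 1 1 ?y \<in> P" using cgr_iff[OF P] double_d[OF P ij a] by metis
  have "(4996785307593900032 :: complex) \<in> P"
    unfolding septic_1_separable[of ?y]
    by (intro P_add[OF P] P_l[OF P _ 1] P_l[OF P _ 2] ZK_closed y)
  hence "int p dvd 4996785307593900032" using P_of_int_iff[OF P p(1,2), of 4996785307593900032] by simp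
  hence d: "p dvd 4996785307593900032" by (metis int_dvd_int_iff of_nat_numeral)
  have "p dvd 2888385" using p(3) unfolding badN_def by (metis int_dvd_int_iff of_nat_numeral)
  moreover have "(2888385 :: nat) = 3 * 5 * 17 * 47 * 241" by simp
  ultimately have "p dvd 3 * 5 * 17 * 47 * 241" by argo
  hence "p dvd 3 \<or> p dvd 5 \<or> p dvd 17 \<or> p dvd 47 \<or> p dvd 241" using p(1) by (simp add: prime_dvd_mult_iff del: numeral_times_numeral mult_numeral_1)
  moreover have "prime (3::nat)" "prime (5::nat)" "prime (17::nat)" "prime (47::nat)" "prime (241::nat)" by simp_all
  ultimately have "p \<in> {3, 5, 17, 47, 241}" using p(1) primes_dvd_imp_eq by blast
  with d show False by auto
qed

text \<open>The number \<open>2 ^ 40 * badN ^ 3\<close> is a common multiple of the constants that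
  have to be inverted modulo \<open>P\<close>. A root in \<open>P\<close> would put
  \<open>4096 * V ^ 7\<close> into \<open>P\<close>, and with the root cancelled
  \<open>ramification_poly\<close> passes from \<open>septic_d\<close> to
  \<open>ram8\<close>.\<close>

lemma
  assumes P: "pid P" and p: "prime p" "of_nat p \<in> P" "odd p" "\<not> int p dvd badN"
  shows not_N: "n dvd 2 ^ 40 * badN ^ 3 \<Longrightarrow> of_int n \<notin> P" and b_notin: "i < 7 \<Longrightarrow> b i \<notin> P"
    and ram8_in: "i < 7 \<Longrightarrow> septic_d U V (b i) \<in> P \<Longrightarrow> ram8 V (b i) \<in> P"
proof -
  have p2: "\<not> int p dvd 2"
  proof
    assume "int p dvd 2"
    hence "p dvd 2" by (metis int_dvd_int_iff of_nat_numeral)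
    hence "p = 2" using p(1) by (metis primes_dvd_imp_eq two_is_prime_nat)
    with p(3) show False by simp
  qed
  have ip: "prime (int p)" using p(1) by simp
  show 1: "n dvd 2 ^ 40 * badN ^ 3 \<Longrightarrow> of_int n \<notin> P" for n
  proof
    assume "n dvd 2 ^ 40 * badN ^ 3" "of_int n \<in> P"
    hence "int p dvd 2 ^ 40 * badN ^ 3" using P_of_int_iff[OF P p(1,2)] dvd_trans by blast
    hence "int p dvd 2 \<or> int p dvd badN" using ip by (metis prime_dvd_mult_iff prime_dvd_power)
    with p2 p(4) show False by blast
  qed
  have V: "V \<notin> P" by (rule w_notin[OF P p(1-3)])
  show 2: "b i \<notin> P" if i: "i < 7" for i
  proof
    assume a: "b i \<in> P"
    let ?y = "b i"
    have y: "?y \<in> ZK" by (rule b_Z[OF i])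
    have "4096 * V ^ 7 = (?y ^ 6 - 46 * V * ?y ^ 5 + 541 * V ^ 2 * ?y ^ 4 - (850 * V ^ 3 + U) * ?y ^ 3
        + (U - 3742 * V ^ 3) * V * ?y ^ 2 + 5120 * V ^ 5 * ?y + 3328 * V ^ 6) * ?y - septic U V ?y"
      unfolding septic_def by Groebner_Basis.algebra
    also have "\<dots> \<in> P" unfolding b_root[OF i]
      by (intro P_diff[OF P] P_0[OF P] P_l[OF P _ a] ZK_closed UV_Z y)
    finally have "of_int 4096 * V ^ 7 \<in> P" by simp
    moreover have "(of_int 4096 :: complex) \<notin> P" by (rule 1) (simp add: badN_def)
    ultimately have "V ^ 7 \<in> P" using P_prime[OF P] ZK_of_int UV_Z ZK_power by blast
    thus False using P_power[OF P] UV_Z V by blast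
  qed
  show "ram8 V (b i) \<in> P" if i: "i < 7" and d: "septic_d U V (b i) \<in> P" for i
  proof -
    let ?y = "b i"
    have y: "?y \<in> ZK" by (rule b_Z[OF i])
    have "?y ^ 2 * ram8 V ?y \<in> P" unfolding ramification_poly[of ?y V U] b_root[OF i]
      by (intro P_diff[OF P] P_l[OF P _ d] P_l[OF P _ P_0[OF P]] ZK_closed UV_Z y)
    moreover have r: "ram8 V ?y \<in> ZK" unfolding ram8_def by (intro ZK_closed UV_Z y)
    ultimately have "?y ^ 2 \<in> P \<or> ram8 V ?y \<in> P" using P_prime[OF P] ZK_power y by blast
    thus ?thesis using 2[OF i] P_power[OF P y] by blast
  qed
qed

text \<open>A triple root modulo \<open>P\<close> would be a common root of \<open>ram8\<close> and
  \<open>ram8_d\<close>, by \<open>ramification_poly\<close> and \<open>ramification_poly_d\<close>;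
  this contradicts \<open>ram8_separable\<close>.\<close>

lemma no_triple:
  assumes P: "pid P" and p: "prime p" "of_nat p \<in> P" "odd p" "\<not> int p dvd badN"
    and ij: "i < 7" "j < 7" "k < 7" "i \<noteq> j" "i \<noteq> k" "j \<noteq> k" "b i - b j \<in> P" "b i - b k \<in> P"
  shows False
proof -
  let ?y = "b i"
  have y: "?y \<in> ZK" by (rule b_Z[OF ij(1)])
  have r: "ram8 V ?y \<in> P" by (rule ram8_in[OF P p ij(1) double_d[OF P ij(1,2,4,7)]])
  have dd: "septic_dd U V ?y \<in> P" by (rule triple_dd[OF P ij])
  have "?y ^ 2 * ram8_d V ?y + 2 * ?y * ram8 V ?y \<in> P"
    unfolding ramification_poly_d[of ?y V U] b_root[OF ij(1)]
    by (intro P_diff[OF P] P_l[OF P _ dd] P_l[OF P _ P_0[OF P]] ZK_closed UV_Z y)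
  moreover have "2 * ?y * ram8 V ?y \<in> P" by (intro P_l[OF P _ r] ZK_closed y)
  ultimately have "(?y ^ 2 * ram8_d V ?y + 2 * ?y * ram8 V ?y) - 2 * ?y * ram8 V ?y \<in> P" by (rule P_diff[OF P])
  hence "?y ^ 2 * ram8_d V ?y \<in> P" by simp
  moreover have rz: "ram8_d V ?y \<in> ZK" unfolding ram8_d_def by (intro ZK_closed UV_Z y)
  ultimately have rd: "ram8_d V ?y \<in> P"
    using P_prime[OF P] ZK_power y b_notin[OF P p ij(1)] P_power[OF P y] by blast
  have "60498106515456000 * V ^ 14 \<in> P" unfolding ram8_separable[of V ?y]
    by (intro P_add[OF P] P_l[OF P _ r] P_l[OF P _ rd] ZK_closed UV_Z y)
  hence "of_int 60498106515456000 * V ^ 14 \<in> P" by simp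
  moreover have "(of_int 60498106515456000 :: complex) \<notin> P" by (rule not_N[OF P p]) (simp add: badN_def)
  ultimately have "V ^ 14 \<in> P" using P_prime[OF P] ZK_of_int UV_Z ZK_power by blast
  thus False using P_power[OF P] UV_Z w_notin[OF P p(1-3)] by blast
qed

lemma quad_in:
  assumes P: "pid P" and p: "prime p" "of_nat p \<in> P" "odd p" "\<not> int p dvd badN"
    and ij: "i < 7" "j < 7" "i \<noteq> j" "b i - b j \<in> P"
  shows "2581252544659456000 * V ^ 18 * b i ^ 2 + quad1 U V * b i + quad0 U V \<in> P"
proof -
  have y: "b i \<in> ZK" by (rule b_Z[OF ij(1)])
  have r: "ram8 V (b i) \<in> P" by (rule ram8_in[OF P p ij(1) double_d[OF P ij]])
  show ?thesis unfolding double_root_quadratic b_root[OF ij(1)]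
    by (intro P_add[OF P] P_l[OF P _ r] P_l[OF P _ P_0[OF P]] ZK_closed UV_Z y)
qed

text \<open>Three incongruent double roots would be three roots of a quadratic whose leading
  coefficient is a unit modulo \<open>P\<close>. Dividing the differences of its values by the
  differences of the roots leads to a contradiction.\<close>

lemma no_three_pairs:
  assumes P: "pid P" and p: "prime p" "of_nat p \<in> P" "odd p" "\<not> int p dvd badN"
    and i: "i < 7" "i' < 7" "i \<noteq> i'" "b i - b i' \<in> P"
    and j: "j < 7" "j' < 7" "j \<noteq> j'" "b j - b j' \<in> P"
    and k: "k < 7" "k' < 7" "k \<noteq> k'" "b k - b k' \<in> P"
  shows "b i - b j \<in> P \<or> b i - b k \<in> P \<or> b j - b k \<in> P"
proof (rule ccontr)
  assume c: "\<not> ?thesis"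
  let ?a = "2581252544659456000 * V ^ 18" and ?b = "quad1 U V" and ?c = "quad0 U V"
  have z: "?a \<in> ZK" "?b \<in> ZK" "b i \<in> ZK" "b j \<in> ZK" "b k \<in> ZK"
    using b_Z i j k unfolding quad1_def by (auto intro!: ZK_closed UV_Z)
  note q = quad_in[OF P p i] quad_in[OF P p j] quad_in[OF P p k]
  have e: "?a * (x + y) + ?b \<in> P" if x: "x \<in> ZK" "y \<in> ZK" "x - y \<notin> P"
    "?a * x ^ 2 + ?b * x + ?c \<in> P" "?a * y ^ 2 + ?b * y + ?c \<in> P" for x y
  proof -
    have "(x - y) * (?a * (x + y) + ?b) = (?a * x ^ 2 + ?b * x + ?c) - (?a * y ^ 2 + ?b * y + ?c)" by Groebner_Basis.algebra
    also have "\<dots> \<in> P" by (rule P_diff[OF P x(4,5)])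
    finally have "x - y \<in> P \<or> ?a * (x + y) + ?b \<in> P" by (intro P_prime[OF P] ZK_diff ZK_add ZK_mult[of ?a] x z)
    with x(3) show ?thesis by blast
  qed
  have "(?a * (b i + b j) + ?b) - (?a * (b i + b k) + ?b) \<in> P"
    using c by (intro P_diff[OF P] e z q) auto
  moreover have "(?a * (b i + b j) + ?b) - (?a * (b i + b k) + ?b) = of_int 2581252544659456000 * (V ^ 18 * (b j - b k))" by (simp add: algebra_simps)
  ultimately have "of_int 2581252544659456000 * (V ^ 18 * (b j - b k)) \<in> P" by simp
  moreover have "(of_int 2581252544659456000 :: complex) \<notin> P" by (rule not_N[OF P p]) (simp add: badN_def)
  ultimately have "V ^ 18 * (b j - b k) \<in> P"
    using P_prime[OF P] ZK_of_int ZK_mult[OF ZK_power[OF UV_Z(2)] ZK_diff[OF z(4,5)]] by blast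
  hence "V ^ 18 \<in> P" using P_prime[OF P ZK_power[OF UV_Z(2)] ZK_diff[OF z(4,5)]] c by blast
  thus False using P_power[OF P] UV_Z w_notin[OF P p(1-3)] by blast
qed

end

section \<open>The prime 2\<close>

text \<open>The monic polynomial with the roots \<open>16 * w ^ 2 / y\<close> for the roots
  \<open>y\<close> of \<open>septic u w\<close>. With this scaling both polynomials have the shape
  of \<open>y ^ 7 - u * y ^ 4\<close> once \<open>w\<close> is replaced by 0, so that the two kinds
  of residues at 2 play symmetric roles.\<close>

definition reciprocal_septic :: "complex \<Rightarrow> complex \<Rightarrow> complex poly" where
  "reciprocal_septic u w = [:- 65536 * w ^ 7, 188416 * w ^ 6, - 138496 * w ^ 5, 16 * w * (850 * w ^ 3 + u),
     3742 * w ^ 3 - u, - 320 * w ^ 2, - 13 * w, 1:]"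

lemma reciprocal_septic_root:
  assumes "z * y = 16 * w ^ 2" "septic u w y = 0" "y \<noteq> 0"
  shows "poly (reciprocal_septic u w) z = 0"
proof -
  have "poly (reciprocal_septic u w) z * y ^ 7 = (z * y) ^ 7 - 13 * w * (z * y) ^ 6 * y - 320 * w ^ 2 * (z * y) ^ 5 * y ^ 2
      + (3742 * w ^ 3 - u) * (z * y) ^ 4 * y ^ 3 + 16 * w * (850 * w ^ 3 + u) * (z * y) ^ 3 * y ^ 4
      - 138496 * w ^ 5 * (z * y) ^ 2 * y ^ 5 + 188416 * w ^ 6 * (z * y) * y ^ 6 - 65536 * w ^ 7 * y ^ 7"
    unfolding reciprocal_septic_def poly_pCons poly_0 by Groebner_Basis.algebra
  also have "\<dots> = - 65536 * w ^ 7 * septic u w y" unfolding assms(1) septic_def by Groebner_Basis.algebra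
  finally show ?thesis using assms by simp
qed

lemma reciprocal_septic_poly:
  "poly (reciprocal_septic u w) z = z ^ 7 - 13 * w * z ^ 6 - 320 * w ^ 2 * z ^ 5 + (3742 * w ^ 3 - u) * z ^ 4
     + 16 * w * (850 * w ^ 3 + u) * z ^ 3 - 138496 * w ^ 5 * z ^ 2 + 188416 * w ^ 6 * z - 65536 * w ^ 7"
  "poly (pderiv (reciprocal_septic u w)) z = 7 * z ^ 6 - 78 * w * z ^ 5 - 1600 * w ^ 2 * z ^ 4 + 4 * (3742 * w ^ 3 - u) * z ^ 3
     + 48 * w * (850 * w ^ 3 + u) * z ^ 2 - 276992 * w ^ 5 * z + 188416 * w ^ 6"
  unfolding reciprocal_septic_def pderiv_pCons poly_pCons poly_0 poly_add pderiv_0 by Groebner_Basis.algebra+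

lemma reciprocal_septic_monic: "degree (reciprocal_septic u w) = 7" "coeff (reciprocal_septic u w) 7 = 1"
    "coeff (reciprocal_septic u w) 4 = 3742 * w ^ 3 - u"
  by (simp_all add: reciprocal_septic_def numeral_eq_Suc)

context septic_field
begin

section \<open>Automorphisms as permutations of the indices of the roots\<close>

definition pl :: "(complex \<Rightarrow> complex) \<Rightarrow> nat \<Rightarrow> nat" where "pl \<sigma> i = (SOME j. j < 7 \<and> b j = \<sigma> (b i))"

lemma pl: assumes "\<sigma> \<in> Gal K" "i < 7" shows pl_less: "pl \<sigma> i < 7" and b_pl: "b (pl \<sigma> i) = \<sigma> (b i)"
proof -
  have "\<sigma> (b i) \<in> R" by (rule Gal_R[OF assms(1) b_R[OF assms(2)]])
  hence "\<exists>j. j < 7 \<and> b j = \<sigma> (b i)" by (auto simp: R_def)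
  from someI_ex[OF this] show "pl \<sigma> i < 7" "b (pl \<sigma> i) = \<sigma> (b i)" unfolding pl_def by auto
qed

lemma pl_eqI: "\<sigma> \<in> Gal K \<Longrightarrow> i < 7 \<Longrightarrow> j < 7 \<Longrightarrow> \<sigma> (b i) = b j \<Longrightarrow> pl \<sigma> i = j"
  using b_eq b_pl pl_less by metis

lemma pl_inj: assumes "\<sigma> \<in> Gal K" "i < 7" "j < 7" "pl \<sigma> i = pl \<sigma> j" shows "i = j"
proof -
  have "\<sigma> (b i) = \<sigma> (b j)" using b_pl assms by metis
  hence "b i = b j" by (rule inj_onD[OF Gal_inj[OF assms(1)] _ b_K[OF assms(2)] b_K[OF assms(3)]])
  thus ?thesis using b_eq assms(2,3) by blast
qed

definition plist :: "(complex \<Rightarrow> complex) \<Rightarrow> nat list" where "plist \<sigma> = map (pl \<sigma>) [0..<7]"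

lemma plist_nth: "i < 7 \<Longrightarrow> plist \<sigma> ! i = pl \<sigma> i" by (simp add: plist_def)
lemma plist_length: "length (plist \<sigma>) = 7" by (simp add: plist_def)

lemma plist_perm7: assumes "\<sigma> \<in> Gal K" shows "perm7 (plist \<sigma>)"
  using pl_less[OF assms] pl_inj[OF assms] by (auto simp: perm7_def plist_def distinct_map inj_on_def)

lemma pl_mult: assumes "\<sigma> \<in> Gal K" "\<tau> \<in> Gal K" "i < 7"
  shows "pl (\<sigma> \<otimes>\<^bsub>GK\<^esub> \<tau>) i = pl \<sigma> (pl \<tau> i)"
  using assms by (intro pl_eqI) (auto simp: Gal_compose b_K pl_less b_pl)

lemma plist_mult: assumes "\<sigma> \<in> Gal K" "\<tau> \<in> Gal K"
  shows "plist (\<sigma> \<otimes>\<^bsub>GK\<^esub> \<tau>) = cmp (plist \<sigma>) (plist \<tau>)"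
  by (rule list7_eqI) (use assms in \<open>auto simp: cmp_nth cmp_length plist_length plist_nth pl_mult pl_less\<close>)

lemma Gal_eq_pl: assumes "\<sigma> \<in> Gal K" "\<tau> \<in> Gal K" "\<And>i. i < 7 \<Longrightarrow> pl \<sigma> i = pl \<tau> i" shows "\<sigma> = \<tau>"
proof (rule Gal_eq_R[OF assms(1,2)])
  fix r assume "r \<in> R"
  then obtain i where i: "i < 7" "r = b i" by (auto simp: R_def)
  thus "\<sigma> r = \<tau> r" using b_pl[OF assms(1) i(1)] b_pl[OF assms(2) i(1)] assms(3)[OF i(1)] by simp
qed

lemma plist_inj: assumes "\<sigma> \<in> Gal K" "\<tau> \<in> Gal K" "plist \<sigma> = plist \<tau>" shows "\<sigma> = \<tau>"
  by (rule Gal_eq_pl[OF assms(1,2)]) (use assms(3) in \<open>simp add: plist_nth[symmetric]\<close>)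

lemma pl_one: "i < 7 \<Longrightarrow> pl \<one>\<^bsub>GK\<^esub> i = i" by (rule pl_eqI[OF one_Gal]) (auto simp: one_app b_K)

lemma plist_one: "plist \<one>\<^bsub>GK\<^esub> = id7"
  by (rule list7_eqI) (simp_all add: plist_length id7_length plist_nth pl_one id7_nth)

lemma iner_trivial:
  assumes P: "pid P" and f: "\<And>\<sigma> i. \<sigma> \<in> iner P \<Longrightarrow> i < 7 \<Longrightarrow> pl \<sigma> i = i"
  shows "iner P = {\<one>\<^bsub>GK\<^esub>}"
proof -
  have "\<sigma> = \<one>\<^bsub>GK\<^esub>" if s: "\<sigma> \<in> iner P" for \<sigma>
    by (rule Gal_eq_pl[OF _ one_Gal]) (use s f pl_one in \<open>auto simp: iner_def\<close>)
  thus ?thesis using one_iner[OF P] by blast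
qed

lemma iner_bad:
  assumes P: "pid P" and p: "prime p" "of_nat p \<in> P" "int p dvd badN" shows "iner P = {\<one>\<^bsub>GK\<^esub>}"
proof (rule iner_trivial[OF P], rule ccontr)
  fix \<sigma> i assume s: "\<sigma> \<in> iner P" and i: "i < 7" and n: "pl \<sigma> i \<noteq> i"
  have sG: "\<sigma> \<in> Gal K" using s by (simp add: iner_def)
  have "\<sigma> (b i) - b i \<in> P" using s b_Z[OF i] by (simp add: iner_def)
  hence "b (pl \<sigma> i) - b i \<in> P" using b_pl[OF sG i] by simp
  thus False using distinct_mod_bad[OF P p pl_less[OF sG i] i n] by simp
qed

definition "z i = 16 * V ^ 2 / b i"

lemma V0: "V \<noteq> 0" using w_even by simp

lemma b_nz: assumes "i < 7" shows "b i \<noteq> 0"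
proof
  assume "b i = 0"
  hence "septic U V (b i) = - 4096 * V ^ 7" by (simp add: septic_def)
  thus False using b_root[OF assms] V0 by simp
qed

lemma z_b: "i < 7 \<Longrightarrow> z i * b i = 16 * V ^ 2" by (simp add: z_def b_nz)

lemma z_root: "i < 7 \<Longrightarrow> poly (reciprocal_septic U V) (z i) = 0"
  by (rule reciprocal_septic_root[OF z_b b_root b_nz])

lemma z_Z: assumes i: "i < 7" shows "z i \<in> ZK"
proof -
  define p :: "int poly" where "p = [:- 65536 * w ^ 7, 188416 * w ^ 6, - 138496 * w ^ 5, 16 * w * (850 * w ^ 3 + u),
     3742 * w ^ 3 - u, - 320 * w ^ 2, - 13 * w, 1:]"
  have "map_poly of_int p = reciprocal_septic U V" unfolding p_def reciprocal_septic_def by (simp add: map_poly_pCons)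
  moreover have "lead_coeff p = 1" by (simp add: p_def)
  ultimately have "algebraic_int (z i)" using z_root[OF i] unfolding algebraic_int_altdef_ipoly by metis
  moreover have "z i \<in> K" unfolding z_def using ZK_K[OF UV_Z(2)] b_K[OF i] ZK_K[OF ZK_numeral]
    by (intro sfield_closed[OF K])
  ultimately show ?thesis by (simp add: ZK_def)
qed

lemma z_inj: "inj_on z {..<7}"
proof (rule inj_onI)
  fix i j assume ij: "i \<in> {..<7}" "j \<in> {..<7}" "z i = z j"
  hence "b i = b j" using V0 b_nz by (auto simp: z_def field_simps)
  thus "i = j" using ij b_eq by auto
qed

lemma z_factor: "reciprocal_septic U V = (\<Prod>i<7. [:- z i, 1:])"
  by (rule prod_linear_eqI[OF reciprocal_septic_monic(1,2) z_inj z_root])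

lemma Gal_z: assumes s: "\<sigma> \<in> Gal K" and i: "i < 7" shows "\<sigma> (z i) = z (pl \<sigma> i)"
proof -
  have zK: "z i \<in> K" by (rule ZK_K[OF z_Z[OF i]])
  have "\<sigma> (z i * b i) = \<sigma> (of_int (16 * w ^ 2))" using z_b[OF i] by simp
  hence "\<sigma> (z i) * b (pl \<sigma> i) = 16 * V ^ 2" unfolding Gal_times[OF s zK b_K[OF i]] Gal_of_int[OF s] b_pl[OF s i] by simp
  thus ?thesis using b_nz[OF pl_less[OF s i]] by (simp add: z_def field_simps)
qed

context
  fixes P assumes P: "pid P" and two: "of_nat 2 \<in> P"
begin

section \<open>Residues modulo a prime above 2\<close>

lemma P2_int: "of_int n \<in> P \<longleftrightarrow> even n" using P_of_int_iff[OF P two_is_prime_nat two, of n] by simp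

lemma P2_even: assumes "x \<in> ZK" shows "2 * x \<in> P" using P_r[OF P two assms] by simp

lemma P2_V: "cgr P V 0" using cgr_P[OF P] P2_int w_even by simp

lemma P2_U: "cgr P U 1" using cgr_of_int[OF P, of u 1, unfolded P2_int] good by (simp add: good_def)

lemmas P2_rules = cgr_rules[OF P] P2_V cgr_refl[OF P]

lemma P2_b_or_z: assumes i: "i < 7" shows "b i \<in> P \<or> z i \<in> P"
proof -
  have "of_int (16 * w ^ 2) \<in> P" unfolding P2_int by simp
  hence "z i * b i \<in> P" using z_b[OF i] by simp
  thus ?thesis using P_prime[OF P z_Z[OF i] b_Z[OF i]] by blast
qed

text \<open>The residue of \<open>y\<close> satisfies \<open>y ^ 3 * (y ^ 4 - y) = 0\<close>, so it
  lies in the field with four elements.\<close>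

lemma P2_fix4: assumes y: "y \<in> ZK" and e: "y ^ 7 - U * y ^ 4 \<in> P" shows "y ^ 4 - y \<in> P"
proof -
  have "cgr P (y ^ 7 - U * y ^ 4) (y ^ 7 - 1 * y ^ 4)" by (intro P2_rules P2_U y ZK_power)
  hence "y ^ 7 - y ^ 4 \<in> P" using e cgr_iff[OF P] by simp
  moreover have "y ^ 7 - y ^ 4 = y ^ 3 * (y ^ 4 - y)" by Groebner_Basis.algebra
  ultimately have "y ^ 3 \<in> P \<or> y ^ 4 - y \<in> P" using P_prime[OF P, of "y ^ 3" "y ^ 4 - y"] y ZK_closed by simp
  moreover have "y ^ 4 - y \<in> P" if "y \<in> P" using that P_diff[OF P P_power'[OF P that]] by simp
  ultimately show ?thesis using P_power[OF P y] by blast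
qed

lemma P2_b4: assumes i: "i < 7" shows "b i ^ 4 - b i \<in> P"
proof (rule P2_fix4[OF b_Z[OF i]])
  have "cgr P (septic U V (b i)) (septic U 0 (b i))" unfolding septic_def by (intro P2_rules UV_Z b_Z i)
  moreover have "septic U 0 (b i) = b i ^ 7 - U * b i ^ 4" by (simp add: septic_def)
  ultimately show "b i ^ 7 - U * b i ^ 4 \<in> P" using cgr_iff[OF P] b_root[OF i] P_0[OF P] by metis
qed

lemma P2_z4: assumes i: "i < 7" shows "z i ^ 4 - z i \<in> P"
proof (rule P2_fix4[OF z_Z[OF i]])
  have "cgr P (poly (reciprocal_septic U V) (z i)) (poly (reciprocal_septic U 0) (z i))"
    unfolding reciprocal_septic_poly by (intro P2_rules UV_Z z_Z i)
  moreover have "poly (reciprocal_septic U 0) (z i) = z i ^ 7 - U * z i ^ 4" by (simp add: reciprocal_septic_poly)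
  ultimately show "z i ^ 7 - U * z i ^ 4 \<in> P" using cgr_iff[OF P] z_root[OF i] P_0[OF P] by metis
qed

text \<open>Modulo 2 the derivative is \<open>y ^ 6\<close>, so only the residue 0 can be a multiple
  root.\<close>

lemma P2_double:
  fixes y :: "nat \<Rightarrow> complex"
  assumes ij: "i < 7" "j < 7" "i \<noteq> j" and y: "\<And>k. k < 7 \<Longrightarrow> y k \<in> ZK" "y i - y j \<in> P"
    and f: "f = (\<Prod>i<7. [:- y i, 1:])" and d: "cgr P (poly (pderiv f) (y i)) (7 * y i ^ 6 - 4 * U * y i ^ 3)"
  shows "y i \<in> P"
proof -
  have "poly (pderiv f) (y i) = (\<Prod>k\<in>{..<7} - {i}. (y i - y k))"
    unfolding f by (rule pderiv_prod_linear) (use ij in auto)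
  also have "\<dots> \<in> P"
    by (rule P_prod[OF P, where i = j and f = "\<lambda>k. y i - y k"]) (use ij y ZK_diff in auto)
  finally have "7 * y i ^ 6 - 4 * U * y i ^ 3 \<in> P" using d cgr_iff[OF P] by blast
  from P_diff[OF P this P2_even[of "3 * y i ^ 6 - 2 * U * y i ^ 3"]]
  have "(7 * y i ^ 6 - 4 * U * y i ^ 3) - 2 * (3 * y i ^ 6 - 2 * U * y i ^ 3) \<in> P"
    using y(1)[OF ij(1)] UV_Z by (simp add: ZK_closed)
  hence "y i ^ 6 \<in> P" by (simp add: algebra_simps)
  thus ?thesis using P_power[OF P y(1)[OF ij(1)]] by blast
qed

lemma P2_card:
  shows "card {i \<in> {..<7}. b i \<in> P} \<le> 4" "card {i \<in> {..<7}. z i \<in> P} \<le> 4"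
proof -
  have u: "odd u" using good by (simp add: good_def)
  have "of_int (- (850 * w ^ 3 + u)) \<notin> P" unfolding P2_int using u by simp
  hence "coeff (\<Prod>i<7. [:- b i, 1:]) 4 \<notin> P" unfolding septic_factor[symmetric] septic_poly_coeff4 by simp
  thus "card {i \<in> {..<7}. b i \<in> P} \<le> 4" using coeff_prod_in[OF P, of "{..<7}" b 4] b_Z by force
  have "of_int (3742 * w ^ 3 - u) \<notin> P" unfolding P2_int using u by simp
  hence "coeff (\<Prod>i<7. [:- z i, 1:]) 4 \<notin> P" unfolding z_factor[symmetric] reciprocal_septic_monic by simp
  thus "card {i \<in> {..<7}. z i \<in> P} \<le> 4" using coeff_prod_in[OF P, of "{..<7}" z 4] z_Z by force
qed

text \<open>Since the coefficients of degree 4 of the two septics are odd, at most four of the \<open>b i\<close> and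
  at most four of the \<open>z i\<close> lie in \<open>P\<close>; as \<open>b i * z i\<close> is even, at most one index belongs to both.\<close>

lemma P2_distinct:
  assumes ij: "i < 7" "j < 7" and bz: "b i - b j \<in> P" "z i - z j \<in> P" shows "i = j"
proof (rule ccontr)
  assume n: "i \<noteq> j"
  have "b i \<in> P"
  proof (rule P2_double[OF ij n b_Z bz(1) septic_factor])
    have "cgr P (septic_d U V (b i)) (septic_d U 0 (b i))" unfolding septic_d_def by (intro P2_rules UV_Z b_Z ij)
    thus "cgr P (poly (pderiv (septic_poly U V)) (b i)) (7 * b i ^ 6 - 4 * U * b i ^ 3)"
      by (simp add: septic_poly_d septic_d_def)
  qed
  moreover have "z i \<in> P"
  proof (rule P2_double[OF ij n z_Z bz(2) z_factor])
    have "cgr P (poly (pderiv (reciprocal_septic U V)) (z i)) (poly (pderiv (reciprocal_septic U 0)) (z i))"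
      unfolding reciprocal_septic_poly by (intro P2_rules UV_Z z_Z ij)
    thus "cgr P (poly (pderiv (reciprocal_septic U V)) (z i)) (7 * z i ^ 6 - 4 * U * z i ^ 3)"
      by (simp add: reciprocal_septic_poly)
  qed
  ultimately have s: "{i, j} \<subseteq> {i \<in> {..<7}. b i \<in> P} \<inter> {i \<in> {..<7}. z i \<in> P}"
    using ij P_cong_iff[OF P bz(1)] P_cong_iff[OF P bz(2)] by auto
  have "card {i, j} \<le> card ({i \<in> {..<7}. b i \<in> P} \<inter> {i \<in> {..<7}. z i \<in> P})" by (rule card_mono[OF _ s]) simp
  moreover have "{i \<in> {..<7}. b i \<in> P} \<union> {i \<in> {..<7}. z i \<in> P} = {..<7}" using P2_b_or_z by auto
  hence "card {i \<in> {..<7}. b i \<in> P} + card {i \<in> {..<7}. z i \<in> P} =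
      7 + card ({i \<in> {..<7}. b i \<in> P} \<inter> {i \<in> {..<7}. z i \<in> P})"
    using card_Un_Int[of "{i \<in> {..<7}. b i \<in> P}" "{i \<in> {..<7}. z i \<in> P}"] by simp
  ultimately show False using P2_card n by simp
qed

lemma P2_fixedI:
  assumes s: "\<sigma> \<in> Gal K" and i: "i < 7" and "\<sigma> (b i) - b i \<in> P" "\<sigma> (z i) - z i \<in> P" shows "pl \<sigma> i = i"
  by (rule P2_distinct[OF pl_less[OF s i] i]) (use assms b_pl[OF s i] Gal_z[OF s i] in simp_all)

lemma iner_2: "iner P = {\<one>\<^bsub>GK\<^esub>}"
  by (rule iner_trivial[OF P], rule P2_fixedI) (auto simp: iner_def b_Z z_Z)

lemma P2_root_1:
  fixes y :: "nat \<Rightarrow> complex"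
  assumes y: "\<And>k. k < 7 \<Longrightarrow> y k \<in> ZK" and f: "f = (\<Prod>i<7. [:- y i, 1:])" "poly f 1 \<in> P"
  shows "\<exists>i<7. y i - 1 \<in> P"
proof (rule ccontr)
  assume n: "\<not> ?thesis"
  have "(\<Prod>i<7. (1 - y i)) \<notin> P"
  proof (rule P_prod_notin[OF P])
    fix i :: nat assume i: "i \<in> {..<7}"
    show "1 - y i \<in> ZK" using y i by (intro ZK_closed) auto
    show "1 - y i \<notin> P" using n i P_cong_sym[OF P] by blast
  qed simp
  thus False using f by (simp add: poly_prod)
qed

text \<open>The residues of all \<open>b k\<close> and \<open>z k\<close> lie in the field with four
  elements, where squaring has order at most 2; as these residues separate the indices, the square
  of the Frobenius is the identity.\<close>

lemma frobenius_2:
  "\<exists>\<delta>\<in>Gal K. plist \<delta> \<noteq> id7 \<and> cmp (plist \<delta>) (plist \<delta>) = id7 \<and>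
     (\<exists>i<7. \<exists>j<7. i \<noteq> j \<and> plist \<delta> ! i = i \<and> plist \<delta> ! j = j)"
proof -
  obtain \<delta> where d: "\<delta> \<in> Gal K" "\<And>x. x \<in> ZK \<Longrightarrow> \<delta> x - x ^ 2 \<in> P"
    using frobenius[OF P two_is_prime_nat two iner_2] by blast
  have one: "\<delta> x - x \<in> P" if x: "x \<in> ZK" "x - 1 \<in> P" for x
  proof -
    have "(\<delta> x - x ^ 2) + x * (x - 1) \<in> P" by (intro P_add[OF P] P_l[OF P] d x)
    thus ?thesis by (simp add: power2_eq_square algebra_simps)
  qed
  have zero: "\<delta> x - x \<in> P" if x: "x \<in> P" for x
  proof -
    have "(\<delta> x - x ^ 2) + (x - 1) * x \<in> P" using P_ZK[OF P x] by (intro P_add[OF P] P_l[OF P] d x ZK_closed)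
    thus ?thesis by (simp add: power2_eq_square algebra_simps)
  qed
  have four: "\<delta> (\<delta> x) - x \<in> P" if x: "x \<in> ZK" "x ^ 4 - x \<in> P" for x
  proof -
    have dx: "\<delta> x \<in> ZK" by (rule ZK_Gal[OF d(1) x(1)])
    have "\<delta> x ^ 2 - (x ^ 2) ^ 2 \<in> P" by (rule P_cong_power[OF P d(2)[OF x(1)] dx ZK_power[OF x(1)]])
    from P_add[OF P P_add[OF P d(2)[OF dx] this] x(2)] show ?thesis by simp
  qed
  have not1: "x \<notin> P" if "x - 1 \<in> P" for x using that P_cong_iff[OF P that] P_1[OF P] by blast
  \<comment> \<open>Modulo 2 both septics vanish at 1. This produces two fixed indices, with the
    residues of \<open>b\<close> and \<open>z\<close> equal to 1, 0 and to 0, 1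
    respectively.\<close>
  have "even (1 - 46 * w + 541 * w ^ 2 - (850 * w ^ 3 + u) + (u - 3742 * w ^ 3) * w + 5120 * w ^ 5 + 3328 * w ^ 6 - 4096 * w ^ 7)"
    using good w_even by (simp add: good_def)
  hence "of_int (1 - 46 * w + 541 * w ^ 2 - (850 * w ^ 3 + u) + (u - 3742 * w ^ 3) * w + 5120 * w ^ 5 + 3328 * w ^ 6 - 4096 * w ^ 7) \<in> P"
    using P2_int by blast
  hence "poly (septic_poly U V) 1 \<in> P" by (simp add: septic_poly septic_def)
  then obtain i where i: "i < 7" "b i - 1 \<in> P" using P2_root_1[OF b_Z septic_factor] by blast
  have zi: "z i \<in> P" using P2_b_or_z[OF i(1)] not1[OF i(2)] by blast
  have fi: "pl \<delta> i = i" by (rule P2_fixedI[OF d(1) i(1) one[OF b_Z[OF i(1)] i(2)] zero[OF zi]])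
  have "even (1 - 13 * w - 320 * w ^ 2 + (3742 * w ^ 3 - u) + 16 * w * (850 * w ^ 3 + u) - 138496 * w ^ 5 + 188416 * w ^ 6 - 65536 * w ^ 7)"
    using good w_even by (simp add: good_def)
  hence "of_int (1 - 13 * w - 320 * w ^ 2 + (3742 * w ^ 3 - u) + 16 * w * (850 * w ^ 3 + u) - 138496 * w ^ 5 + 188416 * w ^ 6 - 65536 * w ^ 7) \<in> P"
    using P2_int by blast
  hence "poly (reciprocal_septic U V) 1 \<in> P" by (simp add: reciprocal_septic_poly)
  then obtain j where j: "j < 7" "z j - 1 \<in> P" using P2_root_1[OF z_Z z_factor] by blast
  have bj: "b j \<in> P" using P2_b_or_z[OF j(1)] not1[OF j(2)] by blast
  have fj: "pl \<delta> j = j" by (rule P2_fixedI[OF d(1) j(1) zero[OF bj] one[OF z_Z[OF j(1)] j(2)]])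
  have ij: "i \<noteq> j" using bj not1[OF i(2)] by blast
  have dd: "\<delta> \<otimes>\<^bsub>GK\<^esub> \<delta> \<in> Gal K" using d(1) by (rule G.m_closed[OF d(1)])
  have "\<delta> \<otimes>\<^bsub>GK\<^esub> \<delta> = \<one>\<^bsub>GK\<^esub>"
  proof (rule Gal_eq_pl[OF dd one_Gal])
    fix k :: nat assume k: "k < 7"
    have "pl (\<delta> \<otimes>\<^bsub>GK\<^esub> \<delta>) k = k"
      by (rule P2_fixedI[OF dd k]) (simp_all add: Gal_compose[OF d(1) d(1)] b_K ZK_K z_Z k four b_Z P2_b4 P2_z4)
    thus "pl (\<delta> \<otimes>\<^bsub>GK\<^esub> \<delta>) k = pl \<one>\<^bsub>GK\<^esub> k" using pl_one[OF k] by simp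
  qed
  hence sq: "cmp (plist \<delta>) (plist \<delta>) = id7" using plist_mult[OF d(1) d(1)] plist_one by simp
  have "plist \<delta> \<noteq> id7"
  proof
    assume e: "plist \<delta> = id7"
    have f: "b k - 1 \<in> P \<and> z k \<in> P" if k: "k < 7" "b k \<notin> P" for k
    proof -
      have "pl \<delta> k = k" using arg_cong[OF e, of "\<lambda>l. l ! k"] k by (simp add: plist_nth id7_nth)
      hence "\<delta> (b k) = b k" using b_pl[OF d(1) k(1)] by simp
      hence "b k - b k ^ 2 \<in> P" using d(2)[OF b_Z[OF k(1)]] by simp
      moreover have "b k - b k ^ 2 = b k * (1 - b k)" by (simp add: power2_eq_square algebra_simps)
      ultimately have "1 - b k \<in> P" using P_prime[OF P b_Z[OF k(1)] ZK_diff[OF ZK_1 b_Z[OF k(1)]]] k by simp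
      thus ?thesis using P_cong_sym[OF P] P2_b_or_z[OF k(1)] k(2) by blast
    qed
    \<comment> \<open>For the identity every nonzero residue of a \<open>b k\<close> would be 1. At
      least three of the seven are nonzero, and two indices with the residues 1, 0 contradict
      \<open>P2_distinct\<close>.\<close>
    have "{k \<in> {..<7}. b k \<in> P} \<union> {k \<in> {..<7}. b k \<notin> P} = {..<7}" by auto
    hence "7 \<le> card {k \<in> {..<7}. b k \<in> P} + card {k \<in> {..<7}. b k \<notin> P}"
      using card_Un_le[of "{k \<in> {..<7}. b k \<in> P}" "{k \<in> {..<7}. b k \<notin> P}"] by (metis card_lessThan)
    hence "\<not> card {k \<in> {..<7}. b k \<notin> P} \<le> 1" using P2_card(1) by simp
    then obtain k l where "k < 7" "l < 7" "k \<noteq> l" "b k \<notin> P" "b l \<notin> P"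
      by (auto simp: card_le_Suc0_iff_eq)
    thus False using f[of k] f[of l] P2_distinct[of k l] P_diff[OF P, of "b k - 1" "b l - 1"] P_diff[OF P, of "z k" "z l"] by auto
  qed
  moreover have "\<exists>i<7. \<exists>j<7. i \<noteq> j \<and> plist \<delta> ! i = i \<and> plist \<delta> ! j = j"
    using i(1) j(1) ij fi fj plist_nth by metis
  ultimately show ?thesis using d(1) sq by blast
qed

end

end

section \<open>The prime 3\<close>

text \<open>Every orbit has at least four elements. If that of 0 were not everything, it and its
  complement would together need eight points.\<close>

lemma seven_cycle:
  fixes s :: "nat \<Rightarrow> nat"
  assumes s: "\<And>i. i < 7 \<Longrightarrow> s i < 7" and inj: "inj_on s {..<7}"
    and short: "\<And>i k. i < 7 \<Longrightarrow> k \<in> {1, 2, 3} \<Longrightarrow> (s ^^ k) i \<noteq> i"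
  shows "inj_on (\<lambda>j. (s ^^ j) 0) {..<7}"
proof -
  have sk: "(s ^^ k) i < 7" if "i < 7" for i k using that by (induction k) (auto intro: s)
  have diff: "\<exists>i<7. (s ^^ (b - a)) i = i" if "(s ^^ a) x = (s ^^ b) x" "a < b" "x < 7" for a b x
  proof -
    have "(s ^^ b) x = (s ^^ (b - a)) ((s ^^ a) x)" using that(2) funpow_add[of "b - a" a s] by simp
    thus ?thesis using that sk by (intro exI[of _ "(s ^^ a) x"]) auto
  qed
  have four: "card ((\<lambda>j. (s ^^ j) x) ` {..<4}) = 4" if x: "x < 7" for x
  proof -
    have "a = b" if "a < 4" "b < 4" "(s ^^ a) x = (s ^^ b) x" for a b
    proof (rule ccontr)
      have *: False if ab: "a < b" "b < 4" "(s ^^ a) x = (s ^^ b) x" for a b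
      proof -
        obtain i where "i < 7" "(s ^^ (b - a)) i = i" using diff[OF ab(3,1) x] by blast
        moreover have "b - a \<in> {1, 2, 3}" using ab by auto
        ultimately show False using short by blast
      qed
      assume "a \<noteq> b"
      thus False using *[of a b] *[of b a] that by (cases "a < b") auto
    qed
    thus ?thesis by (subst card_image) (auto simp: inj_on_def)
  qed
  have inj_lt: False if ab: "a < b" "b < 7" "(s ^^ a) 0 = (s ^^ b) 0" for a b
  proof -
    have injk: "inj_on (s ^^ a) {..<7}" for a
    proof (induction a)
      case (Suc a)
      have "(s ^^ a) ` {..<7} \<subseteq> {..<7}" using sk by auto
      hence "inj_on (s \<circ> (s ^^ a)) {..<7}" using Suc inj by (intro comp_inj_on) (auto intro: inj_on_subset)
      thus ?case by (simp add: comp_def)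
    qed simp
    define d where "d = b - a"
    have d: "0 < d" "d \<le> 6" using ab by (auto simp: d_def)
    have "(s ^^ b) 0 = (s ^^ (a + d)) 0" using ab by (simp add: d_def)
    hence "(s ^^ a) ((s ^^ d) 0) = (s ^^ a) 0" using ab by (simp add: funpow_add)
    hence d0: "(s ^^ d) 0 = 0" by (rule inj_onD[OF injk]) (use sk in auto)
    define B where "B = (\<lambda>j. (s ^^ j) 0) ` {..<d}"
    have sB: "s x \<in> B" if "x \<in> B" for x
    proof -
      obtain j where j: "j < d" "x = (s ^^ j) 0" using \<open>x \<in> B\<close> by (auto simp: B_def)
      show ?thesis
      proof (cases "Suc j = d")
        case True
        hence "s x = 0" using j d0 by auto
        thus ?thesis unfolding B_def using d by (intro image_eqI[of _ _ 0]) auto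
      next
        case False
        thus ?thesis unfolding B_def using j by (intro image_eqI[of _ _ "Suc j"]) auto
      qed
    qed
    have B7: "B \<subseteq> {..<7}" and Bf: "finite B" using sk by (auto simp: B_def)
    have "s ` B = B" using sB inj B7 Bf by (intro endo_inj_surj) (auto intro: inj_on_subset)
    have C: "s x \<in> {..<7} - B" if "x \<in> {..<7} - B" for x
    proof -
      have "s x \<notin> B"
      proof
        assume "s x \<in> B"
        then obtain y where y: "y \<in> B" "s x = s y" using \<open>s ` B = B\<close> by auto
        hence "x = y" using inj that B7 by (auto simp: inj_on_def)
        thus False using y that by simp
      qed
      thus ?thesis using that s by auto
    qed
    have skB: "(s ^^ j) 0 \<in> B" for j
    proof (induction j)
      case 0
      show ?case unfolding B_def using d by (intro image_eqI[of _ _ 0]) auto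
    qed (simp add: sB)
    have "card ((\<lambda>j. (s ^^ j) 0) ` {..<4::nat}) \<le> card B" by (rule card_mono[OF Bf]) (use skB in auto)
    hence "4 \<le> card B" using four[of 0] by simp
    hence cc: "card ({..<7} - B) \<le> 3" using card_Diff_subset[OF Bf B7] by simp
    have "card B \<le> d" unfolding B_def using card_image_le[of "{..<d}"] by simp
    hence "B \<noteq> {..<7}" using d by auto
    then obtain x where x: "x \<in> {..<7} - B" using B7 by auto
    have "(s ^^ j) x \<in> {..<7} - B" for j using x C by (induction j) auto
    hence "card ((\<lambda>j. (s ^^ j) x) ` {..<4::nat}) \<le> card ({..<7} - B)" by (intro card_mono) auto
    thus False using four[of x] x cc by simp
  qed
  show ?thesis
  proof (rule inj_onI, rule ccontr)
    fix a b :: nat assume "a \<in> {..<7}" "b \<in> {..<7}" "(s ^^ a) 0 = (s ^^ b) 0" "a \<noteq> b"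
    thus False using inj_lt[of a b] inj_lt[of b a] by (cases "a < b") auto
  qed
qed

text \<open>No proper nonempty subset of Z/7 is stable under a nonzero shift. For triples this shows
  that the seven lines are different.\<close>

lemma shift_invariant:
  "\<forall>S\<in>set [[x,y,z]. x \<leftarrow> [0..<7], y \<leftarrow> [Suc x..<7], z \<leftarrow> [Suc y..<7]].
     \<forall>d\<in>set [Suc 0..<7]. \<not> list_all (\<lambda>i. (i + d) mod 7 \<in> set S) S"
  by code_simp

lemma moved: "\<forall>l\<in>set nf_lits. l \<noteq> id7 \<longrightarrow> 3 \<le> length (filter (\<lambda>i. l ! i \<noteq> i) [0..<7])"
  by code_simp

context septic_field
begin

lemma frob_iterate:
  assumes P: "pid P" and s: "\<sigma> \<in> Gal K" "\<And>x. x \<in> ZK \<Longrightarrow> \<sigma> x - x ^ p \<in> P" and x: "x \<in> ZK"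
  shows "(\<sigma> ^^ k) x \<in> ZK \<and> (\<sigma> ^^ k) x - x ^ (p ^ k) \<in> P"
proof (induction k)
  case 0
  show ?case using x P_0[OF P] by simp
next
  case (Suc k)
  let ?y = "(\<sigma> ^^ k) x"
  have y: "?y \<in> ZK" "?y - x ^ (p ^ k) \<in> P" using Suc by auto
  have "?y ^ p - (x ^ (p ^ k)) ^ p \<in> P" by (rule P_cong_power[OF P y(2,1) ZK_power[OF x]])
  from P_add[OF P s(2)[OF y(1)] this] have "\<sigma> ?y - x ^ (p ^ Suc k) \<in> P" by (simp add: power_mult[symmetric] mult.commute)
  thus ?case using ZK_Gal[OF s(1) y(1)] by simp
qed

lemma funpow_pl: assumes "\<sigma> \<in> Gal K" "i < 7" shows "(pl \<sigma> ^^ k) i < 7 \<and> b ((pl \<sigma> ^^ k) i) = (\<sigma> ^^ k) (b i)"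
  by (induction k) (use assms pl_less b_pl in auto)

text \<open>Modulo 3 the septic has no irreducible factor of degree at most 3, so it is irreducible and the
  Frobenius at 3 permutes its roots in a 7-cycle.\<close>

lemma frobenius_3: "\<exists>\<sigma>\<in>Gal K. inj_on (\<lambda>j. (pl \<sigma> ^^ j) 0) {..<7}"
proof -
  have p3: "prime (3::nat)" by simp
  obtain P where P: "pid P" "of_nat 3 \<in> P" using pid_exists[OF p3] by blast
  have dv: "int 3 dvd badN" by (simp add: badN_def)
  obtain \<sigma> where s: "\<sigma> \<in> Gal K" "\<And>x. x \<in> ZK \<Longrightarrow> \<sigma> x - x ^ 3 \<in> P"
    using frobenius[OF P(1) p3 P(2) iner_bad[OF P(1) p3 P(2) dv]] by blast
  have "int 3 dvd u - 1" "int 3 dvd w - 1" using good dv by (auto simp: good_def intro: dvd_trans)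
  hence "of_int (u - 1) \<in> P" "of_int (w - 1) \<in> P" using P_of_int_iff[OF P(1) p3 P(2)] by blast+
  hence "cgr P (of_int u) (of_int 1)" "cgr P (of_int w) (of_int 1)" using cgr_of_int[OF P(1)] by blast+
  hence uw: "cgr P U 1" "cgr P V 1" by simp_all
  have sh: "(pl \<sigma> ^^ k) i \<noteq> i" if i: "i < 7" and k: "k \<in> {1, 2, 3}" for i k
  proof
    assume e: "(pl \<sigma> ^^ k) i = i"
    let ?y = "b i"
    have y: "?y \<in> ZK" by (rule b_Z[OF i])
    have "(\<sigma> ^^ k) ?y = ?y" using funpow_pl[OF s(1) i, of k] e by simp
    hence "?y - ?y ^ (3 ^ k) \<in> P" using frob_iterate[OF P(1) s y, of k] by simp
    hence F: "?y ^ (3 ^ k) - ?y \<in> P" by (rule P_cong_sym[OF P(1)])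
    have "cgr P (septic U V ?y) (septic 1 1 ?y)"
      unfolding septic_def by (intro cgr_rules[OF P(1)] uw cgr_refl[OF P(1) y])
    hence S: "septic 1 1 ?y \<in> P" using cgr_iff[OF P(1)] b_root[OF i] P_0[OF P(1)] by metis
    \<comment> \<open>In each certificate the right-hand side lies in \<open>P\<close>, and so does
      3, which leaves 1 in \<open>P\<close>.\<close>
    have fin: False if e: "1 + 3 * a = c * septic 1 1 ?y + d * (?y ^ (3 ^ k) - ?y)" and z: "a \<in> ZK" "c \<in> ZK" "d \<in> ZK" for a c d
    proof -
      have "1 + 3 * a \<in> P" unfolding e by (intro P_add[OF P(1)] P_l[OF P(1)] z S F)
      moreover have "3 * a \<in> P" using P_r[OF P z(1)] by simp
      ultimately have "(1 + 3 * a) - 3 * a \<in> P" by (rule P_diff[OF P(1)])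
      thus False using P_1[OF P(1)] by simp
    qed
    from k consider "k = 1" | "k = 2" | "k = 3" by auto
    thus False
    proof cases
      case 1
      show ?thesis by (rule fin[unfolded 1 power_one_right, OF septic_frob1[of ?y]]; intro ZK_closed y)
    next
      case 2
      have "(3::nat) ^ 2 = 9" by simp
      from fin[unfolded 2 this, OF septic_frob2[of ?y]] show ?thesis by (rule; intro ZK_closed y)
    next
      case 3
      have "(3::nat) ^ 3 = 27" by simp
      from fin[unfolded 3 this, OF septic_frob3[of ?y]] show ?thesis by (rule; intro ZK_closed y)
    qed
  qed
  have "inj_on (pl \<sigma>) {..<7}" using pl_inj[OF s(1)] by (auto simp: inj_on_def)
  from seven_cycle[OF pl_less[OF s(1)] this sh] s(1) show ?thesis by blast
qed

end

section \<open>The Galois group\<close>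

lemma septic_0: "septic u w 0 = - 4096 * w ^ 7" and septic_w: "septic (- u) w w = 256 * w ^ 7"
  unfolding septic_def by (simp, Groebner_Basis.algebra)

definition incid_poly :: "complex \<Rightarrow> complex \<Rightarrow> complex poly" where
  "incid_poly w y = [:- 16 * y * w ^ 3 + 16 * y ^ 2 * w ^ 2, - 16 * w ^ 3 + 30 * y * w ^ 2 - 15 * y ^ 2 * w + y ^ 3,
     16 * w ^ 2 - 15 * y * w - y ^ 2, y:]"

lemma incid_poly: "poly (incid_poly w y) x = incid w x y"
  unfolding incid_poly_def incid_def poly_pCons poly_0 by Groebner_Basis.algebra

lemma septic_poly_rat: "septic_poly (of_int u) (of_int w) \<in> polys_over \<rat>"
proof -
  obtain p :: "int poly" where p: "map_poly of_int p = septic_poly (of_int u) (of_int w)" using septic_poly_of_int by blast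
  have "map_poly of_int p \<in> polys_over \<rat>" by (simp add: polys_over_def coeff_map_poly)
  thus ?thesis unfolding p .
qed

lemma involution_nu: assumes "\<nu> \<in> {id7, neg7}"
  shows "length \<nu> = 7" "i < 7 \<Longrightarrow> \<nu> ! i < 7" "i < 7 \<Longrightarrow> \<nu> ! (\<nu> ! i) = i"
proof -
  have "perm7 id7" "perm7 neg7" by (auto simp: perm7_def id7_def neg7_def)
  hence p: "perm7 \<nu>" using assms by auto
  show "length \<nu> = 7" "i < 7 \<Longrightarrow> \<nu> ! i < 7" using perm7D[OF p] by auto
  have "cmp id7 id7 = id7" "cmp neg7 neg7 = id7" by code_simp+
  hence "cmp \<nu> \<nu> = id7" using assms by auto
  hence "cmp \<nu> \<nu> ! i = id7 ! i" by simp
  thus "i < 7 \<Longrightarrow> \<nu> ! (\<nu> ! i) = i" using perm7D(1)[OF p] by (simp add: cmp_nth id7_nth)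
qed

lemma sorted_triple:
  fixes A :: "nat set" assumes "card A = 3" shows "\<exists>x y z. A = {x, y, z} \<and> x < y \<and> y < z"
proof -
  have f: "finite A" using assms by (intro card_ge_0_finite) simp
  let ?l = "sorted_list_of_set A"
  have "\<exists>x y z. l = [x, y, z]" if "length l = 3" for l :: "nat list"
    using that by (auto simp: numeral_3_eq_3 length_Suc_conv)
  then obtain x y z where l: "?l = [x, y, z]" using assms length_sorted_list_of_set by metis
  hence "A = {x, y, z}" using set_sorted_list_of_set[OF f] by simp
  moreover have "sorted ?l" "distinct ?l" using f by auto
  hence "x < y" "y < z" unfolding l by auto
  ultimately show ?thesis by blast
qed

context numfield
begin

text \<open>The graph of \<tau> with membership in \<open>K\<close> attached, so that \<tau> can be
  pushed through polynomial expressions by introduction rules.\<close>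

definition "gap \<tau> a b \<longleftrightarrow> a \<in> K \<and> b \<in> K \<and> \<tau> a = b"

lemma gap_rules:
  assumes t: "\<tau> \<in> Gal K"
  shows "gap \<tau> a b \<Longrightarrow> gap \<tau> a' b' \<Longrightarrow> gap \<tau> (a + a') (b + b')"
    "gap \<tau> a b \<Longrightarrow> gap \<tau> a' b' \<Longrightarrow> gap \<tau> (a - a') (b - b')"
    "gap \<tau> a b \<Longrightarrow> gap \<tau> a' b' \<Longrightarrow> gap \<tau> (a * a') (b * b')"
    "gap \<tau> a b \<Longrightarrow> gap \<tau> (- a) (- b)" "gap \<tau> a b \<Longrightarrow> gap \<tau> (a ^ n) (b ^ n)"
    "gap \<tau> (numeral k) (numeral k)" "gap \<tau> (of_int i) (of_int i)" "gap \<tau> 1 1"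
proof -
  have i: "of_int i \<in> K" for i by (intro sfield_Rats[OF K, THEN subsetD]) simp
  have n: "numeral k \<in> K" "(1::complex) \<in> K" for k using i[of "numeral k"] i[of 1] by simp_all
  show "gap \<tau> (numeral k) (numeral k)" "gap \<tau> (of_int i) (of_int i)" "gap \<tau> 1 1"
    using n i Gal_of_int[OF t] Gal_of_int[OF t, of "numeral k"] Gal_1[OF t] by (auto simp: gap_def)
  show "gap \<tau> a b \<Longrightarrow> gap \<tau> (a ^ n) (b ^ n)"
    using n by (induction n) (auto simp: gap_def Gal_1[OF t] Gal_times[OF t] sfield_closed[OF K] Gal_power[OF t])
qed (auto simp: gap_def Gal_add[OF t] Gal_times[OF t] Gal_diff[OF t] Gal_uminus[OF t] sfield_closed[OF K])

end

locale septic_cycle = septic_field +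
  fixes \<sigma> assumes sG: "\<sigma> \<in> Gal K" and s_b: "\<And>i. i < 7 \<Longrightarrow> \<sigma> (b i) = b ((i + 1) mod 7)"

text \<open>The roots are renumbered along the orbit of 0 under the Frobenius at 3. After seven
  steps the orbit closes up at 0, as a return to any later index could be cancelled by
  injectivity.\<close>

lemma (in septic_field) cycle_exists: "\<exists>b' \<sigma>. septic_cycle R K \<theta> c m u w b' \<sigma>"
proof -
  obtain \<sigma> where s: "\<sigma> \<in> Gal K" "inj_on (\<lambda>j. (pl \<sigma> ^^ j) 0) {..<7}" using frobenius_3 by blast
  define k where "k j = (pl \<sigma> ^^ j) 0" for j
  have k7: "k j < 7" for j using funpow_pl[OF s(1)] by (simp add: k_def)
  have ki: "inj_on k {..<7}" using s(2) by (simp add: k_def[abs_def])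
  have kim: "k ` {..<7} = {..<7}" using ki k7 by (intro endo_inj_surj) auto
  have "k 7 \<in> k ` {..<7}" using kim k7 by simp
  then obtain j where j: "j < 7" "k j = k 7" by auto
  have "j = 0"
  proof (rule ccontr)
    assume "j \<noteq> 0"
    then obtain i where i: "j = Suc i" by (cases j) auto
    have "k 7 = pl \<sigma> (k 6)" by (simp add: k_def numeral_eq_Suc)
    hence "pl \<sigma> (k i) = pl \<sigma> (k 6)" using j i by (simp add: k_def)
    hence "k i = k 6" using pl_inj[OF s(1) k7 k7] by blast
    hence "i = 6" using ki i j by (auto simp: inj_on_def)
    thus False using i j by simp
  qed
  hence k7': "k 7 = k 0" using j by simp
  have "septic_cycle R K \<theta> c m u w (\<lambda>i. b (k i)) \<sigma>"
  proof unfold_locales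
    show "inj_on (\<lambda>i. b (k i)) {..<7}" using ki k7 b_eq by (auto simp: inj_on_def)
    have "(\<lambda>i. b (k i)) ` {..<7} = b ` (k ` {..<7})" by auto
    thus "R = (\<lambda>i. b (k i)) ` {..<7}" unfolding kim R_def ..
    show "septic U V (b (k i)) = 0" for i using b_root k7 by blast
    show "\<sigma> (b (k i)) = b (k ((i + 1) mod 7))" if "i < 7" for i
    proof -
      have e: "\<sigma> (b (k i)) = b (k (i + 1))" using b_pl[OF s(1) k7] by (simp add: k_def)
      show ?thesis
      proof (cases "i = 6")
        case True
        thus ?thesis using e k7' by simp
      next
        case False
        thus ?thesis using e that by simp
      qed
    qed
  qed (use good s in auto)
  thus ?thesis by blast
qed

context septic_cycle
begin

abbreviation "dual y \<equiv> septic (- U) V y = 0"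

section \<open>The lines given by the roots of the dual septic\<close>

definition line :: "complex \<Rightarrow> nat set" where "line y = {i. i < 7 \<and> incid V (b i) y = 0}"

lemma dual_nz: assumes "dual y" shows "y \<noteq> 0" "V \<noteq> y"
  using assms septic_0[of "- U" V] septic_w[of U V] V0 by auto

lemma line_finite: "finite (line y)" by (simp add: line_def)

text \<open>By \<open>incidence\<close> each of the seven roots is a root of the cubic
  \<open>incid\<close> or the quartic \<open>coincid\<close> in x. As 7 = 3 + 4, the cubic has
  exactly three of them; \<open>dual_nz\<close> keeps both leading coefficients nonzero.\<close>

lemma line_card: assumes y: "dual y" shows "card (line y) = 3"
proof -
  define p where "p = incid_poly V y"
  define q where "q = [:256 * y ^ 2 * V ^ 5, - 256 * y * V ^ 5 + 16 * y ^ 2 * V ^ 4 - 16 * y ^ 3 * V ^ 3,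
     256 * V ^ 5 + 16 * y * V ^ 4 - 258 * y ^ 2 * V ^ 3 - 15 * y ^ 3 * V ^ 2 + y ^ 4 * V,
     - 16 * y * V ^ 3 - 15 * y ^ 2 * V ^ 2 + 32 * y ^ 3 * V - y ^ 4, y ^ 2 * (V - y):]"
  have p: "poly p x = incid V x y" for x unfolding p_def by (rule incid_poly)
  have q: "poly q x = coincid V x y" for x unfolding q_def coincid_def poly_pCons poly_0 by Groebner_Basis.algebra
  have nz: "y \<noteq> 0" "y ^ 2 * (V - y) \<noteq> 0" using dual_nz[OF y] by auto
  hence d: "degree p = 3" "degree q = 4" by (simp_all add: p_def incid_poly_def q_def)
  hence nz': "p \<noteq> 0" "q \<noteq> 0" by auto
  have roots: "card {i. i < 7 \<and> poly r (b i) = 0} \<le> degree r" if "r \<noteq> 0" for r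
  proof -
    have "card {i. i < 7 \<and> poly r (b i) = 0} = card (b ` {i. i < 7 \<and> poly r (b i) = 0})"
      by (rule card_image[symmetric]) (use b_inj in \<open>auto simp: inj_on_def\<close>)
    also have "\<dots> \<le> card {x. poly r x = 0}" by (rule card_mono[OF poly_roots_finite[OF that]]) auto
    also have "\<dots> \<le> degree r" by (rule card_poly_roots_bound[OF that])
    finally show ?thesis .
  qed
  have "{..<7} \<subseteq> line y \<union> {i. i < 7 \<and> poly q (b i) = 0}"
  proof
    fix i :: nat assume i: "i \<in> {..<7}"
    have "incid V (b i) y * coincid V (b i) y = 0" using incidence[of U V "b i" y] b_root i y by simp
    thus "i \<in> line y \<union> {i. i < 7 \<and> poly q (b i) = 0}" using i by (auto simp: line_def q)
  qed
  hence "card {..<7::nat} \<le> card (line y \<union> {i. i < 7 \<and> poly q (b i) = 0})" by (rule card_mono[rotated]) (simp add: line_finite)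
  also have "\<dots> \<le> card (line y) + card {i. i < 7 \<and> poly q (b i) = 0}" by (rule card_Un_le)
  also have "\<dots> \<le> card (line y) + 4" using roots[OF nz'(2)] d by simp
  finally have "3 \<le> card (line y)" by simp
  moreover have "card (line y) \<le> 3" using roots[OF nz'(1)] d by (simp add: line_def p)
  ultimately show ?thesis by simp
qed

text \<open>The product of the three points on the line \<open>y\<close> is \<open>16 w\<^sup>2 (w - y)\<close>.\<close>

lemma dual_K: assumes y: "dual y" shows "y \<in> K"
proof -
  define p where "p = incid_poly V y"
  let ?q = "\<Prod>i\<in>line y. [:- b i, 1:]"
  have p: "poly p x = incid V x y" for x unfolding p_def by (rule incid_poly)
  have nz: "y \<noteq> 0" using dual_nz[OF y] by auto
  have dq: "degree ?q = 3" using line_card[OF y] by (subst degree_prod_eq_sum_degree) auto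
  have lq: "lead_coeff ?q = 1" by (simp add: lead_coeff_prod)
  have "p = Polynomial.smult y ?q"
  proof (rule poly_eqI_degree_lead_coeff[where n = 3 and A = "b ` line y"])
    show "coeff p 3 = coeff (Polynomial.smult y ?q) 3" using lq dq by (simp add: p_def incid_poly_def numeral_3_eq_3)
    have "inj_on b (line y)" using b_inj by (auto simp: inj_on_def line_def)
    thus "3 \<le> card (b ` line y)" using line_card[OF y] by (simp add: card_image)
    fix x assume "x \<in> b ` line y"
    then obtain i where i: "i \<in> line y" "x = b i" by auto
    have "poly ?q x = 0" using i line_finite by (auto simp: poly_prod)
    thus "poly p x = poly (Polynomial.smult y ?q) x" using i p by (simp add: line_def)
  qed (use dq nz in \<open>simp_all add: p_def incid_poly_def\<close>)
  hence "poly p 0 = y * poly ?q 0" by simp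
  also have "poly ?q 0 = (\<Prod>i\<in>line y. - b i)" by (simp add: poly_prod)
  also have "\<dots> = - (\<Prod>i\<in>line y. b i)" using line_card[OF y] by (simp add: prod_uminus)
  finally have "y * (16 * V ^ 2 * (V - y)) = y * (\<Prod>i\<in>line y. b i)" by (simp add: p_def incid_poly_def algebra_simps power2_eq_square power3_eq_cube)
  hence "16 * V ^ 2 * (V - y) = (\<Prod>i\<in>line y. b i)" using nz by simp
  hence e: "y = V - (\<Prod>i\<in>line y. b i) / (16 * V ^ 2)" using V0 by (simp add: field_simps)
  have "(\<Prod>i\<in>line y. b i) \<in> ZK" by (intro ZK_prod b_Z) (simp add: line_def)
  thus ?thesis by (subst e) (intro sfield_closed[OF K] ZK_K ZK_closed UV_Z)
qed

lemma Gal_dual: assumes t: "\<tau> \<in> Gal K" and y: "dual y" shows "dual (\<tau> y)"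
proof -
  have yK: "y \<in> K" by (rule dual_K[OF y])
  have "gap \<tau> (septic (- U) V y) (septic (- U) V (\<tau> y))" unfolding septic_def
    by (intro gap_rules[OF t]) (use yK Gal_in[OF t yK] in \<open>auto simp: gap_def\<close>)
  thus ?thesis using y Gal_0[OF t] by (simp add: gap_def)
qed

lemma Gal_line: assumes t: "\<tau> \<in> Gal K" and y: "dual y" shows "line (\<tau> y) = pl \<tau> ` line y"
proof (rule card_seteq[OF line_finite, symmetric])
  have yK: "y \<in> K" by (rule dual_K[OF y])
  show "pl \<tau> ` line y \<subseteq> line (\<tau> y)"
  proof
    fix j assume "j \<in> pl \<tau> ` line y"
    then obtain i where i: "i < 7" "incid V (b i) y = 0" "j = pl \<tau> i" by (auto simp: line_def)
    have "gap \<tau> (incid V (b i) y) (incid V (b (pl \<tau> i)) (\<tau> y))" unfolding incid_def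
      by (intro gap_rules[OF t])
        (use yK Gal_in[OF t yK] b_K[OF i(1)] b_K[OF pl_less[OF t i(1)]] b_pl[OF t i(1)] in \<open>auto simp: gap_def\<close>)
    thus "j \<in> line (\<tau> y)" using i Gal_0[OF t] pl_less[OF t i(1)] by (simp add: gap_def line_def)
  qed
  have "inj_on (pl \<tau>) (line y)" using pl_inj[OF t] by (auto simp: inj_on_def line_def)
  thus "card (line (\<tau> y)) \<le> card (pl \<tau> ` line y)" using line_card[OF y] line_card[OF Gal_dual[OF t y]] by (simp add: card_image)
qed

lemma pl_s: "i < 7 \<Longrightarrow> pl \<sigma> i = (i + 1) mod 7" by (rule pl_eqI[OF sG]) (simp_all add: s_b)

lemma iter_dual: assumes "dual y" shows "dual ((\<sigma> ^^ j) y) \<and> line ((\<sigma> ^^ j) y) = (\<lambda>i. (i + j) mod 7) ` line y"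
proof (induction j)
  case 0
  have "(\<lambda>i. (i + 0) mod 7) ` line y = (\<lambda>i. i) ` line y" by (rule image_cong) (auto simp: line_def)
  thus ?case using assms by simp
next
  case (Suc j)
  hence d: "dual ((\<sigma> ^^ j) y)" by blast
  have "line (\<sigma> ((\<sigma> ^^ j) y)) = pl \<sigma> ` (\<lambda>i. (i + j) mod 7) ` line y" using Gal_line[OF sG d] Suc by simp
  also have "\<dots> = (\<lambda>i. (i + Suc j) mod 7) ` line y" by (force simp: pl_s mod_Suc_eq image_image)
  finally show ?case using Gal_dual[OF sG d] by simp
qed

text \<open>The iterates under \<sigma> of one root of the dual septic have different lines, by
  \<open>shift_invariant\<close>, so they are all seven roots. Their lines are the translates of one
  triple, and every automorphism permutes them.\<close>

lemma lines_preserved: "\<exists>x y z. x < y \<and> y < z \<and> z < 7 \<and> (\<forall>\<tau>\<in>Gal K. spres (fset7 [x, y, z]) (plist \<tau>))"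
proof -
  have "\<not> constant (poly (septic_poly (- U) V))" using septic_poly_monic[of "- U" V] by (subst constant_degree) auto
  from fundamental_theorem_of_algebra[OF this] obtain y0 where "poly (septic_poly (- U) V) y0 = 0" by blast
  hence y0: "dual y0" by (simp add: septic_poly)
  obtain x y z where S: "line y0 = {x, y, z}" "x < y" "y < z" using sorted_triple[OF line_card[OF y0]] by blast
  have z: "z < 7" using S by (auto simp: line_def)
  have inj: "inj_on (\<lambda>j. (\<sigma> ^^ j) y0) {..<7}"
  proof -
    have "False" if ab: "a < b" "b < 7" "(\<sigma> ^^ a) y0 = (\<sigma> ^^ b) y0" for a b
    proof -
      have l: "(\<lambda>i. (i + b) mod 7) ` line y0 = (\<lambda>i. (i + a) mod 7) ` line y0"
        using iter_dual[OF y0, of a] iter_dual[OF y0, of b] ab(3) by simp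
      have "(i + (b - a)) mod 7 \<in> line y0" if i: "i \<in> line y0" for i
      proof -
        have "(i + b) mod 7 \<in> (\<lambda>i. (i + a) mod 7) ` line y0" unfolding l[symmetric] using i by blast
        then obtain i' where i': "i' \<in> line y0" "(i + b) mod 7 = (i' + a) mod 7" by auto
        have "i' < 7" using i' by (simp add: line_def)
        moreover have "i + b = i + (b - a) + a" using ab by simp
        hence "[i + (b - a) + a = i' + a] (mod 7)" using i'(2) by (simp add: cong_def)
        hence "[i + (b - a) = i'] (mod 7)" by (simp only: cong_add_rcancel_nat)
        ultimately have "(i + (b - a)) mod 7 = i'" by (simp add: cong_def)
        thus ?thesis using i' by simp
      qed
      hence "list_all (\<lambda>i. (i + (b - a)) mod 7 \<in> set [x, y, z]) [x, y, z]" using S(1) by (auto simp: list_all_iff)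
      moreover have "[x, y, z] \<in> set [[x,y,z]. x \<leftarrow> [0..<7], y \<leftarrow> [Suc x..<7], z \<leftarrow> [Suc y..<7]]"
        using S z by (simp, intro bexI[of _ x] bexI[of _ y]) auto
      moreover have "b - a \<in> set [Suc 0..<7]" using ab by auto
      ultimately show False using shift_invariant by blast
    qed
    thus ?thesis by (intro inj_onI) (metis lessThan_iff linorder_neqE_nat)
  qed
  have all: "\<exists>k<7. v = (\<sigma> ^^ k) y0" if "dual v" for v
  proof -
    have "septic_poly (- U) V = (\<Prod>j<7. [:- (\<sigma> ^^ j) y0, 1:])"
      by (rule prod_linear_eqI[OF septic_poly_monic inj]) (use iter_dual[OF y0] in \<open>simp add: septic_poly\<close>)
    from arg_cong[OF this, of "\<lambda>p. poly p v"] that show ?thesis by (auto simp: septic_poly poly_prod)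
  qed
  have fs: "fset7 [x, y, z] = (\<lambda>j. line ((\<sigma> ^^ j) y0)) ` {..<7}"
    using iter_dual[OF y0] S(1) by (force simp: fset7_def fam_def image_image lessThan_atLeast0)
  have "spres (fset7 [x, y, z]) (plist \<tau>)" if t: "\<tau> \<in> Gal K" for \<tau>
    unfolding spres_def
  proof
    fix F assume "F \<in> fset7 [x, y, z]"
    then obtain j where F: "F = line ((\<sigma> ^^ j) y0)" unfolding fs by blast
    have d: "dual ((\<sigma> ^^ j) y0)" using iter_dual[OF y0] by blast
    obtain k where k: "k < 7" "\<tau> ((\<sigma> ^^ j) y0) = (\<sigma> ^^ k) y0" using all[OF Gal_dual[OF t d]] by blast
    have L: "line ((\<sigma> ^^ k) y0) = pl \<tau> ` F" using Gal_line[OF t d] F k by simp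
    have "\<forall>x\<in>F. plist \<tau> ! x \<in> line ((\<sigma> ^^ k) y0)" unfolding L using F by (auto simp: line_def plist_nth)
    thus "\<exists>G\<in>fset7 [x, y, z]. \<forall>x\<in>F. plist \<tau> ! x \<in> G" unfolding fs using k by blast
  qed
  thus ?thesis using S z by blast
qed

text \<open>Here \<open>fano_main\<close> receives the Frobenius at 3 as its 7-cycle and the
  Frobenius at 2 as its involution. The renumbering \<nu> is negation when the lines are translates
  of the other difference set.\<close>

lemma galois_nforms: "\<exists>\<nu>\<in>{id7, neg7}. (\<lambda>l. cmp \<nu> (cmp l \<nu>)) ` (plist ` Gal K) = set nforms"
proof -
  obtain x y z where S: "x < y" "y < z" "z < 7" "\<And>\<tau>. \<tau> \<in> Gal K \<Longrightarrow> spres (fset7 [x, y, z]) (plist \<tau>)"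
    using lines_preserved by blast
  obtain P where P: "pid P" "of_nat 2 \<in> P" using pid_exists[OF two_is_prime_nat] by blast
  obtain \<delta> i j where d: "\<delta> \<in> Gal K" "plist \<delta> \<noteq> id7" "cmp (plist \<delta>) (plist \<delta>) = id7"
    and ij: "i < 7" "j < 7" "i \<noteq> j" "plist \<delta> ! i = i" "plist \<delta> ! j = j" using frobenius_2[OF P] by blast
  show ?thesis
  proof (rule fano_main[OF S(1-3), where Gs = "plist ` Gal K" and d = "plist \<delta>" and i = i and j = j])
    show "perm7 l \<and> spres (fset7 [x, y, z]) l" if "l \<in> plist ` Gal K" for l using that S(4) plist_perm7 by auto
    show "cmp l m \<in> plist ` Gal K" if "l \<in> plist ` Gal K" "m \<in> plist ` Gal K" for l m
      using that plist_mult[symmetric] G.m_closed by auto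
    have "tl7 1 = plist \<sigma>" by (rule list7_eqI) (simp_all add: plist_length plist_nth pl_s tl7_def)
    thus "tl7 1 \<in> plist ` Gal K" using sG by blast
    show "plist \<delta> \<in> plist ` Gal K" using d(1) by blast
  qed (use d ij in auto)
qed

lemma galois_PSL: "GK \<cong> PSL_2_7"
proof -
  obtain \<nu> where n: "\<nu> \<in> {id7, neg7}" "(\<lambda>l. cmp \<nu> (cmp l \<nu>)) ` (plist ` Gal K) = set nforms" using galois_nforms by blast
  note nu = involution_nu[OF n(1)]
  let ?L = "\<lambda>\<tau>. cmp \<nu> (cmp (plist \<tau>) \<nu>)"
  have pnth: "plist \<tau> ! i < 7" if "\<tau> \<in> Gal K" "i < 7" for \<tau> i using plist_nth pl_less that by simp
  have Ln: "?L \<tau> ! i = \<nu> ! (plist \<tau> ! (\<nu> ! i))" if "i < 7" for \<tau> i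
    using that by (simp add: cmp_nth cmp_length nu)
  have Ll: "length (?L \<tau>) = 7" for \<tau> by (simp add: cmp_length nu)
  show ?thesis
  proof (rule iso_PSL_2_7[where L = ?L])
    show "group GK" by (rule G.is_group)
    show "?L ` Gal K = set nforms" using n(2) by (simp add: image_image)
    show "inj_on ?L (Gal K)"
    proof (rule inj_onI)
      fix \<tau> \<rho> assume t: "\<tau> \<in> Gal K" "\<rho> \<in> Gal K" "?L \<tau> = ?L \<rho>"
      have "plist \<tau> = plist \<rho>"
      proof (rule list7_eqI)
        fix i :: nat assume i: "i < 7"
        have "\<nu> ! (plist \<tau> ! i) = \<nu> ! (plist \<rho> ! i)" using Ln[of "\<nu> ! i" \<tau>] Ln[of "\<nu> ! i" \<rho>] t(3) nu i by simp
        thus "plist \<tau> ! i = plist \<rho> ! i" using nu(3) pnth[OF t(1) i] pnth[OF t(2) i] by metis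
      qed (simp_all add: plist_length)
      thus "\<tau> = \<rho>" by (rule plist_inj[OF t(1,2)])
    qed
    fix \<tau> \<rho> assume t: "\<tau> \<in> Gal K" "\<rho> \<in> Gal K"
    show "?L (\<tau> \<otimes>\<^bsub>GK\<^esub> \<rho>) = cmp (?L \<tau>) (?L \<rho>)"
    proof (rule list7_eqI)
      fix i :: nat assume i: "i < 7"
      have "?L (\<tau> \<otimes>\<^bsub>GK\<^esub> \<rho>) ! i = \<nu> ! (plist \<tau> ! (plist \<rho> ! (\<nu> ! i)))"
        using i nu by (simp add: plist_mult[OF t] cmp_nth cmp_length plist_length)
      also have "\<dots> = ?L \<tau> ! (?L \<rho> ! i)" using i nu pnth[OF t(2)] by (simp add: Ln)
      finally show "?L (\<tau> \<otimes>\<^bsub>GK\<^esub> \<rho>) ! i = cmp (?L \<tau>) (?L \<rho>) ! i" using i Ll by (simp add: cmp_nth)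
    qed (simp_all add: cmp_length nu Ll)
  qed
qed

lemma moved_3: assumes t: "\<tau> \<in> Gal K" "\<tau> \<noteq> \<one>\<^bsub>GK\<^esub>" shows "3 \<le> card {i. i < 7 \<and> pl \<tau> i \<noteq> i}"
proof -
  obtain \<nu> where n: "\<nu> \<in> {id7, neg7}" "(\<lambda>l. cmp \<nu> (cmp l \<nu>)) ` (plist ` Gal K) = set nforms" using galois_nforms by blast
  note nu = involution_nu[OF n(1)]
  let ?l = "cmp \<nu> (cmp (plist \<tau>) \<nu>)"
  have Ln: "?l ! i = \<nu> ! (pl \<tau> (\<nu> ! i))" if "i < 7" for i
    using that by (simp add: cmp_nth cmp_length nu plist_nth)
  have "?l \<noteq> id7"
  proof
    assume e: "?l = id7"
    have "pl \<tau> i = pl \<one>\<^bsub>GK\<^esub> i" if i: "i < 7" for i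
    proof -
      have "\<nu> ! (pl \<tau> i) = \<nu> ! i" using Ln[of "\<nu> ! i"] nu i by (simp add: e id7_nth)
      hence "pl \<tau> i = i" using nu(3) pl_less[OF t(1) i] i by metis
      thus ?thesis using pl_one[OF i] by simp
    qed
    hence "\<tau> = \<one>\<^bsub>GK\<^esub>" by (rule Gal_eq_pl[OF t(1) one_Gal])
    with t show False by simp
  qed
  moreover have "?l \<in> set nf_lits" using n(2) t(1) unfolding nforms_lits[symmetric] by blast
  ultimately have "3 \<le> length (filter (\<lambda>i. ?l ! i \<noteq> i) [0..<7])" using moved by blast
  also have "\<dots> = card (set (filter (\<lambda>i. ?l ! i \<noteq> i) [0..<7]))" by (rule distinct_card[symmetric]) simp
  also have "set (filter (\<lambda>i. ?l ! i \<noteq> i) [0..<7]) = {i. i < 7 \<and> ?l ! i \<noteq> i}" by auto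
  also have "card \<dots> \<le> card {i. i < 7 \<and> pl \<tau> i \<noteq> i}"
  proof (rule card_inj_on_le[where f = "(!) \<nu>"])
    show "inj_on ((!) \<nu>) {i. i < 7 \<and> ?l ! i \<noteq> i}" by (rule inj_on_inverseI[where g = "(!) \<nu>"]) (use nu in auto)
    show "(!) \<nu> ` {i. i < 7 \<and> ?l ! i \<noteq> i} \<subseteq> {i. i < 7 \<and> pl \<tau> i \<noteq> i}" using nu Ln by auto
  qed simp
  finally show ?thesis .
qed

text \<open>Every root is congruent to at most one other root and there are at most two pairs of congruent roots,
  so an element of the inertia group which moves at least three roots must swap both pairs.\<close>

lemma iner_unique:
  assumes P: "pid P" and p: "prime p" "of_nat p \<in> P" "odd p" "\<not> int p dvd badN"
    and s: "\<tau> \<in> iner P" "\<tau> \<noteq> \<one>\<^bsub>GK\<^esub>" and t: "\<rho> \<in> iner P" "\<rho> \<noteq> \<one>\<^bsub>GK\<^esub>"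
  shows "\<tau> = \<rho>"
proof -
  note nt = no_triple[OF P p] and n3 = no_three_pairs[OF P p]
  note sym = P_cong_sym[OF P]
  have ib: "b i - b (pl \<tau> i) \<in> P" if "\<tau> \<in> iner P" "i < 7" for \<tau> i
  proof -
    have "\<tau> \<in> Gal K" "\<tau> (b i) - b i \<in> P" using that b_Z by (auto simp: iner_def)
    thus ?thesis using b_pl[of \<tau> i] that sym by simp
  qed
  \<comment> \<open>A nontrivial inertia element is determined: it sends \<open>i\<close> to any
    other root congruent to it.\<close>
  have mv: "pl \<tau> i = j" if t: "\<tau> \<in> iner P" "\<tau> \<noteq> \<one>\<^bsub>GK\<^esub>" and ij: "i < 7" "j < 7" "i \<noteq> j" "b i - b j \<in> P" for \<tau> i j
  proof (rule ccontr)
    assume n: "pl \<tau> i \<noteq> j"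
    have tG: "\<tau> \<in> Gal K" using t by (simp add: iner_def)
    note pl7 = pl_less[OF tG]
    have ji: "b j - b i \<in> P" by (rule sym[OF ij(4)])
    have fi: "pl \<tau> i = i" using nt[OF ij(1,2) pl7[OF ij(1)] ij(3) _ _ ij(4) ib[OF t(1) ij(1)]] n by metis
    have fj: "pl \<tau> j = j"
    proof (rule ccontr)
      assume nj: "pl \<tau> j \<noteq> j"
      hence "pl \<tau> j = i" using nt[OF ij(2,1) pl7[OF ij(2)] _ _ _ ji ib[OF t(1) ij(2)]] ij(3) by metis
      hence "pl \<tau> j = pl \<tau> i" using fi by simp
      thus False using pl_inj[OF tG ij(2,1)] ij(3) by simp
    qed
    \<comment> \<open>Otherwise \<open>i\<close> and \<open>j\<close> are both fixed. Three moved
      roots provide \<open>k\<close> and \<open>l\<close> outside \<open>{k, pl \<tau> k}\<close>,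
      and with \<open>{i, j}\<close> this makes three congruent pairs in different classes.\<close>
    let ?M = "{i. i < 7 \<and> pl \<tau> i \<noteq> i}"
    have c: "3 \<le> card ?M" by (rule moved_3[OF tG t(2)])
    hence "?M \<noteq> {}" by (intro notI) simp
    then obtain k where k: "k < 7" "pl \<tau> k \<noteq> k" by blast
    have "card {k, pl \<tau> k} \<le> 2" by (simp add: card_insert_if)
    hence "\<not> ?M \<subseteq> {k, pl \<tau> k}" using c card_mono[of "{k, pl \<tau> k}" ?M] by force
    then obtain l where l: "l < 7" "pl \<tau> l \<noteq> l" "l \<noteq> k" "l \<noteq> pl \<tau> k" by blast
    have ik: "i \<noteq> k" "j \<noteq> k" "i \<noteq> l" "j \<noteq> l" using k l fi fj by auto
    have "b i - b k \<in> P \<or> b i - b l \<in> P \<or> b k - b l \<in> P"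
      by (rule n3[OF ij k(1) pl7[OF k(1)] k(2)[symmetric] ib[OF t(1) k(1)] l(1) pl7[OF l(1)] l(2)[symmetric] ib[OF t(1) l(1)]])
    moreover have "b i - b k \<notin> P" using nt[OF ij(1,2) k(1) ij(3) ik(1,2) ij(4)] by blast
    moreover have "b i - b l \<notin> P" using nt[OF ij(1,2) l(1) ij(3) ik(3,4) ij(4)] by blast
    moreover have "b k - b l \<notin> P"
      using nt[OF k(1) pl7[OF k(1)] l(1) k(2)[symmetric] l(3)[symmetric] l(4)[symmetric] ib[OF t(1) k(1)]] by blast
    ultimately show False by blast
  qed
  have sG: "\<tau> \<in> Gal K" "\<rho> \<in> Gal K" using s t by (auto simp: iner_def)
  show ?thesis
  proof (rule Gal_eq_pl[OF sG])
    fix i :: nat assume i: "i < 7"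
    show "pl \<tau> i = pl \<rho> i"
    proof (cases "pl \<tau> i = i")
      case False
      thus ?thesis using mv[OF t i pl_less[OF sG(1) i] _ ib[OF s(1) i]] by metis
    next
      case True
      thus ?thesis using mv[OF s i pl_less[OF sG(2) i] _ ib[OF t(1) i]] by metis
    qed
  qed
qed

lemma iner_card:
  assumes P: "pid P" and p: "prime p" "of_nat p \<in> P"
  shows "iner P = {\<one>\<^bsub>GK\<^esub>} \<or> card (iner P) = 2 \<and> odd p"
proof (cases "p = 2 \<or> int p dvd badN")
  case True
  thus ?thesis using iner_2[OF P] iner_bad[OF P p] p(2) by blast
next
  case False
  hence "odd p" using p(1) by (metis prime_odd_nat prime_ge_2_nat le_neq_implies_less)
  show ?thesis
  proof (cases "iner P = {\<one>\<^bsub>GK\<^esub>}")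
    case c: False
    then obtain \<tau> where t: "\<tau> \<in> iner P" "\<tau> \<noteq> \<one>\<^bsub>GK\<^esub>" using one_iner[OF P] by blast
    have "iner P = {\<one>\<^bsub>GK\<^esub>, \<tau>}" using t one_iner[OF P] iner_unique[OF P p \<open>odd p\<close> _ _ _ t] False by blast
    hence "card (iner P) = 2" using t(2) by simp
    thus ?thesis using \<open>odd p\<close> by blast
  qed simp
qed

lemma finite_primesD: assumes "Q \<in> finite_primes K" shows "pid Q" "\<exists>p. prime p \<and> of_nat p \<in> Q"
proof -
  have Q: "primeideal Q (ring_of_integers K)" "Q \<noteq> {0}" using assms by (auto simp: finite_primes_def)
  show P: "pid Q" by (rule primeideal_pid[OF Q(1)])
  obtain x where "x \<in> Q" "x \<noteq> 0" using Q(2) P_0[OF P] by blast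
  thus "\<exists>p. prime p \<and> of_nat p \<in> Q" by (rule pid_nonzero_prime[OF P])
qed

lemma PSL_2_7_extension:
  "PSL_2_7_extension_inertia_2 K" "tamely_ramified K" "unramified_at K 2" "K \<subseteq> \<real>"
proof -
  have "card (inertia_group K Q) = 2" if "Q \<in> finite_primes K" "inertia_group K Q \<noteq> {\<one>\<^bsub>GK\<^esub>}" for Q
    using finite_primesD[OF that(1)] iner_card that(2) unfolding iner_eq by blast
  thus "PSL_2_7_extension_inertia_2 K" unfolding PSL_2_7_extension_inertia_2_def using galois galois_PSL by blast
  show "unramified_at K 2" unfolding unramified_at_def
    using finite_primesD ramification_1[OF _ two_is_prime_nat] iner_2 by blast
  show "tamely_ramified K" unfolding tamely_ramified_def
  proof (intro allI impI ballI)
    fix p Q assume p: "prime (p::nat)" and Q: "Q \<in> finite_primes K" "of_nat p \<in> Q"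
    have P: "pid Q" by (rule finite_primesD[OF Q(1)])
    have p2: "2 \<le> p" by (rule prime_ge_2_nat[OF p])
    from iner_card[OF P p Q(2)] show "\<not> p dvd ramification_index K Q p"
    proof
      assume "iner Q = {\<one>\<^bsub>GK\<^esub>}"
      thus ?thesis using ramification_1[OF P p Q(2)] p2 by auto
    next
      assume c: "card (iner Q) = 2 \<and> odd p"
      hence "ramification_index K Q p \<in> {1, 2}" using ramification_2[OF P p Q(2)] by blast
      moreover have "p \<noteq> 2" using c by auto
      ultimately show ?thesis using p2 by (auto dest: dvd_imp_le)
    qed
  qed
  have "real_of_int w > 0" "0 \<le> real_of_int u" "real_of_int u \<le> real_of_int w ^ 3"
    using good w_even by (auto simp: good_def simp flip: of_int_power)
  from septic_roots_real[OF this] obtain r where r: "inj_on r {..<7::nat}" "\<And>i. i < 7 \<Longrightarrow> septic U V (of_real (r i)) = 0" by auto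
  let ?A = "(\<lambda>i. complex_of_real (r i)) ` {..<7}"
  have "?A \<subseteq> R" using r(2) septic_0_R by auto
  moreover have "card ?A = 7" using r(1) by (subst card_image) (auto simp: inj_on_def)
  ultimately have "?A = R" using R_card fin by (intro card_subset_eq) auto
  hence "R \<subseteq> \<real>" by auto
  thus "K \<subseteq> \<real>" by (rule K_real)
qed

end

lemma septic_cycle_exists: assumes g: "good u w" shows "\<exists>R K \<theta> c m b \<sigma>. septic_cycle R K \<theta> c m u w b \<sigma>"
proof -
  have "real_of_int w > 0" "0 \<le> real_of_int u" "real_of_int u \<le> real_of_int w ^ 3"
    using g by (auto simp: good_def simp flip: of_int_power)
  from septic_roots_real[OF this] obtain r where r: "inj_on r {..<7::nat}"
    "\<And>i. i < 7 \<Longrightarrow> septic (of_int u) (of_int w) (of_real (r i)) = 0" by auto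
  define b where "b i = complex_of_real (r i)" for i
  have b: "inj_on b {..<7}" "\<And>i. i < 7 \<Longrightarrow> septic (of_int u) (of_int w) (b i) = 0"
    using r by (auto simp: b_def inj_on_def)
  let ?R = "b ` {..<7}"
  have f: "septic_poly (of_int u) (of_int w) = (\<Prod>i<7. [:- b i, 1:])"
    by (rule prod_linear_eqI[OF septic_poly_monic b(1)]) (simp add: septic_poly b(2))
  have fR: "(\<Prod>r\<in>?R. [:- r, 1:]) = septic_poly (of_int u) (of_int w)" unfolding f by (subst prod.reindex[OF b(1)]) simp
  have "algebraic_int x" if x: "x \<in> ?R" for x
  proof -
    obtain p :: "int poly" where "lead_coeff p = 1" "map_poly of_int p = septic_poly (of_int u) (of_int w)"
      using septic_poly_of_int by blast
    moreover have "poly (septic_poly (of_int u) (of_int w)) x = 0" using x b(2) by (auto simp: septic_poly)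
    ultimately show ?thesis unfolding algebraic_int_altdef_ipoly by metis
  qed
  moreover have "(\<Prod>r\<in>?R. [:- r, 1:]) \<in> polys_over \<rat>" unfolding fR by (rule septic_poly_rat)
  ultimately obtain K \<theta> c m where S: "splitting ?R K \<theta> c m" using splitting_exists[of ?R] by auto
  have "septic_field ?R K \<theta> c m u w b"
    unfolding septic_field_def septic_field_axioms_def using S g b by blast
  from septic_field.cycle_exists[OF this] show ?thesis by blast
qed

section \<open>Infinitely many fields\<close>

definition septic_int :: "int \<Rightarrow> int \<Rightarrow> int \<Rightarrow> int" where
  "septic_int u w y = y ^ 7 - 46 * w * y ^ 6 + 541 * w ^ 2 * y ^ 5 - (850 * w ^ 3 + u) * y ^ 4 + (u - 3742 * w ^ 3) * w * y ^ 3
     + 5120 * w ^ 5 * y ^ 2 + 3328 * w ^ 6 * y - 4096 * w ^ 7"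

lemma of_int_septic: "of_int (septic_int u w y) = septic (of_int u) (of_int w) (of_int y)"
  by (simp add: septic_int_def septic_def)

lemma septic_int_cong:
  assumes "[u = u'] (mod l)" "[w = w'] (mod l)" "[y = y'] (mod l)"
  shows "[septic_int u w y = septic_int u' w' y'] (mod l)"
  unfolding septic_int_def by (intro cong_add cong_diff cong_mult cong_pow cong_refl assms)

definition septic_ext :: "complex set \<Rightarrow> int \<Rightarrow> int \<Rightarrow> bool" where
  "septic_ext K u w \<longleftrightarrow> (\<exists>R \<theta> c m b \<sigma>. septic_cycle R K \<theta> c m u w b \<sigma>)"

text \<open>The prime depends on \<open>K\<close> alone: modulo a prime of degree one of
  \<open>K\<close>, every integer of \<open>K\<close> is congruent to a rational one. This applies
  to a root of each septic whose splitting field is \<open>K\<close>.\<close>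

lemma septic_ext_split:
  assumes K: "septic_ext K u0 w0"
  shows "\<exists>l. prime l \<and> l > B \<and> (\<forall>u w. septic_ext K u w \<longrightarrow> (\<exists>n. int l dvd septic_int u w n))"
proof -
  obtain R \<theta> c m b \<sigma> where "septic_cycle R K \<theta> c m u0 w0 b \<sigma>" using K by (auto simp: septic_ext_def)
  then interpret S: septic_cycle R K \<theta> c m u0 w0 b \<sigma> .
  obtain l P where l: "prime l" "l > B" "S.pid P" "of_nat l \<in> P" "\<And>x. x \<in> S.ZK \<Longrightarrow> \<exists>n. x - of_int n \<in> P"
    using S.split_primes[of B] by blast
  have "\<exists>n. int l dvd septic_int u w n" if e: "septic_ext K u w" for u w
  proof -
    obtain R' \<theta>' c' m' b' \<sigma>' where "septic_cycle R' K \<theta>' c' m' u w b' \<sigma>'" using e by (auto simp: septic_ext_def)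
    then interpret S': septic_cycle R' K \<theta>' c' m' u w b' \<sigma>' .
    have y: "b' 0 \<in> S.ZK" using S'.b_Z by simp
    obtain n where n: "b' 0 - of_int n \<in> P" using l(5)[OF y] by blast
    have "S.cgr P (b' 0) (of_int n)" using n y S.ZK_of_int by (simp add: S.cgr_def)
    hence "S.cgr P (septic (of_int u) (of_int w) (b' 0)) (septic (of_int u) (of_int w) (of_int n))"
      unfolding septic_def by (intro S.cgr_rules[OF l(3)] S.cgr_refl[OF l(3)] S.ZK_of_int)
    hence "S.cgr P 0 (of_int (septic_int u w n))" using S'.b_root[of 0] by (simp add: of_int_septic)
    hence "of_int (septic_int u w n) \<in> P" using S.cgr_iff[OF l(3)] S.P_0[OF l(3)] by blast
    thus ?thesis using S.P_of_int_iff[OF l(3) l(1) l(4)] by blast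
  qed
  thus ?thesis using l by blast
qed

text \<open>The septic is linear in \<open>u\<close>, so a residue \<open>y\<close> is a root for at most one \<open>u\<close>, and \<open>y = 0\<close> never is.\<close>

lemma rootless_residue:
  assumes l: "prime l" "odd l"
  shows "\<exists>u. \<forall>y. \<not> int l dvd septic_int u 1 y"
proof (rule ccontr)
  assume n: "\<not> ?thesis"
  have lp: "prime (int l)" "l > 0" using l by (auto simp: prime_gt_0_nat)
  have "\<exists>y\<in>{0..<int l}. int l dvd septic_int u 1 y" for u
  proof -
    obtain y where y: "int l dvd septic_int u 1 y" using n by blast
    have "[septic_int u 1 y = septic_int u 1 (y mod int l)] (mod int l)" by (intro septic_int_cong) (simp_all add: cong_def)
    hence "int l dvd septic_int u 1 (y mod int l)" using y by (simp add: cong_dvd_iff)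
    thus ?thesis using lp by (intro bexI[of _ "y mod int l"]) auto
  qed
  then obtain f where f: "\<And>u. f u \<in> {0..<int l}" "\<And>u. int l dvd septic_int u 1 (f u)" by metis
  have l2: "\<not> int l dvd 2 ^ k" for k
  proof
    assume "int l dvd 2 ^ k"
    hence "int l dvd 2" using lp(1) prime_dvd_power by blast
    hence "l dvd 2" by (metis int_dvd_int_iff of_nat_numeral)
    hence "l = 2" using l(1) by (metis primes_dvd_imp_eq two_is_prime_nat)
    with l show False by simp
  qed
  have f0: "\<not> int l dvd f u" for u
  proof
    assume "int l dvd f u"
    hence "[f u = 0] (mod int l)" by (simp add: cong_0_iff)
    hence "[septic_int u 1 (f u) = septic_int u 1 0] (mod int l)" by (intro septic_int_cong) auto
    hence "int l dvd septic_int u 1 0" using f(2)[of u] by (simp add: cong_dvd_iff)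
    hence "int l dvd - (2 ^ 12)" by (simp add: septic_int_def)
    thus False using l2[of 12] by (simp only: dvd_minus_iff)
  qed
  \<comment> \<open>At 1 the coefficient of \<open>u\<close> vanishes, and the value is the constant
    256, prime to \<open>l\<close>.\<close>
  have f1: "\<not> int l dvd f u - 1" for u
  proof
    assume "int l dvd f u - 1"
    hence "[f u = 1] (mod int l)" by (simp add: cong_iff_dvd_diff)
    hence "[septic_int u 1 (f u) = septic_int u 1 1] (mod int l)" by (intro septic_int_cong) auto
    hence "int l dvd septic_int u 1 1" using f(2)[of u] by (simp add: cong_dvd_iff)
    hence "int l dvd 2 ^ 8" by (simp add: septic_int_def)
    thus False using l2[of 8] by blast
  qed
  have "inj_on f {0..<int l}"
  proof (rule inj_onI)
    fix u v assume uv: "u \<in> {0..<int l}" "v \<in> {0..<int l}" "f u = f v"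
    have "septic_int u 1 (f u) - septic_int v 1 (f u) = - ((u - v) * (f u ^ 3 * (f u - 1)))"
      by (simp add: septic_int_def algebra_simps power_numeral_reduce)
    moreover have "int l dvd septic_int u 1 (f u) - septic_int v 1 (f u)" using f(2)[of u] f(2)[of v] uv(3) by (simp add: dvd_diff)
    ultimately have "int l dvd (u - v) * (f u ^ 3 * (f u - 1))" by simp
    hence "int l dvd u - v" using lp(1) f0[of u] f1[of u] by (metis prime_dvd_mult_iff prime_dvd_power)
    hence "[u = v] (mod int l)" by (simp add: cong_iff_dvd_diff)
    thus "u = v" using uv(1,2) by (simp add: cong_def)
  qed
  moreover have "f ` {0..<int l} \<subseteq> {1..<int l}"
  proof
    fix y assume "y \<in> f ` {0..<int l}"
    then obtain u where u: "y = f u" by blast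
    have "y \<noteq> 0" using f0[of u] u by auto
    thus "y \<in> {1..<int l}" using f(1)[of u] u by auto
  qed
  ultimately have "card {0..<int l} \<le> card {1..<int l}" by (rule card_inj_on_le) simp
  thus False using lp by simp
qed

text \<open>The Chinese remainder theorem provides \<open>u\<close>, and Euler's theorem a power of
  2 congruent to 1 modulo \<open>badN * M\<close>.\<close>

lemma good_exists:
  assumes M: "0 < M" "coprime M (2 * badN)"
  shows "\<exists>u w. good u w \<and> [u = a] (mod M) \<and> [w = 1] (mod M)"
proof -
  define N where "N = 2 * badN * M"
  have N: "N > 0" using M by (simp add: N_def badN_def)
  obtain x where x: "[x = a] (mod M)" "[x = 1] (mod 2 * badN)" using binary_chinese_remainder_int[OF M(2)] by blast
  define u where "u = x mod N"
  have uM: "[u = a] (mod M)" and uB: "[u = 1] (mod 2 * badN)"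
    using x by (simp_all add: u_def N_def cong_def mod_mod_cancel)
  have u: "0 \<le> u" "u < N" using N by (auto simp: u_def)
  define q where "q = nat (badN * M)"
  have q: "q > 0" "int q = badN * M" using M by (simp_all add: q_def badN_def)
  have "coprime (badN * M) 2" using M(2) by (auto simp: badN_def coprime_commute)
  hence "coprime (int q) (int 2)" using q by simp
  hence cq: "coprime 2 q" by (simp add: coprime_int_iff coprime_commute)
  \<comment> \<open>The totient makes \<open>2 ^ k\<close> congruent to 1; the factor
    \<open>nat N\<close> makes it exceed the representative \<open>u\<close>.\<close>
  define k where "k = totient q * nat N"
  define w :: int where "w = 2 ^ k"
  have t: "totient q > 0" using q by simp
  have kN: "nat N \<le> k" using t unfolding k_def by (metis Suc_leI mult_1 mult_le_mono1 One_nat_def)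
  have "k < 2 ^ k" by (rule less_exp)
  hence "int k < w" unfolding w_def by (metis of_nat_less_numeral_power_cancel_iff)
  hence wN: "N \<le> w" using kN by linarith
  have "[2 ^ totient q = 1] (mod q)" using euler_theorem[OF cq] .
  hence "[(2 ^ totient q) ^ nat N = 1 ^ nat N] (mod q)" by (rule cong_pow)
  hence "[2 ^ k = 1] (mod q)" by (simp add: k_def power_mult)
  hence "[int (2 ^ k) = int 1] (mod int q)" by (simp only: cong_int_iff)
  hence wq: "[w = 1] (mod badN * M)" using q by (simp add: w_def)
  have "good u w"
    unfolding good_def
  proof (intro conjI)
    have "2 * badN dvd u - 1" using uB by (simp add: cong_iff_dvd_diff)
    hence "2 dvd u - 1" "badN dvd u - 1" by (rule dvd_mult_left, rule dvd_mult_right)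
    thus "odd u" "badN dvd u - 1" by auto
    show "badN dvd w - 1" using wq by (auto simp: cong_iff_dvd_diff intro: dvd_trans[of _ "badN * M"])
    show "\<exists>k>0. w = 2 ^ k" using kN N by (intro exI[of _ k]) (auto simp: w_def)
    show "0 \<le> u" by fact
    have "w \<ge> 1" by (simp add: w_def)
    hence "w ^ 1 \<le> w ^ 3" by (intro power_increasing) auto
    thus "u \<le> w ^ 3" using u wN by simp
  qed
  moreover have "[w = 1] (mod M)" using wq by (auto simp: cong_iff_dvd_diff intro: dvd_trans[of _ "badN * M"])
  ultimately show ?thesis using uM by blast
qed

text \<open>Each field in \<open>T\<close> contributes a prime \<open>l\<close> and a residue of
  \<open>u\<close> for which the septic has no root modulo \<open>l\<close>. Choosing
  \<open>l\<close> above \<open>M * (2 * badN)\<close> keeps the moduli coprime, so the residues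
  combine.\<close>

lemma avoid_finite:
  assumes "finite T"
  shows "\<exists>M a. 0 < M \<and> coprime M (2 * badN) \<and>
    (\<forall>K\<in>T. \<forall>u w. septic_ext K u w \<longrightarrow> \<not> ([u = a] (mod M) \<and> [w = 1] (mod M)))"
  using assms
proof (induction T rule: finite_induct)
  case empty
  show ?case by (rule exI[of _ 1]) simp
next
  case (insert K T)
  then obtain M a where M: "0 < M" "coprime M (2 * badN)"
    "\<And>K u w. K \<in> T \<Longrightarrow> septic_ext K u w \<Longrightarrow> \<not> ([u = a] (mod M) \<and> [w = 1] (mod M))" by blast
  show ?case
  proof (cases "\<exists>u0 w0. septic_ext K u0 w0")
    case False
    thus ?thesis using M by (intro exI[of _ M] exI[of _ a]) auto
  next
    case True
    then obtain l where l: "prime l" "l > nat (M * (2 * badN))"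
      "\<And>u w. septic_ext K u w \<Longrightarrow> \<exists>n. int l dvd septic_int u w n" using septic_ext_split by blast
    have lp: "prime (int l)" using l by simp
    have pos: "0 < M * (2 * badN)" using M by (simp add: badN_def)
    have "\<not> int l dvd M * (2 * badN)" using zdvd_imp_le[OF _ pos, of "int l"] l(2) by linarith
    hence c: "coprime (int l) (M * (2 * badN))" using lp by (rule prime_imp_coprime[rotated])
    hence c': "coprime (int l) M" "coprime (int l) (2 * badN)" "coprime (int l) 2" by auto
    hence "odd l" by simp
    from rootless_residue[OF l(1) this] obtain v where v: "\<And>y. \<not> int l dvd septic_int v 1 y" by blast
    obtain a' where a': "[a' = a] (mod M)" "[a' = v] (mod int l)"
      using binary_chinese_remainder_int[of M "int l" a v] c'(1) by (auto simp: coprime_commute)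
    have "0 < M * int l" using M(1) l(2) by simp
    moreover have "coprime (M * int l) (2 * badN)" using M(2) c'(2) by simp
    moreover have False if K': "K' \<in> insert K T" "septic_ext K' u w"
      and uw: "[u = a'] (mod M * int l)" "[w = 1] (mod M * int l)" for K' u w
    proof -
      have uw': "[u = a'] (mod M)" "[w = 1] (mod M)" "[u = a'] (mod int l)" "[w = 1] (mod int l)"
        using uw by (auto simp: cong_iff_dvd_diff intro: dvd_trans[of _ "M * int l"])
      show ?thesis
      proof (cases "K' = K")
        case True
        then obtain n where n: "int l dvd septic_int u w n" using l(3) K'(2) by blast
        have "[septic_int u w n = septic_int v 1 n] (mod int l)"
          by (intro septic_int_cong cong_trans[OF uw'(3) a'(2)] uw'(4)) simp
        hence "int l dvd septic_int v 1 n" using n by (simp add: cong_dvd_iff)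
        thus False using v by blast
      next
        case False
        hence "K' \<in> T" using K' by simp
        thus False using M(3)[OF _ K'(2)] uw'(2) cong_trans[OF uw'(1) a'(1)] by blast
      qed
    qed
    ultimately show ?thesis by blast
  qed
qed

theorem theorem3p2:
  shows "infinite {K :: complex set. PSL_2_7_extension_inertia_2 K} \<and>
    infinite {K :: complex set. PSL_2_7_extension_inertia_2 K \<and>
      tamely_ramified K \<and> unramified_at K 2 \<and> K \<subseteq> \<real>}"
proof -
  let ?S = "{K :: complex set. PSL_2_7_extension_inertia_2 K \<and> tamely_ramified K \<and> unramified_at K 2 \<and> K \<subseteq> \<real>}"
  have "infinite ?S"
  proof
    assume "finite ?S"
    from avoid_finite[OF this] obtain M a where M: "0 < M" "coprime M (2 * badN)"
      "\<And>K u w. K \<in> ?S \<Longrightarrow> septic_ext K u w \<Longrightarrow> \<not> ([u = a] (mod M) \<and> [w = 1] (mod M))" by blast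
    \<comment> \<open>Admissible parameters exist in the avoided residue class, and their field
      would be one more member of \<open>?S\<close>.\<close>
    obtain u w where uw: "good u w" "[u = a] (mod M)" "[w = 1] (mod M)" using good_exists[OF M(1,2)] by blast
    obtain R K \<theta> c m b \<sigma> where S: "septic_cycle R K \<theta> c m u w b \<sigma>" using septic_cycle_exists[OF uw(1)] by blast
    hence "K \<in> ?S" using septic_cycle.PSL_2_7_extension[OF S] by blast
    moreover have "septic_ext K u w" unfolding septic_ext_def using S by blast
    ultimately show False using M(3) uw(2,3) by blast
  qed
  moreover from this have "infinite {K :: complex set. PSL_2_7_extension_inertia_2 K}"
    by (rule infinite_super[rotated]) auto
  ultimately show ?thesis by blast
qed

end
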